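(* The maximal displacement $M^R_t$ of the branching reflected Brownian motion started at the origin satisfies $$\liminf_{t\to\infty}\frac{M^R_t-\sqrt{2}\,t}{\log t}=-\frac{3}{2\sqrt{2}}\quad\text{almost surely}$$ and $$\limsup_{t\to\infty}\frac{M^R_t-\sqrt{2}\,t}{\log t}=-\frac{1}{2\sqrt{2}}\quad\text{almost surely}.$$
   Context: Branching reflected Brownian motion (quadratic, i.e. binary, branching): the system starts with a single particle at the origin, which moves on $[0,\infty)$ as a reflected Brownian motion with zero drift and unit variance (a process with the law of $|B|$, $B$ a standard linear Brownian motion). After an exponential time with parameter $1$ it splits into two particles, which from their common birth place move as independent reflected Brownian motions on $[0,\infty)$ and each branch at rate $1$ into two in the same way, and so on. Equivalently, it can be constructed by taking the absolute values of the positions of all particles of a binary branching Brownian motion (branching rate $1$) started at $0$. $N^R(t)$ is the set of particles alive at time $t$, $X^R_v(t)$ is the position of $v\in N^R(t)$ at time $t$, and $M^R_t:=\max_{v\in N^R(t)}X^R_v(t)$. The limits are over real $t\to\infty$. *)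

theory Defs
  imports "HOL-Probability.Probability"
begin

text \<open>Paths are indexed by real times; only times \<open>t \<ge> 0\<close> are constrained or used.\<close>

definition (in prob_space) brownian_motion :: "(real \<Rightarrow> 'a \<Rightarrow> real) \<Rightarrow> bool" where
  "brownian_motion B \<longleftrightarrow>
     (\<forall>t\<ge>0. B t \<in> borel_measurable M) \<and>
     (AE \<omega> in M. B 0 \<omega> = 0) \<and>
     (\<forall>n (t :: nat \<Rightarrow> real). 0 \<le> t 0 \<longrightarrow> strict_mono_on {..n} t \<longrightarrow>
        indep_vars (\<lambda>_. borel) (\<lambda>i \<omega>. B (t (Suc i)) \<omega> - B (t i) \<omega>) {..<n}) \<and>
     (\<forall>s t. 0 \<le> s \<longrightarrow> s < t \<longrightarrow>
        distributed M lborel (\<lambda>\<omega>. B t \<omega> - B s \<omega>) (normal_density 0 (sqrt (t - s)))) \<and>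
     (AE \<omega> in M. continuous_on {0..} (\<lambda>t. B t \<omega>))"

text \<open>
  Particles are labelled by finite binary words, the most recent branching first: the root is
  \<open>[]\<close> and the two children of \<open>u\<close> are \<open>True # u\<close> and \<open>False # u\<close>.
\<close>

type_synonym particle = "bool list"

text \<open>
  The driving data are a lifetime \<open>L u\<close> and a Brownian motion \<open>W u\<close> for every label. The
  lifetimes (\<open>Inl\<close>) and the whole paths (\<open>Inr\<close>) form one mutually independent family,
  expressed through the generated \<open>\<sigma>\<close>-algebras since the two kinds of variables have
  different types.
\<close>

locale branching_data = prob_space M for M :: "'a measure" +
  fixes L :: "particle \<Rightarrow> 'a \<Rightarrow> real"
    and W :: "particle \<Rightarrow> real \<Rightarrow> 'a \<Rightarrow> real"
  assumes lifetime: "distributed M lborel (L u) (exponential_density 1)"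
    and motion: "brownian_motion (W u)"
    and independence:
      "indep_sets
         (\<lambda>i. case i of
            Inl u \<Rightarrow> sets (vimage_algebra (space M) (L u) borel)
          | Inr u \<Rightarrow> sets (vimage_algebra (space M) (\<lambda>\<omega>. \<lambda>t\<in>{0..}. W u t \<omega>) (\<Pi>\<^sub>M t\<in>{0..}. borel)))
         UNIV"

text \<open>
  The branching system is built pathwise from a realisation \<open>l\<close> of the lifetimes and a
  realisation \<open>w\<close> of the Brownian paths.
\<close>

primrec birth_time :: "(particle \<Rightarrow> real) \<Rightarrow> particle \<Rightarrow> real" where
  "birth_time l [] = 0"
| "birth_time l (b # u) = birth_time l u + l u"

definition alive :: "(particle \<Rightarrow> real) \<Rightarrow> real \<Rightarrow> particle set" where
  "alive l t = {u. birth_time l u \<le> t \<and> t < birth_time l u + l u}"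

text \<open>
  Reflected Brownian motion started at \<open>x \<ge> 0\<close> is the process with the law of \<open>\<bar>x + B\<bar>\<close> for a
  standard Brownian motion \<open>B\<close>. Each particle performs such a motion from its birth place,
  which is the position of its parent at the branching time.
  The value of \<open>position l w u t\<close> is meaningful for \<open>t\<close> between the birth and the death of \<open>u\<close>.
\<close>

primrec position ::
  "(particle \<Rightarrow> real) \<Rightarrow> (particle \<Rightarrow> real \<Rightarrow> real) \<Rightarrow> particle \<Rightarrow> real \<Rightarrow> real" where
  "position l w [] t = \<bar>w [] t\<bar>"
| "position l w (b # u) t =
     \<bar>position l w u (birth_time l (b # u)) + w (b # u) (t - birth_time l (b # u))\<bar>"

text \<open>The set of living particles is finite and nonempty at all times almost surely.\<close>

definition max_displacement ::
  "(particle \<Rightarrow> real) \<Rightarrow> (particle \<Rightarrow> real \<Rightarrow> real) \<Rightarrow> real \<Rightarrow> real" where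
  "max_displacement l w t = Max ((\<lambda>u. position l w u t) ` alive l t)"

definition branching_RBM_max ::
  "(particle \<Rightarrow> 'a \<Rightarrow> real) \<Rightarrow> (particle \<Rightarrow> real \<Rightarrow> 'a \<Rightarrow> real) \<Rightarrow> real \<Rightarrow> 'a \<Rightarrow> real" where
  "branching_RBM_max L W t \<omega> = max_displacement (\<lambda>u. L u \<omega>) (\<lambda>u s. W u s \<omega>) t"

end

theory Submission
  imports Defs "HOL-Real_Asymp.Real_Asymp" "HOL-Library.Sublist"
begin

text \<open>
  All moments reduce to the heat kernel. Lifetimes are independent of the motions, so the path to
  any particle is a (reflected) Brownian motion and the many-to-one formula turns expected numbers
  of particles into \<open>exp t\<close> times a Brownian expectation; after the Girsanov tilt by
  \<open>sqrt 2\<close> these become estimates for a walk killed above a level, which decay like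
  \<open>n powr (- 3 / 2)\<close> times the depths of the end points.

  Almost surely all particles stay below \<open>sqrt 2 * t + 2 * ln t\<close> up to a constant. First moments
  below this barrier give the upper bounds: at time \<open>n\<close> the expected number of particles above
  \<open>sqrt 2 * n - a * ln n\<close> is \<open>n powr (sqrt 2 * a - 3 / 2)\<close> up to logarithms, which is summable for
  \<open>a < 1 / (2 * sqrt 2)\<close> and tends to 0 for \<open>a < 3 / (2 * sqrt 2)\<close>.

  For the lower bounds the unreflected motion suffices, because reflection only raises a particle.
  Let \<open>r = 1\<close> or \<open>r = n\<close>, let \<open>exp (sqrt 2 * A) = n * sqrt n / r\<close>, and call a particle good at a
  time \<open>j\<close> in \<open>{n..<n+r}\<close> if it is within distance 1 of \<open>sqrt 2 * j - A\<close> and its ancestors stayed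
  well below the line of slope \<open>sqrt 2\<close> except near both ends. The expected number of good pairs is
  bounded below, and the many-to-two formula bounds its second moment by a power of \<open>ln n\<close>. Hence a
  good particle exists with probability at least \<open>1 / ln n ^ 11\<close>. The \<open>2 ^ g\<close> independent copies
  started in generation \<open>g\<close>, a small multiple of \<open>ln n\<close>, make this almost sure; \<open>r = 1\<close> yields the
  limes inferior and \<open>r = n\<close> the limes superior.
\<close>

section \<open>Heat kernels and path expectations\<close>

text \<open>Only the coefficient of \<open>ln t\<close> is claimed, so any power of
  \<open>ln n\<close> may be lost, and this freedom shapes the proof. Barriers are tested at integer
  times, so iterated Gaussian kernels replace stopping times and the reflection principle; a good
  path merely keeps a depth of \<open>3 * ln n\<close> in the bulk instead of following the square
  root shape of a conditioned path; and a success probability that decays like a power of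
  \<open>ln n\<close> is enough, because a power of \<open>n\<close> independent attempts is
  available after a delay of order \<open>ln n\<close>. The two coefficients differ because the line
  lowered by \<open>A\<close> is exceeded at a fixed time by about
  \<open>exp (sqrt 2 * A) / (n * sqrt n)\<close> particles on average: order 1 needs the exponent
  \<open>3 / 2\<close>, while collecting \<open>n\<close> successive times lowers it to
  \<open>1 / 2\<close>. The danger for second moments is a fork at height \<open>x\<close> relative
  to the line, which carries weight \<open>exp (sqrt 2 * x)\<close>; forks near the line are
  confined to the first and last \<open>T\<close> time units, and these produce the power of
  \<open>ln n\<close>. Real times are reached from integer ones by excluding fast moves with
  exponential supersolutions.\<close>

definition gauss :: "real measure" where
  "gauss = density lborel (\<lambda>x. ennreal (std_normal_density x))"

lemma sets_gauss [simp, measurable_cong]: "sets gauss = sets borel"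
  by (simp add: gauss_def)

lemma space_gauss [simp]: "space gauss = UNIV"
  by (simp add: gauss_def)

interpretation gauss: prob_space gauss
  unfolding gauss_def by (rule prob_space_normal_density) simp

lemma nn_integral_gauss:
  "f \<in> borel_measurable borel \<Longrightarrow>
    (\<integral>\<^sup>+z. f z \<partial>gauss) = (\<integral>\<^sup>+z. ennreal (std_normal_density z) * f z \<partial>lborel)"
  unfolding gauss_def by (rule nn_integral_density) simp_all

text \<open>Scaling one fixed Gaussian, rather than using the density of variance \<open>d\<close>,
  covers the degenerate case \<open>d = 0\<close>, where \<open>heat\<close> is the identity, and
  makes joint measurability in \<open>d\<close> immediate. The degenerate case occurs when an
  observation falls exactly on a birth time.\<close>

definition heat :: "real \<Rightarrow> (real \<Rightarrow> ennreal) \<Rightarrow> real \<Rightarrow> ennreal" where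
  "heat d f x = (\<integral>\<^sup>+z. f (x + sqrt d * z) \<partial>gauss)"

lemma heat_0 [simp]: "heat 0 f x = f x"
  using gauss.emeasure_space_1 by (simp add: heat_def)

lemma heat_0_fun [simp]: "heat 0 f = f"
  by auto

lemma heat_const [simp]: "heat d (\<lambda>_. c) x = c"
  using gauss.emeasure_space_1 by (simp add: heat_def)

lemma heat_measurable [measurable (raw)]:
  assumes [measurable]: "case_prod f \<in> borel_measurable (M \<Otimes>\<^sub>M borel)"
    "d \<in> borel_measurable M" "x \<in> borel_measurable M"
  shows "(\<lambda>p. heat (d p) (f p) (x p)) \<in> borel_measurable M"
  unfolding heat_def by measurable

lemma heat_measurable1 [measurable]:
  "f \<in> borel_measurable borel \<Longrightarrow> heat d f \<in> borel_measurable borel"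
  by (rule heat_measurable[of "\<lambda>_. f", unfolded case_prod_beta]) simp_all

lemma heat_mono: "(\<And>y. f y \<le> g y) \<Longrightarrow> heat d f x \<le> heat d g x"
  unfolding heat_def by (intro nn_integral_mono) auto

lemma heat_cmult:
  assumes [measurable]: "f \<in> borel_measurable borel"
  shows "heat d (\<lambda>y. c * f y) x = c * heat d f x"
  unfolding heat_def by (intro nn_integral_cmult) measurable

lemma heat_add:
  assumes [measurable]: "f \<in> borel_measurable borel" "g \<in> borel_measurable borel"
  shows "heat d (\<lambda>y. f y + g y) x = heat d f x + heat d g x"
  unfolding heat_def by (intro nn_integral_add) measurable

lemma heat_shift: "heat d (\<lambda>y. f (y + a)) x = heat d f (x + a)"
  unfolding heat_def by (simp add: algebra_simps)

lemma heat_neg: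
  assumes [measurable]: "f \<in> borel_measurable borel"
  shows "heat d (\<lambda>y. f (- y)) x = heat d f (- x)"
proof -
  have "(\<integral>\<^sup>+z. ennreal (std_normal_density z) * f (- (x + sqrt d * z)) \<partial>lborel)
      = (\<integral>\<^sup>+z. ennreal (std_normal_density z) * f (- x + sqrt d * z) \<partial>lborel)"
    by (subst nn_integral_real_affine[where c="-1" and t=0]) (simp_all add: normal_density_def)
  then show ?thesis
    unfolding heat_def by (simp add: nn_integral_gauss)
qed

lemma normal_density_scale:
  assumes "0 < \<sigma>"
  shows "normal_density 0 \<sigma> (\<sigma> * z) * \<sigma> = std_normal_density z"
  using assms by (simp add: normal_density_def real_sqrt_mult power_mult_distrib)

lemma heat_density:
  assumes [measurable]: "f \<in> borel_measurable borel" and d: "0 < d"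
  shows "heat d f x = (\<integral>\<^sup>+y. ennreal (normal_density 0 (sqrt d) (y - x)) * f y \<partial>lborel)"
proof -
  have "(\<integral>\<^sup>+y. ennreal (normal_density 0 (sqrt d) (y - x)) * f y \<partial>lborel)
      = ennreal (sqrt d) * (\<integral>\<^sup>+z. ennreal (normal_density 0 (sqrt d) (sqrt d * z)) * f (x + sqrt d * z) \<partial>lborel)"
    using d by (subst nn_integral_real_affine[where c="sqrt d" and t=x]) simp_all
  also have "\<dots> = (\<integral>\<^sup>+z. ennreal (std_normal_density z) * f (x + sqrt d * z) \<partial>lborel)"
    using d normal_density_scale[of "sqrt d"]
    by (subst nn_integral_cmult[symmetric], measurable)
      (auto simp: mult.assoc[symmetric] ennreal_mult[symmetric] mult.commute intro!: nn_integral_cong)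
  finally show ?thesis
    by (simp add: heat_def nn_integral_gauss)
qed

text \<open>Chapman-Kolmogorov: after Fubini it is the convolution of two centred normal
  densities.\<close>

lemma heat_semigroup:
  assumes f[measurable]: "f \<in> borel_measurable borel" and d: "0 \<le> d1" "0 \<le> d2"
  shows "heat d1 (heat d2 f) x = heat (d1 + d2) f x"
proof (cases "d1 = 0 \<or> d2 = 0")
  case True
  then show ?thesis by auto
next
  case False
  then have d: "0 < d1" "0 < d2" using d by auto
  let ?n = "\<lambda>d. normal_density 0 (sqrt d)"
  have "heat d1 (heat d2 f) x
      = (\<integral>\<^sup>+y. ennreal (?n d1 (y - x)) * (\<integral>\<^sup>+w. ennreal (?n d2 (w - y)) * f w \<partial>lborel) \<partial>lborel)"
    using d by (subst heat_density) (simp_all add: heat_density)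
  also have "\<dots> = (\<integral>\<^sup>+y. (\<integral>\<^sup>+w. ennreal (?n d1 (y - x)) * (ennreal (?n d2 (w - y)) * f w) \<partial>lborel) \<partial>lborel)"
    by (intro nn_integral_cong nn_integral_cmult[symmetric]) measurable
  also have "\<dots> = (\<integral>\<^sup>+w. (\<integral>\<^sup>+y. ennreal (?n d1 (y - x)) * (ennreal (?n d2 (w - y)) * f w) \<partial>lborel) \<partial>lborel)"
    by (rule lborel_pair.Fubini') measurable
  also have "\<dots> = (\<integral>\<^sup>+w. (\<integral>\<^sup>+y. ennreal (?n d2 (w - y) * ?n d1 (y - x)) \<partial>lborel) * f w \<partial>lborel)"
    by (subst nn_integral_multc[symmetric], measurable)
      (simp add: ennreal_mult mult_ac)
  also have "\<dots> = (\<integral>\<^sup>+w. ennreal (?n (d1 + d2) (w - x)) * f w \<partial>lborel)"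
  proof (intro nn_integral_cong arg_cong2[where f="(*)"] refl)
    fix w
    have "(\<integral>\<^sup>+y. ennreal (?n d2 (w - y) * ?n d1 (y - x)) \<partial>lborel)
        = (\<integral>\<^sup>+y. ennreal (?n d2 ((w - x) - y) * ?n d1 y) \<partial>lborel)"
      by (subst nn_integral_real_affine[where c=1 and t=x]) (simp_all add: algebra_simps)
    also have "\<dots> = ennreal (?n (d1 + d2) (w - x))"
      using fun_cong[OF conv_normal_density_zero_mean[of "sqrt d2" "sqrt d1"], of "w - x"] d
      by (simp add: add.commute)
    finally show "(\<integral>\<^sup>+y. ennreal (?n d2 (w - y) * ?n d1 (y - x)) \<partial>lborel) = ennreal (?n (d1 + d2) (w - x))" .
  qed
  also have "\<dots> = heat (d1 + d2) f x"
    using d by (subst heat_density) simp_all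
  finally show ?thesis .
qed

text \<open>Cameron-Martin formula for a single increment, by completing the square. For
  \<open>c = sqrt 2\<close> the prefactor is \<open>exp d\<close>, exactly the mean growth of the
  population during time \<open>d\<close>.\<close>

lemma heat_girsanov:
  assumes [measurable]: "f \<in> borel_measurable borel" and d: "0 \<le> d"
  shows "ennreal (exp (c\<^sup>2 * d / 2)) * heat d (\<lambda>y. f (y - c * d)) x
       = heat d (\<lambda>y. ennreal (exp (- c * (y - x))) * f y) x"
proof -
  have sq: "sqrt d * sqrt d = d" using d by simp
  have "ennreal (exp (c\<^sup>2 * d / 2)) * heat d (\<lambda>y. f (y - c * d)) x
      = (\<integral>\<^sup>+z. ennreal (exp (c\<^sup>2 * d / 2)) * (ennreal (std_normal_density z) * f (x + sqrt d * z - c * d)) \<partial>lborel)"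
    unfolding heat_def by (subst nn_integral_gauss, measurable) (simp add: nn_integral_cmult)
  also have "\<dots> = (\<integral>\<^sup>+z. ennreal (exp (c\<^sup>2 * d / 2)) * (ennreal (std_normal_density (c * sqrt d + z)) * f (x + sqrt d * (c * sqrt d + z) - c * d)) \<partial>lborel)"
    by (subst nn_integral_real_affine[where c=1 and t="c * sqrt d"]) simp_all
  also have "\<dots> = (\<integral>\<^sup>+z. ennreal (std_normal_density z) * (ennreal (exp (- c * (x + sqrt d * z - x))) * f (x + sqrt d * z)) \<partial>lborel)"
  proof (rule nn_integral_cong)
    fix z
    have 1: "exp (c\<^sup>2 * d / 2) * std_normal_density (c * sqrt d + z)
        = std_normal_density z * exp (- c * (x + sqrt d * z - x))"
    proof -
      have "c\<^sup>2 * d / 2 + - (c * sqrt d + z)\<^sup>2 / 2 = - z\<^sup>2 / 2 + - c * (x + sqrt d * z - x)"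
        using sq by (simp add: power2_eq_square field_simps)
      then show ?thesis
        by (simp add: std_normal_density_def exp_add[symmetric])
    qed
    have 2: "x + sqrt d * (c * sqrt d + z) - c * d = x + sqrt d * z"
      using sq by (simp add: algebra_simps)
    show "ennreal (exp (c\<^sup>2 * d / 2)) * (ennreal (std_normal_density (c * sqrt d + z)) * f (x + sqrt d * (c * sqrt d + z) - c * d))
      = ennreal (std_normal_density z) * (ennreal (exp (- c * (x + sqrt d * z - x))) * f (x + sqrt d * z))"
      unfolding 2 mult.assoc[symmetric] by (subst (1 2) ennreal_mult[symmetric]) (simp_all add: 1)
  qed
  also have "\<dots> = heat d (\<lambda>y. ennreal (exp (- c * (y - x))) * f y) x"
    unfolding heat_def by (rule nn_integral_gauss[symmetric]) measurable
  finally show ?thesis .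
qed

lemma heat_exp:
  assumes "0 \<le> d"
  shows "heat d (\<lambda>y. ennreal (exp (c * y))) x = ennreal (exp (c * x + c\<^sup>2 * d / 2))"
proof -
  have "heat d (\<lambda>y. ennreal (exp (c * y))) x = heat d (\<lambda>y. ennreal (exp (c * x)) * (ennreal (exp (- (- c) * (y - x))) * 1)) x"
    by (simp add: ennreal_mult[symmetric] exp_add[symmetric] algebra_simps)
  also have "\<dots> = ennreal (exp (c * x)) * heat d (\<lambda>y. ennreal (exp (- (- c) * (y - x))) * 1) x"
    by (rule heat_cmult) measurable
  also have "heat d (\<lambda>y. ennreal (exp (- (- c) * (y - x))) * 1) x = ennreal (exp (c\<^sup>2 * d / 2))"
    using assms heat_girsanov[of "\<lambda>_. 1" d "- c" x] by simp
  finally show ?thesis by (simp add: ennreal_mult[symmetric] exp_add)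
qed

text \<open>The expectation of the product of \<open>f (B s)\<close> over the pairs \<open>(s, f)\<close> in the list, for a Brownian
  motion \<open>B\<close> with \<open>B t = x\<close>; the times in the list are to be increasing.\<close>

fun pexp :: "real \<Rightarrow> real \<Rightarrow> (real \<times> (real \<Rightarrow> ennreal)) list \<Rightarrow> ennreal" where
  "pexp t x [] = 1"
| "pexp t x ((s, f) # r) = heat (s - t) (\<lambda>y. f y * pexp s y r) x"

definition borel_list :: "(real \<times> (real \<Rightarrow> ennreal)) list \<Rightarrow> bool" where
  "borel_list r \<longleftrightarrow> (\<forall>(s, f) \<in> set r. f \<in> borel_measurable borel)"

lemma borel_list_simps [simp]:
  "borel_list []"
  "borel_list ((s, f) # r) \<longleftrightarrow> f \<in> borel_measurable borel \<and> borel_list r"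
  "borel_list (r @ r') \<longleftrightarrow> borel_list r \<and> borel_list r'"
  by (auto simp: borel_list_def)

text \<open>Measurability is joint in time and position because the starting time will be a random
  branching time.\<close>

lemma pexp_measurable_pair:
  "borel_list r \<Longrightarrow> (\<lambda>(t, x). pexp t x r) \<in> borel_measurable (borel \<Otimes>\<^sub>M borel)"
proof (induction r)
  case (Cons sf r)
  obtain s f where sf: "sf = (s, f)" by force
  have f[measurable]: "f \<in> borel_measurable borel" and r: "borel_list r"
    using Cons.prems by (auto simp: sf)
  have [measurable]: "(\<lambda>y. pexp s y r) \<in> borel_measurable borel"
    using measurable_compose[OF _ Cons.IH[OF r], of "\<lambda>y. (s, y)" borel] by simp
  show ?case
    unfolding sf pexp.simps by measurable
qed simp

lemma pexp_measurable [measurable (raw)]: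
  assumes "borel_list r" "t \<in> borel_measurable M" "x \<in> borel_measurable M"
  shows "(\<lambda>p. pexp (t p) (x p) r) \<in> borel_measurable M"
  using measurable_compose[OF measurable_Pair[OF assms(2,3)] pexp_measurable_pair[OF assms(1)]] by simp

lemma pexp_measurable_snd: "borel_list r \<Longrightarrow> (\<lambda>x. pexp t x r) \<in> borel_measurable borel"
  by (rule pexp_measurable) simp_all


text \<open>Markov property: the expectation of the future after \<open>s\<close>, taken as an
  observable at time \<open>s\<close>, may be merged with the past. Only the segment across
  \<open>s\<close> changes, and there the semigroup law applies.\<close>

lemma pexp_split:
  assumes "borel_list r" "borel_list r'" "sorted (t # map fst r @ [s])" "sorted (s # map fst r')"
  shows "pexp t x (r @ [(s, \<lambda>y. pexp s y r')]) = pexp t x (r @ r')"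
  using assms
proof (induction r arbitrary: t x)
  case Nil
  show ?case
  proof (cases r')
    case (Cons uf q)
    obtain u f where uf: "uf = (u, f)" by force
    have [measurable]: "(\<lambda>y. pexp u y q) \<in> borel_measurable borel" "f \<in> borel_measurable borel"
      using Nil by (auto simp: Cons uf intro: pexp_measurable_snd)
    show ?thesis
      using Nil by (simp add: Cons uf heat_semigroup)
  qed simp
next
  case (Cons sf r)
  then show ?case by (cases sf) auto
qed

section \<open>Random walk killed above a level\<close>

text \<open>One step of a Gaussian walk, killed if it lands above \<open>b\<close>. The starting
  point is not tested, so several bounds on iterates carry a separate hypothesis
  \<open>x \<le> b\<close>.\<close>

definition kill :: "real \<Rightarrow> (real \<Rightarrow> ennreal) \<Rightarrow> real \<Rightarrow> ennreal" where
  "kill b f = heat 1 (\<lambda>y. indicator {..b} y * f y)"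

lemma kill_measurable [measurable]:
  "f \<in> borel_measurable borel \<Longrightarrow> kill b f \<in> borel_measurable borel"
  unfolding kill_def by measurable

lemma kill_pow_measurable [measurable]:
  "f \<in> borel_measurable borel \<Longrightarrow> (kill b ^^ m) f \<in> borel_measurable borel"
  by (induction m) auto

lemma kill_mono:
  assumes "\<And>y. y \<le> b \<Longrightarrow> f y \<le> g y"
  shows "kill b f x \<le> kill b g x"
  unfolding kill_def using assms by (intro heat_mono) (auto split: split_indicator)

lemma kill_pow_mono:
  assumes "\<And>y. y \<le> b \<Longrightarrow> f y \<le> g y" "x \<le> b"
  shows "(kill b ^^ m) f x \<le> (kill b ^^ m) g x"
  using assms(2) by (induction m arbitrary: x) (auto intro!: kill_mono assms(1))

lemma kill_cmult: 
  assumes [measurable]: "f \<in> borel_measurable borel"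
  shows "kill b (\<lambda>y. c * f y) x = c * kill b f x"
  unfolding kill_def by (subst heat_cmult[symmetric]) (auto simp: mult_ac)

lemma kill_pow_cmult:
  assumes [measurable]: "f \<in> borel_measurable borel"
  shows "(kill b ^^ m) (\<lambda>y. c * f y) x = c * (kill b ^^ m) f x"
proof (induction m arbitrary: x)
  case (Suc m)
  then have "(kill b ^^ m) (\<lambda>y. c * f y) = (\<lambda>x. c * (kill b ^^ m) f x)" by auto
  then show ?case by (simp add: kill_cmult)
qed simp

lemma kill_add:
  assumes [measurable]: "f \<in> borel_measurable borel" "g \<in> borel_measurable borel"
  shows "kill b (\<lambda>y. f y + g y) x = kill b f x + kill b g x"
  unfolding kill_def by (subst heat_add[symmetric]) (auto simp: distrib_left)

lemma kill_pow_add: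
  assumes [measurable]: "f \<in> borel_measurable borel" "g \<in> borel_measurable borel"
  shows "(kill b ^^ m) (\<lambda>y. f y + g y) x = (kill b ^^ m) f x + (kill b ^^ m) g x"
proof (induction m arbitrary: x)
  case (Suc m)
  then have "(kill b ^^ m) (\<lambda>y. f y + g y) = (\<lambda>x. (kill b ^^ m) f x + (kill b ^^ m) g x)" by auto
  then show ?case by (simp add: kill_add)
qed simp

lemma kill_pow_le_1: "(kill b ^^ m) (\<lambda>_. 1) x \<le> 1"
proof (induction m arbitrary: x)
  case (Suc m)
  have "kill b ((kill b ^^ m) (\<lambda>_. 1)) x \<le> heat 1 (\<lambda>_. 1) x"
    unfolding kill_def[of b "(kill b ^^ m) (\<lambda>_. 1)"] using Suc by (intro heat_mono) (auto split: split_indicator)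
  then show ?case by simp
qed simp

text \<open>All killings except the one at the last step are forgotten.\<close>

lemma kill_pow_le_heat:
  assumes [measurable]: "f \<in> borel_measurable borel"
  shows "(kill b ^^ Suc m) f x \<le> heat (Suc m) (\<lambda>y. indicator {..b} y * f y) x"
proof (induction m arbitrary: x)
  case 0
  then show ?case by (simp add: kill_def)
next
  case (Suc m)
  have "(kill b ^^ Suc (Suc m)) f x = heat 1 (\<lambda>y. indicator {..b} y * (kill b ^^ Suc m) f y) x"
    by (simp add: kill_def)
  also have "\<dots> \<le> heat 1 (heat (Suc m) (\<lambda>y. indicator {..b} y * f y)) x"
    using Suc by (intro heat_mono) (auto split: split_indicator)
  also have "\<dots> = heat (Suc (Suc m)) (\<lambda>y. indicator {..b} y * f y) x"
    by (subst heat_semigroup) (auto simp: add_ac)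
  finally show ?case .
qed

lemma heat_le_integral:
  assumes [measurable]: "f \<in> borel_measurable borel" and d: "0 < d"
  shows "heat d f x \<le> ennreal (1 / sqrt (2 * pi * d)) * (\<integral>\<^sup>+y. f y \<partial>lborel)"
proof -
  have "heat d f x \<le> (\<integral>\<^sup>+y. ennreal (1 / sqrt (2 * pi * d)) * f y \<partial>lborel)"
    unfolding heat_density[OF assms]
  proof (intro nn_integral_mono mult_right_mono ennreal_leI)
    fix y
    have "exp (- (y - x)\<^sup>2 / (2 * d)) \<le> 1" using d by simp
    then show "normal_density 0 (sqrt d) (y - x) \<le> 1 / sqrt (2 * pi * d)"
      using d by (simp add: normal_density_def divide_right_mono)
  qed simp
  then show ?thesis by (simp add: nn_integral_cmult)
qed

lemma kill_pow_le_integral: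
  assumes [measurable]: "f \<in> borel_measurable borel" and m: "0 < m"
  shows "(kill b ^^ m) f x \<le> ennreal (1 / sqrt (2 * pi * m)) * (\<integral>\<^sup>+y\<in>{..b}. f y \<partial>lborel)"
proof -
  obtain k where k: "m = Suc k" using m by (cases m) auto
  have "(kill b ^^ m) f x \<le> heat m (\<lambda>y. indicator {..b} y * f y) x"
    unfolding k by (rule kill_pow_le_heat) simp
  also have "\<dots> \<le> ennreal (1 / sqrt (2 * pi * m)) * (\<integral>\<^sup>+y. indicator {..b} y * f y \<partial>lborel)"
    using m by (intro heat_le_integral) auto
  finally show ?thesis by (simp add: mult.commute)
qed

text \<open>The kernel restricted to \<open>{..b}\<close> on both sides is symmetric because the
  Gaussian density is even. Iterated, this is time reversal: survival before the end point can be
  computed as survival of a walk started there.\<close>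

lemma kill_sym:
  assumes [measurable]: "f \<in> borel_measurable borel" "g \<in> borel_measurable borel"
  shows "(\<integral>\<^sup>+x\<in>{..b}. g x * kill b f x \<partial>lborel) = (\<integral>\<^sup>+x\<in>{..b}. f x * kill b g x \<partial>lborel)"
proof -
  have *: "(\<integral>\<^sup>+x\<in>{..b}. g x * kill b f x \<partial>lborel)
      = (\<integral>\<^sup>+x. \<integral>\<^sup>+y. g x * indicator {..b} x * (ennreal (std_normal_density (y - x)) * (indicator {..b} y * f y)) \<partial>lborel \<partial>lborel)"
    if [measurable]: "f \<in> borel_measurable borel" "g \<in> borel_measurable borel" for f g
  proof (rule nn_integral_cong)
    fix x
    have "kill b f x = (\<integral>\<^sup>+y. ennreal (std_normal_density (y - x)) * (indicator {..b} y * f y) \<partial>lborel)"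
      unfolding kill_def by (subst heat_density) simp_all
    then show "g x * kill b f x * indicator {..b} x =
        (\<integral>\<^sup>+y. g x * indicator {..b} x * (ennreal (std_normal_density (y - x)) * (indicator {..b} y * f y)) \<partial>lborel)"
      by (subst nn_integral_cmult) (simp_all add: mult_ac)
  qed
  have "(\<integral>\<^sup>+x\<in>{..b}. g x * kill b f x \<partial>lborel)
      = (\<integral>\<^sup>+y. \<integral>\<^sup>+x. g x * indicator {..b} x * (ennreal (std_normal_density (y - x)) * (indicator {..b} y * f y)) \<partial>lborel \<partial>lborel)"
    by (subst *[OF assms]) (rule lborel_pair.Fubini', measurable)
  also have "\<dots> = (\<integral>\<^sup>+x\<in>{..b}. f x * kill b g x \<partial>lborel)"
    by (subst *[OF assms(2,1)]) (auto intro!: nn_integral_cong simp: mult_ac normal_density_def power2_commute)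
  finally show ?thesis .
qed

lemma kill_pow_sym:
  assumes [measurable]: "f \<in> borel_measurable borel" "g \<in> borel_measurable borel"
  shows "(\<integral>\<^sup>+x\<in>{..b}. g x * (kill b ^^ m) f x \<partial>lborel) = (\<integral>\<^sup>+x\<in>{..b}. f x * (kill b ^^ m) g x \<partial>lborel)"
  using assms
proof (induction m arbitrary: f g)
  case (Suc m)
  note [measurable] = Suc.prems
  have "(\<integral>\<^sup>+x\<in>{..b}. g x * (kill b ^^ Suc m) f x \<partial>lborel) = (\<integral>\<^sup>+x\<in>{..b}. (kill b ^^ m) f x * kill b g x \<partial>lborel)"
    by (simp add: kill_sym)
  also have "\<dots> = (\<integral>\<^sup>+x\<in>{..b}. f x * (kill b ^^ m) (kill b g) x \<partial>lborel)"
    by (subst mult.commute) (simp add: Suc.IH)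
  finally show ?case by (simp add: funpow_swap1)
qed (simp add: mult.commute)

section \<open>Survival of the killed walk and the ballot upper bound\<close>

text \<open>A Mills ratio bound: the mean overshoot of a Gaussian over \<open>w\<close> is at most
  1. The left side equals \<open>std_normal_density w\<close>, and
  \<open>- std_normal_density z / (z + 1)\<close> is an antiderivative of a function below
  \<open>std_normal_density z\<close>, because
  \<open>z\<^sup>2 + z + 1 \<le> (z + 1)\<^sup>2\<close>.\<close>

lemma mills_lower:
  assumes w: "0 \<le> w"
  shows "(\<integral>\<^sup>+z\<in>{w..}. ennreal (z * std_normal_density z) \<partial>lborel)
      \<le> ennreal (w + 1) * (\<integral>\<^sup>+z\<in>{w..}. ennreal (std_normal_density z) \<partial>lborel)"
proof -
  let ?p = std_normal_density
  have tends: "(?p \<longlongrightarrow> 0) at_top"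
    unfolding normal_density_def by real_asymp
  have D: "(?p has_real_derivative (- z * ?p z)) (at z)" for z
  proof -
    have "((\<lambda>z. exp (- z\<^sup>2 / 2)) has_real_derivative (- z * exp (- z\<^sup>2 / 2))) (at z)"
      by (auto intro!: derivative_eq_intros)
    from DERIV_cmult[OF this, of "1 / sqrt (2 * pi)"] show ?thesis
      by (simp add: std_normal_density_def[abs_def] mult.left_commute)
  qed
  have "(\<integral>\<^sup>+z. ennreal (z * ?p z) * indicator {w..} z \<partial>lborel) = ennreal (0 - (- ?p w))"
  proof (rule nn_integral_FTC_atLeast)
    show "((\<lambda>z. - ?p z) has_real_derivative z * ?p z) (at z)" for z
      using DERIV_minus[OF D[of z]] by simp
    show "((\<lambda>z. - ?p z) \<longlongrightarrow> 0) at_top" using tendsto_minus[OF tends] by simp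
  qed (use w in auto)
  moreover have "(\<integral>\<^sup>+z. ennreal (?p z * (z\<^sup>2 + z + 1) / (z + 1)\<^sup>2) * indicator {w..} z \<partial>lborel) = ennreal (0 - (- ?p w / (w + 1)))"
  proof (rule nn_integral_FTC_atLeast)
    show "((\<lambda>z. - ?p z / (z + 1)) has_real_derivative ?p z * (z\<^sup>2 + z + 1) / (z + 1)\<^sup>2) (at z)" if "w \<le> z" for z
    proof -
      have "((\<lambda>z. - ?p z / (z + 1)) has_real_derivative (- (- z * ?p z) * (z + 1) - (- ?p z) * (1 + 0)) / ((z + 1) * (z + 1))) (at z)"
        using w that by (intro DERIV_divide DERIV_minus D DERIV_add DERIV_ident DERIV_const) auto
      then show ?thesis by (simp add: power2_eq_square algebra_simps)
    qed
    show "((\<lambda>z. - ?p z / (z + 1)) \<longlongrightarrow> 0) at_top"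
      unfolding normal_density_def by real_asymp
    show "0 \<le> ?p z * (z\<^sup>2 + z + 1) / (z + 1)\<^sup>2" if "w \<le> z" for z
      using w that by (intro divide_nonneg_nonneg mult_nonneg_nonneg) auto
  qed auto
  moreover have "(\<integral>\<^sup>+z. ennreal (?p z * (z\<^sup>2 + z + 1) / (z + 1)\<^sup>2) * indicator {w..} z \<partial>lborel)
      \<le> (\<integral>\<^sup>+z\<in>{w..}. ennreal (?p z) \<partial>lborel)"
  proof (intro nn_integral_mono)
    fix z show "ennreal (?p z * (z\<^sup>2 + z + 1) / (z + 1)\<^sup>2) * indicator {w..} z \<le> ennreal (?p z) * indicator {w..} z"
    proof (cases "w \<le> z")
      case True
      then have "?p z * (z\<^sup>2 + z + 1) \<le> ?p z * (z + 1)\<^sup>2"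
        using w by (intro mult_left_mono) (auto simp: power2_eq_square algebra_simps)
      then show ?thesis using True w by (auto simp: field_simps intro!: ennreal_leI)
    qed auto
  qed
  ultimately have "ennreal (?p w / (w + 1)) \<le> (\<integral>\<^sup>+z\<in>{w..}. ennreal (?p z) \<partial>lborel)"
    and *: "(\<integral>\<^sup>+z. ennreal (z * ?p z) * indicator {w..} z \<partial>lborel) = ennreal (?p w)" by simp_all
  then have "ennreal (w + 1) * ennreal (?p w / (w + 1)) \<le> ennreal (w + 1) * (\<integral>\<^sup>+z\<in>{w..}. ennreal (?p z) \<partial>lborel)"
    by (intro mult_left_mono) auto
  then show ?thesis
    unfolding * using w by (subst (asm) ennreal_mult[symmetric]) auto
qed

text \<open>Without killing, the mean of \<open>b - y + 1\<close> is preserved by a step. The part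
  discarded above \<open>b\<close> has nonnegative integral, since the mean overshoot is at most 1;
  the summand 1 pays for exactly that. So depth plus one is superharmonic for the killed
  walk.\<close>

lemma kill_linear:
  assumes x: "x \<le> b"
  shows "kill b (\<lambda>y. ennreal (b - y + 1)) x \<le> ennreal (b - x + 1)"
proof -
  define w where "w = b - x"
  have w: "0 \<le> w" using x by (simp add: w_def)
  let ?p = std_normal_density
  have int0: "integrable lborel ?p" by simp
  have int1: "integrable lborel (\<lambda>z. ?p z * z)"
    using integrable_std_normal_moment[of 1] by simp
  have int: "integrable lborel (\<lambda>z. ?p z * (w + 1 - z))"
    using int0 int1 by (simp add: right_diff_distrib)
  have total: "(\<integral>z. ?p z * (w + 1 - z) \<partial>lborel) = w + 1"
    using int0 int1 integral_std_normal_moment_odd[of 0]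
    by (simp add: right_diff_distrib)
  have split: "(\<integral>z. ?p z * (w + 1 - z) \<partial>lborel)
      = (\<integral>z\<in>{..w}. ?p z * (w + 1 - z) \<partial>lborel) + (\<integral>z\<in>{w<..}. ?p z * (w + 1 - z) \<partial>lborel)"
  proof -
    have "(\<integral>z. ?p z * (w + 1 - z) \<partial>lborel) = (\<integral>z. indicator {..w} z *\<^sub>R (?p z * (w + 1 - z)) + indicator {w<..} z *\<^sub>R (?p z * (w + 1 - z)) \<partial>lborel)"
      by (intro Bochner_Integration.integral_cong) (auto split: split_indicator)
    also have "\<dots> = (\<integral>z. indicator {..w} z *\<^sub>R (?p z * (w + 1 - z)) \<partial>lborel) + (\<integral>z. indicator {w<..} z *\<^sub>R (?p z * (w + 1 - z)) \<partial>lborel)"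
      by (intro Bochner_Integration.integral_add integrable_mult_indicator int) auto
    finally show ?thesis by (simp add: set_lebesgue_integral_def)
  qed
  have tail: "0 \<le> (\<integral>z\<in>{w<..}. ?p z * (w + 1 - z) \<partial>lborel)"
  proof -
    have e: "(\<integral>z\<in>{w<..}. ?p z * (w + 1 - z) \<partial>lborel) = (\<integral>z\<in>{w..}. (w + 1) * ?p z \<partial>lborel) - (\<integral>z\<in>{w..}. ?p z * z \<partial>lborel)"
    proof -
      have "(\<integral>z\<in>{w<..}. ?p z * (w + 1 - z) \<partial>lborel) = (\<integral>z\<in>{w..}. ?p z * (w + 1 - z) \<partial>lborel)"
        unfolding set_lebesgue_integral_def
        by (intro integral_cong_AE) (auto intro!: AE_I[where N="{w}"] split: split_indicator)
      also have "\<dots> = (\<integral>z. indicator {w..} z *\<^sub>R ((w + 1) * ?p z) - indicator {w..} z *\<^sub>R (?p z * z) \<partial>lborel)"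
        unfolding set_lebesgue_integral_def
        by (intro Bochner_Integration.integral_cong) (auto simp: algebra_simps split: split_indicator)
      also have "\<dots> = (\<integral>z\<in>{w..}. (w + 1) * ?p z \<partial>lborel) - (\<integral>z\<in>{w..}. ?p z * z \<partial>lborel)"
        unfolding set_lebesgue_integral_def
        by (intro Bochner_Integration.integral_diff integrable_mult_indicator int1 integrable_mult_right int0) auto
      finally show ?thesis .
    qed
    have i1: "integrable lborel (\<lambda>z. indicator {w..} z * ((w + 1) * ?p z))" 
      using integrable_mult_indicator[of "{w..}" lborel "\<lambda>z. (w + 1) * ?p z"] int0 by simp
    have i2: "integrable lborel (\<lambda>z. indicator {w..} z * (?p z * z))"
      using integrable_mult_indicator[of "{w..}" lborel "\<lambda>z. ?p z * z"] int1 by simp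
    have "ennreal (\<integral>z\<in>{w..}. ?p z * z \<partial>lborel) = (\<integral>\<^sup>+z\<in>{w..}. ennreal (z * ?p z) \<partial>lborel)"
      unfolding set_lebesgue_integral_def real_scaleR_def
      by (subst nn_integral_eq_integral[symmetric, OF i2])
        (use w in \<open>auto intro!: nn_integral_cong AE_I2 simp: mult.commute split: split_indicator\<close>)
    moreover have "ennreal (\<integral>z\<in>{w..}. (w + 1) * ?p z \<partial>lborel) = ennreal (w + 1) * (\<integral>\<^sup>+z\<in>{w..}. ennreal (?p z) \<partial>lborel)"
      unfolding set_lebesgue_integral_def real_scaleR_def
      by (subst nn_integral_eq_integral[symmetric, OF i1], (use w in force), subst nn_integral_cmult[symmetric], simp)
        (use w in \<open>auto intro!: nn_integral_cong simp: ennreal_mult split: split_indicator\<close>)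
    ultimately have "ennreal (\<integral>z\<in>{w..}. ?p z * z \<partial>lborel) \<le> ennreal (\<integral>z\<in>{w..}. (w + 1) * ?p z \<partial>lborel)"
      using mills_lower[OF w] by simp
    moreover have "0 \<le> (\<integral>z\<in>{w..}. (w + 1) * ?p z \<partial>lborel)"
      unfolding set_lebesgue_integral_def using w by (intro integral_nonneg_AE) auto
    ultimately show ?thesis
      unfolding e by (simp add: ennreal_le_iff)
  qed
  have i3: "integrable lborel (\<lambda>z. indicator {..w} z * (?p z * (w + 1 - z)))"
    using integrable_mult_indicator[of "{..w}" lborel "\<lambda>z. ?p z * (w + 1 - z)"] int by simp
  have "kill b (\<lambda>y. ennreal (b - y + 1)) x
      = (\<integral>\<^sup>+z. ennreal (?p z) * (indicator {..b} (x + z) * ennreal (b - (x + z) + 1)) \<partial>lborel)"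
    unfolding kill_def heat_def by (subst nn_integral_gauss) simp_all
  also have "\<dots> = (\<integral>\<^sup>+z. ennreal (indicator {..w} z * (?p z * (w + 1 - z))) \<partial>lborel)"
  proof (rule nn_integral_cong)
    fix z
    show "ennreal (?p z) * (indicator {..b} (x + z) * ennreal (b - (x + z) + 1))
        = ennreal (indicator {..w} z * (?p z * (w + 1 - z)))"
    proof (cases "z \<le> w")
      case True
      then have "ennreal (?p z) * ennreal (b - (x + z) + 1) = ennreal (?p z * (b - (x + z) + 1))"
        by (intro ennreal_mult[symmetric]) (auto simp: w_def)
      with True show ?thesis by (simp add: w_def algebra_simps)
    qed (auto simp: w_def split: split_indicator)
  qed
  also have "\<dots> = ennreal (\<integral>z\<in>{..w}. ?p z * (w + 1 - z) \<partial>lborel)"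
    unfolding set_lebesgue_integral_def real_scaleR_def
    by (intro nn_integral_eq_integral i3 AE_I2) (auto split: split_indicator)
  also have "\<dots> \<le> ennreal (w + 1)"
    using tail total split by (intro ennreal_leI) linarith
  finally show ?thesis by (simp add: w_def)
qed

lemma kill_pow_linear:
  "x \<le> b \<Longrightarrow> (kill b ^^ m) (\<lambda>y. ennreal (b - y + 1)) x \<le> ennreal (b - x + 1)"
proof (induction m arbitrary: x)
  case (Suc m)
  have "(kill b ^^ Suc m) (\<lambda>y. ennreal (b - y + 1)) x \<le> kill b (\<lambda>y. ennreal (b - y + 1)) x"
    using Suc.IH by (auto intro!: kill_mono)
  also have "\<dots> \<le> ennreal (b - x + 1)" using Suc.prems by (rule kill_linear)
  finally show ?case .
qed simp

text \<open>Either the walk ends at depth at least \<open>sqrt m / 2\<close>, which the superharmonic function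
  \<open>depth + 1\<close> makes unlikely, or it ends in a short interval, which costs a factor
  \<open>1 / sqrt (2 pi k)\<close> for the last \<open>k = m div 2\<close> steps and leaves a shorter survival problem.\<close>

lemma kill_survival:
  assumes "0 < m" "x \<le> b"
  shows "(kill b ^^ m) (\<lambda>_. 1) x \<le> ennreal (4 * (b - x + 1) / sqrt m)"
  using assms
proof (induction m arbitrary: x rule: less_induct)
  case (less m)
  show ?case
  proof (cases "m \<le> 16")
    case True
    \<comment> \<open>For short walks the claimed bound is at least 1.\<close>
    have "sqrt (real m) \<le> sqrt 16" using True by (intro real_sqrt_le_mono) simp
    then have "sqrt (real m) \<le> 4" by simp
    then have "1 \<le> 4 * (b - x + 1) / sqrt m" using less.prems by (simp add: field_simps)
    then show ?thesis using kill_pow_le_1[where b=b and m=m and x=x] by (metis ennreal_1 ennreal_leI order.trans)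
  next
    case False
    define k where "k = m div 2"
    have k: "0 < k" "k < m" "0 < m - k" using False by (auto simp: k_def)
    define A where "A = sqrt m / 2"
    have A: "0 < A" using False by (simp add: A_def)
    \<comment> \<open>The product \<open>2 * pi * k * (m - k)\<close> is about
      \<open>(pi / 2) * m\<^sup>2\<close>. The margin of \<open>pi / 2\<close> over 1 lets the
      constant 4 reproduce itself as 2 + 2.\<close>
    have km: "real m \<le> sqrt (2 * pi * k) * sqrt (real (m - k))"
    proof -
      have "real k * 2 + 1 \<ge> m" "real k * 2 \<le> m" unfolding k_def by linarith+
      then have "(real m)\<^sup>2 - (2 * real k - real m)\<^sup>2 \<ge> (real m)\<^sup>2 - 1"
        by (simp add: abs_square_le_1)
      then have "4 * (real k * real (m - k)) \<ge> (real m)\<^sup>2 - 1"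
        using k by (simp add: of_nat_diff power2_eq_square algebra_simps)
      moreover have "(real m)\<^sup>2 \<ge> 16\<^sup>2" using False by (intro power_mono) auto
      ultimately have "real k * real (m - k) * 6 \<ge> (real m)\<^sup>2" unfolding power2_eq_square by linarith
      moreover have "real k * real (m - k) * 6 \<le> real k * real (m - k) * (2 * pi)"
        using pi_gt3 by (intro mult_left_mono) auto
      ultimately have "(real m)\<^sup>2 \<le> 2 * pi * k * real (m - k)" by (simp add: mult_ac)
      then have "sqrt ((real m)\<^sup>2) \<le> sqrt (2 * pi * k * real (m - k))" by (rule real_sqrt_le_mono)
      then show ?thesis by (simp add: real_sqrt_mult)
    qed
    have "(kill b ^^ m) (\<lambda>_. 1) x
        = (kill b ^^ m) (\<lambda>y. indicator {..b - A} y + indicator {b - A<..} y) x"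
      by (intro arg_cong[where f="\<lambda>f. (kill b ^^ m) f x"]) (auto split: split_indicator)
    also have "\<dots> = (kill b ^^ m) (indicator {..b - A}) x + (kill b ^^ m) (indicator {b - A<..}) x"
      by (subst kill_pow_add) simp_all
    also have "(kill b ^^ m) (indicator {..b - A}) x \<le> (kill b ^^ m) (\<lambda>y. ennreal (1 / A) * ennreal (b - y + 1)) x"
      using A less.prems
      by (intro kill_pow_mono) (auto simp: ennreal_mult[symmetric] field_simps simp flip: ennreal_1 split: split_indicator intro!: ennreal_leI)
    also have "\<dots> \<le> ennreal (1 / A) * ennreal (b - x + 1)"
      by (subst kill_pow_cmult, simp) (intro mult_left_mono kill_pow_linear less.prems, simp)
    also have "\<dots> = ennreal (2 * (b - x + 1) / sqrt m)"
      using less.prems A by (subst ennreal_mult[symmetric]) (auto simp: A_def)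
    also have "(kill b ^^ m) (indicator {b - A<..}) x = (kill b ^^ (m - k)) ((kill b ^^ k) (indicator {b - A<..})) x"
      using k by (simp add: funpow_add[symmetric, THEN fun_cong, unfolded comp_def])
    also have "\<dots> \<le> (kill b ^^ (m - k)) (\<lambda>_. ennreal (A / sqrt (2 * pi * k)) * 1) x"
    proof (intro kill_pow_mono less.prems)
      fix y
      have "(kill b ^^ k) (indicator {b - A<..}) y \<le> ennreal (1 / sqrt (2 * pi * k)) * (\<integral>\<^sup>+y\<in>{..b}. indicator {b - A<..} y \<partial>lborel)"
        using k by (intro kill_pow_le_integral) auto
      also have "(\<integral>\<^sup>+y\<in>{..b}. indicator {b - A<..} y \<partial>lborel) = (\<integral>\<^sup>+y. indicator {b - A<..b} y \<partial>lborel)"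
        by (intro nn_integral_cong) (auto split: split_indicator)
      also have "\<dots> = ennreal A" using A by simp
      finally show "(kill b ^^ k) (indicator {b - A<..}) y \<le> ennreal (A / sqrt (2 * pi * k)) * 1"
        using A by (simp add: ennreal_mult[symmetric])
    qed
    also have "\<dots> = ennreal (A / sqrt (2 * pi * k)) * (kill b ^^ (m - k)) (\<lambda>_. 1) x"
      by (rule kill_pow_cmult) simp
    also have "\<dots> \<le> ennreal (A / sqrt (2 * pi * k)) * ennreal (4 * (b - x + 1) / sqrt (m - k))"
      using k less by (intro mult_left_mono less.IH) auto
    also have "\<dots> \<le> ennreal (2 * (b - x + 1) / sqrt m)"
    proof -
      have "A / sqrt (2 * pi * k) * (4 * (b - x + 1) / sqrt (m - k)) = 2 * (b - x + 1) * (sqrt m / (sqrt (2 * pi * k) * sqrt (m - k)))"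
        unfolding A_def by (simp add: divide_simps)
      also have "sqrt m / (sqrt (2 * pi * k) * sqrt (m - k)) \<le> sqrt m / m"
        using km False by (intro divide_left_mono) (auto intro: order.strict_trans2)
      also have "sqrt m / m = 1 / sqrt m" 
        using False real_sqrt_mult_self[of "real m"] by (simp add: divide_simps del: real_sqrt_mult_self)
      finally show ?thesis
        using A less.prems by (subst ennreal_mult[symmetric]) (auto intro!: ennreal_leI)
    qed
    also have "ennreal (2 * (b - x + 1) / sqrt m) + ennreal (2 * (b - x + 1) / sqrt m) = ennreal (4 * (b - x + 1) / sqrt m)"
    proof -
      define t where "t = (b - x + 1) / sqrt m"
      have "0 \<le> t" using less.prems by (simp add: t_def)
      then have "ennreal (2 * t) + ennreal (2 * t) = ennreal (4 * t)"
        by (subst ennreal_plus[symmetric]) simp_all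
      then show ?thesis unfolding t_def by simp
    qed
    finally show ?thesis by (simp add: add_mono)
  qed
qed


text \<open>Split into thirds: the first \<open>m\<close> steps cost a survival factor in the
  starting depth, the middle \<open>k\<close> steps a heat kernel factor of order
  \<open>1 / sqrt k\<close>, and the last \<open>m\<close> steps, by time reversal, a survival
  factor in the final depth. The product is the ballot decay
  \<open>n powr (- 3 / 2)\<close>.\<close>

lemma kill_pow_le:
  assumes [measurable]: "f \<in> borel_measurable borel" and x: "x \<le> b" and n: "3 \<le> n"
  shows "(kill b ^^ n) f x \<le> ennreal (100 * (b - x + 1) / (n * sqrt n))
      * (\<integral>\<^sup>+y\<in>{..b}. f y * ennreal (b - y + 1) \<partial>lborel)"
proof -
  define m k where "m = n div 3" and "k = n - 2 * m"
  have mk': "0 < m" "m \<le> k" "n = m + (k + m)" "n \<le> 5 * m"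
  proof -
    show "0 < m" "m \<le> k" "n = m + (k + m)" using n unfolding m_def k_def by linarith+
    then show "n \<le> 5 * m" using div_mult_mod_eq[of n 3] mod_less_divisor[of 3 n] unfolding m_def by linarith
  qed
  have mk: "0 < m" "m \<le> k" "n = m + (k + m)" "real n \<le> 5 * real m"
    using mk' of_nat_mono[OF mk'(4), where 'a=real] by simp_all
  have n0: "0 < real n" using n by simp
  let ?I = "\<integral>\<^sup>+y\<in>{..b}. f y * ennreal (b - y + 1) \<partial>lborel"
  define c where "c = 1 / sqrt (2 * pi * m) * (4 / sqrt m)"
  have c0: "0 \<le> c" by (simp add: c_def)
  have 1: "(kill b ^^ (k + m)) f y \<le> ennreal c * ?I" for y
  proof -
    have "(kill b ^^ (k + m)) f y = (kill b ^^ k) ((kill b ^^ m) f) y"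
      by (simp add: funpow_add)
    also have "\<dots> \<le> ennreal (1 / sqrt (2 * pi * k)) * (\<integral>\<^sup>+y\<in>{..b}. 1 * (kill b ^^ m) f y \<partial>lborel)"
      using mk kill_pow_le_integral[of "(kill b ^^ m) f" k b y] by simp
    also have "(\<integral>\<^sup>+y\<in>{..b}. 1 * (kill b ^^ m) f y \<partial>lborel) = (\<integral>\<^sup>+y\<in>{..b}. f y * (kill b ^^ m) (\<lambda>_. 1) y \<partial>lborel)"
      by (rule kill_pow_sym) auto
    also have "\<dots> \<le> (\<integral>\<^sup>+y. ennreal (4 / sqrt m) * (f y * ennreal (b - y + 1) * indicator {..b} y) \<partial>lborel)"
    proof (rule nn_integral_mono)
      fix y
      have "(kill b ^^ m) (\<lambda>_. 1) y \<le> ennreal (4 / sqrt m) * ennreal (b - y + 1)" if "y \<le> b"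
        using kill_survival[OF mk(1) that] that by (subst ennreal_mult[symmetric]) auto
      then show "f y * (kill b ^^ m) (\<lambda>_. 1) y * indicator {..b} y
          \<le> ennreal (4 / sqrt m) * (f y * ennreal (b - y + 1) * indicator {..b} y)"
        by (auto split: split_indicator simp: mult.left_commute intro!: mult_left_mono)
    qed
    also have "\<dots> = ennreal (4 / sqrt m) * ?I"
      by (rule nn_integral_cmult) measurable
    also have "ennreal (1 / sqrt (2 * pi * k)) * (ennreal (4 / sqrt m) * ?I)
        = ennreal (1 / sqrt (2 * pi * k) * (4 / sqrt m)) * ?I"
      by (subst ennreal_mult) (auto simp: mult.assoc)
    also have "\<dots> \<le> ennreal c * ?I"
      unfolding c_def using mk
      by (intro mult_right_mono ennreal_leI divide_left_mono) (auto intro!: mult_pos_pos)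
    finally show ?thesis by (simp add: mult_left_mono)
  qed
  have "(kill b ^^ n) f x = (kill b ^^ m) ((kill b ^^ (k + m)) f) x"
    by (subst mk(3)) (simp add: funpow_add)
  also have "\<dots> \<le> (kill b ^^ m) (\<lambda>_. ennreal c * ?I * 1) x"
    using 1 by (intro kill_pow_mono x) simp
  also have "\<dots> = ennreal c * ?I * (kill b ^^ m) (\<lambda>_. 1) x"
    by (rule kill_pow_cmult) simp
  also have "\<dots> \<le> ennreal c * ?I * ennreal (4 * (b - x + 1) / sqrt m)"
    by (intro mult_left_mono kill_survival mk x) simp
  also have "\<dots> = ennreal (c * (4 * (b - x + 1) / sqrt m)) * ?I"
    using c0 x by (subst ennreal_mult) (auto simp: mult_ac)
  also have "\<dots> \<le> ennreal (100 * (b - x + 1) / (n * sqrt n)) * ?I"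
  proof (intro mult_right_mono ennreal_leI)
    have s: "sqrt m * sqrt m = real m" by simp
    have "c * (4 * (b - x + 1) / sqrt m) = 16 / sqrt (2 * pi) * ((b - x + 1) / (m * sqrt m))"
      by (simp add: c_def real_sqrt_mult)
    also have "\<dots> \<le> 8 * ((b - x + 1) / (m * sqrt m))"
    proof (intro mult_right_mono)
      have "2 \<le> sqrt (2 * pi)" using pi_gt3 by (intro real_le_rsqrt) auto
      then show "16 / sqrt (2 * pi) \<le> 8" by (simp add: field_simps)
    qed (use x in auto)
    also have "\<dots> \<le> 8 * ((b - x + 1) / (n * sqrt n / 12))"
    proof (intro mult_left_mono divide_left_mono)
      have "sqrt n \<le> sqrt (5 * m)" using mk(4) by (intro real_sqrt_le_mono) simp
      also have "\<dots> = sqrt 5 * sqrt m" by (simp add: real_sqrt_mult)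
      also have "\<dots> \<le> 12 / 5 * sqrt m"
        by (intro mult_right_mono real_le_lsqrt) (auto simp: power2_eq_square)
      finally have "n * sqrt n \<le> (5 * m) * (12 / 5 * sqrt m)" using mk(4) by (intro mult_mono) auto
      then show "n * sqrt n / 12 \<le> m * sqrt m" by simp
      show "0 < real m * sqrt m * (real n * sqrt n / 12)" using mk n0 by simp
    qed (use x in auto)
    also have "\<dots> = 96 * (b - x + 1) / (n * sqrt n)" by simp
    also have "\<dots> \<le> 100 * (b - x + 1) / (n * sqrt n)"
      using x by (intro divide_right_mono) auto
    finally show "c * (4 * (b - x + 1) / sqrt m) \<le> 100 * (b - x + 1) / (n * sqrt n)" .
  qed simp
  finally show ?thesis .
qed

section \<open>Lower bounds for the killed walk by the method of images\<close>

text \<open>Method of images: \<open>2 * b - x\<close> is the mirror image of the starting point,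
  and the difference is the transition density of Brownian motion killed on reaching
  \<open>b\<close>.\<close>

definition reflected_density :: "real \<Rightarrow> real \<Rightarrow> real \<Rightarrow> real \<Rightarrow> real" where
  "reflected_density b t x y = normal_density 0 (sqrt t) (y - x) - normal_density 0 (sqrt t) (y - (2 * b - x))"

lemma reflected_density_measurable [measurable]:
  "(\<lambda>(x, y). reflected_density b t x y) \<in> borel_measurable (borel \<Otimes>\<^sub>M borel)"
  unfolding reflected_density_def by measurable

lemma normal_density_le:
  assumes "\<bar>u\<bar> \<le> \<bar>v\<bar>" "0 < t"
  shows "normal_density 0 (sqrt t) v \<le> normal_density 0 (sqrt t) u"
proof -
  have "u\<^sup>2 \<le> v\<^sup>2" using assms by (simp add: abs_le_square_iff)
  then show ?thesis using assms
    by (auto simp: normal_density_def intro!: divide_right_mono)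
qed

lemma reflected_density_nonneg:
  "x \<le> b \<Longrightarrow> y \<le> b \<Longrightarrow> 0 < t \<Longrightarrow> 0 \<le> reflected_density b t x y"
  unfolding reflected_density_def using normal_density_le[of "y - x" "y - (2 * b - x)" t] by auto

lemma normal_density_conv:
  assumes t: "0 < s" "0 < t"
  shows "(\<integral>\<^sup>+z. ennreal (normal_density 0 (sqrt s) (z - x)) * ennreal (normal_density 0 (sqrt t) (y - z)) \<partial>lborel)
    = ennreal (normal_density 0 (sqrt (s + t)) (y - x))"
proof -
  have "(\<integral>\<^sup>+z. ennreal (normal_density 0 (sqrt s) (z - x)) * ennreal (normal_density 0 (sqrt t) (y - z)) \<partial>lborel)
      = (\<integral>\<^sup>+z. ennreal (normal_density 0 (sqrt t) ((y - x) - z) * normal_density 0 (sqrt s) z) \<partial>lborel)"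
    by (subst nn_integral_real_affine[where c=1 and t=x]) (simp_all add: algebra_simps ennreal_mult)
  also have "\<dots> = ennreal (normal_density 0 (sqrt (s + t)) (y - x))"
    using fun_cong[OF conv_normal_density_zero_mean[of "sqrt t" "sqrt s"], of "y - x"] t
    by (simp add: add.commute)
  finally show ?thesis .
qed

text \<open>Pairing each point with its mirror image moves all image terms to the half line
  \<open>{..b}\<close>, where they can be compared pointwise.\<close>

lemma nn_integral_fold:
  fixes b :: real
  assumes [measurable]: "f \<in> borel_measurable borel"
  shows "(\<integral>\<^sup>+z. f z \<partial>lborel) = (\<integral>\<^sup>+z\<in>{..b}. f z \<partial>lborel) + (\<integral>\<^sup>+z\<in>{..b}. f (2 * b - z) \<partial>lborel)"
proof -
  have "(\<integral>\<^sup>+z\<in>{..b}. f (2 * b - z) \<partial>lborel) = (\<integral>\<^sup>+z\<in>{b..}. f z \<partial>lborel)"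
    by (subst nn_integral_real_affine[where c="-1" and t="2*b"])
      (auto intro!: nn_integral_cong split: split_indicator)
  also have "\<dots> = (\<integral>\<^sup>+z\<in>{b<..}. f z \<partial>lborel)"
    by (intro nn_integral_cong_AE AE_I[where N="{b}"]) (auto split: split_indicator)
  finally have "(\<integral>\<^sup>+z\<in>{..b}. f z \<partial>lborel) + (\<integral>\<^sup>+z\<in>{..b}. f (2 * b - z) \<partial>lborel)
      = (\<integral>\<^sup>+z. f z * indicator {..b} z + f z * indicator {b<..} z \<partial>lborel)"
    by (simp add: nn_integral_add)
  also have "\<dots> = (\<integral>\<^sup>+z. f z \<partial>lborel)"
    by (intro nn_integral_cong) (auto split: split_indicator)
  finally show ?thesis by simp
qed

text \<open>The transition density of the Brownian motion killed at \<open>b\<close> bounds the walk killed at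
  integer times from below, because the latter is killed later.\<close>

lemma kill_pow_ge:
  assumes [measurable]: "f \<in> borel_measurable borel" and x: "x \<le> b" and m: "0 < m"
  shows "(\<integral>\<^sup>+y\<in>{..b}. ennreal (reflected_density b m x y) * f y \<partial>lborel) \<le> (kill b ^^ m) f x"
  using m x
proof (induction m arbitrary: x rule: nat_induct_non_zero)
  case 1
  have "kill b f x = (\<integral>\<^sup>+y. ennreal (std_normal_density (y - x)) * (indicator {..b} y * f y) \<partial>lborel)"
    unfolding kill_def by (subst heat_density) simp_all
  also have "\<dots> = (\<integral>\<^sup>+y. ennreal (std_normal_density (y - x)) * (f y * indicator {..b} y) \<partial>lborel)"
    by (simp add: mult.commute)
  finally show ?case
    by (auto intro!: nn_integral_mono mult_right_mono ennreal_leI simp: reflected_density_def mult.assoc)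
next
  case (Suc m x)
  let ?n = "\<lambda>t. normal_density 0 (sqrt t)"
  let ?g = "\<lambda>y. \<integral>\<^sup>+z\<in>{..b}. ennreal (?n 1 (z - x)) * ennreal (reflected_density b m z y) \<partial>lborel"
  \<comment> \<open>Chapman-Kolmogorov for the killed density, as an inequality because the first
    step uses the free kernel. Both normal densities are written as convolutions folded at
    \<open>b\<close>; subtracting them cancels down to \<open>?g\<close> by \<open>s\<close>, minus
    a remainder whose sign is settled by \<open>le\<close>.\<close>
  have g: "ennreal (reflected_density b (Suc m) x y) \<le> ?g y" if y: "y \<le> b" for y
  proof -
    have m0: "0 < real m" using Suc by simp
    let ?A = "\<lambda>u v. \<integral>\<^sup>+z\<in>{..b}. ennreal (?n 1 u) * ennreal (?n m v) \<partial>lborel"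
    have d1: "ennreal (?n (Suc m) (y - x)) = (\<integral>\<^sup>+z\<in>{..b}. ennreal (?n 1 (z - x)) * ennreal (?n m (y - z)) \<partial>lborel)
        + (\<integral>\<^sup>+z\<in>{..b}. ennreal (?n 1 (2 * b - z - x)) * ennreal (?n m (y - (2 * b - z))) \<partial>lborel)"
      using m0 normal_density_conv[of 1 m x y] by (subst (asm) nn_integral_fold[where b=b]) (auto simp: add.commute)
    have d2: "ennreal (?n (Suc m) (y - (2 * b - x))) = (\<integral>\<^sup>+z\<in>{..b}. ennreal (?n 1 (z - (2 * b - x))) * ennreal (?n m (y - z)) \<partial>lborel)
        + (\<integral>\<^sup>+z\<in>{..b}. ennreal (?n 1 (2 * b - z - (2 * b - x))) * ennreal (?n m (y - (2 * b - z))) \<partial>lborel)"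
      using m0 normal_density_conv[of 1 m "2 * b - x" y] by (subst (asm) nn_integral_fold[where b=b]) (auto simp: add.commute)
    have e1: "?n 1 (2 * b - z - (2 * b - x)) = ?n 1 (z - x)" "?n 1 (2 * b - z - x) = ?n 1 (z - (2 * b - x))" for z
      by (auto simp: normal_density_def power2_eq_square algebra_simps)
    have "ennreal (?n 1 (z - x)) * ennreal (reflected_density b m z y) + ennreal (?n 1 (z - x)) * ennreal (?n m (y - (2 * b - z)))
        = ennreal (?n 1 (z - x)) * ennreal (?n m (y - z))" if "z \<le> b" for z
      using reflected_density_nonneg[OF that y m0]
      by (subst distrib_left[symmetric], subst ennreal_plus[symmetric]) (auto simp: reflected_density_def)
    then have "(\<integral>\<^sup>+z. ennreal (?n 1 (z - x)) * ennreal (reflected_density b m z y) * indicator {..b} z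
          + ennreal (?n 1 (z - x)) * ennreal (?n m (y - (2 * b - z))) * indicator {..b} z \<partial>lborel)
        = (\<integral>\<^sup>+z\<in>{..b}. ennreal (?n 1 (z - x)) * ennreal (?n m (y - z)) \<partial>lborel)"
      by (intro nn_integral_cong) (auto split: split_indicator)
    then have s: "?g y + (\<integral>\<^sup>+z\<in>{..b}. ennreal (?n 1 (z - x)) * ennreal (?n m (y - (2 * b - z))) \<partial>lborel)
        = (\<integral>\<^sup>+z\<in>{..b}. ennreal (?n 1 (z - x)) * ennreal (?n m (y - z)) \<partial>lborel)"
      by (subst (asm) nn_integral_add) auto
    have le: "(\<integral>\<^sup>+z\<in>{..b}. ennreal (?n 1 (2 * b - z - x)) * ennreal (?n m (y - (2 * b - z))) \<partial>lborel)
        \<le> (\<integral>\<^sup>+z\<in>{..b}. ennreal (?n 1 (z - (2 * b - x))) * ennreal (?n m (y - z)) \<partial>lborel)"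
      unfolding e1
    proof (intro nn_integral_mono)
      fix z
      show "ennreal (?n 1 (z - (2 * b - x))) * ennreal (?n m (y - (2 * b - z))) * indicator {..b} z
        \<le> ennreal (?n 1 (z - (2 * b - x))) * ennreal (?n m (y - z)) * indicator {..b} z"
        using y m0 by (auto intro!: mult_left_mono ennreal_leI normal_density_le split: split_indicator)
    qed
    have "ennreal (?n (Suc m) (y - x)) \<le> ?g y + ennreal (?n (Suc m) (y - (2 * b - x)))"
      unfolding d1 d2 e1(1) s[symmetric] using le by (simp add: add_mono add.assoc add.commute)
    then have "ennreal (?n (Suc m) (y - x)) - ennreal (?n (Suc m) (y - (2 * b - x))) \<le> ?g y"
      by (simp add: ennreal_minus_le_iff add.commute)
    then show ?thesis by (simp add: reflected_density_def ennreal_minus)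
  qed
  have "(\<integral>\<^sup>+y\<in>{..b}. ennreal (reflected_density b (Suc m) x y) * f y \<partial>lborel) \<le> (\<integral>\<^sup>+y\<in>{..b}. ?g y * f y \<partial>lborel)"
    using g by (intro nn_integral_mono) (auto intro!: mult_right_mono split: split_indicator)
  also have "\<dots> = (\<integral>\<^sup>+y. \<integral>\<^sup>+z. ennreal (?n 1 (z - x)) * ennreal (reflected_density b m z y) * indicator {..b} z * (f y * indicator {..b} y) \<partial>lborel \<partial>lborel)"
    by (intro nn_integral_cong) (subst nn_integral_multc, auto simp: mult_ac)
  also have "\<dots> = (\<integral>\<^sup>+z. \<integral>\<^sup>+y. ennreal (?n 1 (z - x)) * ennreal (reflected_density b m z y) * indicator {..b} z * (f y * indicator {..b} y) \<partial>lborel \<partial>lborel)"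
    by (rule lborel_pair.Fubini') measurable
  also have "\<dots> = (\<integral>\<^sup>+z. ennreal (?n 1 (z - x)) * (indicator {..b} z * (\<integral>\<^sup>+y\<in>{..b}. ennreal (reflected_density b m z y) * f y \<partial>lborel)) \<partial>lborel)"
  proof (rule nn_integral_cong)
    fix z
    have "(\<integral>\<^sup>+y. ennreal (?n 1 (z - x)) * ennreal (reflected_density b m z y) * indicator {..b} z * (f y * indicator {..b} y) \<partial>lborel)
        = (\<integral>\<^sup>+y. (ennreal (?n 1 (z - x)) * indicator {..b} z) * (ennreal (reflected_density b m z y) * f y * indicator {..b} y) \<partial>lborel)"
      by (simp add: mult_ac)
    also have "\<dots> = (ennreal (?n 1 (z - x)) * indicator {..b} z) * (\<integral>\<^sup>+y\<in>{..b}. ennreal (reflected_density b m z y) * f y \<partial>lborel)"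
      by (rule nn_integral_cmult) measurable
    finally show "(\<integral>\<^sup>+y. ennreal (?n 1 (z - x)) * ennreal (reflected_density b m z y) * indicator {..b} z * (f y * indicator {..b} y) \<partial>lborel)
        = ennreal (?n 1 (z - x)) * (indicator {..b} z * (\<integral>\<^sup>+y\<in>{..b}. ennreal (reflected_density b m z y) * f y \<partial>lborel))"
      by (simp add: mult.assoc)
  qed
  also have "\<dots> \<le> (\<integral>\<^sup>+z. ennreal (?n 1 (z - x)) * (indicator {..b} z * (kill b ^^ m) f z) \<partial>lborel)"
  proof (rule nn_integral_mono)
    fix z
    show "ennreal (?n 1 (z - x)) * (indicator {..b} z * (\<integral>\<^sup>+y\<in>{..b}. ennreal (reflected_density b m z y) * f y \<partial>lborel))
        \<le> ennreal (?n 1 (z - x)) * (indicator {..b} z * (kill b ^^ m) f z)"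
      using Suc.IH[of z] by (cases "z \<le> b") (auto intro: mult_left_mono)
  qed
  also have "\<dots> = (kill b ^^ Suc m) f x"
    by (simp add: kill_def heat_density)
  finally show ?case .
qed

text \<open>The image term equals the direct term times \<open>exp (- u)\<close> with
  \<open>u = 2 * (b - x) * (b - y) / t\<close>, and \<open>1 - exp (- u) \<ge> u / 2\<close> for
  \<open>u\<close> in the unit interval. So killing costs a factor of the order of the product of
  the two depths over \<open>t\<close>.\<close>

lemma reflected_density_ge:
  assumes "x \<le> b" "y \<le> b" "2 * (b - x) * (b - y) \<le> t" "0 < t"
  shows "(b - x) * (b - y) / (t * sqrt (2 * pi * t)) * exp (- (y - x)\<^sup>2 / (2 * t)) \<le> reflected_density b t x y"
proof -
  define u where "u = 2 * (b - x) * (b - y) / t"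
  have u: "0 \<le> u" "u \<le> 1" using assms by (auto simp: u_def)
  have "exp (- u) \<le> 1 - u / 2"
  proof -
    have "exp (- u) \<le> 1 / (1 + u)"
      using exp_ge_add_one_self[of u] u by (simp add: exp_minus field_simps)
    also have "\<dots> \<le> 1 - u / 2"
      using u mult_left_le[of u u] by (simp add: field_simps)
    finally show ?thesis .
  qed
  have "normal_density 0 (sqrt t) (y - (2 * b - x)) = normal_density 0 (sqrt t) (y - x) * exp (- u)"
  proof -
    have "- (y - (2 * b - x))\<^sup>2 / (2 * t) = - (y - x)\<^sup>2 / (2 * t) + - u"
      using assms by (simp add: u_def power2_eq_square field_simps)
    then show ?thesis using assms by (simp add: normal_density_def exp_add[symmetric])
  qed
  then have "reflected_density b t x y = normal_density 0 (sqrt t) (y - x) * (1 - exp (- u))"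
    by (simp add: reflected_density_def right_diff_distrib)
  also have "\<dots> \<ge> normal_density 0 (sqrt t) (y - x) * (u / 2)"
    using \<open>exp (- u) \<le> 1 - u / 2\<close> by (intro mult_left_mono) auto
  also have "normal_density 0 (sqrt t) (y - x) * (u / 2) = (b - x) * (b - y) / (t * sqrt (2 * pi * t)) * exp (- (y - x)\<^sup>2 / (2 * t))"
    using assms by (simp add: normal_density_def u_def divide_simps) (simp add: algebra_simps)
  finally show ?thesis .
qed

section \<open>Independence of labels and the law of a lineage\<close>

text \<open>The random quantity whose Brownian expectation is \<open>pexp\<close>. With observables
  stored as lists, cutting a path at a time becomes list append.\<close>

definition obs :: "(real \<Rightarrow> real) \<Rightarrow> (real \<times> (real \<Rightarrow> ennreal)) list \<Rightarrow> ennreal" where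
  "obs p r = prod_list (map (\<lambda>(t, f). f (p t)) r)"

lemma obs_simps [simp]:
  "obs p [] = 1"
  "obs p ((t, f) # r) = f (p t) * obs p r"
  "obs p (r @ r') = obs p r * obs p r'"
  by (auto simp: obs_def)

lemma obs_cong: "(\<And>t. t \<in> fst ` set r \<Longrightarrow> p t = q t) \<Longrightarrow> obs p r = obs q r"
  by (induction r) auto

lemma obs_measurable:
  assumes "borel_list r" "\<And>t. t \<in> fst ` set r \<Longrightarrow> (\<lambda>x. p x t) \<in> borel_measurable N"
  shows "(\<lambda>x. obs (p x) r) \<in> borel_measurable N"
  using assms
proof (induction r)
  case (Cons tf r)
  obtain t f where tf: "tf = (t, f)" by force
  have [measurable]: "f \<in> borel_measurable borel" "(\<lambda>x. p x t) \<in> borel_measurable N"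
    "(\<lambda>x. obs (p x) r) \<in> borel_measurable N"
    using Cons by (auto simp: tf)
  show ?case by (simp add: tf)
qed simp

lemma borel_list_nth: "borel_list r \<Longrightarrow> i < length r \<Longrightarrow> snd (r ! i) \<in> borel_measurable borel"
  unfolding borel_list_def using nth_mem[of i r] by (metis (no_types, lifting) case_prod_beta)

definition shift_list :: "real \<Rightarrow> (real \<times> (real \<Rightarrow> ennreal)) list \<Rightarrow> (real \<times> (real \<Rightarrow> ennreal)) list" where
  "shift_list a r = map (\<lambda>(s, f). (s - a, f)) r"

lemma pexp_shift: "pexp (t - a) x (shift_list a r) = pexp t x r"
  by (induction r arbitrary: t x) (auto simp: shift_list_def)

lemma borel_list_shift [simp]: "borel_list (shift_list a r) = borel_list r"
  by (auto simp: borel_list_def shift_list_def)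

lemma fst_set_shift_list [simp]: "fst ` set (shift_list a r) = (\<lambda>t. t - a) ` fst ` set r"
  by (force simp: shift_list_def)

lemma sorted_shift_list [simp]:
  "sorted_wrt (<) (map fst (shift_list a r)) = sorted_wrt (<) (map fst r)"
  by (induction r) (auto simp: shift_list_def)

lemma obs_shift: "obs p (shift_list a r) = obs (\<lambda>t. p (t - a)) r"
  by (induction r) (auto simp: shift_list_def)

definition fold_list :: "(real \<Rightarrow> real) \<Rightarrow> (real \<times> (real \<Rightarrow> ennreal)) list \<Rightarrow> (real \<times> (real \<Rightarrow> ennreal)) list" where
  "fold_list \<rho> r = map (\<lambda>(s, f). (s, \<lambda>x. f (\<rho> x))) r"

lemma fold_list_simps [simp]:
  "fold_list \<rho> [] = []"
  "fold_list \<rho> ((s, f) # r) = (s, \<lambda>x. f (\<rho> x)) # fold_list \<rho> r"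
  "fold_list \<rho> (r @ r') = fold_list \<rho> r @ fold_list \<rho> r'"
  "map fst (fold_list \<rho> r) = map fst r"
  by (auto simp: fold_list_def)

lemma fst_set_fold_list [simp]: "fst ` set (fold_list \<rho> r) = fst ` set r"
  by (force simp: fold_list_def)

lemma fold_list_id [simp]: "fold_list (\<lambda>x. x) r = r"
  by (auto simp: fold_list_def)

lemma obs_fold: "obs p (fold_list \<rho> r) = obs (\<lambda>t. \<rho> (p t)) r"
  by (induction r) (auto simp: fold_list_def)

text \<open>The two cases are treated together so that one many-to-one formula serves both the
  reflected and the unreflected system.\<close>

definition folding :: "(real \<Rightarrow> real) \<Rightarrow> bool" where
  "folding \<rho> \<longleftrightarrow> \<rho> = (\<lambda>x. x) \<or> \<rho> = abs"

lemma folding_measurable: "folding \<rho> \<Longrightarrow> \<rho> \<in> borel_measurable borel"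
  by (auto simp: folding_def)

lemma borel_list_fold: "folding \<rho> \<Longrightarrow> borel_list r \<Longrightarrow> borel_list (fold_list \<rho> r)"
  by (auto simp: borel_list_def fold_list_def intro: measurable_compose[OF folding_measurable])

lemma pexp_abs: "borel_list r \<Longrightarrow> pexp t (- x) (fold_list abs r) = pexp t x (fold_list abs r)"
proof (induction r arbitrary: t x)
  case (Cons sf r)
  obtain s f where sf: "sf = (s, f)" by force
  have r: "borel_list r" and [measurable]: "f \<in> borel_measurable borel"
    using Cons.prems by (auto simp: sf)
  have [measurable]: "(\<lambda>y. pexp s y (fold_list abs r)) \<in> borel_measurable borel"
    using r by (intro pexp_measurable_snd borel_list_fold) (auto simp: folding_def)
  have "heat (s - t) (\<lambda>y. f \<bar>y\<bar> * pexp s y (fold_list abs r)) (- x)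
      = heat (s - t) (\<lambda>y. f \<bar>- y\<bar> * pexp s (- y) (fold_list abs r)) x"
    by (subst heat_neg[symmetric]) simp_all
  then show ?case using Cons.IH[OF r] by (simp add: sf)
qed simp

text \<open>Restarting from the folded position does not change the law of the folded future. This
  is why reflecting anew at every birth still yields a single reflected Brownian motion along a
  lineage.\<close>

lemma pexp_fold:
  assumes "folding \<rho>" "borel_list r"
  shows "pexp t (\<rho> x) (fold_list \<rho> r) = pexp t x (fold_list \<rho> r)"
  using assms pexp_abs[of r t x] by (auto simp: folding_def abs_if)

section \<open>Finite-dimensional laws of Brownian motion\<close>

text \<open>The coordinates are increments. The index set starts at a variable \<open>k\<close> so
  that, once the first increment is integrated out, the tail is again an instance.\<close>

lemma nn_integral_PiM_pexp:
  fixes P :: "nat \<Rightarrow> real measure"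
  assumes "borel_list r" and P: "\<And>i. prob_space (P i)" "\<And>i. sets (P i) = sets borel"
    and "\<And>i h y. i < length r \<Longrightarrow> h \<in> borel_measurable borel \<Longrightarrow>
      (\<integral>\<^sup>+a. h (y + a) \<partial>P (k + i)) = heat ((t # map fst r) ! Suc i - (t # map fst r) ! i) h y"
  shows "(\<integral>\<^sup>+v. (\<Prod>i<length r. snd (r ! i) (y + (\<Sum>j\<in>{k..k+i}. v j))) \<partial>PiM {k..<k + length r} P) = pexp t y r"
  using assms(1,4)
proof (induction r arbitrary: k t y)
  case Nil
  then show ?case by (simp add: PiM_empty nn_integral_count_space_finite)
next
  case (Cons sf r)
  interpret product_sigma_finite P
    using P(1) by (intro product_sigma_finite.intro prob_space_imp_sigma_finite)
  obtain s f where sf: "sf = (s, f)" by force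
  have f[measurable]: "f \<in> borel_measurable borel" and r: "borel_list r"
    using Cons.prems(1) by (auto simp: sf)
  let ?F = "\<lambda>v. \<Prod>i<length (sf # r). snd ((sf # r) ! i) (y + (\<Sum>j\<in>{k..k+i}. v j))"
  let ?K = "{Suc k..<Suc k + length r}"
  have I: "{k..<k + length (sf # r)} = insert k ?K" by auto
  have meas: "?F \<in> borel_measurable (PiM (insert k ?K) P)"
  proof (intro borel_measurable_prod_ennreal)
    fix i assume i: "i \<in> {..<length (sf # r)}"
    then have m: "snd ((sf # r) ! i) \<in> borel_measurable borel"
      using Cons.prems(1) by (intro borel_list_nth) auto
    have "(\<lambda>v. v j) \<in> borel_measurable (PiM (insert k ?K) P)" if "j \<in> {k..k+i}" for j
    proof -
      have "j \<in> insert k ?K" using that i by (cases "j = k") auto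
      from measurable_component_singleton[OF this, of P] show ?thesis
        by (simp add: measurable_cong_sets[OF refl P(2)])
    qed
    then show "(\<lambda>v. snd ((sf # r) ! i) (y + (\<Sum>j\<in>{k..k+i}. v j))) \<in> borel_measurable (PiM (insert k ?K) P)"
      by (intro measurable_compose[OF _ m] borel_measurable_add borel_measurable_sum) auto
  qed
  have F: "?F (v(k := a)) = f (y + a) * (\<Prod>i<length r. snd (r ! i) ((y + a) + (\<Sum>j\<in>{Suc k..Suc k+i}. v j)))" for v a
  proof -
    have "(\<Sum>j\<in>{k..Suc (k + i)}. (v(k := a)) j) = a + (\<Sum>j\<in>{Suc k..Suc k+i}. v j)" for i
      by (subst sum.atLeast_Suc_atMost) auto
    then show ?thesis
      by (simp add: sf prod.lessThan_Suc_shift add.assoc del: prod.lessThan_Suc)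
  qed
  have IH: "(\<integral>\<^sup>+v. (\<Prod>i<length r. snd (r ! i) (y + (\<Sum>j\<in>{Suc k..Suc k+i}. v j))) \<partial>PiM ?K P) = pexp s y r" for y
  proof (rule Cons.IH[OF r])
    fix i y and h :: "real \<Rightarrow> ennreal" assume "i < length r" "h \<in> borel_measurable borel"
    then show "(\<integral>\<^sup>+a. h (y + a) \<partial>P (Suc k + i)) = heat ((s # map fst r) ! Suc i - (s # map fst r) ! i) h y"
      using Cons.prems(2)[of "Suc i" h y] by (simp add: sf)
  qed
  have "(\<integral>\<^sup>+v. ?F v \<partial>PiM {k..<k + length (sf # r)} P) = (\<integral>\<^sup>+a. (\<integral>\<^sup>+v. ?F (v(k := a)) \<partial>PiM ?K P) \<partial>P k)"
    unfolding I using meas by (intro product_nn_integral_insert_rev) auto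
  also have "\<dots> = (\<integral>\<^sup>+a. f (y + a) * pexp s (y + a) r \<partial>P k)"
  proof (intro nn_integral_cong)
    fix a
    have "(\<lambda>v. \<Prod>i<length r. snd (r ! i) ((y + a) + (\<Sum>j\<in>{Suc k..Suc k+i}. v j))) \<in> borel_measurable (PiM ?K P)"
    proof (intro borel_measurable_prod_ennreal)
      fix i assume i: "i \<in> {..<length r}"
      then have m: "snd (r ! i) \<in> borel_measurable borel"
        using r by (intro borel_list_nth) auto
      have "(\<lambda>v. v j) \<in> borel_measurable (PiM ?K P)" if "j \<in> {Suc k..Suc k+i}" for j
        using measurable_component_singleton[of j ?K P] that i
        by (auto simp: measurable_cong_sets[OF refl P(2)])
      then show "(\<lambda>v. snd (r ! i) ((y + a) + (\<Sum>j\<in>{Suc k..Suc k+i}. v j))) \<in> borel_measurable (PiM ?K P)"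
        by (intro measurable_compose[OF _ m] borel_measurable_add borel_measurable_sum) auto
    qed
    then show "(\<integral>\<^sup>+v. ?F (v(k := a)) \<partial>PiM ?K P) = f (y + a) * pexp s (y + a) r"
      unfolding F by (subst nn_integral_cmult) (simp_all only: IH)
  qed
  also have "\<dots> = heat (s - t) (\<lambda>y. f y * pexp s y r) y"
    using Cons.prems(2)[of 0 "\<lambda>y. f y * pexp s y r" y] r pexp_measurable_snd[OF r, of s]
    by (simp add: sf)
  finally show ?case by (simp add: sf)
qed

lemma (in prob_space) brownian_motion_pexp_pos:
  assumes B: "brownian_motion B" and r: "borel_list r" and srt: "sorted_wrt (<) (0 # map fst r)"
  shows "(\<integral>\<^sup>+\<omega>. obs (\<lambda>t. y + B t \<omega>) r \<partial>M) = pexp 0 y r"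
proof (cases "r = []")
  case True
  then show ?thesis by (simp add: emeasure_space_1)
next
  case False
  define n where "n = length r"
  define t where "t i = (if i \<le> n then (0 # map fst r) ! i else 0)" for i
  define D where "D i \<omega> = B (t (Suc i)) \<omega> - B (t i) \<omega>" for i \<omega>
  have n: "0 < n" using False by (simp add: n_def)
  have mono: "t i < t j" if "i < j" "j \<le> n" for i j
    using sorted_wrt_nth_less[OF srt, of i j] that by (simp add: t_def n_def)
  then have smono: "strict_mono_on {..n} t" by (auto simp: strict_mono_on_def)
  have t0: "t 0 = 0" by (simp add: t_def)
  have tpos: "0 \<le> t i" if "i \<le> n" for i
    using mono[of 0 i] that t0 by (cases "i = 0") auto
  have Bm: "B s \<in> borel_measurable M" if "0 \<le> s" for s
    using B that by (simp add: brownian_motion_def)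
  have B0: "AE \<omega> in M. B 0 \<omega> = 0" using B by (simp add: brownian_motion_def)
  have indep: "indep_vars (\<lambda>_. borel) D {..<n}"
    using B t0 smono unfolding brownian_motion_def D_def by auto
  have Dm: "D i \<in> borel_measurable M" if "i < n" for i
    using that tpos unfolding D_def by (auto intro!: borel_measurable_diff Bm)
  have dist: "distributed M lborel (D i) (normal_density 0 (sqrt (t (Suc i) - t i)))" if "i < n" for i
    using B mono[of i "Suc i"] tpos[of i] that unfolding brownian_motion_def D_def by auto
  \<comment> \<open>Beyond the \<open>n\<close> increments the family is padded with
    \<open>gauss\<close>, so that every \<open>P i\<close> is a probability measure.\<close>
  define P where "P i = (if i < n then distr M borel (D i) else gauss)" for i
  have P: "prob_space (P i)" "sets (P i) = sets borel" for i
    using Dm[of i] by (auto simp: P_def intro: prob_space_distr gauss.prob_space_axioms)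
  have Pint: "(\<integral>\<^sup>+a. h (y + a) \<partial>P i) = heat (t (Suc i) - t i) h y"
    if "i < n" and h[measurable]: "h \<in> borel_measurable borel" for i h y
  proof -
    have d: "0 < t (Suc i) - t i" using mono[of i "Suc i"] that by simp
    have "(\<integral>\<^sup>+a. h (y + a) \<partial>P i) = (\<integral>\<^sup>+\<omega>. h (y + D i \<omega>) \<partial>M)"
      using that Dm[of i] by (simp add: P_def nn_integral_distr)
    also have "\<dots> = (\<integral>\<^sup>+a. ennreal (normal_density 0 (sqrt (t (Suc i) - t i)) a) * h (y + a) \<partial>lborel)"
      by (rule distributed_nn_integral[OF dist[OF that(1)], symmetric]) simp
    also have "\<dots> = heat (t (Suc i) - t i) h y"
      using d by (subst heat_density, simp, simp, subst nn_integral_real_affine[where c=1 and t=y]) simp_all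
    finally show ?thesis .
  qed
  let ?G = "\<lambda>v. \<Prod>i<n. snd (r ! i) (y + (\<Sum>j\<in>{0..i}. v j))"
  have "(\<integral>\<^sup>+\<omega>. obs (\<lambda>t. y + B t \<omega>) r \<partial>M) = (\<integral>\<^sup>+\<omega>. ?G (\<lambda>i\<in>{..<n}. D i \<omega>) \<partial>M)"
  proof (rule nn_integral_cong_AE)
    show "AE \<omega> in M. obs (\<lambda>t. y + B t \<omega>) r = ?G (\<lambda>i\<in>{..<n}. D i \<omega>)"
      using B0
    proof eventually_elim
      case (elim \<omega>)
      have "(\<Sum>j\<in>{0..i}. (\<lambda>i\<in>{..<n}. D i \<omega>) j) = B (fst (r ! i)) \<omega>" if "i < n" for i
      proof -
        have "(\<Sum>j\<in>{0..i}. (\<lambda>i\<in>{..<n}. D i \<omega>) j) = (\<Sum>j\<le>i. B (t (Suc j)) \<omega> - B (t j) \<omega>)"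
          using that by (intro sum.cong) (auto simp: D_def)
        also have "\<dots> = B (t (Suc i)) \<omega> - B (t 0) \<omega>"
          by (induction i) auto
        finally show ?thesis using elim that by (simp add: t0 t_def n_def)
      qed
      then have "?G (\<lambda>i\<in>{..<n}. D i \<omega>) = (\<Prod>i<n. snd (r ! i) (y + B (fst (r ! i)) \<omega>))"
        by (intro prod.cong) auto
      also have "\<dots> = obs (\<lambda>t. y + B t \<omega>) r"
        unfolding obs_def by (subst prod.list_conv_set_nth) (auto simp: n_def atLeast0LessThan split_beta)
      finally show ?case by simp
    qed
  qed
  also have "\<dots> = (\<integral>\<^sup>+v. ?G v \<partial>distr M (PiM {..<n} (\<lambda>_. borel)) (\<lambda>\<omega>. \<lambda>i\<in>{..<n}. D i \<omega>))"
  proof (rule nn_integral_distr[symmetric])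
    show "(\<lambda>\<omega>. \<lambda>i\<in>{..<n}. D i \<omega>) \<in> M \<rightarrow>\<^sub>M PiM {..<n} (\<lambda>_. borel)"
      using Dm by (intro measurable_restrict) auto
    show "?G \<in> borel_measurable (distr M (PiM {..<n} (\<lambda>_. borel)) (\<lambda>\<omega>. \<lambda>i\<in>{..<n}. D i \<omega>))"
      unfolding measurable_distr_eq1
    proof (intro borel_measurable_prod_ennreal)
      fix i assume i: "i \<in> {..<n}"
      then have m: "snd (r ! i) \<in> borel_measurable borel"
        using r by (intro borel_list_nth) (auto simp: n_def)
      show "(\<lambda>v. snd (r ! i) (y + (\<Sum>j\<in>{0..i}. v j))) \<in> borel_measurable (PiM {..<n} (\<lambda>_. borel))"
        using i by (intro measurable_compose[OF _ m] borel_measurable_add borel_measurable_sum measurable_component_singleton) auto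
    qed
  qed
  also have "distr M (PiM {..<n} (\<lambda>_. borel)) (\<lambda>\<omega>. \<lambda>i\<in>{..<n}. D i \<omega>) = PiM {..<n} (\<lambda>i. distr M borel (D i))"
    using n Dm indep by (subst indep_vars_iff_distr_eq_PiM'[symmetric]) auto
  also have "\<dots> = PiM {..<n} P"
    by (intro PiM_cong) (auto simp: P_def)
  also have "(\<integral>\<^sup>+v. ?G v \<partial>PiM {..<n} P) = pexp 0 y r"
  proof -
    have "(\<integral>\<^sup>+v. (\<Prod>i<length r. snd (r ! i) (y + (\<Sum>j\<in>{0..0+i}. v j))) \<partial>PiM {0..<0 + length r} P) = pexp 0 y r"
    proof (rule nn_integral_PiM_pexp[OF r P])
      fix i y and h :: "real \<Rightarrow> ennreal" assume "i < length r" "h \<in> borel_measurable borel"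
      then show "(\<integral>\<^sup>+a. h (y + a) \<partial>P (0 + i)) = heat ((0 # map fst r) ! Suc i - (0 # map fst r) ! i) h y"
        using Pint[of i h y] by (simp add: t_def n_def)
    qed
    then show ?thesis by (simp add: n_def atLeast0LessThan)
  qed
  finally show ?thesis .
qed

text \<open>Also admits an observation at time 0, where \<open>B 0 = 0\<close> holds only almost
  surely and the increment has no density.\<close>

lemma (in prob_space) brownian_motion_pexp:
  assumes B: "brownian_motion B" and r: "borel_list r"
    and srt: "sorted_wrt (<) (map fst r)" "\<And>t. t \<in> fst ` set r \<Longrightarrow> 0 \<le> t"
  shows "(\<integral>\<^sup>+\<omega>. obs (\<lambda>t. y + B t \<omega>) r \<partial>M) = pexp 0 y r"
proof (cases "\<exists>f q. r = (0, f) # q")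
  case True
  then obtain f q where rq: "r = (0, f) # q" by auto
  have q: "borel_list q" "sorted_wrt (<) (0 # map fst q)" and f[measurable]: "f \<in> borel_measurable borel"
    using r srt by (auto simp: rq)
  have Bm: "B s \<in> borel_measurable M" if "0 \<le> s" for s
    using B that by (simp add: brownian_motion_def)
  have "(\<integral>\<^sup>+\<omega>. obs (\<lambda>t. y + B t \<omega>) r \<partial>M) = (\<integral>\<^sup>+\<omega>. f y * obs (\<lambda>t. y + B t \<omega>) q \<partial>M)"
  proof (rule nn_integral_cong_AE)
    have "AE \<omega> in M. B 0 \<omega> = 0" using B by (simp add: brownian_motion_def)
    then show "AE \<omega> in M. obs (\<lambda>t. y + B t \<omega>) r = f y * obs (\<lambda>t. y + B t \<omega>) q"
      by eventually_elim (simp add: rq)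
  qed
  also have "\<dots> = f y * (\<integral>\<^sup>+\<omega>. obs (\<lambda>t. y + B t \<omega>) q \<partial>M)"
    using q srt(2) Bm by (intro nn_integral_cmult obs_measurable) (auto simp: rq)
  also have "\<dots> = pexp 0 y r"
    by (subst brownian_motion_pexp_pos[OF B q]) (simp add: rq)
  finally show ?thesis .
next
  case False
  then have "sorted_wrt (<) (0 # map fst r)"
    using srt by (cases r) (fastforce simp: less_le)+
  then show ?thesis by (rule brownian_motion_pexp_pos[OF B r])
qed

section \<open>Paths along a lineage\<close>

lemma suffix_neq_Cons: "suffix v u \<Longrightarrow> v \<noteq> b # u"
  by (auto dest: suffix_length_le)

text \<open>Unlike \<open>position\<close>, this follows the ancestors of a particle before its birth. The choice
  \<open>\<rho> = abs\<close> gives the reflected and \<open>\<rho> = (\<lambda>x. x)\<close> the unreflected system.\<close>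

primrec path ::
  "(real \<Rightarrow> real) \<Rightarrow> (particle \<Rightarrow> real) \<Rightarrow> (particle \<Rightarrow> real \<Rightarrow> real) \<Rightarrow> particle \<Rightarrow> real \<Rightarrow> real" where
  "path \<rho> l w [] t = \<rho> (w [] t)"
| "path \<rho> l w (b # u) t = (if t < birth_time l (b # u) then path \<rho> l w u t
     else \<rho> (path \<rho> l w u (birth_time l (b # u)) + w (b # u) (t - birth_time l (b # u))))"

lemma birth_time_measurable:
  assumes "\<And>v. suffix v u \<Longrightarrow> v \<noteq> u \<Longrightarrow> (\<lambda>x. l x v) \<in> borel_measurable N"
  shows "(\<lambda>x. birth_time (l x) u) \<in> borel_measurable N"
  using assms
proof (induction u)
  case (Cons b u)
  have "(\<lambda>x. birth_time (l x) u) \<in> borel_measurable N"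
    using Cons.prems by (intro Cons.IH) (auto simp: suffix_Cons suffix_neq_Cons)
  moreover have "(\<lambda>x. l x u) \<in> borel_measurable N"
    by (intro Cons.prems) (auto simp: suffix_Cons)
  ultimately show ?case by simp
qed simp

text \<open>The evaluation time may be random, hence the joint measurability of \<open>w\<close>.
  Only lifetimes of strict ancestors enter, since the path of \<open>u\<close> ignores the death of
  \<open>u\<close>.\<close>

lemma path_measurable:
  assumes "folding \<rho>"
    and "\<And>v. suffix v u \<Longrightarrow> v \<noteq> u \<Longrightarrow> (\<lambda>x. l x v) \<in> borel_measurable N"
    and "\<And>v. suffix v u \<Longrightarrow> (\<lambda>(t, x). w x v t) \<in> borel_measurable (borel \<Otimes>\<^sub>M N)"
    and "\<theta> \<in> borel_measurable N"
  shows "(\<lambda>x. path \<rho> (l x) (w x) u (\<theta> x)) \<in> borel_measurable N"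
  using assms(2-4)
proof (induction u arbitrary: \<theta>)
  case Nil
  note [measurable] = folding_measurable[OF assms(1)] Nil(3)
  have [measurable]: "(\<lambda>(t, x). w x [] t) \<in> borel_measurable (borel \<Otimes>\<^sub>M N)"
    using Nil by simp
  show ?case by simp
next
  case (Cons b u)
  note [measurable] = folding_measurable[OF assms(1)] Cons.prems(3)
  have [measurable]: "(\<lambda>(t, x). w x (b # u) t) \<in> borel_measurable (borel \<Otimes>\<^sub>M N)"
    using Cons.prems(2) by simp
  have b[measurable]: "(\<lambda>x. birth_time (l x) (b # u)) \<in> borel_measurable N"
    using Cons.prems(1) by (rule birth_time_measurable)
  have [measurable]: "(\<lambda>x. path \<rho> (l x) (w x) u (\<theta> x)) \<in> borel_measurable N"
    "(\<lambda>x. path \<rho> (l x) (w x) u (birth_time (l x) (b # u))) \<in> borel_measurable N"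
    using Cons.prems b by (auto intro!: Cons.IH simp: suffix_Cons suffix_neq_Cons simp del: birth_time.simps)
  show ?case unfolding path.simps by measurable
qed

section \<open>Independence of disjoint groups of labels\<close>

context branching_data
begin

definition label_events :: "particle + particle \<Rightarrow> 'a set set" where
  "label_events i = (case i of
            Inl u \<Rightarrow> sets (vimage_algebra (space M) (L u) borel)
          | Inr u \<Rightarrow> sets (vimage_algebra (space M) (\<lambda>\<omega>. \<lambda>t\<in>{0..}. W u t \<omega>) (\<Pi>\<^sub>M t\<in>{0..}. borel)))"

text \<open>The information carried by the labels in \<open>I\<close>, with \<open>Inl\<close> for
  lifetimes and \<open>Inr\<close> for motions. Independence of two pieces of the system then
  reduces to disjointness of label sets.\<close>

definition GA :: "(particle + particle) set \<Rightarrow> 'a measure" where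
  "GA I = sigma (space M) (\<Union>i\<in>I. label_events i)"

lemma indep_label_events: "indep_sets label_events UNIV"
  using independence by (simp add: label_events_def[abs_def])

lemma label_events_sub: "label_events i \<subseteq> events"
  using indep_label_events by (auto simp: indep_sets_def)

lemma space_GA [simp]: "space (GA I) = space M"
  by (simp add: GA_def space_measure_of_conv)

lemma sets_GA: "sets (GA I) = sigma_sets (space M) (\<Union>i\<in>I. label_events i)"
  unfolding GA_def using label_events_sub sets.sets_into_space by (intro sets_measure_of) blast

lemma sets_GA_sub: "sets (GA I) \<subseteq> events"
  unfolding sets_GA using label_events_sub by (intro sets.sigma_sets_subset) auto

lemma subalgebra_GA: "subalgebra M (GA I)"
  using sets_GA_sub by (auto simp: subalgebra_def)

lemma GA_mono: "I \<subseteq> J \<Longrightarrow> subalgebra (GA J) (GA I)"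
  unfolding subalgebra_def sets_GA by (auto intro!: sigma_sets_mono')

lemma indep_GA:
  assumes "disjoint_family_on I J"
  shows "indep_sets (\<lambda>j. sets (GA (I j))) J"
  unfolding sets_GA
proof (rule indep_sets_collect_sigma)
  show "indep_sets label_events (\<Union>j\<in>J. I j)"
    using indep_label_events by (rule indep_sets_mono_index[rotated]) simp
  show "Int_stable (label_events i)" for i
    unfolding label_events_def by (auto simp: Int_stable_def split: sum.split)
qed fact

text \<open>Independence in Fubini form. The identity maps from \<open>M\<close> to
  \<open>GA I\<close> and to \<open>GA J\<close> are independent random variables, so the diagonal
  \<open>(\<omega>, \<omega>)\<close> has a product law and the second \<open>\<omega>\<close> may
  be replaced by an independent one.\<close>

lemma decouple:
  assumes IJ: "I \<inter> J = {}" and f: "f \<in> borel_measurable (GA I \<Otimes>\<^sub>M GA J)"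
  shows "(\<integral>\<^sup>+\<omega>. f (\<omega>, \<omega>) \<partial>M) = (\<integral>\<^sup>+\<omega>1. (\<integral>\<^sup>+\<omega>2. f (\<omega>1, \<omega>2) \<partial>M) \<partial>M)"
proof -
  have id: "(\<lambda>\<omega>. \<omega>) \<in> M \<rightarrow>\<^sub>M GA K" for K
    using measurable_from_subalg[OF subalgebra_GA, of "\<lambda>\<omega>. \<omega>" K "GA K"] by simp
  have self: "sigma_sets (space M) {A \<inter> space M |A. A \<in> sets (GA K)} = sets (GA K)" for K
  proof -
    have "{A \<inter> space M |A. A \<in> sets (GA K)} = sets (GA K)"
      using sets.sets_into_space[of _ "GA K"] by (auto, metis Int_absorb2 space_GA)
    then show ?thesis using sets.sigma_sets_eq[of "GA K"] by simp
  qed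
  have "indep_sets (\<lambda>j. sets (GA (case_bool I J j))) UNIV"
    using IJ by (intro indep_GA) (auto simp: disjoint_family_on_def split: bool.splits)
  then have "indep_set (sets (GA I)) (sets (GA J))"
    unfolding indep_set_def by (rule indep_sets_cong[THEN iffD1, rotated 2]) (auto split: bool.split)
  then have "indep_var (GA I) (\<lambda>\<omega>. \<omega>) (GA J) (\<lambda>\<omega>. \<omega>)"
    using id by (simp add: indep_var_eq self)
  then have eq: "distr M (GA I) (\<lambda>\<omega>. \<omega>) \<Otimes>\<^sub>M distr M (GA J) (\<lambda>\<omega>. \<omega>)
      = distr M (GA I \<Otimes>\<^sub>M GA J) (\<lambda>\<omega>. (\<omega>, \<omega>))"
    by (simp add: indep_var_distribution_eq)
  interpret J: prob_space "distr M (GA J) (\<lambda>\<omega>. \<omega>)"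
    by (rule prob_space_distr[OF id])
  have f': "f \<in> borel_measurable (distr M (GA I) (\<lambda>\<omega>. \<omega>) \<Otimes>\<^sub>M distr M (GA J) (\<lambda>\<omega>. \<omega>))"
    using f by (subst measurable_cong_sets[OF sets_pair_measure_cong[OF sets_distr sets_distr] refl])
  have "(\<integral>\<^sup>+\<omega>. f (\<omega>, \<omega>) \<partial>M) = (\<integral>\<^sup>+x. f x \<partial>distr M (GA I \<Otimes>\<^sub>M GA J) (\<lambda>\<omega>. (\<omega>, \<omega>)))"
    using f id by (intro nn_integral_distr[symmetric] measurable_Pair) auto
  also have "\<dots> = (\<integral>\<^sup>+\<omega>1. (\<integral>\<^sup>+\<omega>2. f (\<omega>1, \<omega>2) \<partial>distr M (GA J) (\<lambda>\<omega>. \<omega>)) \<partial>distr M (GA I) (\<lambda>\<omega>. \<omega>))"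
    unfolding eq[symmetric] by (rule J.nn_integral_fst[OF f', symmetric])
  also have "\<dots> = (\<integral>\<^sup>+\<omega>1. (\<integral>\<^sup>+\<omega>2. f (\<omega>1, \<omega>2) \<partial>distr M (GA J) (\<lambda>\<omega>. \<omega>)) \<partial>M)"
    using J.borel_measurable_nn_integral_fst[OF f'] by (intro nn_integral_distr id) simp
  also have "\<dots> = (\<integral>\<^sup>+\<omega>1. (\<integral>\<^sup>+\<omega>2. f (\<omega>1, \<omega>2) \<partial>M) \<partial>M)"
  proof (intro nn_integral_cong nn_integral_distr id)
    fix \<omega>1 assume "\<omega>1 \<in> space M"
    then show "(\<lambda>\<omega>2. f (\<omega>1, \<omega>2)) \<in> borel_measurable (distr M (GA J) (\<lambda>\<omega>. \<omega>))"
      unfolding measurable_distr_eq1 by (intro measurable_compose[OF measurable_Pair1' f]) simp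
  qed
  finally show ?thesis .
qed

lemma L_measurable: "Inl u \<in> I \<Longrightarrow> L u \<in> borel_measurable (GA I)"
proof -
  assume u: "Inl u \<in> I"
  have "subalgebra (GA I) (vimage_algebra (space M) (L u) borel)"
    unfolding subalgebra_def sets_GA using u by (auto simp: label_events_def intro!: sigma_sets.Basic bexI[of _ "Inl u"])
  then show ?thesis
    by (rule measurable_from_subalg) (simp add: measurable_vimage_algebra1)
qed

lemma W_measurable: "Inr u \<in> I \<Longrightarrow> 0 \<le> t \<Longrightarrow> W u t \<in> borel_measurable (GA I)"
proof -
  assume u: "Inr u \<in> I" and t: "0 \<le> t"
  let ?V = "vimage_algebra (space M) (\<lambda>\<omega>. \<lambda>t\<in>{0..}. W u t \<omega>) (\<Pi>\<^sub>M t\<in>{0..}. borel)"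
  have "subalgebra (GA I) ?V"
    unfolding subalgebra_def sets_GA using u by (auto simp: label_events_def intro!: sigma_sets.Basic bexI[of _ "Inr u"])
  moreover have "(\<lambda>\<omega>. (\<lambda>t\<in>{0..}. W u t \<omega>) t) \<in> borel_measurable ?V"
  proof (rule measurable_compose[where f="\<lambda>\<omega>. \<lambda>t\<in>{0..}. W u t \<omega>" and g="\<lambda>x. x t" and N="\<Pi>\<^sub>M t\<in>{0..}. borel"])
    show "(\<lambda>\<omega>. \<lambda>t\<in>{0..}. W u t \<omega>) \<in> ?V \<rightarrow>\<^sub>M (\<Pi>\<^sub>M t\<in>{0..}. borel)"
      by (rule measurable_vimage_algebra1) (auto simp: space_PiM)
    show "(\<lambda>x. x t) \<in> borel_measurable (\<Pi>\<^sub>M t\<in>{0..}. borel)"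
      using t by (intro measurable_component_singleton) simp
  qed
  then have "W u t \<in> borel_measurable ?V" using t by simp
  ultimately show ?thesis by (rule measurable_from_subalg)
qed

text \<open>Evaluation of \<open>W u\<close> at a random time is measurable only for regular paths. The dyadic
  limit is jointly measurable without exception and agrees with \<open>W u\<close> on continuous paths.\<close>

definition Wr :: "particle \<Rightarrow> real \<Rightarrow> 'a \<Rightarrow> real" where
  "Wr u t \<omega> = lim (\<lambda>k. W u (max 0 (real_of_int \<lfloor>2 ^ k * t\<rfloor> / 2 ^ k)) \<omega>)"

lemma Wr_measurable:
  assumes "Inr u \<in> I"
  shows "(\<lambda>(t, \<omega>). Wr u t \<omega>) \<in> borel_measurable (borel \<Otimes>\<^sub>M GA I)"
proof -
  have *: "(\<lambda>x. W u (max 0 (real_of_int \<lfloor>(2::real) ^ k * fst x\<rfloor> / 2 ^ k)) (snd x)) \<in> borel_measurable (borel \<Otimes>\<^sub>M GA I)" for k :: nat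
  proof (rule measurable_compose_countable[where f="\<lambda>i x. W u (max 0 (real_of_int i / 2 ^ k)) (snd x)" and g="\<lambda>x. \<lfloor>(2::real) ^ k * fst x\<rfloor>"])
    show "(\<lambda>x. W u (max 0 (real_of_int i / 2 ^ k)) (snd x)) \<in> borel_measurable (borel \<Otimes>\<^sub>M GA I)" for i
      by (rule measurable_compose[OF measurable_snd W_measurable]) (use assms in auto)
  qed measurable
  have "(\<lambda>x. lim (\<lambda>k. W u (max 0 (real_of_int \<lfloor>(2::real) ^ k * fst x\<rfloor> / 2 ^ k)) (snd x))) \<in> borel_measurable (borel \<Otimes>\<^sub>M GA I)"
    by (rule borel_measurable_lim_metric) (rule *)
  then show ?thesis by (simp add: Wr_def split_beta)
qed

lemma Wr_measurable1:
  assumes "Inr u \<in> I" shows "Wr u t \<in> borel_measurable (GA I)"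
  using measurable_compose[OF _ Wr_measurable[OF assms], of "\<lambda>\<omega>. (t, \<omega>)" "GA I"] by simp

lemma Wr_eq:
  assumes c: "continuous_on {0..} (\<lambda>t. W u t \<omega>)" and t: "0 \<le> t"
  shows "Wr u t \<omega> = W u t \<omega>"
proof -
  have "(\<lambda>k. real_of_int \<lfloor>2 ^ k * t\<rfloor> / 2 ^ k) \<longlonglongrightarrow> t"
  proof (rule tendsto_sandwich)
    show "eventually (\<lambda>k. t - (1/2) ^ k \<le> real_of_int \<lfloor>2 ^ k * t\<rfloor> / 2 ^ k) sequentially"
    proof (rule always_eventually, rule allI)
      fix k :: nat
      have "2 ^ k * t - 1 \<le> real_of_int \<lfloor>2 ^ k * t\<rfloor>" by linarith
      then have "(2 ^ k * t - 1) / 2 ^ k \<le> real_of_int \<lfloor>2 ^ k * t\<rfloor> / 2 ^ k"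
        by (rule divide_right_mono) simp
      then show "t - (1/2) ^ k \<le> real_of_int \<lfloor>2 ^ k * t\<rfloor> / 2 ^ k"
        by (simp add: diff_divide_distrib power_one_over)
    qed
    show "eventually (\<lambda>k. real_of_int \<lfloor>2 ^ k * t\<rfloor> / 2 ^ k \<le> t) sequentially"
    proof (rule always_eventually, rule allI)
      fix k :: nat
      have "real_of_int \<lfloor>2 ^ k * t\<rfloor> \<le> 2 ^ k * t" by linarith
      then show "real_of_int \<lfloor>2 ^ k * t\<rfloor> / 2 ^ k \<le> t" by (simp add: field_simps)
    qed
    have "(\<lambda>k. t - (1/2::real) ^ k) \<longlonglongrightarrow> t - 0"
      by (intro tendsto_diff tendsto_const LIMSEQ_realpow_zero) auto
    then show "(\<lambda>k. t - (1/2::real) ^ k) \<longlonglongrightarrow> t" by simp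
  qed simp
  then have "(\<lambda>k. max 0 (real_of_int \<lfloor>2 ^ k * t\<rfloor> / 2 ^ k)) \<longlonglongrightarrow> max 0 t"
    by (intro tendsto_max tendsto_const)
  then have "(\<lambda>k. max 0 (real_of_int \<lfloor>2 ^ k * t\<rfloor> / 2 ^ k)) \<longlonglongrightarrow> t" using t by simp
  then have "(\<lambda>k. W u (max 0 (real_of_int \<lfloor>2 ^ k * t\<rfloor> / 2 ^ k)) \<omega>) \<longlonglongrightarrow> W u t \<omega>"
    using t by (intro continuous_on_tendsto_compose[OF c]) auto
  then show ?thesis unfolding Wr_def by (rule limI)
qed

lemma AE_regular:
  "AE \<omega> in M. \<forall>u. continuous_on {0..} (\<lambda>t. W u t \<omega>) \<and> W u 0 \<omega> = 0 \<and> 0 < L u \<omega>"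
proof (subst AE_all_countable, rule allI)
  fix u
  have 1: "AE \<omega> in M. W u 0 \<omega> = 0" "AE \<omega> in M. continuous_on {0..} (\<lambda>t. W u t \<omega>)"
    using motion[of u] by (auto simp: brownian_motion_def)
  have 2: "AE \<omega> in M. 0 < L u \<omega>"
  proof -
    have "AE x in lborel. 0 < ennreal (exponential_density 1 x) \<longrightarrow> 0 < x"
      by (intro AE_I[where N="{0}"]) (auto simp: exponential_density_def not_less split: if_splits)
    then show ?thesis
      by (subst distributed_AE2[OF lifetime]) auto
  qed
  show "AE \<omega> in M. continuous_on {0..} (\<lambda>t. W u t \<omega>) \<and> W u 0 \<omega> = 0 \<and> 0 < L u \<omega>"
    using 1 2 by eventually_elim auto
qed

lemma Wr_pexp:
  assumes r: "borel_list r" and srt: "sorted_wrt (<) (map fst r)" "\<And>t. t \<in> fst ` set r \<Longrightarrow> 0 \<le> t"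
  shows "(\<integral>\<^sup>+\<omega>. obs (\<lambda>t. y + Wr u t \<omega>) r \<partial>M) = pexp 0 y r"
proof -
  have "(\<integral>\<^sup>+\<omega>. obs (\<lambda>t. y + Wr u t \<omega>) r \<partial>M) = (\<integral>\<^sup>+\<omega>. obs (\<lambda>t. y + W u t \<omega>) r \<partial>M)"
    using AE_regular by (intro nn_integral_cong_AE, eventually_elim) (rule obs_cong, simp add: Wr_eq srt(2))
  also have "\<dots> = pexp 0 y r" by (rule brownian_motion_pexp[OF motion r srt])
  finally show ?thesis .
qed

text \<open>For fixed lifetimes a lineage is one folded Brownian motion. Induction on the label:
  observations before the birth \<open>\<tau>\<close> see the parent only; those after it are
  integrated over the fresh motion of the child, which turns them into one observable of the
  parent's position at \<open>\<tau>\<close>.\<close>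

lemma path_law:
  assumes \<rho>: "folding \<rho>" and l: "\<And>v. 0 \<le> l v"
    and r: "borel_list r" "sorted_wrt (<) (map fst r)" "\<And>t. t \<in> fst ` set r \<Longrightarrow> 0 \<le> t"
  shows "(\<integral>\<^sup>+\<omega>. obs (path \<rho> l (\<lambda>v t. Wr v t \<omega>) u) r \<partial>M) = pexp 0 0 (fold_list \<rho> r)"
  using r
proof (induction u arbitrary: r)
  case Nil
  have "(\<integral>\<^sup>+\<omega>. obs (path \<rho> l (\<lambda>v t. Wr v t \<omega>) []) r \<partial>M) = (\<integral>\<^sup>+\<omega>. obs (\<lambda>t. 0 + Wr [] t \<omega>) (fold_list \<rho> r) \<partial>M)"
    by (simp add: obs_fold path.simps(1)[abs_def])
  also have "\<dots> = pexp 0 0 (fold_list \<rho> r)"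
    using Nil by (intro Wr_pexp borel_list_fold \<rho>) simp_all
  finally show ?case .
next
  case (Cons b u)
  have birth: "0 \<le> birth_time l v" for v
    using l by (induction v) (auto intro: add_nonneg_nonneg)
  define \<tau> where "\<tau> = birth_time l (b # u)"
  have \<tau>: "0 \<le> \<tau>" unfolding \<tau>_def by (rule birth)
  define r1 r2 where "r1 = takeWhile (\<lambda>(t, f). t < \<tau>) r" and "r2 = dropWhile (\<lambda>(t, f). t < \<tau>) r"
  have rr: "r = r1 @ r2" by (simp add: r1_def r2_def)
  have b12: "borel_list r1" "borel_list r2" using Cons.prems(1) by (auto simp: rr)
  have t1: "t < \<tau>" "0 \<le> t" if "t \<in> fst ` set r1" for t
    using that Cons.prems(3) unfolding rr by (auto simp: r1_def dest: set_takeWhileD)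
  have s12: "sorted_wrt (<) (map fst r1)" "sorted_wrt (<) (map fst r2)"
    using Cons.prems(2) unfolding rr by (auto simp: sorted_wrt_append)
  have t2: "\<tau> \<le> t" if "t \<in> fst ` set r2" for t
  proof (cases r2)
    case (Cons sf q)
    then have "\<not> fst sf < \<tau>" using hd_dropWhile[of "\<lambda>(t, f). t < \<tau>" r] unfolding r2_def by (auto simp: split_beta)
    then show ?thesis using that s12(2) unfolding Cons by fastforce
  qed (use that in simp)
  define I J where "I = (Inr ` {v. suffix v u} :: (particle + particle) set)" and "J = {Inr (b # u) :: particle + particle}"
  have IJ: "I \<inter> J = {}" by (auto simp: I_def J_def dest: suffix_length_le)
  have Wm: "(\<lambda>(t, \<omega>). Wr v t \<omega>) \<in> borel_measurable (borel \<Otimes>\<^sub>M GA I)" if "suffix v u" for v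
    by (rule Wr_measurable) (use that in \<open>auto simp: I_def\<close>)
  have Xm: "(\<lambda>\<omega>. path \<rho> l (\<lambda>v t. Wr v t \<omega>) u t) \<in> borel_measurable (GA I)" for t
    using Wm by (intro path_measurable \<rho>) auto
  note [measurable] = Xm Wr_measurable1[of "b # u" J] folding_measurable[OF \<rho>]
  have [simp]: "Inr (b # u) \<in> J" by (simp add: J_def)
  let ?X = "\<lambda>\<omega>. path \<rho> l (\<lambda>v t. Wr v t \<omega>) u"
  let ?f = "\<lambda>(\<omega>1, \<omega>2). obs (?X \<omega>1) r1 * obs (\<lambda>t. \<rho> (?X \<omega>1 \<tau> + Wr (b # u) (t - \<tau>) \<omega>2)) r2"
  have fm: "?f \<in> borel_measurable (GA I \<Otimes>\<^sub>M GA J)"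
    unfolding split_beta
    by (intro borel_measurable_times_ennreal obs_measurable b12; measurable)
  have "(\<integral>\<^sup>+\<omega>. obs (path \<rho> l (\<lambda>v t. Wr v t \<omega>) (b # u)) r \<partial>M) = (\<integral>\<^sup>+\<omega>. ?f (\<omega>, \<omega>) \<partial>M)"
    unfolding rr obs_simps prod.case
    using t1 t2 by (intro nn_integral_cong arg_cong2[where f="(*)"] obs_cong) (force simp: \<tau>_def)+
  also have "\<dots> = (\<integral>\<^sup>+\<omega>1. (\<integral>\<^sup>+\<omega>2. ?f (\<omega>1, \<omega>2) \<partial>M) \<partial>M)"
    by (rule decouple[OF IJ fm])
  also have "\<dots> = (\<integral>\<^sup>+\<omega>1. obs (?X \<omega>1) (r1 @ [(\<tau>, \<lambda>y. pexp \<tau> y (fold_list \<rho> r2))]) \<partial>M)"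
  proof (rule nn_integral_cong)
    fix \<omega>1
    have "(\<integral>\<^sup>+\<omega>2. ?f (\<omega>1, \<omega>2) \<partial>M) = obs (?X \<omega>1) r1 * (\<integral>\<^sup>+\<omega>2. obs (\<lambda>t. \<rho> (?X \<omega>1 \<tau> + Wr (b # u) (t - \<tau>) \<omega>2)) r2 \<partial>M)"
      unfolding prod.case
      by (intro nn_integral_cmult measurable_from_subalg[OF subalgebra_GA[of J]] obs_measurable b12) measurable
    also have "(\<integral>\<^sup>+\<omega>2. obs (\<lambda>t. \<rho> (?X \<omega>1 \<tau> + Wr (b # u) (t - \<tau>) \<omega>2)) r2 \<partial>M)
        = (\<integral>\<^sup>+\<omega>2. obs (\<lambda>t. ?X \<omega>1 \<tau> + Wr (b # u) t \<omega>2) (shift_list \<tau> (fold_list \<rho> r2)) \<partial>M)"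
      by (simp add: obs_shift obs_fold)
    also have "\<dots> = pexp 0 (?X \<omega>1 \<tau>) (shift_list \<tau> (fold_list \<rho> r2))"
    proof (rule Wr_pexp)
      fix t assume "t \<in> fst ` set (shift_list \<tau> (fold_list \<rho> r2))"
      then obtain x where "x \<in> set r2" "t = fst x - \<tau>" by auto
      then show "0 \<le> t" using t2[of "fst x"] by simp
    qed (simp_all add: b12 s12 \<rho> borel_list_fold)
    also have "\<dots> = pexp \<tau> (?X \<omega>1 \<tau>) (fold_list \<rho> r2)"
      using pexp_shift[of \<tau> \<tau> "?X \<omega>1 \<tau>" "fold_list \<rho> r2"] by simp
    finally show "(\<integral>\<^sup>+\<omega>2. ?f (\<omega>1, \<omega>2) \<partial>M) = obs (?X \<omega>1) (r1 @ [(\<tau>, \<lambda>y. pexp \<tau> y (fold_list \<rho> r2))])"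
      by simp
  qed
  also have "\<dots> = pexp 0 0 (fold_list \<rho> (r1 @ [(\<tau>, \<lambda>y. pexp \<tau> y (fold_list \<rho> r2))]))"
  proof (rule Cons.IH)
    show "borel_list (r1 @ [(\<tau>, \<lambda>y. pexp \<tau> y (fold_list \<rho> r2))])"
      using b12 \<rho> by (auto intro!: pexp_measurable_snd borel_list_fold)
    show "sorted_wrt (<) (map fst (r1 @ [(\<tau>, \<lambda>y. pexp \<tau> y (fold_list \<rho> r2))]))"
      using s12(1) t1 by (auto simp: sorted_wrt_append)
  qed (use t1 \<tau> in auto)
  \<comment> \<open>\<open>pexp_fold\<close> removes the folding of the position at
    \<open>\<tau>\<close>; afterwards \<open>pexp_split\<close> removes the auxiliary observation
    time itself.\<close>
  also have "\<dots> = pexp 0 0 (fold_list \<rho> r1 @ [(\<tau>, \<lambda>y. pexp \<tau> y (fold_list \<rho> r2))])"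
    using pexp_fold[OF \<rho> b12(2)] by simp
  also have "\<dots> = pexp 0 0 (fold_list \<rho> r1 @ fold_list \<rho> r2)"
  proof (rule pexp_split)
    show "sorted (0 # map fst (fold_list \<rho> r1) @ [\<tau>])"
      using strict_sorted_imp_sorted[OF s12(1)] t1 \<tau> by (auto simp: sorted_append less_imp_le)
    show "sorted (\<tau> # map fst (fold_list \<rho> r2))"
      using strict_sorted_imp_sorted[OF s12(2)] t2 by auto
  qed (use b12 \<rho> in \<open>auto intro: borel_list_fold\<close>)
  finally show ?case by (simp add: rr del: path.simps birth_time.simps)
qed

end

section \<open>Many-to-one and many-to-two formulas\<close>

text \<open>Transfers independence to the injectively relabelled family of a subtree.\<close>

lemma (in prob_space) indep_sets_reindex:
  assumes "inj_on \<phi> I" "indep_sets F (\<phi> ` I)"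
  shows "indep_sets (\<lambda>i. F (\<phi> i)) I"
  unfolding indep_sets_def
proof (intro conjI ballI allI impI)
  fix i assume "i \<in> I"
  then show "F (\<phi> i) \<subseteq> events" using assms(2) by (auto simp: indep_sets_def)
next
  fix J A assume J: "J \<subseteq> I" "J \<noteq> {}" "finite J" and A: "A \<in> Pi J (\<lambda>i. F (\<phi> i))"
  have inj: "inj_on \<phi> J" using assms(1) J(1) by (rule inj_on_subset)
  define A' where "A' k = A (inv_into J \<phi> k)" for k
  have A': "A' (\<phi> j) = A j" if "j \<in> J" for j using inj that by (simp add: A'_def)
  have "prob (\<Inter>k\<in>\<phi> ` J. A' k) = (\<Prod>k\<in>\<phi> ` J. prob (A' k))"
    using J A A' by (intro indep_setsD[OF assms(2)]) auto
  then show "prob (\<Inter>j\<in>J. A j) = (\<Prod>j\<in>J. prob (A j))"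
    using inj A' by (simp add: prod.reindex)
qed

lemma nn_integral_length:
  fixes g :: "nat \<Rightarrow> ennreal"
  shows "(\<integral>\<^sup>+w. g (length w) \<partial>count_space (UNIV :: bool list set)) = (\<Sum>n. 2 ^ n * g n)"
proof -
  have fin: "finite {w :: bool list. length w = n}" and card: "card {w :: bool list. length w = n} = 2 ^ n" for n
    using finite_lists_length_eq[of "UNIV :: bool set" n] card_lists_length_eq[of "UNIV :: bool set" n] by auto
  have "(\<integral>\<^sup>+w. g (length w) \<partial>count_space (UNIV :: bool list set))
      = (\<integral>\<^sup>+w. (\<integral>\<^sup>+n. g n * indicator {w. length w = n} w \<partial>count_space UNIV) \<partial>count_space (UNIV :: bool list set))"
  proof (intro nn_integral_cong)
    fix w :: "bool list"
    have "(\<integral>\<^sup>+n. g n * indicator {w. length w = n} w \<partial>count_space UNIV) = (\<Sum>n\<in>{length w}. g n * indicator {w. length w = n} w)"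
      by (rule nn_integral_count_space') auto
    then show "g (length w) = (\<integral>\<^sup>+n. g n * indicator {w. length w = n} w \<partial>count_space UNIV)" by simp
  qed
  also have "\<dots> = (\<integral>\<^sup>+n. (\<integral>\<^sup>+w. g n * indicator {w. length w = n} w \<partial>count_space (UNIV :: bool list set)) \<partial>count_space UNIV)"
    by (rule nn_integral_count_space_nn_integral) auto
  also have "\<dots> = (\<integral>\<^sup>+n. 2 ^ n * g n \<partial>count_space UNIV)"
    by (simp add: nn_integral_cmult fin card mult.commute)
  finally show ?thesis by (simp add: nn_integral_count_space_nat)
qed

text \<open>As the most recent branching comes first, the descendants of \<open>x\<close> are the
  words \<open>v @ x\<close>, and \<open>\<lambda>v. l (v @ x)\<close> holds the data of the subtree
  rooted at \<open>x\<close>.\<close>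

lemma birth_time_append:
  "birth_time l (v @ x) = birth_time l x + birth_time (\<lambda>v. l (v @ x)) v"
  by (induction v) auto

lemma alive_append:
  "v @ x \<in> alive l t \<longleftrightarrow> v \<in> alive (\<lambda>v. l (v @ x)) (t - birth_time l x)"
  by (auto simp: alive_def birth_time_append)

text \<open>Without reflection, paths are additive over generations, so a subtree is a copy
  translated to its birth point. This fails for the reflected motion, a reason to run second moments
  on the unreflected one.\<close>

lemma path_append:
  assumes "birth_time l (b # w) \<le> t" "\<And>v. 0 \<le> l v"
  shows "path (\<lambda>x. x) l W (v @ (b # w)) t = path (\<lambda>x. x) l W w (birth_time l (b # w))
    + path (\<lambda>x. x) (\<lambda>v. l (v @ (b # w))) (\<lambda>v. W (v @ (b # w))) v (t - birth_time l (b # w))"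
  using assms(1)
proof (induction v arbitrary: t)
  case Nil
  then show ?case by simp
next
  case (Cons c v)
  let ?B = "birth_time l (b # w)"
  have pos: "0 \<le> birth_time l' v" if "\<And>v. 0 \<le> l' v" for l' v
    using that by (induction v) (auto intro: add_nonneg_nonneg)
  have e: "birth_time l (c # v @ b # w) = ?B + birth_time (\<lambda>v. l (v @ b # w)) (c # v)"
    using birth_time_append[of l "c # v" "b # w"] by simp
  have p: "0 \<le> birth_time (\<lambda>v. l (v @ b # w)) (c # v)"
    by (rule pos) (use assms(2) in auto)
  show ?case
  proof (cases "t < birth_time l (c # v @ b # w)")
    case True
    then have "t - ?B < birth_time (\<lambda>v. l (v @ b # w)) (c # v)" using e by linarith
    with True Cons.IH[OF Cons.prems] show ?thesis by (simp del: birth_time.simps)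
  next
    case False
    then have "\<not> t - ?B < birth_time (\<lambda>v. l (v @ b # w)) (c # v)" using e by linarith
    with False Cons.IH[of "birth_time l (c # v @ b # w)"] e p show ?thesis by (simp add: diff_diff_add del: birth_time.simps)
  qed
qed

lemma alive_measurable:
  assumes "\<And>v. suffix v u \<Longrightarrow> (\<lambda>x. l x v) \<in> borel_measurable N" "\<theta> \<in> borel_measurable N"
  shows "(\<lambda>x. indicator (alive (l x) (\<theta> x)) u :: ennreal) \<in> borel_measurable N"
proof -
  have [measurable]: "(\<lambda>x. birth_time (l x) u) \<in> borel_measurable N" "(\<lambda>x. l x u) \<in> borel_measurable N" "\<theta> \<in> borel_measurable N"
    using assms by (auto intro: birth_time_measurable)
  have "(\<lambda>x. if birth_time (l x) u \<le> \<theta> x \<and> \<theta> x < birth_time (l x) u + l x u then 1 else 0 :: ennreal) \<in> borel_measurable N"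
    by measurable
  then show ?thesis by (simp add: alive_def indicator_def)
qed

lemma pexp_translate: "pexp t x (map (\<lambda>(s, f). (s, \<lambda>a. f (y + a))) r) = pexp t (y + x) r"
proof (induction r arbitrary: t x)
  case (Cons sf r)
  obtain s f where sf: "sf = (s, f)" by force
  have "heat (s - t) (\<lambda>a. f (a + y) * pexp s (a + y) r) x = heat (s - t) (\<lambda>a. f a * pexp s a r) (x + y)"
    by (rule heat_shift)
  then show ?case using Cons by (simp add: sf add.commute)
qed simp

lemma obs_translate: "obs p (map (\<lambda>(s, f). (s, \<lambda>a. f (y + a))) r) = obs (\<lambda>t. y + p t) r"
  by (induction r) auto

text \<open>Here \<open>s\<close> will be the random time of a fork, and the observable placed there
  depends on \<open>s\<close> as well.\<close>

lemma pexp_snoc_measurable: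
  assumes "borel_list r" and [measurable]: "case_prod \<Xi> \<in> borel_measurable (borel \<Otimes>\<^sub>M borel)"
  shows "(\<lambda>(s, x). pexp t x (r @ [(s, \<Xi> s)])) \<in> borel_measurable (borel \<Otimes>\<^sub>M borel)"
  using assms(1)
proof (induction r arbitrary: t)
  case Nil
  show ?case by simp
next
  case (Cons uf r)
  obtain u f where uf: "uf = (u, f)" by force
  have [measurable]: "f \<in> borel_measurable borel" "(\<lambda>(s, x). pexp u x (r @ [(s, \<Xi> s)])) \<in> borel_measurable (borel \<Otimes>\<^sub>M borel)"
    using Cons by (auto simp: uf)
  show ?case unfolding uf by simp
qed

context branching_data
begin

text \<open>The branching property: appending \<open>x\<close> is injective on labels, so the data
  of the subtree are again mutually independent.\<close>

lemma branching_data_copy: "branching_data M (\<lambda>v. L (v @ x)) (\<lambda>v. W (v @ x))"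
proof (unfold_locales)
  let ?\<phi> = "map_sum (\<lambda>v :: particle. v @ x) (\<lambda>v :: particle. v @ x)"
  have "inj_on ?\<phi> UNIV" by (intro sum.inj_map) (auto simp: inj_on_def)
  then have "indep_sets (\<lambda>i. label_events (?\<phi> i)) UNIV"
    by (rule indep_sets_reindex) (rule indep_sets_mono_index[OF subset_UNIV indep_label_events])
  then show "indep_sets
         (\<lambda>i. case i of
            Inl u \<Rightarrow> sets (vimage_algebra (space M) (L (u @ x)) borel)
          | Inr u \<Rightarrow> sets (vimage_algebra (space M) (\<lambda>\<omega>. \<lambda>t\<in>{0..}. W (u @ x) t \<omega>) (\<Pi>\<^sub>M t\<in>{0..}. borel)))
         UNIV"
    by (rule indep_sets_cong[THEN iffD1, rotated 2]) (auto simp: label_events_def split: sum.split)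
qed (rule lifetime motion)+

lemma Wr_copy: "branching_data.Wr (\<lambda>v. W (v @ x)) v t \<omega> = Wr (v @ x) t \<omega>"
proof -
  interpret c: branching_data M "\<lambda>v. L (v @ x)" "\<lambda>v. W (v @ x)" by (rule branching_data_copy)
  show ?thesis by (simp add: c.Wr_def Wr_def)
qed

section \<open>Lifetimes and population size\<close>

lemma L_meas [measurable]: "L u \<in> borel_measurable M"
  using distributed_measurable[OF lifetime[of u]] by simp

definition death :: "particle \<Rightarrow> 'a \<Rightarrow> real" where
  "death u \<omega> = birth_time (\<lambda>v. L v \<omega>) u + L u \<omega>"

lemma birth_eq_death: "birth_time (\<lambda>v. L v \<omega>) (b # u) = death u \<omega>"
  by (simp add: death_def)

lemma death_Cons: "death (b # u) \<omega> = death u \<omega> + L (b # u) \<omega>"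
  by (simp add: death_def)

lemma death_measurable:
  assumes "\<And>v. suffix v u \<Longrightarrow> Inl v \<in> I"
  shows "death u \<in> borel_measurable (GA I)"
proof -
  have "(\<lambda>\<omega>. birth_time (\<lambda>v. L v \<omega>) (True # u)) \<in> borel_measurable (GA I)"
    by (rule birth_time_measurable, rule L_measurable, rule assms) (simp add: suffix_Cons)
  then show ?thesis unfolding birth_eq_death by simp
qed

lemma death_meas [measurable]: "death u \<in> borel_measurable M"
  using death_measurable[of u UNIV, OF UNIV_I] by (rule measurable_from_subalg[OF subalgebra_GA])

lemma death_sum: "death u \<omega> = (\<Sum>v\<in>{v. suffix v u}. L v \<omega>)"
proof (induction u)
  case Nil
  then show ?case by (simp add: death_def)
next
  case (Cons b u)
  have "{v. suffix v (b # u)} = insert (b # u) {v. suffix v u}" by (auto simp: suffix_Cons)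
  moreover have "finite {v. suffix v u}" by (simp add: set_suffixes_eq[symmetric])
  moreover have "b # u \<notin> {v. suffix v u}" by (auto dest: suffix_length_le)
  ultimately show ?case using Cons by (simp add: death_def)
qed

text \<open>A lineage consists of \<open>length u + 1\<close> independent exponential
  lifetimes.\<close>

lemma death_distributed: "distributed M lborel (death u) (erlang_density (length u) 1)"
proof -
  have card: "finite {v. suffix v u} \<and> card {v. suffix v u} = Suc (length u)"
    by (metis distinct_card distinct_suffixes length_suffixes List.finite_set set_suffixes_eq)
  have "indep_vars (\<lambda>_. borel) L {v. suffix v u}"
    unfolding indep_vars_def2
  proof (intro conjI ballI)
    have "indep_sets (\<lambda>v. label_events (Inl v)) {v. suffix v u}"
      by (rule indep_sets_reindex[where \<phi>=Inl and F=label_events], simp)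
        (rule indep_sets_mono_index[OF subset_UNIV indep_label_events])
    then show "indep_sets (\<lambda>i. {L i -` A \<inter> space M |A. A \<in> sets borel}) {v. suffix v u}"
      by (rule indep_sets_cong[THEN iffD1, rotated 2]) (auto simp: label_events_def sets_vimage_algebra2)
  qed simp
  then have "distributed M lborel (\<lambda>\<omega>. \<Sum>v\<in>{v. suffix v u}. L v \<omega>) (erlang_density (card {v. suffix v u} - 1) 1)"
    using card lifetime by (intro exponential_distributed_sum) auto
  then show ?thesis using card by (simp add: death_sum[abs_def])
qed

lemma AE_pos: "AE \<omega> in M. \<forall>u. 0 < L u \<omega>"
  using AE_regular by eventually_elim auto

lemma AE_death_pos: "AE \<omega> in M. 0 < death u \<omega>"
  using AE_pos
proof eventually_elim
  case (elim \<omega>)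
  have "0 \<le> birth_time (\<lambda>v. L v \<omega>) u" using elim by (induction u) (auto simp: less_imp_le)
  then show ?case using elim by (simp add: death_def add_nonneg_pos)
qed

lemma sums_exp_ennreal:
  assumes "0 \<le> x"
  shows "(\<Sum>n. ennreal (x ^ n / fact n)) = ennreal (exp x)"
  using assms exp_converges[of x]
  by (intro sums_unique[symmetric] sums_ennreal[THEN iffD2]) (auto simp: divide_inverse mult.commute)

text \<open>Splittings occur with mean intensity \<open>exp s\<close>: summing the Erlang densities
  over the \<open>2 ^ n\<close> labels of each length \<open>n\<close> gives the series of
  \<open>exp (2 * s)\<close> times \<open>exp (- s)\<close>.\<close>

lemma nn_integral_deaths:
  assumes [measurable]: "h \<in> borel_measurable borel"
  shows "(\<integral>\<^sup>+w. (\<integral>\<^sup>+\<omega>. h (death w \<omega>) \<partial>M) \<partial>count_space UNIV) = (\<integral>\<^sup>+s\<in>{0..}. ennreal (exp s) * h s \<partial>lborel)"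
proof -
  have "(\<integral>\<^sup>+w. (\<integral>\<^sup>+\<omega>. h (death w \<omega>) \<partial>M) \<partial>count_space UNIV)
      = (\<integral>\<^sup>+w. (\<integral>\<^sup>+s. ennreal (erlang_density (length w) 1 s) * h s \<partial>lborel) \<partial>count_space (UNIV :: particle set))"
    by (rule nn_integral_cong, rule distributed_nn_integral[OF death_distributed, symmetric]) simp
  also have "\<dots> = (\<Sum>n. 2 ^ n * (\<integral>\<^sup>+s. ennreal (erlang_density n 1 s) * h s \<partial>lborel))"
    by (rule nn_integral_length)
  also have "\<dots> = (\<Sum>n. (\<integral>\<^sup>+s. 2 ^ n * (ennreal (erlang_density n 1 s) * h s) \<partial>lborel))"
    by (simp add: nn_integral_cmult)
  also have "\<dots> = (\<integral>\<^sup>+s. (\<Sum>n. 2 ^ n * (ennreal (erlang_density n 1 s) * h s)) \<partial>lborel)"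
    by (rule nn_integral_suminf[symmetric]) simp
  also have "\<dots> = (\<integral>\<^sup>+s\<in>{0..}. ennreal (exp s) * h s \<partial>lborel)"
  proof (rule nn_integral_cong)
    fix s :: real
    show "(\<Sum>n. 2 ^ n * (ennreal (erlang_density n 1 s) * h s)) = ennreal (exp s) * h s * indicator {0..} s"
    proof (cases "0 \<le> s")
      case True
      have "2 ^ n * (ennreal (erlang_density n 1 s) * h s) = ennreal ((2 * s) ^ n / fact n) * (ennreal (exp (- s)) * h s)" for n
      proof -
        have "2 ^ n * ennreal (erlang_density n 1 s) = ennreal (2 ^ n * erlang_density n 1 s)"
          using ennreal_power[of 2 n] by (subst ennreal_mult) auto
        also have "2 ^ n * erlang_density n 1 s = (2 * s) ^ n / fact n * exp (- s)"
          using True by (simp add: erlang_density_def power_mult_distrib)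
        finally show ?thesis
          using True by (subst mult.assoc[symmetric], subst mult.assoc[symmetric], subst ennreal_mult[symmetric]) auto
      qed
      then have "(\<Sum>n. 2 ^ n * (ennreal (erlang_density n 1 s) * h s)) = ennreal (exp (2 * s)) * (ennreal (exp (- s)) * h s)"
        using True by (simp only: ennreal_suminf_multc sums_exp_ennreal[of "2 * s"] mult_nonneg_nonneg zero_le_numeral)
      also have "\<dots> = ennreal (exp s) * h s"
        by (simp add: mult.assoc[symmetric] ennreal_mult[symmetric] exp_add[symmetric])
      finally show ?thesis using True by simp
    qed (simp add: erlang_density_def)
  qed
  finally show ?thesis .
qed

lemma alive_meas [measurable]: "(\<lambda>\<omega>. indicator (alive (\<lambda>v. L v \<omega>) t) u :: ennreal) \<in> borel_measurable M"
  by (rule alive_measurable) auto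

text \<open>\<open>u\<close> is alive at \<open>t\<close> when exactly \<open>length u\<close>
  splittings have happened along its line, a Poisson probability; it is obtained as a difference of
  two Erlang distribution functions.\<close>

lemma prob_alive:
  assumes t: "0 \<le> t"
  shows "(\<integral>\<^sup>+\<omega>. indicator (alive (\<lambda>v. L v \<omega>) t) u \<partial>M) = ennreal (t ^ length u / fact (length u) * exp (- t))"
proof -
  have le: "emeasure M {\<omega>\<in>space M. death v \<omega> \<le> t} = ennreal (1 - (\<Sum>n\<le>length v. t ^ n * exp (- t) / fact n))" for v
    using erlang_distributed_le[OF death_distributed[of v] _ t] t by (simp add: emeasure_eq_measure erlang_CDF_def)
  have nn: "0 \<le> 1 - (\<Sum>n\<le>k. t ^ n * exp (- t) / fact n)" for k
    using erlang_CDF_nonneg[of 1 k t] t by (simp add: erlang_CDF_def)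
  show ?thesis
  proof (cases u)
    case Nil
    have "(\<integral>\<^sup>+\<omega>. indicator (alive (\<lambda>v. L v \<omega>) t) u \<partial>M) + emeasure M {\<omega>\<in>space M. death [] \<omega> \<le> t}
        = (\<integral>\<^sup>+\<omega>. indicator (alive (\<lambda>v. L v \<omega>) t) u + indicator {\<omega>\<in>space M. death [] \<omega> \<le> t} \<omega> \<partial>M)"
      by (subst nn_integral_add) auto
    also have "\<dots> = (\<integral>\<^sup>+\<omega>. 1 \<partial>M)"
      using t by (intro nn_integral_cong) (auto simp: Nil alive_def death_def indicator_def)
    finally have "(\<integral>\<^sup>+\<omega>. indicator (alive (\<lambda>v. L v \<omega>) t) u \<partial>M) + ennreal (1 - exp (- t)) = ennreal (exp (- t)) + ennreal (1 - exp (- t))"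
      using t unfolding le by (subst ennreal_plus[symmetric]) (auto simp: emeasure_space_1)
    then show ?thesis by (simp add: Nil)
  next
    case (Cons b v)
    let ?k = "length v"
    have "(\<integral>\<^sup>+\<omega>. indicator (alive (\<lambda>v. L v \<omega>) t) u \<partial>M) + emeasure M {\<omega>\<in>space M. death u \<omega> \<le> t}
        = (\<integral>\<^sup>+\<omega>. indicator (alive (\<lambda>v. L v \<omega>) t) u + indicator {\<omega>\<in>space M. death u \<omega> \<le> t} \<omega> \<partial>M)"
      by (subst nn_integral_add) auto
    also have "\<dots> = (\<integral>\<^sup>+\<omega>. indicator {\<omega>\<in>space M. death v \<omega> \<le> t} \<omega> \<partial>M)"
      using AE_pos AE_space[of M]
    proof (intro nn_integral_cong_AE, eventually_elim)
      case (elim \<omega>)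
      have "0 < L (b # v) \<omega>" "\<omega> \<in> space M" using elim by blast+
      then show ?case
        by (auto simp: alive_def indicator_def death_Cons birth_eq_death Cons simp del: birth_time.simps)
    qed
    also have "\<dots> = ennreal (1 - (\<Sum>n\<le>?k. t ^ n * exp (- t) / fact n))"
      by (simp add: le)
    also have "\<dots> = ennreal (t ^ Suc ?k / fact (Suc ?k) * exp (- t)) + ennreal (1 - (\<Sum>n\<le>Suc ?k. t ^ n * exp (- t) / fact n))"
      using t nn[of "Suc ?k"] by (subst ennreal_plus[symmetric]) (auto simp: mult.commute)
    finally show ?thesis unfolding le using Cons by simp
  qed
qed

lemma expected_alive:
  assumes t: "0 \<le> t"
  shows "(\<integral>\<^sup>+u. (\<integral>\<^sup>+\<omega>. indicator (alive (\<lambda>v. L v \<omega>) t) u \<partial>M) \<partial>count_space UNIV) = ennreal (exp t)"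
proof -
  have "(\<integral>\<^sup>+u. (\<integral>\<^sup>+\<omega>. indicator (alive (\<lambda>v. L v \<omega>) t) u \<partial>M) \<partial>count_space UNIV)
      = (\<Sum>n. 2 ^ n * ennreal (t ^ n / fact n * exp (- t)))"
    unfolding prob_alive[OF t] by (rule nn_integral_length)
  also have "\<dots> = (\<Sum>n. ennreal ((2 * t) ^ n / fact n) * ennreal (exp (- t)))"
  proof (intro suminf_cong)
    fix n :: nat
    have "2 ^ n * ennreal (t ^ n / fact n * exp (- t)) = ennreal (2 ^ n * (t ^ n / fact n * exp (- t)))"
    proof -
      have "(2 :: ennreal) ^ n = ennreal (2 ^ n)" using ennreal_power[of 2 n] by simp
      then show ?thesis using t by (subst ennreal_mult) auto
    qed
    also have "2 ^ n * (t ^ n / fact n * exp (- t)) = ((2 * t) ^ n / fact n) * exp (- t)"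
      by (simp add: power_mult_distrib)
    finally show "2 ^ n * ennreal (t ^ n / fact n * exp (- t)) = ennreal ((2 * t) ^ n / fact n) * ennreal (exp (- t))"
      using t by (subst ennreal_mult[symmetric]) auto
  qed
  also have "\<dots> = ennreal (exp (2 * t)) * ennreal (exp (- t))"
    using t by (simp only: ennreal_suminf_multc sums_exp_ennreal[of "2 * t"] mult_nonneg_nonneg zero_le_numeral)
  also have "\<dots> = ennreal (exp t)"
    by (simp add: ennreal_mult[symmetric] exp_add[symmetric])
  finally show ?thesis .
qed

section \<open>Many-to-one formulas\<close>

abbreviation "IL \<equiv> (range Inl :: (particle + particle) set)"
abbreviation "IR \<equiv> (range Inr :: (particle + particle) set)"

lemma path_IL_IR:
  assumes \<rho>: "folding \<rho>" and \<theta>: "\<theta> \<in> borel_measurable (GA IL \<Otimes>\<^sub>M GA IR)"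
  shows "(\<lambda>x. path \<rho> (\<lambda>v. L v (fst x)) (\<lambda>v t. Wr v t (snd x)) u (\<theta> x)) \<in> borel_measurable (GA IL \<Otimes>\<^sub>M GA IR)"
proof (rule path_measurable[OF \<rho> _ _ \<theta>])
  show "(\<lambda>x. L v (fst x)) \<in> borel_measurable (GA IL \<Otimes>\<^sub>M GA IR)" for v
    by (rule measurable_compose[OF measurable_fst L_measurable]) auto
  have "(\<lambda>x. (fst x, snd (snd x))) \<in> borel \<Otimes>\<^sub>M (GA IL \<Otimes>\<^sub>M GA IR) \<rightarrow>\<^sub>M borel \<Otimes>\<^sub>M GA IR" by measurable
  from measurable_compose[OF this Wr_measurable]
  show "(\<lambda>(t, x). Wr v t (snd x)) \<in> borel_measurable (borel \<Otimes>\<^sub>M (GA IL \<Otimes>\<^sub>M GA IR))" for v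
    by (simp add: split_beta)
qed

text \<open>Conditioning on all lifetimes (\<open>IL\<close>) leaves the motions (\<open>IR\<close>)
  untouched, so the observation times and observables may depend on the lifetimes. This allows an
  observation at a random fork time.\<close>

lemma path_law_random:
  assumes \<rho>: "folding \<rho>" and \<phi>: "\<phi> \<in> borel_measurable (GA IL)"
    and R: "\<And>\<omega>. \<phi> \<omega> \<noteq> 0 \<Longrightarrow> borel_list (R \<omega>) \<and> sorted_wrt (<) (map fst (R \<omega>)) \<and> (\<forall>t\<in>fst ` set (R \<omega>). 0 \<le> t)"
    and meas: "(\<lambda>x. obs (path \<rho> (\<lambda>v. L v (fst x)) (\<lambda>v t. Wr v t (snd x)) u) (R (fst x))) \<in> borel_measurable (GA IL \<Otimes>\<^sub>M GA IR)"
  shows "(\<integral>\<^sup>+\<omega>. \<phi> \<omega> * obs (path \<rho> (\<lambda>v. L v \<omega>) (\<lambda>v t. Wr v t \<omega>) u) (R \<omega>) \<partial>M)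
       = (\<integral>\<^sup>+\<omega>. \<phi> \<omega> * pexp 0 0 (fold_list \<rho> (R \<omega>)) \<partial>M)"
proof -
  let ?f = "\<lambda>x. \<phi> (fst x) * obs (path \<rho> (\<lambda>v. L v (fst x)) (\<lambda>v t. Wr v t (snd x)) u) (R (fst x))"
  have f: "?f \<in> borel_measurable (GA IL \<Otimes>\<^sub>M GA IR)"
    by (intro borel_measurable_times_ennreal meas measurable_compose[OF measurable_fst \<phi>])
  have "(\<integral>\<^sup>+\<omega>. ?f (\<omega>, \<omega>) \<partial>M) = (\<integral>\<^sup>+\<omega>1. (\<integral>\<^sup>+\<omega>2. ?f (\<omega>1, \<omega>2) \<partial>M) \<partial>M)"
    by (rule decouple[OF _ f]) auto
  also have "\<dots> = (\<integral>\<^sup>+\<omega>. \<phi> \<omega> * pexp 0 0 (fold_list \<rho> (R \<omega>)) \<partial>M)"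
    using AE_pos AE_space[of M]
  proof (intro nn_integral_cong_AE, eventually_elim)
    case (elim \<omega>1)
    have m: "(\<lambda>\<omega>2. obs (path \<rho> (\<lambda>v. L v \<omega>1) (\<lambda>v t. Wr v t \<omega>2) u) (R \<omega>1)) \<in> borel_measurable M"
      using measurable_compose[OF measurable_Pair1' meas, of \<omega>1] elim
      by (intro measurable_from_subalg[OF subalgebra_GA[of IR]]) simp
    show ?case
    proof (cases "\<phi> \<omega>1 = 0")
      case False
      have "(\<integral>\<^sup>+\<omega>2. obs (path \<rho> (\<lambda>v. L v \<omega>1) (\<lambda>v t. Wr v t \<omega>2) u) (R \<omega>1) \<partial>M) = pexp 0 0 (fold_list \<rho> (R \<omega>1))"
        using R[OF False] elim by (intro path_law \<rho>) (auto simp: less_imp_le)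
      then show ?thesis using m by (simp add: nn_integral_cmult)
    qed simp
  qed
  finally show ?thesis by simp
qed

lemma many_to_one_particle:
  assumes \<rho>: "folding \<rho>" and t: "0 \<le> t"
    and r: "borel_list r" "sorted_wrt (<) (map fst r)" "\<And>t. t \<in> fst ` set r \<Longrightarrow> 0 \<le> t"
  shows "(\<integral>\<^sup>+\<omega>. indicator (alive (\<lambda>v. L v \<omega>) t) u * obs (path \<rho> (\<lambda>v. L v \<omega>) (\<lambda>v t. Wr v t \<omega>) u) r \<partial>M)
      = (\<integral>\<^sup>+\<omega>. indicator (alive (\<lambda>v. L v \<omega>) t) u \<partial>M) * pexp 0 0 (fold_list \<rho> r)"
proof -
  have "(\<integral>\<^sup>+\<omega>. indicator (alive (\<lambda>v. L v \<omega>) t) u * obs (path \<rho> (\<lambda>v. L v \<omega>) (\<lambda>v t. Wr v t \<omega>) u) r \<partial>M)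
      = (\<integral>\<^sup>+\<omega>. indicator (alive (\<lambda>v. L v \<omega>) t) u * pexp 0 0 (fold_list \<rho> r) \<partial>M)"
  proof (rule path_law_random[OF \<rho>])
    show "(\<lambda>\<omega>. indicator (alive (\<lambda>v. L v \<omega>) t) u :: ennreal) \<in> borel_measurable (GA IL)"
      by (intro alive_measurable L_measurable) auto
    show "(\<lambda>x. obs (path \<rho> (\<lambda>v. L v (fst x)) (\<lambda>v t. Wr v t (snd x)) u) r) \<in> borel_measurable (GA IL \<Otimes>\<^sub>M GA IR)"
      by (intro obs_measurable r path_IL_IR \<rho>) simp
  qed (use r in auto)
  then show ?thesis by (simp add: nn_integral_multc)
qed

lemma many_to_one:
  assumes \<rho>: "folding \<rho>" and t: "0 \<le> t"
    and r: "borel_list r" "sorted_wrt (<) (map fst r)" "\<And>t. t \<in> fst ` set r \<Longrightarrow> 0 \<le> t"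
  shows "(\<integral>\<^sup>+u. (\<integral>\<^sup>+\<omega>. indicator (alive (\<lambda>v. L v \<omega>) t) u * obs (path \<rho> (\<lambda>v. L v \<omega>) (\<lambda>v t. Wr v t \<omega>) u) r \<partial>M) \<partial>count_space UNIV)
      = ennreal (exp t) * pexp 0 0 (fold_list \<rho> r)"
proof -
  have "(\<integral>\<^sup>+u. (\<integral>\<^sup>+\<omega>. indicator (alive (\<lambda>v. L v \<omega>) t) u * obs (path \<rho> (\<lambda>v. L v \<omega>) (\<lambda>v t. Wr v t \<omega>) u) r \<partial>M) \<partial>count_space UNIV)
      = (\<integral>\<^sup>+u. (\<integral>\<^sup>+\<omega>. indicator (alive (\<lambda>v. L v \<omega>) t) u \<partial>M) * pexp 0 0 (fold_list \<rho> r) \<partial>count_space UNIV)"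
    by (rule nn_integral_cong) (rule many_to_one_particle[OF assms])
  then show ?thesis by (simp add: nn_integral_multc expected_alive[OF t])
qed

lemma many_to_one_shifted:
  assumes t: "\<tau> \<le> t" and r: "borel_list r" "sorted_wrt (<) (map fst r)" "\<And>t. t \<in> fst ` set r \<Longrightarrow> \<tau> \<le> t"
  shows "(\<integral>\<^sup>+u. (\<integral>\<^sup>+\<omega>. indicator (alive (\<lambda>v. L v \<omega>) (t - \<tau>)) u * obs (\<lambda>s. y + path (\<lambda>x. x) (\<lambda>v. L v \<omega>) (\<lambda>v t. Wr v t \<omega>) u (s - \<tau>)) r \<partial>M) \<partial>count_space UNIV)
      = ennreal (exp (t - \<tau>)) * pexp \<tau> y r"
proof -
  let ?r = "shift_list \<tau> (map (\<lambda>(s, f). (s, \<lambda>a. f (y + a))) r)"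
  let ?q = "map (\<lambda>(s, f). (s, \<lambda>a. f (y + a))) r"
  have q: "fst ` set ?q = fst ` set r" "map fst ?q = map fst r" "borel_list ?q"
    using r(1) by (force, auto simp: borel_list_def)
  have "(\<integral>\<^sup>+u. (\<integral>\<^sup>+\<omega>. indicator (alive (\<lambda>v. L v \<omega>) (t - \<tau>)) u * obs (path (\<lambda>x. x) (\<lambda>v. L v \<omega>) (\<lambda>v t. Wr v t \<omega>) u) ?r \<partial>M) \<partial>count_space UNIV)
      = ennreal (exp (t - \<tau>)) * pexp 0 0 (fold_list (\<lambda>x. x) ?r)"
  proof (rule many_to_one)
    show "borel_list ?r" using q(3) by simp
    show "sorted_wrt (<) (map fst ?r)" using r(2) by (simp only: sorted_shift_list q(2))
    show "0 \<le> s" if "s \<in> fst ` set ?r" for s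
    proof -
      have "s \<in> (\<lambda>t. t - \<tau>) ` fst ` set r" using that by (simp only: fst_set_shift_list q(1))
      then obtain s' where "s' \<in> fst ` set r" "s = s' - \<tau>" by blast
      then show ?thesis using r(3)[of s'] by simp
    qed
  qed (use t in \<open>auto simp: folding_def\<close>)
  also have "pexp 0 0 (fold_list (\<lambda>x. x) ?r) = pexp \<tau> y r"
    using pexp_shift[of \<tau> \<tau> 0 "map (\<lambda>(s, f). (s, \<lambda>a. f (y + a))) r"] by (simp add: pexp_translate)
  finally show ?thesis by (simp add: obs_shift obs_translate)
qed


section \<open>Integrating out subtrees and the many-to-two formula\<close>

lemma Wr_pair_measurable:
  assumes K: "Inr v \<in> K" and f: "f \<in> N \<rightarrow>\<^sub>M GA K"
  shows "(\<lambda>(t, x). Wr v t (f x)) \<in> borel_measurable (borel \<Otimes>\<^sub>M N)"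
proof -
  have "(\<lambda>p. (fst p, f (snd p))) \<in> borel \<Otimes>\<^sub>M N \<rightarrow>\<^sub>M borel \<Otimes>\<^sub>M GA K"
    using f by measurable
  from measurable_compose[OF this Wr_measurable[OF K]] show ?thesis by (simp add: split_beta)
qed

lemma path_copy_measurable:
  assumes K: "\<And>v. Inl (v @ x) \<in> K" "\<And>v. Inr (v @ x) \<in> K" and f: "f \<in> N \<rightarrow>\<^sub>M GA K" and \<theta>: "\<theta> \<in> borel_measurable N"
  shows "(\<lambda>z. path (\<lambda>x. x) (\<lambda>v. L (v @ x) (f z)) (\<lambda>v t. Wr (v @ x) t (f z)) u (\<theta> z)) \<in> borel_measurable N"
  by (rule path_measurable[OF _ _ _ \<theta>])
    (auto simp: folding_def intro: measurable_compose[OF f L_measurable[OF K(1)]] Wr_pair_measurable[OF K(2) f])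

lemma alive_copy_measurable:
  assumes K: "\<And>v. Inl (v @ x) \<in> K" and f: "f \<in> N \<rightarrow>\<^sub>M GA K" and \<theta>: "\<theta> \<in> borel_measurable N"
  shows "(\<lambda>z. indicator (alive (\<lambda>v. L (v @ x) (f z)) (\<theta> z)) u :: ennreal) \<in> borel_measurable N"
  by (rule alive_measurable[OF _ \<theta>]) (rule measurable_compose[OF f L_measurable[OF K]])

text \<open>The birth time \<open>\<tau>\<close> and birth place \<open>y\<close> of the subtree are
  known from labels in \<open>I\<close>, while the subtree itself is an independent copy. It can
  therefore be averaged with \<open>\<tau>\<close> and \<open>y\<close> frozen, where the shifted
  many-to-one formula evaluates the sum over its particles.\<close>

lemma integrate_subtree:
  assumes disj: "\<And>v. Inl (v @ x) \<notin> I" "\<And>v. Inr (v @ x) \<notin> I"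
    and m: "\<phi> \<in> borel_measurable (GA I)" "\<tau> \<in> borel_measurable (GA I)" "y \<in> borel_measurable (GA I)"
    and r: "borel_list r" "sorted_wrt (<) (map fst r)"
    and \<tau>: "\<And>\<omega>. \<phi> \<omega> \<noteq> 0 \<Longrightarrow> \<tau> \<omega> \<le> t \<and> (\<forall>s\<in>fst ` set r. \<tau> \<omega> \<le> s)"
  shows "(\<integral>\<^sup>+u. (\<integral>\<^sup>+\<omega>. \<phi> \<omega> * (indicator (alive (\<lambda>v. L (v @ x) \<omega>) (t - \<tau> \<omega>)) u *
          obs (\<lambda>s. y \<omega> + path (\<lambda>x. x) (\<lambda>v. L (v @ x) \<omega>) (\<lambda>v t. Wr (v @ x) t \<omega>) u (s - \<tau> \<omega>)) r) \<partial>M) \<partial>count_space UNIV)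
      = (\<integral>\<^sup>+\<omega>. \<phi> \<omega> * (ennreal (exp (t - \<tau> \<omega>)) * pexp (\<tau> \<omega>) (y \<omega>) r) \<partial>M)"
proof -
  interpret c: branching_data M "\<lambda>v. L (v @ x)" "\<lambda>v. W (v @ x)" by (rule branching_data_copy)
  define J :: "(particle + particle) set" where "J = {Inl (v @ x) |v. True} \<union> {Inr (v @ x) |v. True}"
  have IJ: "I \<inter> J = {}" using disj by (auto simp: J_def)
  have J: "Inl (v @ x) \<in> J" "Inr (v @ x) \<in> J" for v by (auto simp: J_def)
  let ?g = "\<lambda>u \<omega>1 \<omega>2. indicator (alive (\<lambda>v. L (v @ x) \<omega>2) (t - \<tau> \<omega>1)) u *
          obs (\<lambda>s. y \<omega>1 + path (\<lambda>x. x) (\<lambda>v. L (v @ x) \<omega>2) (\<lambda>v t. Wr (v @ x) t \<omega>2) u (s - \<tau> \<omega>1)) r :: ennreal"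
  let ?N = "GA I \<Otimes>\<^sub>M GA J"
  have [measurable]: "(\<lambda>z. \<phi> (fst z)) \<in> borel_measurable ?N" "(\<lambda>z. \<tau> (fst z)) \<in> borel_measurable ?N" "(\<lambda>z. y (fst z)) \<in> borel_measurable ?N"
    using m by (auto intro: measurable_compose[OF measurable_fst])
  have g: "(\<lambda>z. ?g u (fst z) (snd z)) \<in> borel_measurable ?N" for u
    by (intro borel_measurable_times_ennreal obs_measurable r(1) borel_measurable_add
        alive_copy_measurable[where K=J] path_copy_measurable[where K=J]) (use J in measurable)
  have "(\<integral>\<^sup>+\<omega>. \<phi> \<omega> * ?g u \<omega> \<omega> \<partial>M) = (\<integral>\<^sup>+\<omega>1. \<phi> \<omega>1 * (\<integral>\<^sup>+\<omega>2. ?g u \<omega>1 \<omega>2 \<partial>M) \<partial>M)" for u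
  proof -
    have "(\<integral>\<^sup>+\<omega>. \<phi> (fst (\<omega>, \<omega>)) * ?g u (fst (\<omega>, \<omega>)) (snd (\<omega>, \<omega>)) \<partial>M)
        = (\<integral>\<^sup>+\<omega>1. (\<integral>\<^sup>+\<omega>2. \<phi> (fst (\<omega>1, \<omega>2)) * ?g u (fst (\<omega>1, \<omega>2)) (snd (\<omega>1, \<omega>2)) \<partial>M) \<partial>M)"
      by (rule decouple[OF IJ]) (intro borel_measurable_times_ennreal g, simp)
    also have "\<dots> = (\<integral>\<^sup>+\<omega>1. \<phi> \<omega>1 * (\<integral>\<^sup>+\<omega>2. ?g u \<omega>1 \<omega>2 \<partial>M) \<partial>M)"
    proof (rule nn_integral_cong)
      fix \<omega>1 assume "\<omega>1 \<in> space M"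
      then have "(\<lambda>\<omega>2. ?g u \<omega>1 \<omega>2) \<in> borel_measurable (GA J)"
        using measurable_compose[OF measurable_Pair1' g, of \<omega>1 u] by simp
      then have "(\<lambda>\<omega>2. ?g u \<omega>1 \<omega>2) \<in> borel_measurable M"
        by (rule measurable_from_subalg[OF subalgebra_GA])
      then show "(\<integral>\<^sup>+\<omega>2. \<phi> (fst (\<omega>1, \<omega>2)) * ?g u (fst (\<omega>1, \<omega>2)) (snd (\<omega>1, \<omega>2)) \<partial>M) = \<phi> \<omega>1 * (\<integral>\<^sup>+\<omega>2. ?g u \<omega>1 \<omega>2 \<partial>M)"
        by (simp add: nn_integral_cmult)
    qed
    finally show ?thesis by simp
  qed
  then have "(\<integral>\<^sup>+u. (\<integral>\<^sup>+\<omega>. \<phi> \<omega> * ?g u \<omega> \<omega> \<partial>M) \<partial>count_space UNIV)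
      = (\<integral>\<^sup>+u. (\<integral>\<^sup>+\<omega>1. \<phi> \<omega>1 * (\<integral>\<^sup>+\<omega>2. ?g u \<omega>1 \<omega>2 \<partial>M) \<partial>M) \<partial>count_space UNIV)"
    by simp
  also have "\<dots> = (\<integral>\<^sup>+\<omega>1. (\<integral>\<^sup>+u. \<phi> \<omega>1 * (\<integral>\<^sup>+\<omega>2. ?g u \<omega>1 \<omega>2 \<partial>M) \<partial>count_space UNIV) \<partial>M)"
  proof (rule nn_integral_count_space_nn_integral[symmetric])
    fix u
    have id: "(\<lambda>\<omega>. \<omega>) \<in> M \<rightarrow>\<^sub>M GA K" for K
      using measurable_from_subalg[OF subalgebra_GA, of "\<lambda>\<omega>. \<omega>" K "GA K"] by simp
    have "(\<lambda>z. (fst z, snd z)) \<in> M \<Otimes>\<^sub>M M \<rightarrow>\<^sub>M ?N"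
      by (intro measurable_Pair measurable_compose[OF measurable_fst id] measurable_compose[OF measurable_snd id])
    from measurable_compose[OF this g[of u]]
    have "(\<lambda>(\<omega>1, \<omega>2). ?g u \<omega>1 \<omega>2) \<in> borel_measurable (M \<Otimes>\<^sub>M M)" by (simp add: split_beta)
    then have "(\<lambda>\<omega>1. \<integral>\<^sup>+\<omega>2. ?g u \<omega>1 \<omega>2 \<partial>M) \<in> borel_measurable M"
      by (rule borel_measurable_nn_integral)
    then show "(\<lambda>\<omega>1. \<phi> \<omega>1 * (\<integral>\<^sup>+\<omega>2. ?g u \<omega>1 \<omega>2 \<partial>M)) \<in> borel_measurable M"
      by (intro borel_measurable_times_ennreal measurable_from_subalg[OF subalgebra_GA m(1)])
  qed simp
  also have "\<dots> = (\<integral>\<^sup>+\<omega>. \<phi> \<omega> * (ennreal (exp (t - \<tau> \<omega>)) * pexp (\<tau> \<omega>) (y \<omega>) r) \<partial>M)"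
  proof (rule nn_integral_cong)
    fix \<omega>1
    show "(\<integral>\<^sup>+u. \<phi> \<omega>1 * (\<integral>\<^sup>+\<omega>2. ?g u \<omega>1 \<omega>2 \<partial>M) \<partial>count_space UNIV) = \<phi> \<omega>1 * (ennreal (exp (t - \<tau> \<omega>1)) * pexp (\<tau> \<omega>1) (y \<omega>1) r)"
    proof (cases "\<phi> \<omega>1 = 0")
      case False
      then have "(\<integral>\<^sup>+u. (\<integral>\<^sup>+\<omega>2. ?g u \<omega>1 \<omega>2 \<partial>M) \<partial>count_space UNIV) = ennreal (exp (t - \<tau> \<omega>1)) * pexp (\<tau> \<omega>1) (y \<omega>1) r"
        using \<tau>[of \<omega>1] r c.many_to_one_shifted[of "\<tau> \<omega>1" t r "y \<omega>1"] unfolding Wr_copy by blast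
      then show ?thesis by (simp add: nn_integral_cmult)
    qed simp
  qed
  finally show ?thesis .
qed

text \<open>\<open>w\<close> is the last common ancestor of the pair. Integrating out the subtree of
  one child and then that of the other leaves the lineage of \<open>w\<close> with the observable
  \<open>\<Xi>\<close> at its death, and the sum over \<open>w\<close> becomes an integral with
  intensity \<open>exp s\<close>. Confining the fork to a unit interval keeps every prescribed
  observation time on a definite side of it.\<close>

lemma many_to_two:
  fixes k j j' :: nat
  assumes kj: "k < j" "k < j'"
    and F: "borel_list F" "sorted_wrt (<) (map fst F)" "\<And>t :: real. t \<in> fst ` set F \<Longrightarrow> 0 \<le> t \<and> t \<le> k"
    and R: "borel_list R" "sorted_wrt (<) (map fst R)" "\<And>t :: real. t \<in> fst ` set R \<Longrightarrow> real k + 1 \<le> t"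
    and R': "borel_list R'" "sorted_wrt (<) (map fst R')" "\<And>t :: real. t \<in> fst ` set R' \<Longrightarrow> real k + 1 \<le> t"
  defines "p \<equiv> \<lambda>\<omega>. path (\<lambda>x. x) (\<lambda>v. L v \<omega>) (\<lambda>v t. Wr v t \<omega>)"
    and "\<Xi> \<equiv> \<lambda>(s :: real) y. (ennreal (exp (j - s)) * pexp s y R) * (ennreal (exp (j' - s)) * pexp s y R')"
  shows "(\<integral>\<^sup>+w. (\<integral>\<^sup>+u. (\<integral>\<^sup>+v. (\<integral>\<^sup>+\<omega>. indicator {real k<..real k+1} (death w \<omega>) * obs (p \<omega> w) F
        * (indicator (alive (\<lambda>v. L v \<omega>) j) (u @ b # w) * obs (p \<omega> (u @ b # w)) R)
        * (indicator (alive (\<lambda>v. L v \<omega>) j') (v @ (\<not> b) # w) * obs (p \<omega> (v @ (\<not> b) # w)) R')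
        \<partial>M) \<partial>count_space UNIV) \<partial>count_space UNIV) \<partial>count_space UNIV)
    = (\<integral>\<^sup>+s\<in>{real k<..real k+1}. ennreal (exp s) * pexp 0 0 (F @ [(s, \<Xi> s)]) \<partial>lborel)" (is "?lhs = _")
proof -
  have \<Xi>m: "case_prod \<Xi> \<in> borel_measurable (borel \<Otimes>\<^sub>M borel)"
    unfolding \<Xi>_def using R(1) R'(1) by measurable
  have id: "folding (\<lambda>x. x)" by (simp add: folding_def)
  let ?D = "{real k<..real k+1}"
  let ?a = "\<lambda>w \<omega>. indicator ?D (death w \<omega>) * obs (p \<omega> w) F :: ennreal"
  let ?q = "\<lambda>x t u \<omega> \<tau> y r. indicator (alive (\<lambda>v. L (v @ x) \<omega>) (t - \<tau>)) u *
          obs (\<lambda>s. y + path (\<lambda>x. x) (\<lambda>v. L (v @ x) \<omega>) (\<lambda>v t. Wr (v @ x) t \<omega>) u (s - \<tau>)) r :: ennreal"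
  have rewr: "AE \<omega> in M. \<forall>w b u t r. (\<forall>t\<in>fst ` set r. real k + 1 \<le> t) \<longrightarrow> indicator ?D (death w \<omega>) * (indicator (alive (\<lambda>v. L v \<omega>) t) (u @ b # w) * obs (p \<omega> (u @ b # w)) r)
      = indicator ?D (death w \<omega>) * ?q (b # w) t u \<omega> (death w \<omega>) (p \<omega> w (death w \<omega>)) r"
    using AE_pos
  proof eventually_elim
    case (elim \<omega>)
    have "obs (p \<omega> (u @ b # w)) r = obs (\<lambda>s. p \<omega> w (death w \<omega>) + path (\<lambda>x. x) (\<lambda>v. L (v @ b # w) \<omega>) (\<lambda>v t. Wr (v @ b # w) t \<omega>) u (s - death w \<omega>)) r"
      if "\<forall>t\<in>fst ` set r. real k + 1 \<le> t" "death w \<omega> \<in> ?D" for w b u r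
    proof (rule obs_cong)
      fix t assume "t \<in> fst ` set r"
      then have "death w \<omega> \<le> t" using that by force
      then show "p \<omega> (u @ b # w) t = p \<omega> w (death w \<omega>) + path (\<lambda>x. x) (\<lambda>v. L (v @ b # w) \<omega>) (\<lambda>v t. Wr (v @ b # w) t \<omega>) u (t - death w \<omega>)"
        unfolding p_def using path_append[of "\<lambda>v. L v \<omega>" b w t "\<lambda>v t. Wr v t \<omega>" u] elim
        by (simp add: less_imp_le birth_eq_death del: birth_time.simps)
    qed
    then show ?case
      by (auto simp: indicator_def alive_append birth_eq_death simp del: birth_time.simps)
  qed
  have "?lhs = (\<integral>\<^sup>+w. (\<integral>\<^sup>+s. indicator ?D s * pexp 0 0 (F @ [(s, \<Xi> s)]) \<partial>distr M borel (death w)) \<partial>count_space UNIV)"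
  proof (rule nn_integral_cong)
    fix w
    let ?x = "b # w" and ?x' = "(\<not> b) # w"
    let ?\<tau> = "death w" and ?y = "\<lambda>\<omega>. p \<omega> w (death w \<omega>)"
    \<comment> \<open>\<open>A\<close> carries the labels of \<open>w\<close> and its ancestors, and
      \<open>B\<close> adds the subtree of the child \<open>b # w\<close>. The other child's subtree
      is integrated out first, relative to \<open>B\<close>, and then this one relative to
      \<open>A\<close>.\<close>
    define A where "A = {Inl v |v. suffix v w} \<union> {Inr v |v. suffix v (w :: particle)}"
    define B where "B = A \<union> {Inl (v @ ?x) |v. True} \<union> {Inr (v @ ?x) |v. True}"
    have AB: "A \<subseteq> B" by (auto simp: B_def)
    have pm: "(\<lambda>\<omega>. p \<omega> w (\<theta> \<omega>)) \<in> borel_measurable (GA I)" if "A \<subseteq> I" "\<theta> \<in> borel_measurable (GA I)" for \<theta> I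
      unfolding p_def
    proof (rule path_measurable[OF id _ _ that(2)])
      show "L v \<in> borel_measurable (GA I)" if "suffix v w" for v
        using that \<open>A \<subseteq> I\<close> by (intro L_measurable) (auto simp: A_def)
      show "(\<lambda>(t, \<omega>). Wr v t \<omega>) \<in> borel_measurable (borel \<Otimes>\<^sub>M GA I)" if "suffix v w" for v
        using that \<open>A \<subseteq> I\<close> by (intro Wr_measurable) (auto simp: A_def)
    qed
    have dm: "death w \<in> borel_measurable (GA I)" if "A \<subseteq> I" for I
      using that by (intro death_measurable) (auto simp: A_def)
    have am: "?a w \<in> borel_measurable (GA I)" if "A \<subseteq> I" for I
      using dm[OF that] pm[OF that] F(1) by (intro borel_measurable_times_ennreal obs_measurable) auto
    have nsuf: "\<not> suffix (v @ c # w) w" for v c by (auto dest: suffix_length_le)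
    have dA: "Inl (v @ c # w) \<notin> A" "Inr (v @ c # w) \<notin> A" for v c
      using nsuf by (auto simp: A_def)
    have ne: "v @ (\<not> b) # w \<noteq> v' @ b # w" for v v'
    proof
      assume "v @ (\<not> b) # w = v' @ b # w"
      then have "v @ [\<not> b] = v' @ [b]" by (metis append_Cons append_Nil append_assoc append_same_eq)
      then show False by simp
    qed
    have dB: "Inl (v @ (\<not> b) # w) \<notin> B" "Inr (v @ (\<not> b) # w) \<notin> B" for v
      using dA ne by (auto simp: B_def)
    have "(\<integral>\<^sup>+u. (\<integral>\<^sup>+v. (\<integral>\<^sup>+\<omega>. ?a w \<omega>
        * (indicator (alive (\<lambda>v. L v \<omega>) j) (u @ ?x) * obs (p \<omega> (u @ ?x)) R)
        * (indicator (alive (\<lambda>v. L v \<omega>) j') (v @ ?x') * obs (p \<omega> (v @ ?x')) R')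
        \<partial>M) \<partial>count_space UNIV) \<partial>count_space UNIV)
      = (\<integral>\<^sup>+u. (\<integral>\<^sup>+v. (\<integral>\<^sup>+\<omega>. (?a w \<omega> * ?q ?x j u \<omega> (?\<tau> \<omega>) (?y \<omega>) R) * ?q ?x' j' v \<omega> (?\<tau> \<omega>) (?y \<omega>) R'
        \<partial>M) \<partial>count_space UNIV) \<partial>count_space UNIV)"
    proof (rule nn_integral_cong, rule nn_integral_cong, rule nn_integral_cong_AE)
      fix u v
      show "AE \<omega> in M. ?a w \<omega>
        * (indicator (alive (\<lambda>v. L v \<omega>) j) (u @ ?x) * obs (p \<omega> (u @ ?x)) R)
        * (indicator (alive (\<lambda>v. L v \<omega>) j') (v @ ?x') * obs (p \<omega> (v @ ?x')) R')
        = (?a w \<omega> * ?q ?x j u \<omega> (?\<tau> \<omega>) (?y \<omega>) R) * ?q ?x' j' v \<omega> (?\<tau> \<omega>) (?y \<omega>) R'"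
        using rewr
      proof eventually_elim
        case (elim \<omega>)
        show ?case
        proof (cases "death w \<omega> \<in> ?D")
          case True
          have "indicator ?D (death w \<omega>) * (indicator (alive (\<lambda>v. L v \<omega>) j) (u @ ?x) * obs (p \<omega> (u @ ?x)) R)
              = indicator ?D (death w \<omega>) * ?q ?x j u \<omega> (?\<tau> \<omega>) (?y \<omega>) R"
            and "indicator ?D (death w \<omega>) * (indicator (alive (\<lambda>v. L v \<omega>) j') (v @ ?x') * obs (p \<omega> (v @ ?x')) R')
              = indicator ?D (death w \<omega>) * ?q ?x' j' v \<omega> (?\<tau> \<omega>) (?y \<omega>) R'"
            using elim R(3) R'(3) by blast+
          with True show ?thesis by simp
        qed simp
      qed
    qed
    also have "\<dots> = (\<integral>\<^sup>+u. (\<integral>\<^sup>+\<omega>. (?a w \<omega> * ?q ?x j u \<omega> (?\<tau> \<omega>) (?y \<omega>) R) * (ennreal (exp (j' - ?\<tau> \<omega>)) * pexp (?\<tau> \<omega>) (?y \<omega>) R') \<partial>M) \<partial>count_space UNIV)"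
    proof (intro nn_integral_cong integrate_subtree[where I=B] dB pm dm AB R')
      fix u
      have BB: "Inl (v @ ?x) \<in> B" "Inr (v @ ?x) \<in> B" for v by (auto simp: B_def)
      have "(\<lambda>\<omega>. ?q ?x j u \<omega> (?\<tau> \<omega>) (?y \<omega>) R) \<in> borel_measurable (GA B)"
        using dm[OF AB] pm[OF AB dm[OF AB]] BB R(1)
        by (intro borel_measurable_times_ennreal obs_measurable borel_measurable_add
          alive_copy_measurable[where K=B] path_copy_measurable[where K=B]) auto
      then show "(\<lambda>\<omega>. ?a w \<omega> * ?q ?x j u \<omega> (?\<tau> \<omega>) (?y \<omega>) R) \<in> borel_measurable (GA B)"
        by (rule borel_measurable_times_ennreal[OF am[OF AB]])
      fix \<omega> assume "?a w \<omega> * ?q ?x j u \<omega> (?\<tau> \<omega>) (?y \<omega>) R \<noteq> 0"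
      then have "death w \<omega> \<in> ?D" by (auto split: split_indicator_asm)
      then show "?\<tau> \<omega> \<le> real j' \<and> (\<forall>s\<in>fst ` set R'. ?\<tau> \<omega> \<le> s)"
        using R'(3) kj by fastforce
    qed
    also have "\<dots> = (\<integral>\<^sup>+u. (\<integral>\<^sup>+\<omega>. (?a w \<omega> * (ennreal (exp (j' - ?\<tau> \<omega>)) * pexp (?\<tau> \<omega>) (?y \<omega>) R')) * ?q ?x j u \<omega> (?\<tau> \<omega>) (?y \<omega>) R \<partial>M) \<partial>count_space UNIV)"
      by (simp only: mult_ac)
    also have "\<dots> = (\<integral>\<^sup>+\<omega>. (?a w \<omega> * (ennreal (exp (j' - ?\<tau> \<omega>)) * pexp (?\<tau> \<omega>) (?y \<omega>) R')) * (ennreal (exp (j - ?\<tau> \<omega>)) * pexp (?\<tau> \<omega>) (?y \<omega>) R) \<partial>M)"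
    proof (rule integrate_subtree[where I=A, OF dA])
      show "(\<lambda>\<omega>. ?a w \<omega> * (ennreal (exp (j' - ?\<tau> \<omega>)) * pexp (?\<tau> \<omega>) (?y \<omega>) R')) \<in> borel_measurable (GA A)"
        using dm[OF order.refl] pm[OF order.refl dm[OF order.refl]] R'(1)
        by (intro borel_measurable_times_ennreal[OF am[OF order.refl]] borel_measurable_times_ennreal[OF _ pexp_measurable]) auto
      fix \<omega> assume "?a w \<omega> * (ennreal (exp (j' - ?\<tau> \<omega>)) * pexp (?\<tau> \<omega>) (?y \<omega>) R') \<noteq> 0"
      then have "death w \<omega> \<in> ?D" by (auto split: split_indicator_asm)
      then show "?\<tau> \<omega> \<le> real j \<and> (\<forall>s\<in>fst ` set R. ?\<tau> \<omega> \<le> s)"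
        using R(3) kj by fastforce
    qed (use dm[OF order.refl] pm[OF order.refl dm[OF order.refl]] R in auto)
    also have "\<dots> = (\<integral>\<^sup>+\<omega>. indicator ?D (?\<tau> \<omega>) * obs (p \<omega> w) (F @ [(?\<tau> \<omega>, \<Xi> (?\<tau> \<omega>))]) \<partial>M)"
      by (simp add: \<Xi>_def mult_ac)
    also have "\<dots> = (\<integral>\<^sup>+\<omega>. indicator ?D (?\<tau> \<omega>) * pexp 0 0 (fold_list (\<lambda>x. x) (F @ [(?\<tau> \<omega>, \<Xi> (?\<tau> \<omega>))])) \<partial>M)"
      unfolding p_def
    proof (rule path_law_random[OF id])
      have dIL: "death w \<in> borel_measurable (GA IL)" by (rule death_measurable) auto
      then show "(\<lambda>\<omega>. indicator ?D (?\<tau> \<omega>) :: ennreal) \<in> borel_measurable (GA IL)" by auto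
      have d': "(\<lambda>x. death w (fst x)) \<in> borel_measurable (GA IL \<Otimes>\<^sub>M GA IR)"
        by (rule measurable_compose[OF measurable_fst dIL])
      have "(\<lambda>x. \<Xi> (death w (fst x)) (path (\<lambda>x. x) (\<lambda>v. L v (fst x)) (\<lambda>v t. Wr v t (snd x)) w (death w (fst x)))) \<in> borel_measurable (GA IL \<Otimes>\<^sub>M GA IR)"
        using measurable_compose[OF measurable_Pair[OF d' path_IL_IR[OF id d']] \<Xi>m] by simp
      then show "(\<lambda>x. obs (path (\<lambda>x. x) (\<lambda>v. L v (fst x)) (\<lambda>v t. Wr v t (snd x)) w) (F @ [(death w (fst x), \<Xi> (death w (fst x)))]))
          \<in> borel_measurable (GA IL \<Otimes>\<^sub>M GA IR)"
        unfolding obs_simps mult_1_right by (intro borel_measurable_times_ennreal obs_measurable F path_IL_IR id) auto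
      fix \<omega> assume "indicator ?D (?\<tau> \<omega>) \<noteq> (0 :: ennreal)"
      then have "death w \<omega> \<in> ?D" by (auto split: split_indicator_asm)
      moreover have "\<Xi> (death w \<omega>) \<in> borel_measurable borel"
        using measurable_compose[OF measurable_Pair1' \<Xi>m, of "death w \<omega>"] by simp
      ultimately show "borel_list (F @ [(?\<tau> \<omega>, \<Xi> (?\<tau> \<omega>))]) \<and> sorted_wrt (<) (map fst (F @ [(?\<tau> \<omega>, \<Xi> (?\<tau> \<omega>))]))
          \<and> (\<forall>t\<in>fst ` set (F @ [(?\<tau> \<omega>, \<Xi> (?\<tau> \<omega>))]). 0 \<le> t)"
        using F by (fastforce simp: sorted_wrt_append)
    qed
    also have "\<dots> = (\<integral>\<^sup>+s. indicator ?D s * pexp 0 0 (F @ [(s, \<Xi> s)]) \<partial>distr M borel (death w))"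
    proof (subst nn_integral_distr)
      have "(\<lambda>s. pexp 0 0 (F @ [(s, \<Xi> s)])) \<in> borel_measurable borel"
        using measurable_compose[OF _ pexp_snoc_measurable[OF F(1) \<Xi>m], of "\<lambda>s. (s, 0)" borel 0] by simp
      then show "(\<lambda>s. indicator ?D s * pexp 0 0 (F @ [(s, \<Xi> s)])) \<in> borel_measurable (distr M borel (death w))"
        by auto
    qed auto
    finally show "(\<integral>\<^sup>+u. (\<integral>\<^sup>+v. (\<integral>\<^sup>+\<omega>. ?a w \<omega>
        * (indicator (alive (\<lambda>v. L v \<omega>) j) (u @ ?x) * obs (p \<omega> (u @ ?x)) R)
        * (indicator (alive (\<lambda>v. L v \<omega>) j') (v @ ?x') * obs (p \<omega> (v @ ?x')) R')
        \<partial>M) \<partial>count_space UNIV) \<partial>count_space UNIV) = \<dots>" .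
  qed
  also have "\<dots> = (\<integral>\<^sup>+w. (\<integral>\<^sup>+\<omega>. indicator ?D (death w \<omega>) * pexp 0 0 (F @ [(death w \<omega>, \<Xi> (death w \<omega>))]) \<partial>M) \<partial>count_space UNIV)"
  proof (intro nn_integral_cong nn_integral_distr)
    have "(\<lambda>s. pexp 0 0 (F @ [(s, \<Xi> s)])) \<in> borel_measurable borel"
      using measurable_compose[OF _ pexp_snoc_measurable[OF F(1) \<Xi>m], of "\<lambda>s. (s, 0)" borel 0] by simp
    then show "(\<lambda>s. indicator ?D s * pexp 0 0 (F @ [(s, \<Xi> s)])) \<in> borel_measurable (distr M borel (death w))" for w
      by auto
  qed auto
  also have "\<dots> = (\<integral>\<^sup>+s\<in>{0..}. ennreal (exp s) * (indicator ?D s * pexp 0 0 (F @ [(s, \<Xi> s)])) \<partial>lborel)"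
  proof (rule nn_integral_deaths)
    have "(\<lambda>s. pexp 0 0 (F @ [(s, \<Xi> s)])) \<in> borel_measurable borel"
      using measurable_compose[OF _ pexp_snoc_measurable[OF F(1) \<Xi>m], of "\<lambda>s. (s, 0)" borel 0] by simp
    then show "(\<lambda>s. indicator ?D s * pexp 0 0 (F @ [(s, \<Xi> s)])) \<in> borel_measurable borel"
      by auto
  qed
  also have "\<dots> = (\<integral>\<^sup>+s\<in>?D. ennreal (exp s) * pexp 0 0 (F @ [(s, \<Xi> s)]) \<partial>lborel)"
    by (intro nn_integral_cong) (auto split: split_indicator)
  finally show ?thesis .
qed

end

section \<open>Path expectations at integer times\<close>

text \<open>The left end \<open>k\<close> is excluded because it is the starting time of the walk;
  lists for adjacent ranges therefore concatenate.\<close>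

definition steps :: "(nat \<Rightarrow> real \<Rightarrow> ennreal) \<Rightarrow> nat \<Rightarrow> nat \<Rightarrow> (real \<times> (real \<Rightarrow> ennreal)) list" where
  "steps f k n = map (\<lambda>i. (real i, f i)) [Suc k..<Suc n]"

lemma steps_Nil [simp]: "n \<le> k \<Longrightarrow> steps f k n = []"
  by (simp add: steps_def)

lemma steps_Cons: "k < n \<Longrightarrow> steps f k n = (real (Suc k), f (Suc k)) # steps f (Suc k) n"
  unfolding steps_def by (subst upt_conv_Cons) auto

lemma steps_append: "k \<le> m \<Longrightarrow> m \<le> n \<Longrightarrow> steps f k n = steps f k m @ steps f m n"
  using upt_add_eq_append[of "Suc k" "Suc m" "n - m"] by (simp add: steps_def del: upt_Suc)

lemma borel_list_steps: "(\<And>i. f i \<in> borel_measurable borel) \<Longrightarrow> borel_list (steps f k n)"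
  by (auto simp: borel_list_def steps_def)

lemma map_fst_steps: "map fst (steps f k n) = map real [Suc k..<Suc n]"
  by (simp add: steps_def)

lemma sorted_steps: "sorted_wrt (<) (map fst (steps f k n))"
  unfolding map_fst_steps by (simp add: sorted_wrt_map del: upt_Suc)

lemma fst_set_steps: "fst ` set (steps f k n) = real ` {k<..n}"
  by (auto simp: steps_def image_image)

lemma pexp_steps_mono:
  assumes "\<And>i y. k < i \<Longrightarrow> i \<le> n \<Longrightarrow> f i y \<le> f' i y" "\<And>y. pexp n y r \<le> pexp n y r'" "k \<le> n"
  shows "pexp k x (steps f k n @ r) \<le> pexp k x (steps f' k n @ r')"
  using assms
proof (induction "n - k" arbitrary: k x)
  case (Suc d)
  then have k: "k < n" "d = n - Suc k" by auto
  have "pexp (Suc k) y (steps f (Suc k) n @ r) \<le> pexp (Suc k) y (steps f' (Suc k) n @ r')" for y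
    using Suc.prems k by (intro Suc.hyps) auto
  then show ?case
    using k Suc.prems(1)[of "Suc k"] by (auto simp: steps_Cons intro!: heat_mono mult_mono)
qed simp

lemma pexp_steps_le_kill:
  assumes "\<And>i y. k < i \<Longrightarrow> i < n \<Longrightarrow> f i y \<le> indicator {..b} y"
    and "\<And>y. f n y * pexp n y r \<le> indicator {..b} y * g y" "k < n"
  shows "pexp k x (steps f k n @ r) \<le> (kill b ^^ (n - k)) g x"
  using assms
proof (induction "n - Suc k" arbitrary: k x)
  case 0
  then have "n = Suc k" by simp
  then show ?case using 0 by (auto simp: steps_Cons kill_def intro!: heat_mono)
next
  case (Suc d)
  then have k: "k < n" "d = n - Suc (Suc k)" "Suc k < n" by auto
  have IH: "pexp (Suc k) y (steps f (Suc k) n @ r) \<le> (kill b ^^ (n - Suc k)) g y" for y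
    using Suc.prems k by (intro Suc.hyps) auto
  have "pexp k x (steps f k n @ r) = heat 1 (\<lambda>y. f (Suc k) y * pexp (Suc k) y (steps f (Suc k) n @ r)) x"
    using k by (simp add: steps_Cons)
  also have "\<dots> \<le> heat 1 (\<lambda>y. indicator {..b} y * (kill b ^^ (n - Suc k)) g y) x"
    using Suc.prems(1)[of "Suc k"] k IH by (intro heat_mono mult_mono) auto
  also have "\<dots> = (kill b ^^ (n - k)) g x"
    using k(1) by (subst Suc_diff_Suc[symmetric]) (auto simp: kill_def)
  finally show ?case .
qed

section \<open>Change of slope\<close>

text \<open>Converts constraints relative to the line of slope \<open>sqrt 2\<close> into
  constraints on the actual position.\<close>

definition tilt :: "(real \<times> (real \<Rightarrow> ennreal)) list \<Rightarrow> (real \<times> (real \<Rightarrow> ennreal)) list" where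
  "tilt r = map (\<lambda>(s, f). (s, \<lambda>x. f (x - sqrt 2 * s))) r"

lemma tilt_simps [simp]:
  "tilt [] = []" "tilt ((s, f) # r) = (s, \<lambda>x. f (x - sqrt 2 * s)) # tilt r"
  "tilt (r @ r') = tilt r @ tilt r'" "borel_list r \<Longrightarrow> borel_list (tilt r)" "map fst (tilt r) = map fst r"
  "fst ` set (tilt r) = fst ` set r"
  by (auto simp: tilt_def borel_list_def) (force simp: image_iff split_beta)+

lemma obs_tilt: "obs p (tilt r) = obs (\<lambda>t. p t - sqrt 2 * t) r"
  by (induction r) auto

text \<open>The one-step Girsanov formula on each segment. The slope is critical: the cost
  \<open>exp (- (T - t))\<close> of following the line balances the mean number
  \<open>exp (T - t)\<close> of particles, and only the weights \<open>exp (sqrt 2 * x)\<close> at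
  the start and \<open>exp (- sqrt 2 * y)\<close> at the end remain.\<close>

lemma pexp_tilt:
  assumes "borel_list r" "g \<in> borel_measurable borel" "sorted (t # map fst r @ [T])"
  shows "ennreal (exp (T - t)) * pexp t (x + sqrt 2 * t) (tilt (r @ [(T, g)]))
    = ennreal (exp (sqrt 2 * x)) * pexp t x (r @ [(T, \<lambda>y. ennreal (exp (- sqrt 2 * y)) * g y)])"
proof -
  have step: "ennreal (exp d) * heat d (\<lambda>y. G (y - sqrt 2 * (t + d))) (x + sqrt 2 * t)
      = heat d (\<lambda>y. ennreal (exp (- sqrt 2 * (y - x))) * G y) x"
    if [measurable]: "G \<in> borel_measurable borel" and "0 \<le> d" for d t x and G :: "real \<Rightarrow> ennreal"
  proof -
    have "heat d (\<lambda>y. G (y - sqrt 2 * (t + d))) (x + sqrt 2 * t) = heat d (\<lambda>y. G (y + sqrt 2 * t - sqrt 2 * (t + d))) x"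
      by (rule heat_shift[symmetric])
    also have "\<dots> = heat d (\<lambda>y. G (y - sqrt 2 * d)) x" by (simp add: algebra_simps)
    finally show ?thesis using heat_girsanov[OF that, of "sqrt 2" x] by simp
  qed
  have ee: "ennreal (exp a) * (ennreal (exp b) * c) = ennreal (exp (a + b)) * c" for a b c
    by (simp add: exp_add ennreal_mult mult.assoc)
  show ?thesis
    using assms
  proof (induction r arbitrary: t x)
    case Nil
    note [measurable] = Nil(2)
    have "ennreal (exp (T - t)) * pexp t (x + sqrt 2 * t) (tilt ([] @ [(T, g)]))
        = heat (T - t) (\<lambda>y. ennreal (exp (- sqrt 2 * (y - x))) * g y) x"
      using step[OF Nil(2), of "T - t" t x] Nil(3) by simp
    also have "\<dots> = heat (T - t) (\<lambda>y. ennreal (exp (sqrt 2 * x)) * (ennreal (exp (- sqrt 2 * y)) * g y)) x"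
      unfolding ee by (simp add: algebra_simps)
    also have "\<dots> = ennreal (exp (sqrt 2 * x)) * heat (T - t) (\<lambda>y. ennreal (exp (- sqrt 2 * y)) * g y) x"
      by (rule heat_cmult) simp
    finally show ?case by simp
  next
    case (Cons sf r)
    obtain s f where sf: "sf = (s, f)" by force
    have f[measurable]: "f \<in> borel_measurable borel" and r: "borel_list r" and srt: "sorted (s # map fst r @ [T])" "t \<le> s"
      using Cons.prems by (auto simp: sf)
    note [measurable] = Cons.prems(2)
    let ?q = "r @ [(T, g)]" and ?q' = "r @ [(T, \<lambda>y. ennreal (exp (- sqrt 2 * y)) * g y)]"
    have q[measurable]: "(\<lambda>y. pexp s (y + sqrt 2 * s) (tilt ?q)) \<in> borel_measurable borel"
      "(\<lambda>y. pexp s y ?q') \<in> borel_measurable borel"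
      using r Cons.prems(2) by (auto intro!: pexp_measurable simp del: tilt_simps simp: tilt_simps(4))
    let ?G = "\<lambda>y. f y * pexp s (y + sqrt 2 * s) (tilt ?q)"
    have G[measurable]: "?G \<in> borel_measurable borel"
      by (rule borel_measurable_times_ennreal[OF f q(1)])
    have IH: "ennreal (exp (T - s)) * pexp s (y + sqrt 2 * s) (tilt ?q) = ennreal (exp (sqrt 2 * y)) * pexp s y ?q'" for y
      by (rule Cons.IH[OF r Cons.prems(2) srt(1)])
    have "ennreal (exp (T - t)) * pexp t (x + sqrt 2 * t) (tilt ((sf # r) @ [(T, g)]))
        = ennreal (exp (T - s)) * (ennreal (exp (s - t)) * heat (s - t) (\<lambda>y. ?G (y - sqrt 2 * (t + (s - t)))) (x + sqrt 2 * t))"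
      unfolding ee by (simp add: sf)
    also have "\<dots> = ennreal (exp (T - s)) * heat (s - t) (\<lambda>y. ennreal (exp (- sqrt 2 * (y - x))) * ?G y) x"
      using srt(2) step[OF G, of "s - t" t x] by (simp only:)
    also have "\<dots> = heat (s - t) (\<lambda>y. ennreal (exp (T - s)) * (ennreal (exp (- sqrt 2 * (y - x))) * ?G y)) x"
      by (rule heat_cmult[symmetric], rule borel_measurable_times_ennreal[OF _ G]) simp
    also have "\<dots> = heat (s - t) (\<lambda>y. ennreal (exp (sqrt 2 * x)) * (f y * pexp s y ?q')) x"
    proof (intro arg_cong[where f="\<lambda>F. heat (s - t) F x"] ext)
      fix y
      have "ennreal (exp (T - s)) * (ennreal (exp (- sqrt 2 * (y - x))) * ?G y)
          = ennreal (exp (- sqrt 2 * (y - x))) * (f y * (ennreal (exp (T - s)) * pexp s (y + sqrt 2 * s) (tilt ?q)))"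
        by (simp only: mult_ac)
      also have "\<dots> = ennreal (exp (- sqrt 2 * (y - x))) * (ennreal (exp (sqrt 2 * y)) * (f y * pexp s y ?q'))"
        unfolding IH by (simp only: mult_ac)
      also have "\<dots> = ennreal (exp (sqrt 2 * x)) * (f y * pexp s y ?q')"
        unfolding ee by (simp add: algebra_simps)
      finally show "ennreal (exp (T - s)) * (ennreal (exp (- sqrt 2 * (y - x))) * ?G y) = ennreal (exp (sqrt 2 * x)) * (f y * pexp s y ?q')" .
    qed
    also have "\<dots> = ennreal (exp (sqrt 2 * x)) * pexp t x ((sf # r) @ [(T, \<lambda>y. ennreal (exp (- sqrt 2 * y)) * g y)])"
      using heat_cmult[OF borel_measurable_times_ennreal[OF f q(2)]] by (simp add: sf)
    finally show ?case .
  qed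
qed

lemma pexp_tilt_steps:
  assumes f: "\<And>i. f i \<in> borel_measurable borel" and k: "s \<le> real (Suc k)" "k < n"
  shows "ennreal (exp (n - s)) * pexp s (x + sqrt 2 * s) (tilt (steps f k n))
    = ennreal (exp (sqrt 2 * x)) * pexp s x (steps f k n @ [(n, \<lambda>y. ennreal (exp (- sqrt 2 * y)))])"
proof -
  \<comment> \<open>A constant observation at the last time is appended to fit the form of
    \<open>pexp_tilt\<close>.\<close>
  have one: "pexp s z (r @ [(real n, \<lambda>_. 1)]) = pexp s z r" for s z and r :: "(real \<times> (real \<Rightarrow> ennreal)) list"
    by (induction r arbitrary: s z) auto
  have "sorted (map real [Suc k..<Suc n] @ [real n])"
    by (auto simp: sorted_append sorted_wrt_map simp del: upt_Suc intro!: sorted_wrt_mono_rel[OF _ sorted_wrt_upt])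
  then have srt: "sorted (s # map fst (steps f k n) @ [real n])"
    using k unfolding map_fst_steps by (auto simp del: upt_Suc)
  have "tilt (steps f k n @ [(real n, \<lambda>_. 1)]) = tilt (steps f k n) @ [(real n, \<lambda>_. 1)]" by simp
  then show ?thesis
    using pexp_tilt[OF borel_list_steps[OF f] _ srt, of "\<lambda>_. 1" x] one by simp
qed

text \<open>An upper barrier obeyed by \<open>\<bar>x\<bar>\<close> is obeyed by both
  \<open>x\<close> and \<open>- x\<close>, so the sign has to be resolved only in the final
  observable \<open>g\<close>, which may be arbitrary. Started at the origin, reflection thus costs
  a factor 2.\<close>

lemma pexp_abs_le:
  assumes "borel_list r" "g \<in> borel_measurable borel"
    and low: "\<And>s f x. (s, f) \<in> set r \<Longrightarrow> f \<bar>x\<bar> \<le> f x \<and> f \<bar>x\<bar> \<le> f (- x)"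
  shows "pexp t x (fold_list abs (r @ [(T, g)])) \<le> pexp t x (r @ [(T, g)]) + pexp t (- x) (r @ [(T, g)])"
  using assms(1,3)
proof (induction r arbitrary: t x)
  case Nil
  note [measurable] = assms(2)
  have "heat (T - t) (\<lambda>y. g \<bar>y\<bar>) x \<le> heat (T - t) (\<lambda>y. g y + g (- y)) x"
    by (intro heat_mono) (auto simp: abs_if)
  also have "\<dots> = heat (T - t) g x + heat (T - t) g (- x)"
    by (subst heat_add) (auto simp: heat_neg)
  finally show ?case by simp
next
  case (Cons sf r)
  obtain s f where sf: "sf = (s, f)" by force
  have f[measurable]: "f \<in> borel_measurable borel" and r: "borel_list r"
    using Cons.prems by (auto simp: sf)
  let ?P = "\<lambda>y. pexp s y (r @ [(T, g)])"
  have [measurable]: "?P \<in> borel_measurable borel" using r assms(2) by (intro pexp_measurable_snd) simp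
  have f2: "f \<bar>y\<bar> \<le> f y" "f \<bar>y\<bar> \<le> f (- y)" for y using Cons.prems(2)[of s f y] by (auto simp: sf)
  have "heat (s - t) (\<lambda>y. f \<bar>y\<bar> * pexp s y (fold_list abs (r @ [(T, g)]))) x
      \<le> heat (s - t) (\<lambda>y. f y * ?P y + f (- y) * ?P (- y)) x"
  proof (intro heat_mono)
    fix y
    have "f \<bar>y\<bar> * pexp s y (fold_list abs (r @ [(T, g)])) \<le> f \<bar>y\<bar> * (?P y + ?P (- y))"
      using Cons.prems r by (intro mult_left_mono Cons.IH) auto
    also have "\<dots> \<le> f y * ?P y + f (- y) * ?P (- y)"
      unfolding distrib_left by (intro add_mono mult_right_mono f2) auto
    finally show "f \<bar>y\<bar> * pexp s y (fold_list abs (r @ [(T, g)])) \<le> f y * ?P y + f (- y) * ?P (- y)" .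
  qed
  also have "\<dots> = heat (s - t) (\<lambda>y. f y * ?P y) x + heat (s - t) (\<lambda>y. f y * ?P y) (- x)"
    by (subst heat_add) (auto simp: heat_neg[of "\<lambda>y. f y * ?P y"])
  finally show ?case by (simp add: sf)
qed

text \<open>A maximal inequality without stopping times: \<open>V\<close> is a supersolution and is
  at least 1 where an observable vanishes, so induction along the list bounds the probability of
  ever meeting the forbidden set by \<open>V t x\<close>.\<close>

lemma pexp_hit:
  assumes r: "borel_list r" "sorted (t # map fst r)"
    and V: "\<And>s. V s \<in> borel_measurable borel" "\<And>s u x. t \<le> s \<Longrightarrow> s \<le> u \<Longrightarrow> u \<in> fst ` set r \<Longrightarrow> heat (u - s) (V u) x \<le> V s x"
    and f: "\<And>s f x. (s, f) \<in> set r \<Longrightarrow> 1 \<le> f x + V s x \<and> (f x = 0 \<or> f x = 1)"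
  shows "1 \<le> pexp t x r + V t x"
  using r V(2) f
proof (induction r arbitrary: t x)
  case Nil
  then show ?case by simp
next
  case (Cons sf r)
  obtain s f where sf: "sf = (s, f)" by force
  note [measurable] = V(1)
  have [measurable]: "f \<in> borel_measurable borel" and r: "borel_list r" "sorted (s # map fst r)" and ts: "t \<le> s"
    using Cons.prems by (auto simp: sf)
  have P[measurable]: "(\<lambda>y. pexp s y r) \<in> borel_measurable borel" using r by (intro pexp_measurable_snd)
  have IH: "1 \<le> pexp s y r + V s y" for y
  proof (rule Cons.IH[OF r])
    show "heat (u - s') (V u) x \<le> V s' x" if "s \<le> s'" "s' \<le> u" "u \<in> fst ` set r" for s' u x
      using Cons.prems(3)[of s' u x] that ts by (auto simp: sf)
    show "1 \<le> f x + V s' x \<and> (f x = 0 \<or> f x = 1)" if "(s', f) \<in> set r" for s' f x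
      using Cons.prems(4)[of s' f x] that by simp
  qed
  have "1 = heat (s - t) (\<lambda>_. 1) x" by simp
  also have "\<dots> \<le> heat (s - t) (\<lambda>y. f y * pexp s y r + V s y) x"
  proof (rule heat_mono)
    fix y
    have "1 \<le> f y + V s y" "f y = 0 \<or> f y = 1" using Cons.prems(4)[of s f y] by (auto simp: sf)
    then show "1 \<le> f y * pexp s y r + V s y" using IH[of y] by auto
  qed
  also have "\<dots> = pexp t x (sf # r) + heat (s - t) (V s) x"
    by (subst heat_add) (auto simp: sf)
  also have "\<dots> \<le> pexp t x (sf # r) + V t x"
    using Cons.prems(3)[of t s x] ts by (intro add_left_mono) (auto simp: sf)
  finally show ?case .
qed

section \<open>Genealogy and regularity of lineages\<close>

lemma finite_alive:
  "finite {w. birth_time l w \<le> t} \<Longrightarrow> finite (alive l t)"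
  by (rule finite_subset[rotated]) (auto simp: alive_def)

lemma birth_time_nonneg: "(\<And>v. 0 < l v) \<Longrightarrow> 0 \<le> birth_time l u"
  by (induction u) (auto intro: add_nonneg_nonneg less_imp_le)

lemma birth_time_suffix:
  assumes l: "\<And>v. 0 < l v" and "suffix v u" "v \<noteq> u"
  shows "birth_time l v + l v \<le> birth_time l u"
  using assms(2,3)
proof (induction u)
  case (Cons b u)
  then have v: "suffix v u" by (auto simp: suffix_Cons)
  show ?case
  proof (cases "v = u")
    case False
    then have "birth_time l v + l v \<le> birth_time l u" using Cons.IH v by blast
    then show ?thesis using l[of u] by simp
  qed simp
qed (auto simp: suffix_def)

text \<open>Otherwise the line of descent \<open>replicate k True @ v\<close> would produce
  infinitely many births up to time \<open>t\<close>.\<close>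

lemma alive_ex:
  assumes l: "\<And>v. 0 < l v" and fin: "finite {w. birth_time l w \<le> t}" and v: "birth_time l v \<le> t"
  shows "\<exists>u\<in>alive l t. suffix v u"
proof (rule ccontr)
  assume none: "\<not> (\<exists>u\<in>alive l t. suffix v u)"
  have "birth_time l (replicate k True @ v) \<le> t" for k
  proof (induction k)
    case (Suc k)
    have "replicate k True @ v \<notin> alive l t" using none by (auto simp: suffix_def)
    with Suc show ?case by (auto simp: alive_def)
  qed (use v in simp)
  then have "range (\<lambda>k. replicate k True @ v) \<subseteq> {w. birth_time l w \<le> t}" by auto
  then have "finite (range (\<lambda>k. replicate k True @ v))" using fin finite_subset by blast
  moreover have "inj (\<lambda>k. replicate k True @ v)" by (auto simp: inj_def)
  ultimately show False using finite_imageD by fastforce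
qed

lemma alive_ancestor_ex:
  assumes l: "\<And>v. 0 < l v" and u: "u \<in> alive l t'" and t: "0 \<le> t" "t \<le> t'"
  shows "\<exists>v\<in>alive l t. suffix v u"
proof -
  have "\<exists>v. suffix v u \<and> birth_time l v \<le> t \<and> t < birth_time l v + l v" if "t < birth_time l u + l u" for u
    using that
  proof (induction u)
    case (Cons b u)
    show ?case
    proof (cases "birth_time l (b # u) \<le> t")
      case False
      then have "t < birth_time l u + l u" by simp
      from Cons.IH[OF this] show ?thesis by (auto simp: suffix_Cons)
    qed (use Cons in auto)
  qed (use t in auto)
  moreover have "t < birth_time l u + l u" using u t by (auto simp: alive_def)
  ultimately show ?thesis unfolding alive_def by blast
qed

lemma path_ancestor:
  assumes l: "\<And>v. 0 < l v" and "suffix v u" "t < birth_time l v + l v"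
  shows "path \<rho> l w u t = path \<rho> l w v t"
  using assms(2)
proof (induction u)
  case (Cons b u)
  show ?case
  proof (cases "v = b # u")
    case False
    then have v: "suffix v u" using Cons by (auto simp: suffix_Cons)
    have "birth_time l v + l v \<le> birth_time l (b # u)"
      using birth_time_suffix[OF l Cons.prems False] .
    then show ?thesis using assms(3) Cons.IH[OF v] by (simp del: birth_time.simps)
  qed simp
qed (auto simp: suffix_def)

lemma position_eq_path:
  assumes l: "\<And>v. 0 < l v" and w: "\<And>v. w v 0 = 0" and "birth_time l u \<le> t"
  shows "position l w u t = path abs l w u t"
proof (cases u)
  case (Cons b v)
  have "position l w v t = path abs l w v t" if "birth_time l v \<le> t" for v t
    using that
  proof (induction v arbitrary: t)
    case (Cons c v)
    have "birth_time l v \<le> birth_time l (c # v)" using l[of v] by simp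
    with Cons show ?case by (simp del: birth_time.simps)
  qed simp
  with assms(3) show ?thesis by blast
qed simp

lemma path_abs_nonneg: "0 \<le> path abs l w u t"
  by (induction u arbitrary: t) auto

text \<open>Parent and child agree at the birth time because the motion of the child starts at 0 and
  the position of the parent is already folded.\<close>

lemma path_continuous:
  assumes \<rho>: "folding \<rho>" and l: "\<And>v. 0 < l v" and w: "\<And>v. w v 0 = 0" "\<And>v. continuous_on {0..} (w v)"
  shows "continuous_on {0..} (path \<rho> l w u)"
proof (induction u)
  case Nil
  have "continuous_on {0..} (\<lambda>t. \<rho> (w [] t))"
    using w(2)[of "[]"] \<rho> by (auto simp: folding_def intro!: continuous_intros)
  then show ?case by simp
next
  case (Cons b u)
  define \<tau> where "\<tau> = birth_time l (b # u)"
  have \<tau>: "0 \<le> \<tau>" unfolding \<tau>_def by (rule birth_time_nonneg[OF l])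
  have fix_path: "\<rho> (path \<rho> l w u t) = path \<rho> l w u t" for t
    using \<rho> path_abs_nonneg[of l w u t] by (auto simp: folding_def)
  have "continuous_on {\<tau>..} (\<lambda>t. path \<rho> l w u \<tau> + w (b # u) (t - \<tau>))"
    by (intro continuous_intros continuous_on_compose2[OF w(2)[of "b # u"]]) auto
  then have c2: "continuous_on {\<tau>..} (\<lambda>t. \<rho> (path \<rho> l w u \<tau> + w (b # u) (t - \<tau>)))"
    using \<rho> by (auto simp: folding_def intro!: continuous_intros)
  have c1: "continuous_on {0..\<tau>} (path \<rho> l w u)"
    using Cons by (rule continuous_on_subset) auto
  have "continuous_on ({0..\<tau>} \<union> {\<tau>..}) (\<lambda>t. if t \<le> \<tau> then path \<rho> l w u t else \<rho> (path \<rho> l w u \<tau> + w (b # u) (t - \<tau>)))"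
    by (rule continuous_on_If[where P="\<lambda>t. t \<le> \<tau>"]) (use c1 c2 w(1) fix_path in auto)
  moreover have "{0..\<tau>} \<union> {\<tau>..} = {0..}" using \<tau> by auto
  moreover have "(\<lambda>t. if t \<le> \<tau> then path \<rho> l w u t else \<rho> (path \<rho> l w u \<tau> + w (b # u) (t - \<tau>))) = path \<rho> l w (b # u)"
    using w(1) fix_path by (auto simp: \<tau>_def fun_eq_iff not_less simp del: birth_time.simps)
  ultimately show ?case by (simp only:)
qed

section \<open>First moment bounds\<close>

lemma path_cong:
  assumes "\<And>v s. 0 \<le> s \<Longrightarrow> w v s = w' v s" "\<And>v. 0 < l v" "0 \<le> t"
  shows "path \<rho> l w u t = path \<rho> l w' u t"
  using assms(3)
proof (induction u arbitrary: t)
  case (Cons b u)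
  have "0 \<le> birth_time l (b # u)" by (rule birth_time_nonneg) (rule assms(2))
  then show ?case using Cons assms(1) by (simp del: birth_time.simps)
qed (use assms in simp)

text \<open>From the origin, \<open>exp (sqrt 2 * x)\<close> and \<open>exp (- sqrt 2 * x)\<close>
  both have mean \<open>exp d\<close>.\<close>

lemma heat_le_exp_abs:
  assumes d: "0 \<le> d" and f: "\<And>x. f x \<le> ennreal (a * exp (sqrt 2 * \<bar>x\<bar>))" and a: "0 \<le> a"
  shows "heat d f 0 \<le> ennreal (2 * a * exp d)"
proof -
  have "heat d f 0 \<le> heat d (\<lambda>x. ennreal a * (ennreal (exp (sqrt 2 * x)) + ennreal (exp (- sqrt 2 * x)))) 0"
  proof (rule heat_mono)
    fix x :: real
    have "exp (sqrt 2 * \<bar>x\<bar>) \<le> exp (sqrt 2 * x) + exp (- sqrt 2 * x)"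
      by (cases "0 \<le> x") (auto simp: add_increasing add_increasing2)
    then have "a * exp (sqrt 2 * \<bar>x\<bar>) \<le> a * (exp (sqrt 2 * x) + exp (- sqrt 2 * x))"
      using a by (rule mult_left_mono)
    then show "f x \<le> ennreal a * (ennreal (exp (sqrt 2 * x)) + ennreal (exp (- sqrt 2 * x)))"
      using f[of x] a by (simp add: ennreal_mult[symmetric] ennreal_plus[symmetric] del: ennreal_plus) (meson ennreal_leI order.trans)
  qed
  also have "\<dots> = ennreal a * (ennreal (exp d) + ennreal (exp d))"
    using d heat_exp[OF d, of "sqrt 2" 0] heat_exp[OF d, of "- sqrt 2" 0] by (subst heat_cmult, simp) (simp add: heat_add)
  also have "\<dots> = ennreal (2 * a * exp d)"
    using a by (simp add: ennreal_mult[symmetric] ennreal_plus[symmetric] mult.assoc mult.left_commute del: ennreal_plus)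
  finally show ?thesis .
qed

text \<open>Dyadic times after \<open>n\<close> and up to \<open>n + 3\<close>. Each level refines
  the previous one, so the event of a hit increases with \<open>m\<close>.\<close>

definition grid :: "nat \<Rightarrow> nat \<Rightarrow> (real \<Rightarrow> ennreal) \<Rightarrow> (real \<times> (real \<Rightarrow> ennreal)) list" where
  "grid m n f = map (\<lambda>i. (real n + real i / 2 ^ m, f)) [1..<Suc (3 * 2 ^ m)]"

lemma borel_list_grid: "f \<in> borel_measurable borel \<Longrightarrow> borel_list (grid m n f)"
  by (auto simp: borel_list_def grid_def)

lemma sorted_grid: "sorted_wrt (<) (map fst (grid m n f))"
  unfolding grid_def map_map comp_def fst_conv sorted_wrt_map
  by (rule sorted_wrt_mono_rel[OF _ sorted_wrt_upt]) (simp add: divide_strict_right_mono)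

lemma set_grid: "x \<in> set (grid m n f) \<longleftrightarrow> (\<exists>i\<in>{1..3 * 2 ^ m}. x = (real n + real i / 2 ^ m, f))"
  by (auto simp: grid_def less_Suc_eq_le image_iff simp del: upt_Suc)

lemma fst_set_grid: 
  assumes "t \<in> fst ` set (grid m n f)"
  shows "real n < t \<and> t \<le> real n + 3"
proof -
  obtain i where i: "i \<in> {1..3 * 2 ^ m}" "t = real n + real i / 2 ^ m"
    using assms by (auto simp: set_grid)
  have "real i \<le> real (3 * 2 ^ m)" using i(1) by (intro of_nat_mono) simp
  then have "real i / 2 ^ m \<le> 3" by (simp add: divide_le_eq)
  then show ?thesis using i by simp
qed

text \<open>The indicator is evaluated at the point \<open>()\<close> of a set that is either
  everything or empty; it merely encodes a truth value as 1 or 0.\<close>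

lemma obs_grid:
  "obs p (grid m n (indicator J)) = indicator {x. \<forall>i\<in>{1..3 * 2 ^ m}. p (real n + real i / 2 ^ m) \<in> J} ()"
proof -
  have "obs p (map (\<lambda>i. (g i, indicator J)) xs) = (if \<forall>i\<in>set xs. p (g i) \<in> J then 1 else 0)" for g :: "nat \<Rightarrow> real" and xs
    by (induction xs) (auto simp: indicator_def)
  from this[of "\<lambda>i. real n + real i / 2 ^ m" "[1..<Suc (3 * 2 ^ m)]"] show ?thesis
    by (auto simp: grid_def indicator_def simp del: upt_Suc)
qed

text \<open>Dyadic approximations of \<open>t\<close> from above stay inside the grid, and by
  continuity they eventually fall into the open target.\<close>

lemma grid_dense:
  assumes c: "continuous_on {0..} p" and J: "open J" and t: "real n < t" "t \<le> real n + 3" "p t \<in> J"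
  shows "\<exists>m. \<exists>i\<in>{1..3 * 2 ^ m}. p (real n + real i / 2 ^ m) \<in> J"
proof -
  define i where "i m = nat \<lceil>2 ^ m * (t - real n)\<rceil>" for m :: nat
  define s where "s m = real n + real (i m) / 2 ^ m" for m
  have i1: "2 ^ m * (t - real n) \<le> real (i m)" "real (i m) \<le> 2 ^ m * (t - real n) + 1" for m
    using t(1) unfolding i_def by (auto simp: of_nat_nat)
  have i2: "i m \<in> {1..3 * 2 ^ m}" for m
  proof -
    have "0 < 2 ^ m * (t - real n)" using t by simp
    then have "1 \<le> i m" unfolding i_def by linarith
    have "2 ^ m * (t - real n) \<le> 2 ^ m * 3" using t by (intro mult_left_mono) auto
    then have "2 ^ m * (t - real n) \<le> real_of_int (3 * 2 ^ m)" by simp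
    then have "\<lceil>2 ^ m * (t - real n)\<rceil> \<le> 3 * 2 ^ m" by (simp only: ceiling_le_iff)
    then have "i m \<le> nat (3 * 2 ^ m)" unfolding i_def by (rule nat_mono)
    then have "i m \<le> 3 * 2 ^ m" by (simp add: nat_mult_distrib nat_power_eq)
    with \<open>1 \<le> i m\<close> show ?thesis by simp
  qed
  have "s \<longlonglongrightarrow> t"
  proof (rule tendsto_sandwich)
    have "t \<le> s m" for m using i1(1)[of m] by (simp add: s_def field_simps)
    then show "\<forall>\<^sub>F m in sequentially. t \<le> s m" by simp
    have "s m \<le> t + (1/2) ^ m" for m
      using divide_right_mono[OF i1(2)[of m], of "2 ^ m"] by (simp add: s_def add_divide_distrib power_one_over)
    then show "\<forall>\<^sub>F m in sequentially. s m \<le> t + (1/2) ^ m" by simp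
    have "(\<lambda>m. t + (1/2::real) ^ m) \<longlonglongrightarrow> t + 0"
      by (intro tendsto_add tendsto_const LIMSEQ_realpow_zero) auto
    then show "(\<lambda>m. t + (1/2::real) ^ m) \<longlonglongrightarrow> t" by simp
  qed simp
  then have "(\<lambda>m. p (s m)) \<longlonglongrightarrow> p t"
    using t unfolding s_def by (intro continuous_on_tendsto_compose[OF c]) auto
  from topological_tendstoD[OF this J t(3)] obtain m where "p (s m) \<in> J"
    by (auto simp: eventually_sequentially)
  then have "p (real n + real (i m) / 2 ^ m) \<in> J" by (simp add: s_def)
  then show ?thesis using i2[of m] by blast
qed

lemma count_space_measurable:
  fixes f :: "particle \<Rightarrow> 'b \<Rightarrow> ennreal"
  assumes [measurable]: "\<And>u. f u \<in> borel_measurable K"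
  shows "(\<lambda>\<omega>. \<integral>\<^sup>+u. f u \<omega> \<partial>count_space UNIV) \<in> borel_measurable K"
proof -
  have "bij_betw (from_nat_into (UNIV :: particle set)) UNIV UNIV"
    by (rule bij_betw_from_nat_into) (auto simp: infinite_UNIV_listI)
  from nn_integral_bij_count_space[OF this, symmetric] show ?thesis
    by (simp add: nn_integral_count_space_nat)
qed

section \<open>First moments, Borel-Cantelli and hitting between integer times\<close>

context branching_data
begin

abbreviation X :: "'a \<Rightarrow> particle \<Rightarrow> real \<Rightarrow> real" where
  "X \<omega> \<equiv> path abs (\<lambda>v. L v \<omega>) (\<lambda>v t. Wr v t \<omega>)"

abbreviation U :: "'a \<Rightarrow> particle \<Rightarrow> real \<Rightarrow> real" where
  "U \<omega> \<equiv> path (\<lambda>x. x) (\<lambda>v. L v \<omega>) (\<lambda>v t. Wr v t \<omega>)"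

abbreviation N :: "'a \<Rightarrow> real \<Rightarrow> particle set" where
  "N \<omega> t \<equiv> alive (\<lambda>v. L v \<omega>) t"

lemma path_meas:
  assumes "folding \<rho>" "\<theta> \<in> borel_measurable M"
  shows "(\<lambda>\<omega>. path \<rho> (\<lambda>v. L v \<omega>) (\<lambda>v t. Wr v t \<omega>) u (\<theta> \<omega>)) \<in> borel_measurable M"
proof (rule path_measurable[OF assms(1) _ _ assms(2)])
  have id: "(\<lambda>\<omega>. \<omega>) \<in> M \<rightarrow>\<^sub>M GA UNIV"
    using measurable_from_subalg[OF subalgebra_GA, of "\<lambda>\<omega>. \<omega>" UNIV "GA UNIV"] by simp
  show "(\<lambda>(t, \<omega>). Wr v t \<omega>) \<in> borel_measurable (borel \<Otimes>\<^sub>M M)" for v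
    by (rule Wr_pair_measurable[OF UNIV_I id])
qed simp

lemma X_meas [measurable]: "(\<lambda>\<omega>. X \<omega> u t) \<in> borel_measurable M"
  by (rule path_meas) (auto simp: folding_def)

lemma U_meas [measurable]: "(\<lambda>\<omega>. U \<omega> u t) \<in> borel_measurable M"
  by (rule path_meas) (auto simp: folding_def)

text \<open>Collects the almost sure path properties once, so that later arguments can be
  pathwise.\<close>

definition regular :: "'a \<Rightarrow> bool" where
  "regular \<omega> \<longleftrightarrow> (\<forall>u. 0 < L u \<omega>) \<and> (\<forall>u. Wr u 0 \<omega> = 0 \<and> W u 0 \<omega> = 0 \<and> continuous_on {0..} (\<lambda>t. Wr u t \<omega>))
    \<and> (\<forall>u t. 0 \<le> t \<longrightarrow> Wr u t \<omega> = W u t \<omega>) \<and> (\<forall>t. finite {w. birth_time (\<lambda>v. L v \<omega>) w \<le> t})"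

text \<open>The expected number of splittings up to time \<open>n\<close> is finite, which excludes
  explosion.\<close>

lemma AE_finite_births: "AE \<omega> in M. finite {w. birth_time (\<lambda>v. L v \<omega>) w \<le> real n}"
proof -
  have "(\<integral>\<^sup>+\<omega>. (\<integral>\<^sup>+w. indicator {..real n} (death w \<omega>) \<partial>count_space UNIV) \<partial>M)
      = (\<integral>\<^sup>+w. (\<integral>\<^sup>+\<omega>. indicator {..real n} (death w \<omega>) \<partial>M) \<partial>count_space UNIV)"
    by (rule nn_integral_count_space_nn_integral) auto
  also have "\<dots> = (\<integral>\<^sup>+s\<in>{0..}. ennreal (exp s) * indicator {..real n} s \<partial>lborel)"
    by (rule nn_integral_deaths) simp
  also have "\<dots> \<le> (\<integral>\<^sup>+s. ennreal (exp n) * indicator {0..real n} s \<partial>lborel)"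
    by (intro nn_integral_mono) (auto split: split_indicator)
  also have "\<dots> < \<infinity>" by (simp add: nn_integral_cmult ennreal_mult_less_top)
  finally have "AE \<omega> in M. (\<integral>\<^sup>+w. indicator {..real n} (death w \<omega>) \<partial>count_space UNIV) \<noteq> \<infinity>"
    by (intro nn_integral_PInf_AE) (auto simp: less_top[symmetric] intro!: count_space_measurable)
  then show ?thesis
  proof eventually_elim
    case (elim \<omega>)
    have "(\<integral>\<^sup>+w. indicator {..real n} (death w \<omega>) \<partial>count_space UNIV) = (\<integral>\<^sup>+w. indicator {w. death w \<omega> \<le> n} w \<partial>count_space UNIV)"
      by (intro nn_integral_cong) (auto split: split_indicator)
    then have "emeasure (count_space UNIV) {w. death w \<omega> \<le> n} \<noteq> \<infinity>" using elim by simp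
    then have fin: "finite {w. death w \<omega> \<le> n}" by (simp add: emeasure_count_space split: if_splits)
    have "{w. birth_time (\<lambda>v. L v \<omega>) w \<le> real n} \<subseteq> insert [] ((\<lambda>(b, w). b # w) ` (UNIV \<times> {w. death w \<omega> \<le> n}))"
    proof
      fix w assume "w \<in> {w. birth_time (\<lambda>v. L v \<omega>) w \<le> real n}"
      then show "w \<in> insert [] ((\<lambda>(b, w). b # w) ` (UNIV \<times> {w. death w \<omega> \<le> n}))"
        by (cases w) (auto simp: death_def image_iff)
    qed
    moreover have "finite (insert [] ((\<lambda>(b, w). b # w) ` (UNIV \<times> {w. death w \<omega> \<le> n})))"
      using fin by (intro finite.insertI finite_imageI finite_cartesian_product) auto
    ultimately show ?case by (rule finite_subset)
  qed
qed

lemma AE_regular': "AE \<omega> in M. regular \<omega>"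
proof -
  have "AE \<omega> in M. \<forall>n::nat. finite {w. birth_time (\<lambda>v. L v \<omega>) w \<le> real n}"
    using AE_finite_births by (simp add: AE_all_countable)
  with AE_regular show ?thesis
  proof eventually_elim
    case (elim \<omega>)
    have eq: "Wr u t \<omega> = W u t \<omega>" if "0 \<le> t" for u t using elim Wr_eq that by blast
    have "continuous_on {0..} (\<lambda>t. Wr u t \<omega>)" for u
      using elim eq by (subst continuous_on_cong[OF refl, of "{0..}" _ "\<lambda>t. W u t \<omega>"]) auto
    moreover have "finite {w. birth_time (\<lambda>v. L v \<omega>) w \<le> t}" for t
    proof (rule finite_subset)
      show "{w. birth_time (\<lambda>v. L v \<omega>) w \<le> t} \<subseteq> {w. birth_time (\<lambda>v. L v \<omega>) w \<le> real (nat \<lceil>t\<rceil>)}"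
        by (auto intro: order.trans[OF _ real_nat_ceiling_ge])
    qed (use elim in auto)
    ultimately show ?case using elim eq by (auto simp: regular_def)
  qed
qed

lemma regularD:
  assumes "regular \<omega>"
  shows "0 < L u \<omega>" "Wr u 0 \<omega> = 0" "continuous_on {0..} (\<lambda>t. Wr u t \<omega>)"
    "finite {w. birth_time (\<lambda>v. L v \<omega>) w \<le> t}" "finite (N \<omega> t)" "continuous_on {0..} (X \<omega> u)" "continuous_on {0..} (U \<omega> u)"
proof -
  show *: "0 < L u \<omega>" "Wr u 0 \<omega> = 0" "continuous_on {0..} (\<lambda>t. Wr u t \<omega>)" "finite {w. birth_time (\<lambda>v. L v \<omega>) w \<le> t}" for u t
    using assms by (auto simp: regular_def)
  then show "finite (N \<omega> t)" by (intro finite_alive)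
  show "continuous_on {0..} (X \<omega> u)" "continuous_on {0..} (U \<omega> u)"
    using * by (auto intro!: path_continuous simp: folding_def)
qed

lemma RBM_max_eq:
  assumes r: "regular \<omega>" and t: "0 \<le> t"
  shows "branching_RBM_max L W t \<omega> = Max ((\<lambda>u. X \<omega> u t) ` N \<omega> t)" and "N \<omega> t \<noteq> {}"
proof -
  have "position (\<lambda>u. L u \<omega>) (\<lambda>u s. W u s \<omega>) u t = X \<omega> u t" if "u \<in> N \<omega> t" for u
  proof -
    have "position (\<lambda>u. L u \<omega>) (\<lambda>u s. W u s \<omega>) u t = path abs (\<lambda>u. L u \<omega>) (\<lambda>u s. W u s \<omega>) u t"
      using r that by (intro position_eq_path) (auto simp: regular_def alive_def)
    also have "\<dots> = X \<omega> u t"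
      using r t by (intro path_cong) (auto simp: regular_def)
    finally show ?thesis .
  qed
  then show "branching_RBM_max L W t \<omega> = Max ((\<lambda>u. X \<omega> u t) ` N \<omega> t)"
    unfolding branching_RBM_max_def max_displacement_def by (intro arg_cong[where f=Max] image_cong) auto
  show "N \<omega> t \<noteq> {}"
    using alive_ex[of "\<lambda>v. L v \<omega>" t "[]"] regularD[OF r] t by auto
qed

lemma RBM_max_ge: "regular \<omega> \<Longrightarrow> 0 \<le> t \<Longrightarrow> u \<in> N \<omega> t \<Longrightarrow> X \<omega> u t \<le> branching_RBM_max L W t \<omega>"
  using RBM_max_eq[of \<omega> t] regularD(5)[of \<omega> t] by simp

lemma RBM_max_less: "regular \<omega> \<Longrightarrow> 0 \<le> t \<Longrightarrow> (\<And>u. u \<in> N \<omega> t \<Longrightarrow> X \<omega> u t < c) \<Longrightarrow> branching_RBM_max L W t \<omega> < c"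
  using RBM_max_eq[of \<omega> t] regularD(5)[of \<omega> t] by simp

lemma first_moment_event:
  fixes Y :: "particle \<Rightarrow> 'a \<Rightarrow> ennreal"
  assumes meas: "\<And>u. Y u \<in> borel_measurable M"
    and bound: "(\<integral>\<^sup>+u. (\<integral>\<^sup>+\<omega>. Y u \<omega> \<partial>M) \<partial>count_space UNIV) \<le> ennreal c" and c: "0 \<le> c"
  shows "{\<omega>\<in>space M. 1 \<le> (\<integral>\<^sup>+u. Y u \<omega> \<partial>count_space UNIV)} \<in> events"
    and "prob {\<omega>\<in>space M. 1 \<le> (\<integral>\<^sup>+u. Y u \<omega> \<partial>count_space UNIV)} \<le> c"
proof -
  define S where "S \<omega> = (\<integral>\<^sup>+u. Y u \<omega> \<partial>count_space UNIV)" for \<omega>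
  have S[measurable]: "S \<in> borel_measurable M"
    unfolding S_def by (intro count_space_measurable meas)
  show "{\<omega>\<in>space M. 1 \<le> (\<integral>\<^sup>+u. Y u \<omega> \<partial>count_space UNIV)} \<in> events"
    unfolding S_def[symmetric] by measurable
  have "emeasure M {\<omega>\<in>space M. 1 \<le> S \<omega>} \<le> 1 * (\<integral>\<^sup>+\<omega>. S \<omega> * indicator (space M) \<omega> \<partial>M)"
    using nn_integral_Markov_inequality[of S "space M" M 1] by simp
  also have "\<dots> = (\<integral>\<^sup>+\<omega>. S \<omega> \<partial>M)" by (auto intro!: nn_integral_cong)
  also have "\<dots> = (\<integral>\<^sup>+u. (\<integral>\<^sup>+\<omega>. Y u \<omega> \<partial>M) \<partial>count_space UNIV)"
    unfolding S_def by (rule nn_integral_count_space_nn_integral) (auto intro: meas)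
  also have "\<dots> \<le> ennreal c" by (rule bound)
  finally show "prob {\<omega>\<in>space M. 1 \<le> (\<integral>\<^sup>+u. Y u \<omega> \<partial>count_space UNIV)} \<le> c"
    using c unfolding S_def emeasure_eq_measure by simp
qed

lemma first_moment_none:
  fixes Y :: "particle \<Rightarrow> 'a \<Rightarrow> ennreal"
  assumes "\<not> 1 \<le> (\<integral>\<^sup>+u. Y u \<omega> \<partial>count_space UNIV)"
  shows "Y u \<omega> < 1"
proof -
  have "Y u \<omega> \<le> (\<integral>\<^sup>+u. Y u \<omega> \<partial>count_space UNIV)" by (rule nn_integral_ge_point) simp
  then show ?thesis using assms by (meson le_less_trans not_le)
qed

text \<open>Markov's inequality for the count and Borel-Cantelli. In applications \<open>Y\<close>
  takes the values 0 and 1, so \<open>Y n u \<omega> < 1\<close> says that no particle has the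
  property.\<close>

lemma AE_eventually_none:
  assumes meas: "\<And>n u. Y n u \<in> borel_measurable M"
    and bound: "\<forall>\<^sub>F n in sequentially. (\<integral>\<^sup>+u. (\<integral>\<^sup>+\<omega>. Y n u \<omega> \<partial>M) \<partial>count_space UNIV) \<le> ennreal (c n)"
    and c: "summable c" "\<And>n. 0 \<le> c n"
  shows "AE \<omega> in M. \<forall>\<^sub>F n in sequentially. \<forall>u :: particle. Y n u \<omega> < (1 :: ennreal)"
proof -
  define A where "A n = {\<omega>\<in>space M. 1 \<le> (\<integral>\<^sup>+u. Y n u \<omega> \<partial>count_space UNIV)}" for n
  have A: "A n \<in> sets M" for n
    unfolding A_def using count_space_measurable[of "Y n" M] meas by simp
  have "\<forall>\<^sub>F n in sequentially. norm (prob (A n)) \<le> c n"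
    using bound by eventually_elim (use first_moment_event(2)[OF meas _ c(2)] in \<open>simp add: A_def\<close>)
  then have "summable (\<lambda>n. prob (A n))"
    using c(1) by (rule summable_comparison_test_ev)
  then have "AE \<omega> in M. \<forall>\<^sub>F n in sequentially. \<omega> \<in> space M - A n"
    using A by (intro borel_cantelli_AE1) (auto simp: emeasure_eq_measure)
  then show ?thesis
    by eventually_elim (auto elim!: eventually_mono simp: A_def intro!: first_moment_none)
qed

text \<open>The factor \<open>1 - obs\<close> is not a product over times. The many-to-one formula
  is therefore applied to all particles weighted by \<open>g\<close> (\<open>A\<close>) and to those
  among them that never hit (\<open>B\<close>), and \<open>C\<close> is their difference; finiteness
  of \<open>A\<close> permits the cancellation.\<close>

lemma hit_moment:
  assumes \<rho>: "folding \<rho>" and T: "0 \<le> t" "t \<le> T"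
    and r: "borel_list r" "sorted_wrt (<) (t # map fst r)" "\<And>s f x. (s, f) \<in> set r \<Longrightarrow> f x = 0 \<or> f x = 1"
    and g[measurable]: "g \<in> borel_measurable borel" "\<And>x. g x \<le> 1"
    and V[measurable]: "V \<in> borel_measurable borel" "\<And>x. 1 \<le> pexp t x (fold_list \<rho> r) + V x"
  defines "p \<equiv> \<lambda>\<omega>. path \<rho> (\<lambda>v. L v \<omega>) (\<lambda>v t. Wr v t \<omega>)"
  shows "(\<integral>\<^sup>+u. (\<integral>\<^sup>+\<omega>. indicator (N \<omega> T) u * (g (p \<omega> u t) * (1 - obs (p \<omega> u) r)) \<partial>M) \<partial>count_space UNIV)
    \<le> ennreal (exp T) * heat t (\<lambda>x. g (\<rho> x) * V x) 0"
proof -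
  note [measurable] = folding_measurable[OF \<rho>] 
  have pm[measurable]: "(\<lambda>\<omega>. p \<omega> u s) \<in> borel_measurable M" for u s
    unfolding p_def by (rule path_meas[OF \<rho>]) simp
  have om[measurable]: "(\<lambda>\<omega>. obs (p \<omega> u) r) \<in> borel_measurable M" for u
    by (intro obs_measurable r pm)
  have o01: "obs q r = 0 \<or> obs q r = 1" for q
    using r(3)
  proof (induction r)
    case (Cons sf r)
    then have "obs q r = 0 \<or> obs q r = 1" by (metis list.set_intros(2))
    moreover have "snd sf (q (fst sf)) = 0 \<or> snd sf (q (fst sf)) = 1"
      using Cons.prems[of "fst sf" "snd sf"] by simp
    ultimately show ?case by (cases sf) auto
  qed simp
  have P[measurable]: "(\<lambda>x. pexp t x (fold_list \<rho> r)) \<in> borel_measurable borel"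
    by (intro pexp_measurable_snd borel_list_fold \<rho> r)
  define A where "A = (\<integral>\<^sup>+u. (\<integral>\<^sup>+\<omega>. indicator (N \<omega> T) u * g (p \<omega> u t) \<partial>M) \<partial>count_space UNIV)"
  define B where "B = (\<integral>\<^sup>+u. (\<integral>\<^sup>+\<omega>. indicator (N \<omega> T) u * (g (p \<omega> u t) * obs (p \<omega> u) r) \<partial>M) \<partial>count_space UNIV)"
  define C where "C = (\<integral>\<^sup>+u. (\<integral>\<^sup>+\<omega>. indicator (N \<omega> T) u * (g (p \<omega> u t) * (1 - obs (p \<omega> u) r)) \<partial>M) \<partial>count_space UNIV)"
  have "A = B + C"
  proof -
    have "A = (\<integral>\<^sup>+u. (\<integral>\<^sup>+\<omega>. indicator (N \<omega> T) u * (g (p \<omega> u t) * obs (p \<omega> u) r) + indicator (N \<omega> T) u * (g (p \<omega> u t) * (1 - obs (p \<omega> u) r)) \<partial>M) \<partial>count_space UNIV)"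
      unfolding A_def
    proof (intro nn_integral_cong)
      fix u \<omega>
      show "indicator (N \<omega> T) u * g (p \<omega> u t) = indicator (N \<omega> T) u * (g (p \<omega> u t) * obs (p \<omega> u) r) + indicator (N \<omega> T) u * (g (p \<omega> u t) * (1 - obs (p \<omega> u) r))"
        using o01[of "p \<omega> u"] by auto
    qed
    then show ?thesis unfolding B_def C_def by (simp add: nn_integral_add)
  qed
  have A: "A = ennreal (exp T) * heat t (\<lambda>x. g (\<rho> x)) 0"
    using many_to_one[OF \<rho>, of T "[(t, g)]"] T by (simp add: A_def p_def)
  have B: "B = ennreal (exp T) * heat t (\<lambda>x. g (\<rho> x) * pexp t x (fold_list \<rho> r)) 0"
    using many_to_one[OF \<rho>, of T "(t, g) # r"] T r by (force simp: B_def p_def)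
  have fin: "A < \<infinity>"
  proof -
    have "heat t (\<lambda>x. g (\<rho> x)) 0 \<le> heat t (\<lambda>_. 1) 0" by (intro heat_mono g)
    then show ?thesis unfolding A by (auto simp: ennreal_mult_less_top intro: le_less_trans)
  qed
  have "heat t (\<lambda>x. g (\<rho> x)) 0 \<le> heat t (\<lambda>x. g (\<rho> x) * pexp t x (fold_list \<rho> r) + g (\<rho> x) * V x) 0"
  proof (rule heat_mono)
    fix x
    show "g (\<rho> x) \<le> g (\<rho> x) * pexp t x (fold_list \<rho> r) + g (\<rho> x) * V x"
      using mult_left_mono[OF V(2)[of x], of "g (\<rho> x)"] by (simp add: distrib_left)
  qed
  also have "\<dots> = heat t (\<lambda>x. g (\<rho> x) * pexp t x (fold_list \<rho> r)) 0 + heat t (\<lambda>x. g (\<rho> x) * V x) 0"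
    by (rule heat_add) measurable
  finally have "A \<le> B + ennreal (exp T) * heat t (\<lambda>x. g (\<rho> x) * V x) 0"
    unfolding A B by (subst distrib_left[symmetric]) (rule mult_left_mono, auto)
  moreover have "B < \<infinity>" using fin \<open>A = B + C\<close> by auto
  ultimately have "C \<le> ennreal (exp T) * heat t (\<lambda>x. g (\<rho> x) * V x) 0"
    using \<open>A = B + C\<close> by (simp add: ennreal_add_left_cancel_le less_top[symmetric])
  then show ?thesis by (simp add: C_def)
qed

text \<open>Hits on the grid increase with the level \<open>m\<close>, so monotone convergence
  carries the bound, uniform in \<open>m\<close>, to the supremum; by continuity a path that meets
  the open set \<open>J n\<close> meets it at a dyadic time. Counting particles alive at
  \<open>n + 3\<close> makes their lineages cover the whole interval.\<close>

lemma AE_eventually_no_hit: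
  fixes I J :: "nat \<Rightarrow> real set" and V :: "nat \<Rightarrow> real \<Rightarrow> ennreal"
  assumes sets: "\<And>n. I n \<in> sets borel" "\<And>n. open (J n)" "\<And>n. I n \<inter> J n = {}"
    and V: "\<And>n. V n \<in> borel_measurable borel" "\<And>n m x. 1 \<le> pexp n x (fold_list abs (grid m n (indicator (- J n)))) + V n x"
    and bound: "\<forall>\<^sub>F n in sequentially. ennreal (exp (real n + 3)) * heat n (\<lambda>x. indicator (I n) \<bar>x\<bar> * V n x) 0 \<le> ennreal (c n)"
    and c: "summable c" "\<And>n. 0 \<le> c n"
  shows "AE \<omega> in M. \<forall>\<^sub>F n in sequentially. \<forall>u\<in>N \<omega> (real n + 3). X \<omega> u n \<in> I n \<longrightarrow> (\<forall>t\<in>{real n..real n + 3}. X \<omega> u t \<notin> J n)"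
proof -
  define Z where "Z n m u \<omega> = indicator (N \<omega> (real n + 3)) u * (indicator (I n) (X \<omega> u n) * (1 - obs (X \<omega> u) (grid m n (indicator (- J n)))))" for n m u \<omega>
  have Jm: "(indicator (- J n) :: real \<Rightarrow> ennreal) \<in> borel_measurable borel" for n
    using sets(2)[of n] by (auto intro!: borel_measurable_indicator)
  have om[measurable]: "(\<lambda>\<omega>. obs (X \<omega> u) (grid m n (indicator (- J n)))) \<in> borel_measurable M" for u m n
    by (intro obs_measurable borel_list_grid Jm X_meas)
  have Zm[measurable]: "Z n m u \<in> borel_measurable M" for n m u
    unfolding Z_def using sets(1)[of n] by measurable
  have inc: "incseq (\<lambda>m. Z n m u \<omega>)" for n u \<omega>
  proof (rule incseq_SucI)
    fix m
    have "obs (X \<omega> u) (grid (Suc m) n (indicator (- J n))) \<le> obs (X \<omega> u) (grid m n (indicator (- J n)))"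
    proof -
      have "X \<omega> u (real n + real i / 2 ^ m) \<in> - J n"
        if "\<forall>i\<in>{1..3 * 2 ^ Suc m}. X \<omega> u (real n + real i / 2 ^ Suc m) \<in> - J n" "i \<in> {1..3 * 2 ^ m}" for i
        using that(1)[rule_format, of "2 * i"] that(2) by simp
      then show ?thesis unfolding obs_grid by (auto simp: indicator_def)
    qed
    then show "Z n m u \<omega> \<le> Z n (Suc m) u \<omega>"
      unfolding Z_def by (intro mult_left_mono ennreal_minus_mono) auto
  qed
  have "AE \<omega> in M. \<forall>\<^sub>F n in sequentially. \<forall>u. (SUP m. Z n m u \<omega>) < (1 :: ennreal)"
  proof (rule AE_eventually_none[OF _ _ c])
    show "(\<lambda>\<omega>. SUP m. Z n m u \<omega>) \<in> borel_measurable M" for n u by measurable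
    have "(\<integral>\<^sup>+u. (\<integral>\<^sup>+\<omega>. (SUP m. Z n m u \<omega>) \<partial>M) \<partial>count_space UNIV)
        \<le> ennreal (exp (real n + 3)) * heat n (\<lambda>x. indicator (I n) \<bar>x\<bar> * V n x) 0" for n
    proof -
      have "(\<integral>\<^sup>+u. (\<integral>\<^sup>+\<omega>. (SUP m. Z n m u \<omega>) \<partial>M) \<partial>count_space UNIV)
          = (\<integral>\<^sup>+u. (SUP m. \<integral>\<^sup>+\<omega>. Z n m u \<omega> \<partial>M) \<partial>count_space UNIV)"
        using inc by (intro nn_integral_cong nn_integral_monotone_convergence_SUP) (auto simp: incseq_def le_fun_def)
      also have "\<dots> = (SUP m. (\<integral>\<^sup>+u. (\<integral>\<^sup>+\<omega>. Z n m u \<omega> \<partial>M) \<partial>count_space UNIV))"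
        using inc by (intro nn_integral_monotone_convergence_SUP) (auto simp: incseq_def le_fun_def intro!: nn_integral_mono)
      also have "\<dots> \<le> ennreal (exp (real n + 3)) * heat n (\<lambda>x. indicator (I n) \<bar>x\<bar> * V n x) 0"
      proof (rule SUP_least)
        fix m
        show "(\<integral>\<^sup>+u. (\<integral>\<^sup>+\<omega>. Z n m u \<omega> \<partial>M) \<partial>count_space UNIV) \<le> ennreal (exp (real n + 3)) * heat n (\<lambda>x. indicator (I n) \<bar>x\<bar> * V n x) 0"
          unfolding Z_def
        proof (rule hit_moment)
          show "sorted_wrt (<) (real n # map fst (grid m n (indicator (- J n))))"
            using sorted_grid fst_set_grid by auto
          show "f x = 0 \<or> f x = 1" if "(s, f) \<in> set (grid m n (indicator (- J n)))" for s f x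
            using that by (auto simp: set_grid indicator_def)
        qed (use V Jm sets(1)[of n] in \<open>auto simp: folding_def intro: borel_list_grid split: split_indicator\<close>)
      qed
      finally show ?thesis .
    qed
    then show "\<forall>\<^sub>F n in sequentially. (\<integral>\<^sup>+u. (\<integral>\<^sup>+\<omega>. (SUP m. Z n m u \<omega>) \<partial>M) \<partial>count_space UNIV) \<le> ennreal (c n)"
      using bound by (auto elim!: eventually_mono intro: order.trans)
  qed
  then show ?thesis
    using AE_regular'
  proof eventually_elim
    case (elim \<omega>)
    from elim(1) show ?case
    proof eventually_elim
      case (elim n)
      show ?case
      proof (intro ballI impI notI)
        fix u t assume u: "u \<in> N \<omega> (real n + 3)" "X \<omega> u n \<in> I n" and t: "t \<in> {real n..real n + 3}" "X \<omega> u t \<in> J n"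
        have "t \<noteq> real n" using u t sets(3)[of n] by auto
        then obtain m i where "i \<in> {1..3 * 2 ^ m}" "X \<omega> u (real n + real i / 2 ^ m) \<in> J n"
          using grid_dense[OF regularD(6)[OF \<open>regular \<omega>\<close>] sets(2), of n t u n] t by auto
        then have "obs (X \<omega> u) (grid m n (indicator (- J n))) = 0"
          unfolding obs_grid by (auto simp: indicator_def)
        then have "Z n m u \<omega> = 1" using u by (simp add: Z_def)
        moreover have "Z n m u \<omega> \<le> (SUP m. Z n m u \<omega>)" by (rule SUP_upper) simp
        ultimately show False using elim[rule_format, of u] by simp
      qed
    qed
  qed
qed

end

section \<open>Exponential supersolutions for fast moves\<close>

lemma heat_exp_affine:
  assumes "0 \<le> d"
  shows "heat d (\<lambda>y. ennreal (exp (c * y + k))) x = ennreal (exp (c * x + c\<^sup>2 * d / 2 + k))"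
proof -
  have "heat d (\<lambda>y. ennreal (exp k) * ennreal (exp (c * y))) x = ennreal (exp k) * ennreal (exp (c * x + c\<^sup>2 * d / 2))"
    by (subst heat_cmult) (auto simp: heat_exp assms)
  then show ?thesis by (simp add: ennreal_mult[symmetric] exp_add[symmetric] add_ac)
qed

text \<open>An exponential martingale and its mirror image are added because either sign of the
  underlying motion may cross the level. The term \<open>\<mu>\<^sup>2 * (n + 3 - s) / 2\<close> is
  nonnegative up to time \<open>n + 3\<close>, so the sum is at least 1 on crossing.\<close>

lemma rise_supersolution:
  fixes \<mu> c :: real
  assumes "0 \<le> \<mu>"
  shows "1 \<le> pexp n x (fold_list abs (grid m n (indicator (- {c<..}))))
    + ennreal (exp (\<mu>\<^sup>2 * 3 / 2 + \<mu> * (x - c)) + exp (\<mu>\<^sup>2 * 3 / 2 + \<mu> * (- x - c)))"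
proof -
  define V where "V s y = ennreal (exp (\<mu> * y + (\<mu>\<^sup>2 * (n + 3 - s) / 2 - \<mu> * c))) + ennreal (exp (- \<mu> * y + (\<mu>\<^sup>2 * (n + 3 - s) / 2 - \<mu> * c)))" for s y :: real
  have "1 \<le> pexp n x (fold_list abs (grid m n (indicator (- {c<..})))) + V n x"
  proof (rule pexp_hit)
    show "borel_list (fold_list abs (grid m n (indicator (- {c<..}))))"
      by (intro borel_list_fold borel_list_grid) (auto simp: folding_def)
    show "sorted (real n # map fst (fold_list abs (grid m n (indicator (- {c<..})))))"
      using strict_sorted_imp_sorted[OF sorted_grid] fst_set_grid by (force simp: less_imp_le)
    show "V s \<in> borel_measurable borel" for s unfolding V_def by measurable
    show "heat (u - s) (V u) x \<le> V s x" if "s \<le> u" for s u x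
    proof -
      have h: "heat (u - s) (\<lambda>y. ennreal (exp (a * y + (\<mu>\<^sup>2 * (n + 3 - u) / 2 - \<mu> * c)))) x = ennreal (exp (a * x + (\<mu>\<^sup>2 * (n + 3 - s) / 2 - \<mu> * c)))"
        if "a\<^sup>2 = \<mu>\<^sup>2" for a
        using \<open>s \<le> u\<close> that by (subst heat_exp_affine) (simp_all add: diff_divide_distrib add_divide_distrib algebra_simps)
      have "heat (u - s) (V u) x = V s x"
        unfolding V_def by (subst heat_add, simp, simp) (simp only: h power2_minus)
      then show ?thesis by simp
    qed
    fix s f y assume "(s, f) \<in> set (fold_list abs (grid m n (indicator (- {c<..}))))"
    then have "(s, indicator (- {c<..}) :: real \<Rightarrow> ennreal) \<in> set (grid m n (indicator (- {c<..})))" and f: "f = (\<lambda>x. indicator (- {c<..}) \<bar>x\<bar>)"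
      by (auto simp: fold_list_def set_grid)
    then have s: "s \<le> n + 3" using fst_set_grid[of s m n "indicator (- {c<..})"] by (force simp: image_iff)
    have "1 \<le> V s y" if "c < \<bar>y\<bar>"
    proof -
      have nn: "0 \<le> \<mu>\<^sup>2 * (n + 3 - s) / 2" using s by simp
      have "0 \<le> \<mu> * (\<bar>y\<bar> - c)" using that \<open>0 \<le> \<mu>\<close> by simp
      then have "1 \<le> exp (\<mu> * \<bar>y\<bar> + (\<mu>\<^sup>2 * (n + 3 - s) / 2 - \<mu> * c))"
        using nn unfolding right_diff_distrib one_le_exp_iff by linarith
      then show ?thesis
        unfolding V_def by (cases "0 \<le> y") (auto simp: add_increasing add_increasing2)
    qed
    then show "1 \<le> f y + V s y \<and> (f y = 0 \<or> f y = 1)"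
      unfolding f by (cases "c < \<bar>y\<bar>") auto
  qed
  moreover have "V n x = ennreal (exp (\<mu>\<^sup>2 * 3 / 2 + \<mu> * (x - c)) + exp (\<mu>\<^sup>2 * 3 / 2 + \<mu> * (- x - c)))"
    unfolding V_def by (subst ennreal_plus) (auto simp: algebra_simps)
  ultimately show ?thesis by simp
qed

text \<open>A single exponential is at least 1 on all of \<open>\<bar>y\<bar> < c\<close>, whichever
  its sign. Choosing the sign according to that of the starting point makes
  \<open>\<bar>x\<bar>\<close> appear.\<close>

lemma drop_supersolution:
  fixes \<mu> c :: real
  assumes \<mu>: "0 \<le> \<mu>"
  shows "1 \<le> pexp n x (fold_list abs (grid m n (indicator (- {..<c}))))
    + ennreal (exp (\<mu>\<^sup>2 * 3 / 2 - \<mu> * (\<bar>x\<bar> - c)))"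
proof -
  define V where "V \<sigma> s y = ennreal (exp (- (\<sigma> * \<mu>) * y + (\<mu>\<^sup>2 * (n + 3 - s) / 2 + \<mu> * c)))" for \<sigma> s y :: real
  have "1 \<le> pexp n x (fold_list abs (grid m n (indicator (- {..<c})))) + V \<sigma> n x" if \<sigma>: "\<sigma> = 1 \<or> \<sigma> = -1" for \<sigma>
  proof (rule pexp_hit)
    show "borel_list (fold_list abs (grid m n (indicator (- {..<c}))))"
      by (intro borel_list_fold borel_list_grid) (auto simp: folding_def)
    show "sorted (real n # map fst (fold_list abs (grid m n (indicator (- {..<c})))))"
      using strict_sorted_imp_sorted[OF sorted_grid] fst_set_grid by (force simp: less_imp_le)
    show "V \<sigma> s \<in> borel_measurable borel" for s unfolding V_def by measurable
    show "heat (u - s) (V \<sigma> u) x \<le> V \<sigma> s x" if "s \<le> u" for s u x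
    proof -
      have "(- (\<sigma> * \<mu>))\<^sup>2 = \<mu>\<^sup>2" using \<sigma> by auto
      then show ?thesis using that unfolding V_def by (subst heat_exp_affine) (auto simp: field_simps)
    qed
    fix s f y assume "(s, f) \<in> set (fold_list abs (grid m n (indicator (- {..<c}))))"
    then have "(s, indicator (- {..<c}) :: real \<Rightarrow> ennreal) \<in> set (grid m n (indicator (- {..<c})))" and f: "f = (\<lambda>x. indicator (- {..<c}) \<bar>x\<bar>)"
      by (auto simp: fold_list_def set_grid)
    then have s: "s \<le> n + 3" using fst_set_grid[of s m n "indicator (- {..<c})"] by (force simp: image_iff)
    have "1 \<le> V \<sigma> s y" if "\<bar>y\<bar> < c"
    proof -
      have nn: "0 \<le> \<mu>\<^sup>2 * (n + 3 - s) / 2" using s by simp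
      have "\<sigma> * y \<le> c" using that \<sigma> by auto
      then have "0 \<le> \<mu> * (c - \<sigma> * y)" using \<mu> by simp
      then have "0 \<le> - (\<sigma> * \<mu>) * y + (\<mu>\<^sup>2 * (n + 3 - s) / 2 + \<mu> * c)"
        using nn right_diff_distrib[of \<mu> c "\<sigma> * y"] by (simp only: mult.left_commute mult.commute[of \<sigma>] mult.assoc mult_minus_left)
      then show ?thesis unfolding V_def by simp
    qed
    then show "1 \<le> f y + V \<sigma> s y \<and> (f y = 0 \<or> f y = 1)"
      unfolding f by (cases "\<bar>y\<bar> < c") auto
  qed
  from this[of "if x < 0 then - 1 else 1"] show ?thesis
    unfolding V_def by (cases "x < 0") (auto simp: algebra_simps)
qed

section \<open>Barrier and ballot estimates at integer times\<close>

context branching_data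
begin

text \<open>The expected number of particles above \<open>sqrt 2 * n + 2 * ln n\<close> is at most
  \<open>2 * n powr (- 2 * sqrt 2)\<close>, hence summable; the random \<open>K\<close> absorbs the
  finitely many exceptional times.\<close>

lemma AE_barrier: "AE \<omega> in M. \<exists>K::nat. \<forall>n\<ge>1. \<forall>u\<in>N \<omega> (real n). X \<omega> u n \<le> sqrt 2 * n + 2 * ln n + K"
proof -
  let ?c = "\<lambda>n::nat. sqrt 2 * n + 2 * ln n"
  define Y where "Y n u \<omega> = indicator (N \<omega> (real n)) u * obs (X \<omega> u) [(real n, indicator {?c n<..})]" for n u \<omega>
  have "AE \<omega> in M. \<forall>\<^sub>F n in sequentially. \<forall>u. Y n u \<omega> < 1"
  proof (rule AE_eventually_none)
    show "Y n u \<in> borel_measurable M" for n u unfolding Y_def by simp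
    show "\<forall>\<^sub>F n in sequentially. (\<integral>\<^sup>+u. (\<integral>\<^sup>+\<omega>. Y n u \<omega> \<partial>M) \<partial>count_space UNIV) \<le> ennreal (2 * inverse (real n ^ 2))"
      using eventually_ge_at_top[of 1]
    proof eventually_elim
      case (elim n)
      have "(\<integral>\<^sup>+u. (\<integral>\<^sup>+\<omega>. Y n u \<omega> \<partial>M) \<partial>count_space UNIV) = ennreal (exp n) * heat n (\<lambda>x. indicator {?c n<..} \<bar>x\<bar>) 0"
        unfolding Y_def by (subst many_to_one) (auto simp: folding_def)
      also have "heat n (\<lambda>x. indicator {?c n<..} \<bar>x\<bar>) 0 \<le> ennreal (2 * exp (- sqrt 2 * ?c n) * exp n)"
      proof (rule heat_le_exp_abs)
        fix x :: real
        have "1 \<le> exp (- sqrt 2 * ?c n) * exp (sqrt 2 * \<bar>x\<bar>)" if "?c n < \<bar>x\<bar>"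
          using that by (simp add: exp_add[symmetric])
        then show "indicator {?c n<..} \<bar>x\<bar> \<le> ennreal (exp (- sqrt 2 * ?c n) * exp (sqrt 2 * \<bar>x\<bar>))"
          by (auto simp: indicator_def ennreal_1[symmetric] simp del: ennreal_1 intro!: ennreal_leI)
      qed auto
      also have "ennreal (exp n) * ennreal (2 * exp (- sqrt 2 * ?c n) * exp n) = ennreal (2 * exp (- 2 * sqrt 2 * ln n))"
        by (simp add: ennreal_mult[symmetric] exp_add[symmetric] algebra_simps)
      also have "\<dots> \<le> ennreal (2 * inverse (real n ^ 2))"
      proof (intro ennreal_leI mult_left_mono)
        have "- 2 * sqrt 2 * ln n \<le> - 2 * ln n"
          using elim mult_right_mono[of 1 "sqrt 2" "ln n"] by simp
        then have "exp (- 2 * sqrt 2 * ln n) \<le> exp (- 2 * ln n)" by simp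
        also have "\<dots> = real n powr - 2" using elim by (simp add: powr_def)
        also have "\<dots> = inverse (real n ^ 2)" using elim by (simp add: powr_minus powr_numeral)
        finally show "exp (- 2 * sqrt 2 * ln n) \<le> inverse (real n ^ 2)" .
      qed simp
      finally show ?case by (simp add: mult_left_mono)
    qed
    show "summable (\<lambda>n. 2 * inverse (real n ^ 2))"
      by (intro summable_mult inverse_power_summable) simp
  qed simp
  then show ?thesis
    using AE_regular'
  proof eventually_elim
    case (elim \<omega>)
    then obtain n0 where n0: "\<And>n u. n0 \<le> n \<Longrightarrow> Y n u \<omega> < 1"
      by (auto simp: eventually_sequentially)
    have "finite (\<Union>n<n0. (\<lambda>u. X \<omega> u n) ` N \<omega> (real n))"
      using regularD(5)[OF elim(2)] by auto
    then have "bdd_above (\<Union>n<n0. (\<lambda>u. X \<omega> u n) ` N \<omega> (real n))"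
      by (rule bdd_above_finite)
    then obtain B where B: "\<And>x. x \<in> (\<Union>n<n0. (\<lambda>u. X \<omega> u n) ` N \<omega> (real n)) \<Longrightarrow> x \<le> B"
      unfolding bdd_above_def by blast
    show ?case
    proof (intro exI[of _ "nat \<lceil>B\<rceil>"] allI impI ballI)
      fix n :: nat and u assume n: "1 \<le> n" and u: "u \<in> N \<omega> (real n)"
      have nn: "0 \<le> ln (real n)" using n by simp
      show "X \<omega> u n \<le> sqrt 2 * n + 2 * ln n + real (nat \<lceil>B\<rceil>)"
      proof (cases "n < n0")
        case True
        then have "X \<omega> u n \<le> B" using u by (intro B) auto
        also have "\<dots> \<le> real (nat \<lceil>B\<rceil>)" by (rule real_nat_ceiling_ge)
        finally show ?thesis using nn by (simp add: add_increasing)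
      next
        case False
        then have "Y n u \<omega> < 1" by (intro n0) simp
        then have "X \<omega> u n \<le> sqrt 2 * n + 2 * ln n"
          using u by (cases "sqrt 2 * n + 2 * ln n < X \<omega> u n") (auto simp: Y_def)
        then show ?thesis by simp
      qed
    qed
  qed
qed

definition below :: "real \<Rightarrow> real \<Rightarrow> nat \<Rightarrow> nat \<Rightarrow> real \<Rightarrow> ennreal" where
  "below H c n i = (if i < n then indicator {..H} else indicator {- c..H})"

lemma below_measurable [measurable]: "below H c n i \<in> borel_measurable borel"
  by (auto simp: below_def)

lemma tilt_steps_measurable: "(\<And>i. f i \<in> borel_measurable borel) \<Longrightarrow> borel_list (tilt (steps f k n))"
  by (intro tilt_simps borel_list_steps)

text \<open>200 is 2 from the reflection times 100 from the killed walk. The end window contributes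
  the weight \<open>exp (sqrt 2 * c)\<close>, its length \<open>H + c\<close> and the bound
  \<open>H + c + 1\<close> on the final depth; \<open>H + 1\<close> comes from the start.\<close>

lemma ballot_moment:
  assumes n: "3 \<le> n" and H: "0 \<le> H" "0 \<le> c"
  shows "(\<integral>\<^sup>+u. (\<integral>\<^sup>+\<omega>. indicator (N \<omega> (real n)) u * obs (X \<omega> u) (tilt (steps (below H c n) 0 n)) \<partial>M) \<partial>count_space UNIV)
    \<le> ennreal (200 * exp (sqrt 2 * c) * (H + 1) * (H + c) * (H + c + 1) / (n * sqrt n))"
proof -
  let ?f = "below H c n"
  \<comment> \<open>The two-sided window at time \<open>n\<close>, unlike the barriers before it, is
    not inherited by the negative sign, so it is split off as the final observable of
    \<open>pexp_abs_le\<close>.\<close>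
  have steps_n: "steps ?f 0 n = steps ?f 0 (n - 1) @ [(real n, ?f n)]"
    using steps_append[of 0 "n - 1" n ?f] n by (simp add: steps_Cons)
  have "(\<integral>\<^sup>+u. (\<integral>\<^sup>+\<omega>. indicator (N \<omega> (real n)) u * obs (X \<omega> u) (tilt (steps ?f 0 n)) \<partial>M) \<partial>count_space UNIV)
      = ennreal (exp n) * pexp 0 0 (fold_list abs (tilt (steps ?f 0 n)))"
    by (rule many_to_one)
      (auto simp: folding_def sorted_steps fst_set_steps intro!: tilt_steps_measurable)
  also have "\<dots> \<le> ennreal (exp n) * (2 * pexp 0 0 (tilt (steps ?f 0 n)))"
  proof (rule mult_left_mono)
    have "pexp 0 0 (fold_list abs (tilt (steps ?f 0 n))) \<le> pexp 0 0 (tilt (steps ?f 0 n)) + pexp 0 (- 0) (tilt (steps ?f 0 n))"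
      unfolding steps_n tilt_simps
    proof (rule pexp_abs_le)
      fix s g x assume "(s, g) \<in> set (tilt (steps ?f 0 (n - 1)))"
      then have "\<exists>i\<in>{1..<Suc (n - 1)}. g = (\<lambda>x. ?f i (x - sqrt 2 * i))"
        by (auto simp: steps_def tilt_def simp del: upt_Suc)
      then obtain i where "i < n" "g = (\<lambda>x. ?f i (x - sqrt 2 * i))" using n by fastforce
      then show "g \<bar>x\<bar> \<le> g x \<and> g \<bar>x\<bar> \<le> g (- x)" by (auto simp: below_def indicator_def)
    qed (auto intro!: tilt_steps_measurable)
    then show "pexp 0 0 (fold_list abs (tilt (steps ?f 0 n))) \<le> 2 * pexp 0 0 (tilt (steps ?f 0 n))"
      by (simp add: mult_2)
  qed simp
  also have "\<dots> = 2 * (ennreal (exp n) * pexp 0 0 (tilt (steps ?f 0 n)))"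
    by (rule mult.left_commute)
  also have "\<dots> \<le> 2 * (ennreal (100 * (H + 1) / (n * sqrt n)) * ennreal (exp (sqrt 2 * c) * (H + c + 1) * (H + c)))"
  proof (rule mult_left_mono)
    let ?g = "\<lambda>y. ennreal (exp (sqrt 2 * c)) * indicator {- c..H} y"
    have "ennreal (exp n) * pexp 0 0 (tilt (steps ?f 0 n)) = pexp (real 0) 0 (steps ?f 0 n @ [(n, \<lambda>y. ennreal (exp (- sqrt 2 * y)))])"
      using pexp_tilt_steps[where f="below H c n" and s=0 and k=0 and n=n and x=0] n by simp
    also have "\<dots> \<le> (kill H ^^ (n - 0)) ?g 0"
    proof (rule pexp_steps_le_kill)
      show "?f n y * pexp n y [(n, \<lambda>y. ennreal (exp (- sqrt 2 * y)))] \<le> indicator {..H} y * ?g y" for y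
        using mult_left_mono[of "- c" y "sqrt 2"] by (auto simp: below_def indicator_def intro!: ennreal_leI)
    qed (use n in \<open>auto simp: below_def\<close>)
    also have "(kill H ^^ (n - 0)) ?g 0 = (kill H ^^ n) ?g 0" by simp
    also have "\<dots> \<le> ennreal (100 * (H - 0 + 1) / (n * sqrt n)) * (\<integral>\<^sup>+y\<in>{..H}. ?g y * ennreal (H - y + 1) \<partial>lborel)"
      by (rule kill_pow_le) (simp_all add: n H)
    also have "\<dots> \<le> ennreal (100 * (H + 1) / (n * sqrt n)) * ennreal (exp (sqrt 2 * c) * (H + c + 1) * (H + c))"
      unfolding diff_zero
    proof (rule mult_left_mono)
      have "(\<integral>\<^sup>+y\<in>{..H}. ?g y * ennreal (H - y + 1) \<partial>lborel) \<le> (\<integral>\<^sup>+y. ennreal (exp (sqrt 2 * c) * (H + c + 1)) * indicator {- c..H} y \<partial>lborel)"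
      proof (rule nn_integral_mono)
        fix y
        show "?g y * ennreal (H - y + 1) * indicator {..H} y \<le> ennreal (exp (sqrt 2 * c) * (H + c + 1)) * indicator {- c..H} y"
        proof (cases "- c \<le> y \<and> y \<le> H")
          case True
          then have "ennreal (exp (sqrt 2 * c)) * ennreal (H - y + 1) \<le> ennreal (exp (sqrt 2 * c) * (H + c + 1))"
            by (subst ennreal_mult[symmetric]) (auto intro!: ennreal_leI)
          with True show ?thesis by simp
        qed auto
      qed
      also have "\<dots> = ennreal (exp (sqrt 2 * c) * (H + c + 1)) * ennreal (H + c)"
        using H by (simp add: nn_integral_cmult)
      also have "\<dots> = ennreal (exp (sqrt 2 * c) * (H + c + 1) * (H + c))"
        using H by (intro ennreal_mult[symmetric]) auto
      finally show "(\<integral>\<^sup>+y\<in>{..H}. ?g y * ennreal (H - y + 1) \<partial>lborel) \<le> ennreal (exp (sqrt 2 * c) * (H + c + 1) * (H + c))" .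
    qed simp
    finally show "ennreal (exp n) * pexp 0 0 (tilt (steps ?f 0 n))
        \<le> ennreal (100 * (H + 1) / (n * sqrt n)) * ennreal (exp (sqrt 2 * c) * (H + c + 1) * (H + c))" .
  qed simp
  also have "\<dots> = ennreal (2 * (100 * (H + 1) / (n * sqrt n) * (exp (sqrt 2 * c) * (H + c + 1) * (H + c))))"
    using H by (subst ennreal_mult[symmetric], simp, simp, subst ennreal_mult) auto
  also have "2 * (100 * (H + 1) / (n * sqrt n) * (exp (sqrt 2 * c) * (H + c + 1) * (H + c)))
      = 200 * exp (sqrt 2 * c) * (H + 1) * (H + c) * (H + c + 1) / (n * sqrt n)"
    by simp
  finally show ?thesis .
qed

lemma obs_below:
  assumes "1 \<le> n" "\<And>i. 1 \<le> i \<Longrightarrow> i \<le> n \<Longrightarrow> p (real i) \<le> sqrt 2 * i + H" "sqrt 2 * n - c \<le> p (real n)"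
  shows "obs p (tilt (steps (below H c n) 0 n)) = 1"
proof -
  have "obs p (tilt (steps (below H c n) k n)) = 1" for k
  proof (induction "n - k" arbitrary: k)
    case (Suc d)
    then have k: "k < n" by simp
    then have "obs p (tilt (steps (below H c n) (Suc k) n)) = 1" using Suc by (intro Suc.hyps) auto
    then show ?case using k assms(2)[of "Suc k"] assms(3)
      by (cases "Suc k = n") (auto simp: steps_Cons below_def indicator_def)
  qed simp
  then show ?thesis .
qed

text \<open>The cubic polynomial in \<open>ln n\<close> is absorbed into an arbitrarily small power
  \<open>n powr d\<close>.\<close>

lemma ballot_bound:
  assumes a: "0 < a" and d: "0 < d"
  shows "\<forall>\<^sub>F n::nat in sequentially. (\<integral>\<^sup>+u. (\<integral>\<^sup>+\<omega>. indicator (N \<omega> (real n)) u * obs (X \<omega> u) (tilt (steps (below (2 * ln n + K) (a * ln n) n) 0 n)) \<partial>M) \<partial>count_space UNIV)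
    \<le> ennreal (real n powr (sqrt 2 * a - 3 / 2 + d))"
proof -
  define C where "C = \<bar>K\<bar> + a + 3"
  have "\<forall>\<^sub>F n::nat in sequentially. 200 * C ^ 3 * ln (real n) ^ 3 \<le> real n powr d"
    using d by real_asymp
  moreover have "\<forall>\<^sub>F n::nat in sequentially. \<bar>K\<bar> + 1 \<le> ln (real n)" by real_asymp
  ultimately show ?thesis
    using eventually_ge_at_top[of 3]
  proof eventually_elim
    case (elim n)
    let ?l = "ln (real n)"
    have l1: "1 \<le> ?l" using elim by linarith
    have KL: "\<bar>K\<bar> \<le> \<bar>K\<bar> * ?l" using l1 by (simp add: mult_le_cancel_left1)
    have H: "0 \<le> 2 * ?l + K" "0 \<le> a * ?l" using elim a by (auto intro: mult_nonneg_nonneg)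
    have al: "0 \<le> a * ?l" by fact
    have 1: "2 * ?l + K + 1 \<le> C * ?l" "2 * ?l + K + a * ?l \<le> C * ?l" "2 * ?l + K + a * ?l + 1 \<le> C * ?l"
      using l1 KL al unfolding C_def by (simp_all add: distrib_right)
    have pow: "exp (sqrt 2 * (a * ?l)) / (n * sqrt n) = real n powr (sqrt 2 * a - 3 / 2)"
    proof -
      have "real n * sqrt n = real n powr (3 / 2)"
        using elim by (simp add: powr_half_sqrt[symmetric] powr_mult_base)
      moreover have "exp (sqrt 2 * (a * ?l)) = real n powr (sqrt 2 * a)"
        using elim by (simp add: powr_def mult.assoc)
      ultimately show ?thesis by (simp add: powr_diff)
    qed
    have "200 * exp (sqrt 2 * (a * ?l)) * (2 * ?l + K + 1) * (2 * ?l + K + a * ?l) * (2 * ?l + K + a * ?l + 1) / (n * sqrt n)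
        = real n powr (sqrt 2 * a - 3 / 2) * (200 * ((2 * ?l + K + 1) * (2 * ?l + K + a * ?l) * (2 * ?l + K + a * ?l + 1)))"
      unfolding pow[symmetric] by simp
    also have "\<dots> \<le> real n powr (sqrt 2 * a - 3 / 2) * (200 * ((C * ?l) * (C * ?l) * (C * ?l)))"
      using H 1 l1 by (intro mult_left_mono mult_mono) (auto simp: C_def intro!: mult_nonneg_nonneg)
    also have "\<dots> \<le> real n powr (sqrt 2 * a - 3 / 2) * real n powr d"
      using elim(1) by (intro mult_left_mono) (auto simp: power3_eq_cube mult_ac)
    also have "\<dots> = real n powr (sqrt 2 * a - 3 / 2 + d)" by (simp add: powr_add)
    finally show ?case
      using ballot_moment[of n "2 * ?l + K" "a * ?l"] H elim by (meson ennreal_leI order.trans)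
  qed
qed

text \<open>At each earlier time \<open>i\<close> the ancestor of \<open>u\<close> obeys the almost
  sure barrier, and \<open>ln i \<le> ln n\<close>; a high \<open>u\<close> would therefore be among
  the counted particles.\<close>

lemma below_violation:
  assumes r: "regular \<omega>" and K: "\<And>n u. 1 \<le> n \<Longrightarrow> u \<in> N \<omega> (real n) \<Longrightarrow> X \<omega> u n \<le> sqrt 2 * n + 2 * ln n + K"
    and n: "1 \<le> n" and u: "u \<in> N \<omega> (real n)" and Y: "indicator (N \<omega> (real n)) u * obs (X \<omega> u) (tilt (steps (below (2 * ln n + K) c n) 0 n)) < (1 :: ennreal)"
  shows "X \<omega> u n < sqrt 2 * n - c"
proof (rule ccontr)
  assume "\<not> X \<omega> u n < sqrt 2 * n - c"
  moreover have "X \<omega> u i \<le> sqrt 2 * i + (2 * ln n + K)" if i: "1 \<le> i" "i \<le> n" for i :: nat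
  proof -
    obtain v where v: "v \<in> N \<omega> (real i)" "suffix v u"
      using alive_ancestor_ex[OF regularD(1)[OF r] u, of "real i"] i by auto
    then have "X \<omega> u i = X \<omega> v i"
      using regularD(1)[OF r] by (intro path_ancestor) (auto simp: alive_def)
    also have "\<dots> \<le> sqrt 2 * i + 2 * ln i + K" using i v by (intro K) auto
    also have "\<dots> \<le> sqrt 2 * i + (2 * ln n + K)" using i by simp
    finally show ?thesis .
  qed
  ultimately have "obs (X \<omega> u) (tilt (steps (below (2 * ln n + K) c n) 0 n)) = 1"
    using n by (intro obs_below) auto
  then show False using Y u by simp
qed

lemma AE_upper_integer:
  assumes a: "0 < a" "a < 1 / (2 * sqrt 2)"
  shows "AE \<omega> in M. \<forall>\<^sub>F n in sequentially. \<forall>u\<in>N \<omega> (real n). X \<omega> u n < sqrt 2 * n - a * ln n"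
proof -
  \<comment> \<open>Half of the gap to the critical coefficient pays for the powers of
    \<open>ln n\<close>; the other half leaves the summable exponent \<open>- 1 - d\<close>.\<close>
  define d where "d = (1 / 2 - sqrt 2 * a) / 2"
  have "sqrt 2 * a < sqrt 2 * (1 / (2 * sqrt 2))" using a by (intro mult_strict_left_mono) auto
  then have d: "0 < d" by (simp add: d_def)
  have e: "sqrt 2 * a - 3 / 2 + d = - 1 - d" by (simp add: d_def field_simps)
  have "AE \<omega> in M. \<forall>K::nat. \<forall>\<^sub>F n in sequentially. \<forall>u. indicator (N \<omega> (real n)) u * obs (X \<omega> u) (tilt (steps (below (2 * ln n + K) (a * ln n) n) 0 n)) < (1 :: ennreal)"
    unfolding AE_all_countable
  proof (intro allI AE_eventually_none)
    fix K n :: nat and u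
    show "(\<lambda>\<omega>. indicator (N \<omega> (real n)) u * obs (X \<omega> u) (tilt (steps (below (2 * ln n + K) (a * ln n) n) 0 n))) \<in> borel_measurable M"
      by (intro borel_measurable_times_ennreal alive_meas obs_measurable X_meas tilt_steps_measurable) simp
    show "\<forall>\<^sub>F n in sequentially. (\<integral>\<^sup>+u. (\<integral>\<^sup>+\<omega>. indicator (N \<omega> (real n)) u * obs (X \<omega> u) (tilt (steps (below (2 * ln n + K) (a * ln n) n) 0 n)) \<partial>M) \<partial>count_space UNIV)
      \<le> ennreal (real n powr (- 1 - d))"
      using ballot_bound[OF a(1) d, of K] by (simp only: e)
    show "summable (\<lambda>n. real n powr (- 1 - d))"
      using d by (subst summable_real_powr_iff) simp
  qed simp
  then show ?thesis
    using AE_barrier AE_regular'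
  proof eventually_elim
    case (elim \<omega>)
    from elim(2) obtain K :: nat where K: "\<And>n u. 1 \<le> n \<Longrightarrow> u \<in> N \<omega> (real n) \<Longrightarrow> X \<omega> u n \<le> sqrt 2 * n + 2 * ln n + K" by blast
    have "\<forall>\<^sub>F n in sequentially. \<forall>u. indicator (N \<omega> (real n)) u * obs (X \<omega> u) (tilt (steps (below (2 * ln n + K) (a * ln n) n) 0 n)) < (1 :: ennreal)"
      using elim(1) by blast
    then show ?case
      using eventually_ge_at_top[of 1]
      by eventually_elim (auto intro!: below_violation[OF elim(3) K])
  qed
qed

lemma AE_frequently_not:
  assumes A: "\<And>n. A n \<in> events" and lim: "(\<lambda>n. prob (A n)) \<longlonglongrightarrow> 0"
  shows "AE \<omega> in M. \<exists>\<^sub>F n in sequentially. \<omega> \<notin> A n"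
proof -
  have "(\<Inter>n\<in>{m..}. A n) \<in> null_sets M" for m
  proof -
    have s: "(\<Inter>n\<in>{m..}. A n) \<in> events" by (rule sets.countable_INT') (auto intro: A)
    have "prob (\<Inter>n\<in>{m..}. A n) \<le> 0"
    proof (rule tendsto_lowerbound[OF lim])
      show "\<forall>\<^sub>F n in sequentially. prob (\<Inter>n\<in>{m..}. A n) \<le> prob (A n)"
        using eventually_ge_at_top[of m] by eventually_elim (intro finite_measure_mono A, auto)
    qed simp
    then show ?thesis using s by (simp add: emeasure_eq_measure null_sets_def measure_nonneg order.antisym)
  qed
  then have "(\<Union>m. \<Inter>n\<in>{m..}. A n) \<in> null_sets M" by auto
  then have "AE \<omega> in M. \<omega> \<notin> (\<Union>m. \<Inter>n\<in>{m..}. A n)" by (rule AE_not_in)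
  then show ?thesis
    by eventually_elim (auto simp: frequently_def eventually_sequentially)
qed

lemma AE_frequently_none:
  assumes meas: "\<And>n u. Y n u \<in> borel_measurable M"
    and bound: "\<forall>\<^sub>F n in sequentially. (\<integral>\<^sup>+u. (\<integral>\<^sup>+\<omega>. Y n u \<omega> \<partial>M) \<partial>count_space UNIV) \<le> ennreal (c n)"
    and c: "c \<longlonglongrightarrow> 0" "\<And>n. 0 \<le> c n"
  shows "AE \<omega> in M. \<exists>\<^sub>F n in sequentially. \<forall>u :: particle. Y n u \<omega> < (1 :: ennreal)"
proof -
  define A where "A n = {\<omega>\<in>space M. 1 \<le> (\<integral>\<^sup>+u. Y n u \<omega> \<partial>count_space UNIV)}" for n
  have A: "A n \<in> sets M" for n
    unfolding A_def using count_space_measurable[of "Y n" M] meas by simp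
  have "(\<lambda>n. prob (A n)) \<longlonglongrightarrow> 0"
  proof (rule tendsto_sandwich[OF _ _ tendsto_const c(1)])
    show "\<forall>\<^sub>F n in sequentially. prob (A n) \<le> c n"
      using bound by eventually_elim (use first_moment_event(2)[OF meas _ c(2)] in \<open>simp add: A_def\<close>)
  qed simp
  from AE_frequently_not[OF A this] AE_space show ?thesis
    by eventually_elim (auto elim!: frequently_elim1 simp: A_def intro!: first_moment_none)
qed

text \<open>In this larger range of \<open>a\<close> the first moment still tends to 0 but need not
  be summable, so the conclusion holds for infinitely many \<open>n\<close> instead of almost
  all.\<close>

lemma AE_lower_liminf:
  assumes a: "0 < a" "a < 3 / (2 * sqrt 2)"
  shows "AE \<omega> in M. \<exists>\<^sub>F n in sequentially. \<forall>u\<in>N \<omega> (real n). X \<omega> u n < sqrt 2 * n - a * ln n"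
proof -
  define d where "d = (3 / 2 - sqrt 2 * a) / 2"
  have "sqrt 2 * a < sqrt 2 * (3 / (2 * sqrt 2))" using a by (intro mult_strict_left_mono) auto
  then have d: "0 < d" by (simp add: d_def)
  have e: "sqrt 2 * a - 3 / 2 + d = - d" by (simp add: d_def field_simps)
  have "AE \<omega> in M. \<forall>K::nat. \<exists>\<^sub>F n in sequentially. \<forall>u. indicator (N \<omega> (real n)) u * obs (X \<omega> u) (tilt (steps (below (2 * ln n + K) (a * ln n) n) 0 n)) < (1 :: ennreal)"
    unfolding AE_all_countable
  proof (intro allI AE_frequently_none)
    fix K n :: nat and u
    show "(\<lambda>\<omega>. indicator (N \<omega> (real n)) u * obs (X \<omega> u) (tilt (steps (below (2 * ln n + K) (a * ln n) n) 0 n))) \<in> borel_measurable M"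
      by (intro borel_measurable_times_ennreal alive_meas obs_measurable X_meas tilt_steps_measurable) simp
    show "\<forall>\<^sub>F n in sequentially. (\<integral>\<^sup>+u. (\<integral>\<^sup>+\<omega>. indicator (N \<omega> (real n)) u * obs (X \<omega> u) (tilt (steps (below (2 * ln n + K) (a * ln n) n) 0 n)) \<partial>M) \<partial>count_space UNIV)
      \<le> ennreal (real n powr (- d))"
      using ballot_bound[OF a(1) d, of K] by (simp only: e)
    show "(\<lambda>n. real n powr (- d)) \<longlonglongrightarrow> 0"
      using d by real_asymp
  qed simp
  then show ?thesis
    using AE_barrier AE_regular'
  proof eventually_elim
    case (elim \<omega>)
    from elim(2) obtain K :: nat where K: "\<And>n u. 1 \<le> n \<Longrightarrow> u \<in> N \<omega> (real n) \<Longrightarrow> X \<omega> u n \<le> sqrt 2 * n + 2 * ln n + K" by blast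
    have "\<exists>\<^sub>F n in sequentially. 1 \<le> n \<and> (\<forall>u. indicator (N \<omega> (real n)) u * obs (X \<omega> u) (tilt (steps (below (2 * ln n + K) (a * ln n) n) 0 n)) < (1 :: ennreal))"
      using elim(1) by (intro frequently_eventually_conj eventually_ge_at_top) blast
    then show ?case
      by (rule frequently_elim1) (auto intro!: below_violation[OF elim(3) K])
  qed
qed

section \<open>Excluding fast moves between integer times\<close>

lemma exp_ln_bound: "1 \<le> n \<Longrightarrow> exp (k - 2 * ln (real n)) = exp k * inverse (real n ^ 2)"
proof -
  assume n: "1 \<le> n"
  have "exp (k - 2 * ln (real n)) = exp k * (real n powr - 2)"
    using n by (simp add: powr_def exp_add[symmetric])
  also have "real n powr - 2 = inverse (real n ^ 2)"
    using n by (simp add: powr_minus powr_numeral)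
  finally show ?thesis .
qed

lemma AE_no_rise:
  assumes \<epsilon>: "0 < \<epsilon>" and a: "0 \<le> a"
  shows "AE \<omega> in M. \<forall>\<^sub>F n in sequentially. \<forall>u\<in>N \<omega> (real n + 3). X \<omega> u n \<le> sqrt 2 * n - (a + \<epsilon>) * ln n
    \<longrightarrow> (\<forall>t\<in>{real n..real n + 3}. X \<omega> u t \<le> sqrt 2 * n - a * ln n)"
proof -
  define c1 c2 where "c1 n = sqrt 2 * n - a * ln n" and "c2 n = sqrt 2 * n - (a + \<epsilon>) * ln n" for n :: nat
  \<comment> \<open>Solves \<open>(\<mu> - sqrt 2) * \<epsilon> = 2 + sqrt 2 * a\<close>, which
    makes the expected number of rising particles of order \<open>n powr (- 2)\<close>. As
    \<open>sqrt 2 \<le> \<mu>\<close>, the worst starting point is the top of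
    \<open>{..c2 n}\<close>.\<close>
  define \<mu> where "\<mu> = sqrt 2 + (2 + sqrt 2 * a) / \<epsilon>"
  have \<mu>: "sqrt 2 \<le> \<mu>" "0 \<le> \<mu>" "(\<mu> - sqrt 2) * \<epsilon> = 2 + sqrt 2 * a" using \<epsilon> a by (auto simp: \<mu>_def)
  have lnn: "0 \<le> ln (real n)" for n by (cases "n = 0") auto
  have c12: "c2 n \<le> c1 n" for n using \<epsilon> lnn[of n] by (simp add: c1_def c2_def distrib_right)
  define V where "V n x = ennreal (exp (\<mu>\<^sup>2 * 3 / 2 + \<mu> * (x - c1 n)) + exp (\<mu>\<^sup>2 * 3 / 2 + \<mu> * (- x - c1 n)))" for n x
  define C where "C = 4 * exp (3 + \<mu>\<^sup>2 * 3 / 2)"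
  have "AE \<omega> in M. \<forall>\<^sub>F n in sequentially. \<forall>u\<in>N \<omega> (real n + 3). X \<omega> u n \<in> {..c2 n} \<longrightarrow> (\<forall>t\<in>{real n..real n + 3}. X \<omega> u t \<notin> {c1 n<..})"
  proof (rule AE_eventually_no_hit[where V=V])
    show "V n \<in> borel_measurable borel" for n unfolding V_def by measurable
    show "1 \<le> pexp n x (fold_list abs (grid m n (indicator (- {c1 n<..})))) + V n x" for n m x
      unfolding V_def using \<mu>(2) by (rule rise_supersolution)
    show "\<forall>\<^sub>F n in sequentially. ennreal (exp (real n + 3)) * heat n (\<lambda>x. indicator {..c2 n} \<bar>x\<bar> * V n x) 0 \<le> ennreal (C * inverse (real n ^ 2))"
      using eventually_ge_at_top[of 1]
    proof eventually_elim
      case (elim n)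
      define b where "b = 2 * exp (\<mu>\<^sup>2 * 3 / 2 + (\<mu> - sqrt 2) * c2 n - \<mu> * c1 n)"
      have "heat n (\<lambda>x. indicator {..c2 n} \<bar>x\<bar> * V n x) 0 \<le> ennreal (2 * b * exp n)"
      proof (rule heat_le_exp_abs)
        fix x :: real
        have "exp (\<mu>\<^sup>2 * 3 / 2 + \<mu> * (x - c1 n)) + exp (\<mu>\<^sup>2 * 3 / 2 + \<mu> * (- x - c1 n)) \<le> b * exp (sqrt 2 * \<bar>x\<bar>)"
          if "\<bar>x\<bar> \<le> c2 n"
        proof -
          have e: "exp (\<mu>\<^sup>2 * 3 / 2 + \<mu> * (y - c1 n)) \<le> exp (\<mu>\<^sup>2 * 3 / 2 + (\<mu> - sqrt 2) * c2 n - \<mu> * c1 n) * exp (sqrt 2 * \<bar>x\<bar>)" if y: "y \<le> \<bar>x\<bar>" for y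
          proof -
            have "\<mu> * y \<le> \<mu> * \<bar>x\<bar>" using y \<mu> by (intro mult_left_mono)
            moreover have "(\<mu> - sqrt 2) * \<bar>x\<bar> \<le> (\<mu> - sqrt 2) * c2 n" using \<mu> \<open>\<bar>x\<bar> \<le> c2 n\<close> by (intro mult_left_mono) auto
            ultimately show ?thesis by (simp add: exp_add[symmetric] algebra_simps)
          qed
          from e[OF abs_ge_self] e[OF abs_ge_minus_self] show ?thesis unfolding b_def by linarith
        qed
        then show "indicator {..c2 n} \<bar>x\<bar> * V n x \<le> ennreal (b * exp (sqrt 2 * \<bar>x\<bar>))"
          unfolding V_def by (cases "\<bar>x\<bar> \<le> c2 n") (auto intro!: ennreal_leI simp del: ennreal_plus)
      qed (auto simp: b_def)
      then have "ennreal (exp (real n + 3)) * heat n (\<lambda>x. indicator {..c2 n} \<bar>x\<bar> * V n x) 0 \<le> ennreal (exp (real n + 3) * (2 * b * exp n))"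
        by (simp add: ennreal_mult mult_left_mono b_def)
      also have "exp (real n + 3) * (2 * b * exp n) = 4 * exp ((3 + \<mu>\<^sup>2 * 3 / 2) - 2 * ln n)"
      proof -
        have "real n + 3 + (\<mu>\<^sup>2 * 3 / 2 + (\<mu> - sqrt 2) * c2 n - \<mu> * c1 n) + n
            = 3 + \<mu>\<^sup>2 * 3 / 2 + sqrt 2 * a * ln n - ((\<mu> - sqrt 2) * \<epsilon>) * ln n"
          by (simp add: c1_def c2_def algebra_simps)
        also have "\<dots> = (3 + \<mu>\<^sup>2 * 3 / 2) - 2 * ln n" unfolding \<mu>(3) by (simp add: algebra_simps)
        finally show ?thesis by (simp add: b_def exp_add[symmetric] mult_ac)
      qed
      also have "\<dots> = C * inverse (real n ^ 2)"
        using elim by (subst exp_ln_bound) (auto simp: C_def)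
      finally show ?case .
    qed
    show "summable (\<lambda>n. C * inverse (real n ^ 2))"
      by (intro summable_mult inverse_power_summable) simp
    show "{..c2 n} \<inter> {c1 n<..} = {}" for n using c12[of n] by auto
  qed (auto simp: C_def)
  then show ?thesis by (simp add: c1_def c2_def not_less)
qed

lemma AE_no_drop:
  assumes \<epsilon>: "0 < \<epsilon>" and a: "0 \<le> a"
  shows "AE \<omega> in M. \<forall>\<^sub>F n in sequentially. \<forall>u\<in>N \<omega> (real n + 3). sqrt 2 * n - a * ln n \<le> X \<omega> u n
    \<longrightarrow> (\<forall>t\<in>{real n..real n + 3}. sqrt 2 * n - (a + \<epsilon>) * ln n \<le> X \<omega> u t)"
proof -
  define c2 c3 where "c2 n = sqrt 2 * n - a * ln n" and "c3 n = sqrt 2 * n - (a + \<epsilon>) * ln n" for n :: nat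
  \<comment> \<open>About \<open>n powr (sqrt 2 * a)\<close> particles are expected above
    \<open>c2 n\<close>; the cost \<open>\<mu> * \<epsilon>\<close> of the drop outweighs them with
    a surplus of \<open>n powr (- 2)\<close>.\<close>
  define \<mu> where "\<mu> = (2 + sqrt 2 * a) / \<epsilon>"
  have \<mu>: "0 \<le> \<mu>" "\<mu> * \<epsilon> = 2 + sqrt 2 * a" using \<epsilon> a by (auto simp: \<mu>_def)
  have lnn: "0 \<le> ln (real n)" for n by (cases "n = 0") auto
  have c23: "c3 n \<le> c2 n" for n using \<epsilon> lnn[of n] by (simp add: c2_def c3_def distrib_right)
  define V where "V n x = ennreal (exp (\<mu>\<^sup>2 * 3 / 2 - \<mu> * (\<bar>x\<bar> - c3 n)))" for n x
  define C where "C = 2 * exp (3 + \<mu>\<^sup>2 * 3 / 2)"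
  have "AE \<omega> in M. \<forall>\<^sub>F n in sequentially. \<forall>u\<in>N \<omega> (real n + 3). X \<omega> u n \<in> {c2 n..} \<longrightarrow> (\<forall>t\<in>{real n..real n + 3}. X \<omega> u t \<notin> {..<c3 n})"
  proof (rule AE_eventually_no_hit[where V=V])
    show "V n \<in> borel_measurable borel" for n unfolding V_def by measurable
    show "1 \<le> pexp n x (fold_list abs (grid m n (indicator (- {..<c3 n})))) + V n x" for n m x
      unfolding V_def using \<mu>(1) by (rule drop_supersolution)
    show "\<forall>\<^sub>F n in sequentially. ennreal (exp (real n + 3)) * heat n (\<lambda>x. indicator {c2 n..} \<bar>x\<bar> * V n x) 0 \<le> ennreal (C * inverse (real n ^ 2))"
      using eventually_ge_at_top[of 1]
    proof eventually_elim
      case (elim n)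
      define b where "b = exp (\<mu>\<^sup>2 * 3 / 2 - \<mu> * (c2 n - c3 n) - sqrt 2 * c2 n)"
      have "heat n (\<lambda>x. indicator {c2 n..} \<bar>x\<bar> * V n x) 0 \<le> ennreal (2 * b * exp n)"
      proof (rule heat_le_exp_abs)
        fix x :: real
        have "exp (\<mu>\<^sup>2 * 3 / 2 - \<mu> * (\<bar>x\<bar> - c3 n)) \<le> b * exp (sqrt 2 * \<bar>x\<bar>)" if "c2 n \<le> \<bar>x\<bar>"
        proof -
          have "\<mu> * c2 n \<le> \<mu> * \<bar>x\<bar>" "sqrt 2 * c2 n \<le> sqrt 2 * \<bar>x\<bar>" using that \<mu> by (intro mult_left_mono; simp)+
          then have "\<mu>\<^sup>2 * 3 / 2 - \<mu> * (\<bar>x\<bar> - c3 n) \<le> (\<mu>\<^sup>2 * 3 / 2 - \<mu> * (c2 n - c3 n) - sqrt 2 * c2 n) + sqrt 2 * \<bar>x\<bar>"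
            unfolding right_diff_distrib by linarith
          then show ?thesis by (simp add: b_def exp_add[symmetric])
        qed
        then show "indicator {c2 n..} \<bar>x\<bar> * V n x \<le> ennreal (b * exp (sqrt 2 * \<bar>x\<bar>))"
          unfolding V_def by (cases "c2 n \<le> \<bar>x\<bar>") (auto intro!: ennreal_leI)
      qed (auto simp: b_def)
      then have "ennreal (exp (real n + 3)) * heat n (\<lambda>x. indicator {c2 n..} \<bar>x\<bar> * V n x) 0 \<le> ennreal (exp (real n + 3) * (2 * b * exp n))"
        by (simp add: ennreal_mult mult_left_mono b_def)
      also have "exp (real n + 3) * (2 * b * exp n) = 2 * exp ((3 + \<mu>\<^sup>2 * 3 / 2) - 2 * ln n)"
      proof -
        have "real n + 3 + (\<mu>\<^sup>2 * 3 / 2 - \<mu> * (c2 n - c3 n) - sqrt 2 * c2 n) + n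
            = 3 + \<mu>\<^sup>2 * 3 / 2 + sqrt 2 * a * ln n - (\<mu> * \<epsilon>) * ln n"
          by (simp add: c2_def c3_def algebra_simps)
        also have "\<dots> = (3 + \<mu>\<^sup>2 * 3 / 2) - 2 * ln n" unfolding \<mu>(2) by (simp add: algebra_simps)
        finally show ?thesis by (simp add: b_def exp_add[symmetric] mult_ac)
      qed
      also have "\<dots> = C * inverse (real n ^ 2)"
        using elim by (subst exp_ln_bound) (auto simp: C_def)
      finally show ?case .
    qed
    show "summable (\<lambda>n. C * inverse (real n ^ 2))"
      by (intro summable_mult inverse_power_summable) simp
    show "{c2 n..} \<inter> {..<c3 n} = {}" for n using c23[of n] by auto
  qed (auto simp: C_def)
  then show ?thesis by (simp add: c2_def c3_def not_less)
qed

end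

section \<open>The good particles\<close>

lemma pexp_le_1:
  assumes "\<And>s f x. (s, f) \<in> set r \<Longrightarrow> f x \<le> 1"
  shows "pexp t x r \<le> 1"
  using assms
proof (induction r arbitrary: t x)
  case (Cons sf r)
  obtain s f where sf: "sf = (s, f)" by force
  have IH: "pexp s y r \<le> 1" for y by (rule Cons.IH) (use Cons.prems in auto)
  have 1: "f y * pexp s y r \<le> 1 * 1" for y
    using Cons.prems[of s f y] IH by (intro mult_mono) (auto simp: sf)
  have "heat (s - t) (\<lambda>y. f y * pexp s y r) x \<le> heat (s - t) (\<lambda>_. 1) x"
    by (rule heat_mono) (use 1 in simp)
  then show ?case by (simp add: sf)
qed simp

lemma pexp_steps_ge_kill:
  assumes "\<And>i y. k < i \<Longrightarrow> i < n \<Longrightarrow> indicator {..b} y \<le> f i y"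
    and "\<And>y. indicator {..b} y * g y \<le> f n y * pexp n y r" "k < n"
  shows "(kill b ^^ (n - k)) g x \<le> pexp k x (steps f k n @ r)"
  using assms
proof (induction "n - Suc k" arbitrary: k x)
  case 0
  then have "n = Suc k" by simp
  then show ?case using 0 by (auto simp: steps_Cons kill_def intro!: heat_mono)
next
  case (Suc d)
  then have k: "k < n" "d = n - Suc (Suc k)" "Suc k < n" by auto
  have IH: "(kill b ^^ (n - Suc k)) g y \<le> pexp (Suc k) y (steps f (Suc k) n @ r)" for y
    using Suc.prems k by (intro Suc.hyps) auto
  have "(kill b ^^ (n - k)) g x = heat 1 (\<lambda>y. indicator {..b} y * (kill b ^^ (n - Suc k)) g y) x"
    using k(1) by (subst Suc_diff_Suc[symmetric]) (auto simp: kill_def)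
  also have "\<dots> \<le> heat 1 (\<lambda>y. f (Suc k) y * pexp (Suc k) y (steps f (Suc k) n @ r)) x"
    using Suc.prems(1)[of "Suc k"] k IH by (intro heat_mono mult_mono) auto
  also have "\<dots> = pexp k x (steps f k n @ r)" using k by (simp add: steps_Cons)
  finally show ?case .
qed

lemma kill_pow_ge_interval:
  assumes [measurable]: "f \<in> borel_measurable borel" and x: "x \<le> b" and m: "0 < m"
    and I: "I \<in> sets borel" "\<And>y. y \<in> I \<Longrightarrow> y \<le> b" and c: "\<And>y. y \<in> I \<Longrightarrow> c \<le> reflected_density b m x y" "\<And>y. y \<in> I \<Longrightarrow> v \<le> f y"
  shows "ennreal c * v * emeasure lborel I \<le> (kill b ^^ m) f x"
proof -
  have "ennreal c * v * emeasure lborel I = (\<integral>\<^sup>+y. ennreal c * v * indicator I y \<partial>lborel)"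
    using I(1) by (simp add: nn_integral_cmult)
  also have "\<dots> \<le> (\<integral>\<^sup>+y\<in>{..b}. ennreal (reflected_density b m x y) * f y \<partial>lborel)"
    using I(2) c by (intro nn_integral_mono) (auto simp: indicator_def intro!: mult_mono ennreal_leI)
  also have "\<dots> \<le> (kill b ^^ m) f x" by (rule kill_pow_ge) fact+
  finally show ?thesis .
qed

text \<open>Constraints at time \<open>i\<close> on the path to a good particle at time \<open>j\<close>, relative to the line of
  slope \<open>sqrt 2\<close>.\<close>

definition G :: "nat \<Rightarrow> real \<Rightarrow> real \<Rightarrow> nat \<Rightarrow> nat \<Rightarrow> real set" where
  "G T D A j i = (if i < T then {..1} else if i \<le> j - T then {..- D} else if i < j then {..1 - A} else {- A - 1..- A})"

definition gf :: "nat \<Rightarrow> real \<Rightarrow> real \<Rightarrow> nat \<Rightarrow> nat \<Rightarrow> real \<Rightarrow> ennreal" where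
  "gf T D A j i = indicator (G T D A j i)"

lemma gf_measurable [measurable]: "gf T D A j i \<in> borel_measurable borel"
  by (auto simp: gf_def G_def)

text \<open>The choice of \<open>A\<close> makes the expected number of good particles at a fixed time of order \<open>1 / r\<close>.
  The bulk depth \<open>D\<close> makes pairs that split in the bulk negligible, and \<open>2 * D \<le> sqrt T\<close> lets the path
  reach this depth within time \<open>T\<close>.\<close>

definition admissible :: "nat \<Rightarrow> nat \<Rightarrow> nat \<Rightarrow> real \<Rightarrow> real \<Rightarrow> bool" where
  "admissible n r T D A \<longleftrightarrow> 1 \<le> r \<and> r \<le> n \<and> 100 \<le> T \<and> 16 * T \<le> n \<and> D = 3 * ln n
    \<and> exp (sqrt 2 * A) = n * sqrt n / r \<and> 0 \<le> A \<and> A + 1 < D \<and> 2 * D \<le> sqrt T"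

lemma admissibleD:
  assumes "admissible n r T D A"
  shows "1 \<le> r" "r \<le> n" "100 \<le> T" "16 * T \<le> n" "D = 3 * ln n" "exp (sqrt 2 * A) = n * sqrt n / r" "0 \<le> A" "A + 1 < D" "2 * D \<le> sqrt T"
  using assms by (auto simp: admissible_def)

lemma gf_le_1: "gf T D A j i y \<le> 1" by (simp add: gf_def indicator_def)

lemma gf_le_barrier:
  assumes "admissible n r T D A" shows "gf T D A j i y \<le> indicator {..1} y"
  using admissibleD(7,8)[OF assms] by (auto simp: gf_def G_def indicator_def)

lemma reflected_density_lower:
  assumes "x \<le> b" "y \<le> b" "2 * (b - x) * (b - y) \<le> t" "0 < t" "p \<le> (b - x) * (b - y)" "0 \<le> p" "(y - x)\<^sup>2 \<le> 2 * e * t"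
  shows "p / (t * sqrt (2 * pi * t)) * exp (- e) \<le> reflected_density b t x y"
proof -
  have "p / (t * sqrt (2 * pi * t)) * exp (- e) \<le> (b - x) * (b - y) / (t * sqrt (2 * pi * t)) * exp (- (y - x)\<^sup>2 / (2 * t))"
    using assms by (intro mult_mono divide_right_mono) (auto simp: field_simps)
  also have "\<dots> \<le> reflected_density b t x y" using assms by (intro reflected_density_ge)
  finally show ?thesis .
qed

text \<open>The exponent is 2 + 1 + 2 and the cube of \<open>sqrt (2 * pi)\<close> arises from the
  three stages of the next lemma; 32 is 8 from the depths times 4 from
  \<open>m \<le> 2 * n\<close>.\<close>

definition c_low :: real where
  "c_low = exp (- 5) / (32 * (sqrt (2 * pi)) ^ 3)"

lemma c_low_pos: "0 < c_low" by (simp add: c_low_def)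

text \<open>Three stages: with \<open>q = sqrt T\<close>, in \<open>T\<close> steps from 0 down to
  \<open>{- 2 * q..- q}\<close>, then \<open>m = j - 2 * T\<close> steps back into this interval
  while staying below \<open>- D\<close>, then \<open>T\<close> steps up to the window. By
  \<open>2 * D \<le> q\<close> the interval is at depth at least \<open>q / 2\<close> below
  \<open>- D\<close>. All powers of \<open>T\<close> cancel and \<open>m powr (- 3 / 2)\<close>
  remains.\<close>

lemma good_prob_ge:
  assumes ad: "admissible n r T D A" and j: "n \<le> j" "j < 2 * n"
  shows "ennreal (c_low / (n * sqrt n)) \<le> pexp 0 0 (steps (gf T D A j) 0 j)"
proof -
  note ad' = admissibleD[OF ad]
  define q where "q = sqrt (real T)"
  have "sqrt 100 \<le> q" unfolding q_def using ad'(3) by (intro real_sqrt_le_mono) simp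
  then have q: "10 \<le> q" "q * q = real T" "2 * D \<le> q" using ad' by (auto simp: q_def)
  have D: "1 \<le> D" using ad' by linarith
  have T: "0 < T" "T < j - T" "j - T < j" "0 < j - 2 * T" using ad'(3,4) j by auto
  let ?f = "gf T D A j" and ?I = "{- 2 * q..- q}" and ?s = "sqrt (2 * pi)"
  have s0: "0 < ?s" by simp
  have I: "emeasure lborel ?I = ennreal q" using q by simp
  define P3 where "P3 z = pexp (j - T) z (steps ?f (j - T) j)" for z
  define P2 where "P2 y = pexp T y (steps ?f T (j - T) @ steps ?f (j - T) j)" for y
  have m[measurable]: "P2 \<in> borel_measurable borel" "P3 \<in> borel_measurable borel"
    unfolding P2_def P3_def by (intro pexp_measurable_snd; simp add: borel_list_steps)+
  have qq: "10 * q \<le> q * q" using q by (intro mult_right_mono) auto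
  have P3: "ennreal ((q / 2) / (T * sqrt (2 * pi * T)) * exp (- 2)) \<le> P3 z" if z: "z \<in> ?I" for z
  proof -
    have "ennreal ((q / 2) / (T * sqrt (2 * pi * T)) * exp (- 2)) * 1 * emeasure lborel {- A - 1..- A} \<le> (kill (1 - A) ^^ T) (indicator {- A - 1..- A}) z"
    proof (rule kill_pow_ge_interval)
      fix w assume w: "w \<in> {- A - 1..- A}"
      show "(q / 2) / (T * sqrt (2 * pi * T)) * exp (- 2) \<le> reflected_density (1 - A) T z w"
      proof (rule reflected_density_lower)
        have "2 * (1 - A - z) * (1 - A - w) \<le> 2 * (1 + 2 * q) * 2"
          using z w q ad' by (intro mult_mono) auto
        also have "\<dots> \<le> real T" using qq q by simp
        finally show "2 * (1 - A - z) * (1 - A - w) \<le> real T" .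
        have "(q / 2) * 1 \<le> (1 - A - z) * (1 - A - w)"
          using z w q ad' by (intro mult_mono) auto
        then show "q / 2 \<le> (1 - A - z) * (1 - A - w)" by simp
        have "\<bar>w - z\<bar> \<le> \<bar>2 * q\<bar>" using z w q ad' by auto
        then have "(w - z)\<^sup>2 \<le> (2 * q)\<^sup>2" by (simp only: abs_le_square_iff)
        then show "(w - z)\<^sup>2 \<le> 2 * 2 * real T" using q(2) by (simp add: power2_eq_square)
      qed (use z w q ad' in auto)
    qed (use z q ad' T in auto)
    also have "(kill (1 - A) ^^ T) (indicator {- A - 1..- A}) z = (kill (1 - A) ^^ (j - (j - T))) (indicator {- A - 1..- A}) z"
      using T by simp
    also have "\<dots> \<le> pexp (j - T) z (steps ?f (j - T) j @ [])"
      using T by (intro pexp_steps_ge_kill) (auto simp: gf_def G_def indicator_def)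
    finally show ?thesis by (simp add: P3_def)
  qed
  define m where "m = j - 2 * T"
  have m8: "8 * real T \<le> real m" "real m \<le> 2 * real n" "0 < real m"
  proof -
    have "8 * T \<le> m" "m \<le> 2 * n" "0 < m" using ad'(3,4) j by (auto simp: m_def)
    then show "8 * real T \<le> real m" "real m \<le> 2 * real n" "0 < real m" by linarith+
  qed
  have P2: "ennreal ((T / 4) / (m * sqrt (2 * pi * m)) * exp (- 1)) * ennreal ((q / 2) / (T * sqrt (2 * pi * T)) * exp (- 2)) * ennreal q \<le> P2 y" if y: "y \<in> ?I" for y
  proof -
    have "ennreal ((T / 4) / (m * sqrt (2 * pi * m)) * exp (- 1)) * ennreal ((q / 2) / (T * sqrt (2 * pi * T)) * exp (- 2)) * emeasure lborel ?I \<le> (kill (- D) ^^ m) P3 y"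
    proof (rule kill_pow_ge_interval)
      fix z assume z: "z \<in> ?I"
      show "ennreal ((q / 2) / (T * sqrt (2 * pi * T)) * exp (- 2)) \<le> P3 z" using z by (rule P3)
      show "(T / 4) / (m * sqrt (2 * pi * m)) * exp (- 1) \<le> reflected_density (- D) m y z"
      proof (rule reflected_density_lower)
        have "2 * (- D - y) * (- D - z) \<le> 2 * (2 * q) * (2 * q)"
          using z y q D by (intro mult_mono) auto
        also have "\<dots> \<le> real m" using q(2) m8 by simp
        finally show "2 * (- D - y) * (- D - z) \<le> real m" .
        have "(q / 2) * (q / 2) \<le> (- D - y) * (- D - z)"
          using z y q by (intro mult_mono) auto
        then show "T / 4 \<le> (- D - y) * (- D - z)" using q(2) by simp
        have "\<bar>z - y\<bar> \<le> \<bar>q\<bar>" using z y q by auto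
        then have "(z - y)\<^sup>2 \<le> q\<^sup>2" by (simp only: abs_le_square_iff)
        then show "(z - y)\<^sup>2 \<le> 2 * 1 * real m" using q(2) m8 by (simp add: power2_eq_square)
      qed (use z y q m8 D in auto)
    qed (use y q m8 D in auto)
    also have "(kill (- D) ^^ m) P3 y = (kill (- D) ^^ (j - T - T)) P3 y" by (simp add: m_def mult_2)
    also have "\<dots> \<le> pexp T y (steps ?f T (j - T) @ steps ?f (j - T) j)"
      using T unfolding P3_def by (intro pexp_steps_ge_kill) (auto simp: gf_def G_def indicator_def)
    finally show ?thesis unfolding I by (simp add: P2_def)
  qed
  have "ennreal (q / (T * sqrt (2 * pi * T)) * exp (- 2)) * (ennreal ((T / 4) / (m * sqrt (2 * pi * m)) * exp (- 1)) * ennreal ((q / 2) / (T * sqrt (2 * pi * T)) * exp (- 2)) * ennreal q) * emeasure lborel ?I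
      \<le> (kill 1 ^^ T) (\<lambda>y. indicator {..- D} y * P2 y) 0"
  proof (rule kill_pow_ge_interval)
    fix y assume y: "y \<in> ?I"
    show "ennreal ((T / 4) / (m * sqrt (2 * pi * m)) * exp (- 1)) * ennreal ((q / 2) / (T * sqrt (2 * pi * T)) * exp (- 2)) * ennreal q \<le> indicator {..- D} y * P2 y"
      using P2[OF y] y q D by simp
    show "q / (T * sqrt (2 * pi * T)) * exp (- 2) \<le> reflected_density 1 T 0 y"
    proof (rule reflected_density_lower)
      show "2 * (1 - 0) * (1 - y) \<le> real T" using y q qq by simp
      have "\<bar>y - 0\<bar> \<le> \<bar>2 * q\<bar>" using y q by auto
      then have "(y - 0)\<^sup>2 \<le> (2 * q)\<^sup>2" by (simp only: abs_le_square_iff)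
      then show "(y - 0)\<^sup>2 \<le> 2 * 2 * real T" using q(2) by (simp add: power2_eq_square)
    qed (use y q T in auto)
  qed (use q T in auto)
  also have "(kill 1 ^^ T) (\<lambda>y. indicator {..- D} y * P2 y) 0 = (kill 1 ^^ (T - 0)) (\<lambda>y. indicator {..- D} y * P2 y) 0" by simp
  also have "\<dots> \<le> pexp (real 0) 0 (steps ?f 0 T @ steps ?f T (j - T) @ steps ?f (j - T) j)"
    using T D unfolding P2_def by (intro pexp_steps_ge_kill) (auto simp: gf_def G_def indicator_def)
  also have "steps ?f 0 T @ steps ?f T (j - T) @ steps ?f (j - T) j = steps ?f 0 j"
    using T steps_append[of 0 T j ?f] steps_append[of T "j - T" j ?f] by simp
  finally have fin: "ennreal (q / (T * sqrt (2 * pi * T)) * exp (- 2)) * (ennreal ((T / 4) / (m * sqrt (2 * pi * m)) * exp (- 1)) * ennreal ((q / 2) / (T * sqrt (2 * pi * T)) * exp (- 2)) * ennreal q) * emeasure lborel ?I \<le> pexp (real 0) 0 (steps ?f 0 j)" .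
  have E: "ennreal a * (ennreal b * ennreal c * ennreal q) * ennreal q = ennreal (a * (b * c * q) * q)" if "0 \<le> a" "0 \<le> b" "0 \<le> c" for a b c
    using that q by (simp add: ennreal_mult)
  have "ennreal (q / (T * sqrt (2 * pi * T)) * exp (- 2) * ((T / 4) / (m * sqrt (2 * pi * m)) * exp (- 1) * ((q / 2) / (T * sqrt (2 * pi * T)) * exp (- 2)) * q) * q)
      \<le> pexp 0 0 (steps ?f 0 j)"
    using fin q unfolding I by (subst (asm) E) auto
  moreover have "c_low / (n * sqrt n) \<le> q / (T * sqrt (2 * pi * T)) * exp (- 2) * ((T / 4) / (m * sqrt (2 * pi * m)) * exp (- 1) * ((q / 2) / (T * sqrt (2 * pi * T)) * exp (- 2)) * q) * q"
  proof -
    have "q / (T * sqrt (2 * pi * T)) * exp (- 2) * ((T / 4) / (m * sqrt (2 * pi * m)) * exp (- 1) * ((q / 2) / (T * sqrt (2 * pi * T)) * exp (- 2)) * q) * q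
        = (exp (- 2) * exp (- 1) * exp (- 2)) / (8 * ?s ^ 3) / (m * sqrt m)"
    proof -
      have e: "q / (T * sqrt (2 * pi * T)) = 1 / (?s * (q * q))" "(q / 2) / (T * sqrt (2 * pi * T)) = 1 / (2 * ?s * (q * q))"
        "(T / 4) / (m * sqrt (2 * pi * m)) = (q * q) / (4 * ?s * (m * sqrt m))"
        using q T by (simp_all add: real_sqrt_mult q_def[symmetric] del: real_sqrt_mult_self)
      have "1 / (s * (q * q)) * a * (q * q / (4 * s * M) * b * (1 / (2 * s * (q * q)) * a) * q) * q = a * b * a / (8 * s ^ 3) / M"
        if "0 < s" for s a b M
        using q(1) that by (simp add: power3_eq_cube field_simps)
      then show ?thesis unfolding e using s0 by blast
    qed
    moreover have "exp (- 2) * exp (- 1) * exp (- 2) = exp (- 5 :: real)" by (simp add: exp_add[symmetric])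
    moreover have "exp (- 5) / (32 * ?s ^ 3) / (n * sqrt n) \<le> exp (- 5) / (8 * ?s ^ 3) / (m * sqrt m)"
    proof -
      have "sqrt m \<le> sqrt (4 * n)" using m8 by (intro real_sqrt_le_mono) simp
      then have "sqrt m \<le> 2 * sqrt n" by (simp add: real_sqrt_mult)
      then have "m * sqrt m \<le> (2 * n) * (2 * sqrt n)" using m8 by (intro mult_mono) auto
      then have "8 * ?s ^ 3 * (m * sqrt m) \<le> 8 * ?s ^ 3 * ((2 * n) * (2 * sqrt n))"
        using s0 by (intro mult_left_mono) auto
      then have "exp (- 5) / (8 * ?s ^ 3 * ((2 * n) * (2 * sqrt n))) \<le> exp (- 5) / (8 * ?s ^ 3 * (m * sqrt m))"
        using m8 s0 by (intro divide_left_mono) auto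
      then show ?thesis by (simp add: mult_ac)
    qed
    ultimately show ?thesis by (simp add: c_low_def)
  qed
  ultimately show ?thesis by (meson ennreal_leI order.trans)
qed

lemma window_integral:
  assumes "0 \<le> A"
  shows "(\<integral>\<^sup>+y\<in>{..1}. indicator {- A - 1..- A} y * ennreal (1 - y + 1) \<partial>lborel) \<le> ennreal (A + 3)"
proof -
  have "(\<integral>\<^sup>+y\<in>{..1}. indicator {- A - 1..- A} y * ennreal (1 - y + 1) \<partial>lborel) \<le> (\<integral>\<^sup>+y. ennreal (A + 3) * indicator {- A - 1..- A} y \<partial>lborel)"
    by (intro nn_integral_mono) (auto simp: indicator_def intro!: ennreal_leI)
  then show ?thesis using assms by (simp add: nn_integral_cmult)
qed

lemma half_power: 
  assumes "real n \<le> 2 * real k" "0 < n"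
  shows "1 / (k * sqrt k) \<le> 3 / (n * sqrt n)"
proof -
  have "sqrt n \<le> sqrt (2 * k)" using assms by (intro real_sqrt_le_mono) simp
  also have "\<dots> \<le> 3 / 2 * sqrt k"
  proof -
    have "sqrt 2 \<le> 3 / 2" by (rule real_le_lsqrt) (auto simp: power2_eq_square)
    then have "sqrt 2 * sqrt k \<le> 3 / 2 * sqrt k" by (rule mult_right_mono) simp
    then show ?thesis by (simp add: real_sqrt_mult)
  qed
  finally have "n * sqrt n \<le> (2 * k) * (3 / 2 * sqrt k)" using assms by (intro mult_mono) auto
  then show ?thesis using assms by (simp add: field_simps)
qed

lemma window_kill:
  assumes A: "0 \<le> A" and z: "z \<le> 1" and m: "3 \<le> m" "real n \<le> 2 * real m" "0 < n"
  shows "(kill 1 ^^ m) (indicator {- A - 1..- A}) z \<le> ennreal (300 * (A + 3) / (n * sqrt n) * (2 - z))"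
proof -
  have "(kill 1 ^^ m) (indicator {- A - 1..- A}) z \<le> ennreal (100 * (1 - z + 1) / (m * sqrt m)) * (\<integral>\<^sup>+y\<in>{..1}. indicator {- A - 1..- A} y * ennreal (1 - y + 1) \<partial>lborel)"
    using z m by (intro kill_pow_le) auto
  also have "\<dots> \<le> ennreal (100 * (1 - z + 1) / (m * sqrt m)) * ennreal (A + 3)"
    using window_integral[OF A] by (intro mult_left_mono) auto
  also have "\<dots> = ennreal (100 * (2 - z) * (A + 3) * (1 / (m * sqrt m)))"
    using z A by (subst ennreal_mult[symmetric]) (auto simp: mult_ac)
  also have "\<dots> \<le> ennreal (100 * (2 - z) * (A + 3) * (3 / (n * sqrt n)))"
    using z A m half_power[of n m] by (intro ennreal_leI mult_left_mono) auto
  also have "100 * (2 - z) * (A + 3) * (3 / (n * sqrt n)) = 300 * (A + 3) / (n * sqrt n) * (2 - z)"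
    by (simp only: times_divide_eq_right times_divide_eq_left) (simp add: algebra_simps)
  finally show ?thesis .
qed

lemma gf_last: "0 < T \<Longrightarrow> T \<le> j \<Longrightarrow> gf T D A j j = indicator {- A - 1..- A}"
  by (auto simp: gf_def G_def)

text \<open>On the window the end point weight is at most \<open>exp (sqrt 2 * (A + 1))\<close>, and
  by the choice of \<open>A\<close> the factor \<open>exp (sqrt 2 * A)\<close> cancels the ballot
  decay up to \<open>1 / r\<close>.\<close>

lemma good_weight_le:
  assumes ad: "admissible n r T D A" and j: "n \<le> j" "j < 2 * n"
  shows "pexp 0 0 (steps (gf T D A j) 0 j @ [(j, \<lambda>y. ennreal (exp (- sqrt 2 * y)))])
    \<le> ennreal (600 * exp (sqrt 2) * (A + 3) / r)"
proof -
  note ad' = admissibleD[OF ad]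
  have T: "0 < T" "T \<le> j" "3 \<le> j" "0 < n" using ad'(3,4) j by auto
  let ?b = "exp (sqrt 2 * (A + 1))"
  have "pexp (real 0) 0 (steps (gf T D A j) 0 j @ [(j, \<lambda>y. ennreal (exp (- sqrt 2 * y)))]) \<le> (kill 1 ^^ (j - 0)) (\<lambda>y. ennreal ?b * indicator {- A - 1..- A} y) 0"
  proof (rule pexp_steps_le_kill)
    show "gf T D A j j y * pexp j y [(j, \<lambda>y. ennreal (exp (- sqrt 2 * y)))] \<le> indicator {..1} y * (ennreal ?b * indicator {- A - 1..- A} y)" for y
      using gf_last[of T j D A] T ad'(7) mult_left_mono[of "- A - 1" y "sqrt 2"]
      by (auto simp: indicator_def algebra_simps intro!: ennreal_leI)
  qed (use T gf_le_barrier[OF ad] in auto)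
  also have "\<dots> = ennreal ?b * (kill 1 ^^ j) (indicator {- A - 1..- A}) 0"
    by (simp add: kill_pow_cmult)
  also have "\<dots> \<le> ennreal ?b * ennreal (300 * (A + 3) / (n * sqrt n) * (2 - 0))"
    using T ad'(7) j by (intro mult_left_mono window_kill) auto
  also have "\<dots> = ennreal (?b * (300 * (A + 3) / (n * sqrt n) * (2 - 0)))"
    using ad'(7) by (subst ennreal_mult[symmetric]) auto
  also have "?b = exp (sqrt 2) * exp (sqrt 2 * A)" by (simp add: distrib_left exp_add)
  also have "exp (sqrt 2) * exp (sqrt 2 * A) * (300 * (A + 3) / (n * sqrt n) * (2 - 0)) = 600 * exp (sqrt 2) * (A + 3) * (exp (sqrt 2 * A) / (n * sqrt n))"
    by simp
  also have "exp (sqrt 2 * A) / (n * sqrt n) = 1 / r"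
    using ad'(6) T by simp
  finally show ?thesis by simp
qed

lemma pexp_snoc_cmult:
  assumes "borel_list r" "f \<in> borel_measurable borel"
  shows "pexp s x (r @ [(u, \<lambda>y. c * f y)]) = c * pexp s x (r @ [(u, f)])"
  using assms
proof (induction r arbitrary: s x)
  case Nil
  then show ?case by (simp add: heat_cmult)
next
  case (Cons a r)
  obtain s' g where a: "a = (s', g)" by force
  have [measurable]: "g \<in> borel_measurable borel" "(\<lambda>y. pexp s' y (r @ [(u, f)])) \<in> borel_measurable borel"
    using Cons.prems by (auto simp: a intro!: pexp_measurable_snd)
  show ?case using Cons by (simp add: a mult.left_commute[of _ c] heat_cmult)
qed

text \<open>On the window the end point weight is at least \<open>exp (sqrt 2 * A)\<close>, which
  turns the lower bound of order \<open>1 / (n * sqrt n)\<close> into one of order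
  \<open>1 / r\<close>.\<close>

lemma good_weight_ge:
  assumes ad: "admissible n r T D A" and j: "n \<le> j" "j < 2 * n"
  shows "ennreal (c_low / r) \<le> pexp 0 0 (steps (gf T D A j) 0 j @ [(j, \<lambda>y. ennreal (exp (- sqrt 2 * y)))])"
proof -
  note ad' = admissibleD[OF ad]
  have T: "0 < T" "T \<le> j" "0 < n" "0 < j" using ad'(3,4) j by auto
  let ?f = "\<lambda>i y. if i = j then ennreal (exp (sqrt 2 * A)) * gf T D A j j y else gf T D A j i y"
  have st: "steps (gf T D A j) 0 j = steps (gf T D A j) 0 (j - 1) @ [(real j, gf T D A j j)]"
    using steps_append[of 0 "j - 1" j "gf T D A j"] T by (simp add: steps_Cons)
  have "ennreal (c_low / r) = ennreal (exp (sqrt 2 * A)) * ennreal (c_low / (n * sqrt n))"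
    using ad'(6) T c_low_pos by (simp add: ennreal_mult[symmetric])
  also have "\<dots> \<le> ennreal (exp (sqrt 2 * A)) * pexp 0 0 (steps (gf T D A j) 0 j)"
    by (intro mult_left_mono good_prob_ge[OF ad j]) simp
  also have "\<dots> = pexp 0 0 (steps (gf T D A j) 0 (j - 1) @ [(real j, \<lambda>y. ennreal (exp (sqrt 2 * A)) * gf T D A j j y)])"
    unfolding st by (rule pexp_snoc_cmult[symmetric]) (auto intro: borel_list_steps)
  also have "\<dots> \<le> pexp 0 0 (steps (gf T D A j) 0 (j - 1) @ [(real j, gf T D A j j), (j, \<lambda>y. ennreal (exp (- sqrt 2 * y)))])"
  proof -
    have "pexp (real 0) 0 (steps (gf T D A j) 0 (j - 1) @ [(real j, \<lambda>y. ennreal (exp (sqrt 2 * A)) * gf T D A j j y)])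
      \<le> pexp (real 0) 0 (steps (gf T D A j) 0 (j - 1) @ [(real j, gf T D A j j), (j, \<lambda>y. ennreal (exp (- sqrt 2 * y)))])"
    proof (rule pexp_steps_mono)
      show "pexp (real (j - 1)) y [(real j, \<lambda>y. ennreal (exp (sqrt 2 * A)) * gf T D A j j y)]
        \<le> pexp (real (j - 1)) y [(real j, gf T D A j j), (j, \<lambda>y. ennreal (exp (- sqrt 2 * y)))]" for y
    proof -
      have "ennreal (exp (sqrt 2 * A)) * gf T D A j j z \<le> gf T D A j j z * ennreal (exp (- sqrt 2 * z))" for z
        using gf_last[of T j D A] T mult_left_mono[of z "- A" "sqrt 2"]
        by (auto simp: indicator_def intro!: ennreal_leI)
      then show ?thesis by (auto intro!: heat_mono)
    qed
    qed auto
    then show ?thesis by simp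
  qed
  finally show ?thesis unfolding st by simp
qed

section \<open>Second moment of the number of good particles\<close>

lemma heat_exp_scaled:
  assumes "0 \<le> d" "0 \<le> a"
  shows "heat d (\<lambda>y. ennreal (a * exp (c * y))) x = ennreal (a * exp (c * x + c\<^sup>2 * d / 2))"
  using assms by (simp add: ennreal_mult heat_cmult heat_exp)

lemma pexp_append_le:
  assumes "\<And>s f y. (s, f) \<in> set a \<Longrightarrow> f y \<le> 1" "\<And>s y. pexp s y r \<le> C"
  shows "pexp t x (a @ r) \<le> C"
  using assms(1)
proof (induction a arbitrary: t x)
  case Nil
  then show ?case using assms(2) by simp
next
  case (Cons sf a)
  obtain s f where sf: "sf = (s, f)" by force
  have IH: "pexp s y (a @ r) \<le> C" for y by (rule Cons.IH) (use Cons.prems in auto)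
  have 1: "f y * pexp s y (a @ r) \<le> 1 * C" for y
    using Cons.prems[of s f y] IH by (intro mult_mono) (auto simp: sf)
  have "heat (s - t) (\<lambda>y. f y * pexp s y (a @ r)) x \<le> heat (s - t) (\<lambda>_. C) x"
    by (rule heat_mono) (use 1 in simp)
  then show ?case by (simp add: sf)
qed

text \<open>Keeps only the constraint at time \<open>k\<close>, the last one before the fork. The
  case \<open>k = 0\<close> is separate because there is no observation at time 0.\<close>

lemma pexp_steps_le_const:
  assumes f: "\<And>i y. f i y \<le> 1" and "k = 0 \<Longrightarrow> pexp 0 0 r \<le> C" "\<And>y. 0 < k \<Longrightarrow> f k y * pexp k y r \<le> C"
  shows "pexp 0 0 (steps f 0 k @ r) \<le> C"
proof (cases k)
  case (Suc l)
  have "steps f 0 k @ r = steps f 0 l @ (real k, f k) # r"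
    using steps_append[of 0 l k f] by (simp add: Suc steps_Cons)
  moreover have "pexp 0 0 (steps f 0 l @ (real k, f k) # r) \<le> C"
  proof (rule pexp_append_le)
    show "pexp s y ((real k, f k) # r) \<le> C" for s y
    proof -
      have "heat (real k - s) (\<lambda>y. f k y * pexp k y r) y \<le> heat (real k - s) (\<lambda>_. C) y"
        by (rule heat_mono) (use assms(3) Suc in simp)
      then show ?thesis by simp
    qed
  qed (auto simp: steps_def f)
  ultimately show ?thesis by simp
qed (use assms(2) in simp)

text \<open>Probability, in the frame of the line, that a branch leaving a fork at time
  \<open>s\<close> and height \<open>x\<close> meets the remaining constraints of a good particle at
  time \<open>j\<close>.\<close>

definition psi :: "nat \<Rightarrow> real \<Rightarrow> real \<Rightarrow> nat \<Rightarrow> nat \<Rightarrow> real \<Rightarrow> real \<Rightarrow> ennreal" where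
  "psi T D A j k s x = pexp s x (steps (gf T D A j) k j)"

text \<open>The contribution to the second moment of two particles at times \<open>j\<close> and \<open>j'\<close> whose common ancestor
  splits at a time \<open>s\<close> in \<open>{k<..k+1}\<close>, up to the factor \<open>exp (2 * sqrt 2 * (A + 1))\<close>.\<close>

definition pair_weight :: "nat \<Rightarrow> real \<Rightarrow> real \<Rightarrow> nat \<Rightarrow> nat \<Rightarrow> nat \<Rightarrow> real \<Rightarrow> ennreal" where
  "pair_weight T D A j j' k s = pexp 0 0 (steps (\<lambda>i y. gf T D A j i y * gf T D A j' i y) 0 k
     @ [(s, \<lambda>x. ennreal (exp (sqrt 2 * x)) * (psi T D A j k s x * psi T D A j' k s x))])"

lemma psi_le_1: "psi T D A j k s x \<le> 1"
  unfolding psi_def by (rule pexp_le_1) (auto simp: steps_def gf_le_1)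

lemma sqrt2_bounds: "7 / 5 < sqrt 2" "sqrt 2 < 3 / 2"
  by (rule real_less_rsqrt real_less_lsqrt; simp add: power2_eq_square)+

text \<open>The ballot bound is linear in the depth: \<open>2 - y\<close>. Bounding it by
  \<open>8 * exp (- y / 4)\<close> gives a function on which the heat kernel for the rest of the
  unit step acts explicitly; this step raises 8 to 9.\<close>

lemma psi_early:
  assumes ad: "admissible n r T D A" and j: "n \<le> j" and k: "k < T" "k \<le> s" "s \<le> real k + 1"
  shows "psi T D A j k s x \<le> ennreal (9 * (300 * (A + 3) / (n * sqrt n)) * exp (- (1 / 4) * x))"
proof -
  note ad' = admissibleD[OF ad]
  define q where "q = 300 * (A + 3) / (n * sqrt n)"
  let ?d = "real (Suc k) - s"
  have T: "Suc k < j" "3 \<le> j - Suc k" "real n \<le> 2 * real (j - Suc k)" "0 < n" using ad'(3,4) j k(1) by auto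
  have \<kappa>: "0 \<le> q" using ad'(7) by (simp add: q_def)
  have 1: "gf T D A j (Suc k) y * pexp (Suc k) y (steps (gf T D A j) (Suc k) j) \<le> ennreal (8 * q * exp (- (1 / 4) * y))" for y
  proof (cases "y \<le> 1")
    case True
    have "pexp (Suc k) y (steps (gf T D A j) (Suc k) j @ []) \<le> (kill 1 ^^ (j - Suc k)) (indicator {- A - 1..- A}) y"
    proof (rule pexp_steps_le_kill)
      show "gf T D A j i z \<le> indicator {..1} z" for i z by (rule gf_le_barrier[OF ad])
      show "gf T D A j j z * pexp j z [] \<le> indicator {..1} z * indicator {- A - 1..- A} z" for z
        using gf_last[of T j D A] T k ad'(7) ad'(4) j by (auto simp: indicator_def)
    qed (use T in auto)
    also have "\<dots> \<le> ennreal (q * (2 - y))" unfolding q_def using ad'(7) True T by (intro window_kill) auto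
    also have "\<dots> \<le> ennreal (8 * q * exp (- (1 / 4) * y))"
    proof -
      have "2 - y \<le> 8 * (1 + (- (1 / 4) * y))" using True by simp
      also have "\<dots> \<le> 8 * exp (- (1 / 4) * y)" by (intro mult_left_mono exp_ge_add_one_self) simp
      finally have "q * (2 - y) \<le> q * (8 * exp (- (1 / 4) * y))" using \<kappa> by (rule mult_left_mono)
      then show ?thesis by (intro ennreal_leI) (simp only: mult_ac)
    qed
    finally have "1 * pexp (Suc k) y (steps (gf T D A j) (Suc k) j) \<le> ennreal (8 * q * exp (- (1 / 4) * y))"
      by simp
    then show ?thesis using mult_right_mono[OF gf_le_1[of T D A j "Suc k" y], of "pexp (Suc k) y (steps (gf T D A j) (Suc k) j)"]
      by (rule order_trans[rotated]) simp
  next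
    case False
    then have "gf T D A j (Suc k) y \<le> 0" using gf_le_barrier[OF ad, of j "Suc k" y] by simp
    then show ?thesis by simp
  qed
  have "psi T D A j k s x = heat ?d (\<lambda>y. gf T D A j (Suc k) y * pexp (Suc k) y (steps (gf T D A j) (Suc k) j)) x"
    using T by (simp add: psi_def steps_Cons)
  also have "\<dots> \<le> heat ?d (\<lambda>y. ennreal (8 * q * exp (- (1 / 4) * y))) x"
    using 1 by (intro heat_mono) auto
  also have "\<dots> = ennreal (8 * q * exp (- (1 / 4) * x + (- (1 / 4))\<^sup>2 * ?d / 2))"
    using k \<kappa> by (intro heat_exp_scaled) auto
  also have "\<dots> \<le> ennreal (9 * q * exp (- (1 / 4) * x))"
  proof (rule ennreal_leI)
    have "exp ((- (1 / 4))\<^sup>2 * ?d / 2) \<le> exp (1 / 32)" using k by (simp add: power2_eq_square)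
    also have "exp (1 / 32) \<le> (9 / 8 :: real)"
    proof -
      have "exp (1 / 32 :: real) \<le> 1 + 1 / 32 + (1 / 32)\<^sup>2" by (rule exp_bound) auto
      also have "\<dots> \<le> 9 / 8" by (simp add: power2_eq_square)
      finally show ?thesis .
    qed
    finally have "(8 * q * exp (- (1 / 4) * x)) * exp ((- (1 / 4))\<^sup>2 * ?d / 2) \<le> (8 * q * exp (- (1 / 4) * x)) * (9 / 8)"
      using \<kappa> by (intro mult_left_mono) auto
    then show "8 * q * exp (- (1 / 4) * x + (- (1 / 4))\<^sup>2 * ?d / 2) \<le> 9 * q * exp (- (1 / 4) * x)"
      unfolding exp_add by simp
  qed
  finally show ?thesis unfolding q_def .
qed

lemma exp_3_2_le: "exp (3 / 2 :: real) \<le> 5"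
proof -
  have "exp (1 / 8 :: real) \<le> 1 + 1 / 8 + (1 / 8)\<^sup>2" by (rule exp_bound) auto
  also have "\<dots> \<le> 1141 / 1000" by (simp add: power2_eq_square)
  finally have "exp (1 / 8 :: real) ^ 12 \<le> (1141 / 1000) ^ 12" by (rule power_mono) simp
  also have "exp (1 / 8 :: real) ^ 12 = exp (3 / 2)" by (simp add: exp_of_nat_mult[symmetric])
  also have "(1141 / 1000 :: real) ^ 12 \<le> 5" by (simp add: power_divide)
  finally show ?thesis .
qed

text \<open>Both branches pay the ballot price, and their two factors \<open>exp (- x / 4)\<close>
  reduce \<open>exp (sqrt 2 * x)\<close> to \<open>exp (c * x)\<close>, which is bounded on average
  since the stem is at height at most 1 at time \<open>k\<close>. The constant is 405 = 81 *
  5.\<close>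

lemma pair_weight_early:
  assumes ad: "admissible n r T D A" and j: "n \<le> j" "n \<le> j'" and k: "k < T" "k \<le> s" "s \<le> real k + 1"
  shows "pair_weight T D A j j' k s \<le> ennreal (405 * (300 * (A + 3) / (n * sqrt n))\<^sup>2)"
proof -
  note ad' = admissibleD[OF ad]
  define q where "q = 300 * (A + 3) / (n * sqrt n)"
  have \<kappa>: "0 \<le> q" using ad'(7) by (simp add: q_def)
  define c where "c = sqrt 2 - 1 / 2"
  have c: "0 < c" "c \<le> 1" using sqrt2_bounds by (auto simp: c_def)
  have 1: "ennreal (exp (sqrt 2 * x)) * (psi T D A j k s x * psi T D A j' k s x) \<le> ennreal (81 * q\<^sup>2 * exp (c * x))" for x
  proof -
    have "ennreal (exp (sqrt 2 * x)) * (psi T D A j k s x * psi T D A j' k s x)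
        \<le> ennreal (exp (sqrt 2 * x)) * (ennreal (9 * q * exp (- (1 / 4) * x)) * ennreal (9 * q * exp (- (1 / 4) * x)))"
      unfolding q_def using j by (intro mult_left_mono mult_mono psi_early[OF ad _ k]) simp_all
    also have "\<dots> = ennreal (exp (sqrt 2 * x) * ((9 * q * exp (- (1 / 4) * x)) * (9 * q * exp (- (1 / 4) * x))))"
    proof -
      have "ennreal a * (ennreal b * ennreal b) = ennreal (a * (b * b))" if "0 \<le> a" "0 \<le> b" for a b
        using that by (simp add: ennreal_mult)
      then show ?thesis using \<kappa> by simp
    qed
    also have "exp (sqrt 2 * x) * ((9 * q * exp (- (1 / 4) * x)) * (9 * q * exp (- (1 / 4) * x)))
        = 81 * q\<^sup>2 * (exp (sqrt 2 * x) * exp (- (1 / 4) * x) * exp (- (1 / 4) * x))"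
      by (simp only: power2_eq_square) simp
    also have "exp (sqrt 2 * x) * exp (- (1 / 4) * x) * exp (- (1 / 4) * x) = exp (c * x)"
      unfolding exp_add[symmetric] by (simp add: c_def algebra_simps)
    finally show ?thesis .
  qed
  have 2: "pexp u y [(s, \<lambda>x. ennreal (exp (sqrt 2 * x)) * (psi T D A j k s x * psi T D A j' k s x))] \<le> ennreal (405 * q\<^sup>2)"
    if y: "y \<le> 1" and u: "u \<le> s" "s \<le> u + 1" for u y
  proof -
    have "heat (s - u) (\<lambda>x. ennreal (exp (sqrt 2 * x)) * (psi T D A j k s x * psi T D A j' k s x)) y \<le> heat (s - u) (\<lambda>x. ennreal (81 * q\<^sup>2 * exp (c * x))) y"
      using 1 by (intro heat_mono)
    also have "\<dots> = ennreal (81 * q\<^sup>2 * exp (c * y + c\<^sup>2 * (s - u) / 2))"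
      using u by (intro heat_exp_scaled) auto
    also have "\<dots> \<le> ennreal (81 * q\<^sup>2 * 5)"
    proof (intro ennreal_leI mult_left_mono)
      have "c\<^sup>2 * (s - u) \<le> 1 * 1" using c u by (intro mult_mono power_le_one) auto
      moreover have "c * y \<le> 1" by (rule order_trans[of _ "c * 1"]) (use c y in auto)
      ultimately have "exp (c * y + c\<^sup>2 * (s - u) / 2) \<le> exp (3 / 2)" using c by simp
      then show "exp (c * y + c\<^sup>2 * (s - u) / 2) \<le> 5" using exp_3_2_le by linarith
    qed simp
    finally show ?thesis by simp
  qed
  show ?thesis unfolding pair_weight_def q_def[symmetric]
  proof (rule pexp_steps_le_const)
    show "gf T D A j i y * gf T D A j' i y \<le> 1" for i y
      using mult_mono[OF gf_le_1[of T D A j i y] gf_le_1[of T D A j' i y]] by simp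
    show "pexp 0 0 [(s, \<lambda>x. ennreal (exp (sqrt 2 * x)) * (psi T D A j k s x * psi T D A j' k s x))] \<le> ennreal (405 * q\<^sup>2)" if "k = 0"
      using that k by (intro 2) auto
    show "gf T D A j k y * gf T D A j' k y * pexp k y [(s, \<lambda>x. ennreal (exp (sqrt 2 * x)) * (psi T D A j k s x * psi T D A j' k s x))] \<le> ennreal (405 * q\<^sup>2)" for y
    proof (cases "y \<le> 1")
      case True
      have "gf T D A j k y * gf T D A j' k y * pexp k y [(s, \<lambda>x. ennreal (exp (sqrt 2 * x)) * (psi T D A j k s x * psi T D A j' k s x))] \<le> 1 * 1 * ennreal (405 * q\<^sup>2)"
        using True k by (intro mult_mono 2 gf_le_1) auto
      then show ?thesis by simp
    next
      case False
      then have "gf T D A j k y \<le> 0" using gf_le_barrier[OF ad, of j k y] by simp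
      then show ?thesis by simp
    qed
  qed
qed

text \<open>Both branches are bounded by 1; \<open>exp 1\<close> covers the growth of the mean of
  \<open>exp (sqrt 2 * x)\<close> over at most one unit of time.\<close>

lemma pair_weight_last:
  assumes k: "0 < k" "k \<le> s" "s \<le> real k + 1" and b: "\<And>y. gf T D A j k y * gf T D A j' k y \<le> indicator {..b} y"
  shows "gf T D A j k y * gf T D A j' k y * pexp k y [(s, \<lambda>x. ennreal (exp (sqrt 2 * x)) * (psi T D A j k s x * psi T D A j' k s x))]
    \<le> indicator {..b} y * ennreal (exp (1 + sqrt 2 * y))"
proof (rule mult_mono)
  have "heat (s - k) (\<lambda>x. ennreal (exp (sqrt 2 * x)) * (psi T D A j k s x * psi T D A j' k s x)) y \<le> heat (s - k) (\<lambda>x. ennreal (exp (sqrt 2 * x))) y"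
    using mult_mono[OF psi_le_1[of T D A j k s] psi_le_1[of T D A j' k s]]
    by (intro heat_mono) (auto intro!: mult_left_le)
  also have "\<dots> \<le> ennreal (exp (1 + sqrt 2 * y))" using k by (subst heat_exp) (auto intro!: ennreal_leI)
  finally show "pexp k y [(s, \<lambda>x. ennreal (exp (sqrt 2 * x)) * (psi T D A j k s x * psi T D A j' k s x))] \<le> ennreal (exp (1 + sqrt 2 * y))"
    by simp
qed (use b in auto)

text \<open>The depth \<open>D\<close> of the stem at time \<open>k\<close> alone makes the weight
  small; it is imposed by the particle at time \<open>j'\<close>.\<close>

lemma pair_weight_middle:
  assumes ad: "admissible n r T D A" and k: "T \<le> k" "k \<le> j' - T" "k \<le> s" "s \<le> real k + 1"
  shows "pair_weight T D A j j' k s \<le> ennreal (exp (1 - sqrt 2 * D))"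
proof -
  note ad' = admissibleD[OF ad]
  have k0: "0 < k" using ad'(3) k by simp
  have b: "gf T D A j k y * gf T D A j' k y \<le> indicator {..- D} y" for y
  proof -
    have "gf T D A j k y * gf T D A j' k y \<le> 1 * gf T D A j' k y" by (intro mult_right_mono gf_le_1) simp
    also have "\<dots> \<le> indicator {..- D} y" using k by (simp add: gf_def G_def)
    finally show ?thesis .
  qed
  show ?thesis unfolding pair_weight_def
  proof (rule pexp_steps_le_const)
    show "gf T D A j i y * gf T D A j' i y \<le> 1" for i y
      using mult_mono[OF gf_le_1[of T D A j i y] gf_le_1[of T D A j' i y]] by simp
    show "gf T D A j k y * gf T D A j' k y * pexp k y [(s, \<lambda>x. ennreal (exp (sqrt 2 * x)) * (psi T D A j k s x * psi T D A j' k s x))] \<le> ennreal (exp (1 - sqrt 2 * D))" for y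
      by (rule order_trans[OF pair_weight_last[OF k0 k(3,4) b]]) (use mult_left_mono[of y "- D" "sqrt 2"] in \<open>auto simp: indicator_def intro!: ennreal_leI\<close>)
  qed (use k0 in auto)
qed

text \<open>With \<open>z\<close> the depth below \<open>1 - A\<close>, the linear factor
  \<open>1 + A + z\<close> is at most \<open>(A + 1) * exp z\<close>, which leaves an exponential
  density of rate \<open>l = sqrt 2 - 1\<close>.\<close>

lemma integral_exp_barrier:
  assumes A: "0 \<le> A"
  shows "(\<integral>\<^sup>+y\<in>{..1}. (indicator {..1 - A} y * ennreal (exp (1 + sqrt 2 * y))) * ennreal (1 - y + 1) \<partial>lborel)
    \<le> ennreal (3 * exp (1 + sqrt 2) * (A + 1) * exp (- sqrt 2 * A))"
proof -
  define l where "l = sqrt 2 - 1"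
  have l: "2 / 5 < l" using sqrt2_bounds by (simp add: l_def)
  let ?K = "(A + 1) * exp (1 + sqrt 2 * (1 - A)) / l"
  have K: "0 \<le> ?K" using A l by simp
  have "(\<integral>\<^sup>+y\<in>{..1}. (indicator {..1 - A} y * ennreal (exp (1 + sqrt 2 * y))) * ennreal (1 - y + 1) \<partial>lborel)
      = (\<integral>\<^sup>+z. (indicator {..1 - A} ((1 - A) + (-1) * z) * ennreal (exp (1 + sqrt 2 * ((1 - A) + (-1) * z)))) * ennreal (1 - ((1 - A) + (-1) * z) + 1) * indicator {..1} ((1 - A) + (-1) * z) \<partial>lborel)"
    by (subst nn_integral_real_affine[where c = "- 1" and t = "1 - A"]) auto
  also have "\<dots> \<le> (\<integral>\<^sup>+z. ennreal ?K * ennreal (exponential_density l z) \<partial>lborel)"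
  proof (rule nn_integral_mono)
    fix z :: real
    show "(indicator {..1 - A} ((1 - A) + (-1) * z) * ennreal (exp (1 + sqrt 2 * ((1 - A) + (-1) * z)))) * ennreal (1 - ((1 - A) + (-1) * z) + 1) * indicator {..1} ((1 - A) + (-1) * z)
      \<le> ennreal ?K * ennreal (exponential_density l z)"
    proof (cases "0 \<le> z")
      case True
      have "1 + A + z \<le> (A + 1) * (1 + z)" using A True by (simp add: algebra_simps)
      also have "\<dots> \<le> (A + 1) * exp z" using A by (intro mult_left_mono exp_ge_add_one_self) auto
      finally have "exp (1 + sqrt 2 * (1 - A - z)) * (1 + A + z) \<le> exp (1 + sqrt 2 * (1 - A - z)) * ((A + 1) * exp z)"
        by (intro mult_left_mono) auto
      also have "\<dots> = (A + 1) * (exp (1 + sqrt 2 * (1 - A - z)) * exp z)" by simp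
      also have "exp (1 + sqrt 2 * (1 - A - z)) * exp z = exp (1 + sqrt 2 * (1 - A)) * exp (- z * l)"
        unfolding exp_add[symmetric] by (simp add: l_def algebra_simps)
      finally have *: "exp (1 + sqrt 2 * (1 - A - z)) * (1 + A + z) \<le> ?K * (l * exp (- z * l))"
        using l by simp
      have "ennreal (exp (1 + sqrt 2 * (1 - A - z))) * ennreal (1 + A + z) \<le> ennreal ?K * ennreal (l * exp (- z * l))"
        using * A True l K by (subst (1 2) ennreal_mult[symmetric]) (auto simp del: ennreal_plus intro: ennreal_leI)
      moreover have "1 - (1 - A + - 1 * z) + 1 = 1 + A + z" "1 - A + - 1 * z = 1 - A - z" by simp_all
      ultimately show ?thesis using True A by (simp only:) (auto simp: exponential_density_def indicator_def simp del: ennreal_plus)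
    qed (simp add: indicator_def)
  qed
  also have "\<dots> = ennreal ?K"
    using prob_space.emeasure_space_1[OF prob_space_exponential_density[of l]] l
    by (simp add: emeasure_density nn_integral_cmult del: ennreal_plus)
  also have "\<dots> \<le> ennreal (3 * exp (1 + sqrt 2) * (A + 1) * exp (- sqrt 2 * A))"
  proof (rule ennreal_leI)
    have "exp (1 + sqrt 2 * (1 - A)) = exp (1 + sqrt 2) * exp (- sqrt 2 * A)"
      unfolding exp_add[symmetric] by (simp add: algebra_simps)
    moreover have "(A + 1) * (exp (1 + sqrt 2) * exp (- sqrt 2 * A)) * (1 / l) \<le> (A + 1) * (exp (1 + sqrt 2) * exp (- sqrt 2 * A)) * 3"
      using A l by (intro mult_left_mono) (auto simp: field_simps)
    ultimately show "?K \<le> 3 * exp (1 + sqrt 2) * (A + 1) * exp (- sqrt 2 * A)" by (simp add: mult_ac)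
  qed
  finally show ?thesis .
qed

text \<open>Here the stem pays the ballot price over its \<open>k\<close> steps and the branches are
  bounded by 1. Its height at time \<open>k\<close> is at most \<open>1 - A\<close>, which supplies
  \<open>exp (- sqrt 2 * A)\<close>.\<close>

lemma pair_weight_late:
  assumes ad: "admissible n r T D A" and j: "n \<le> j" "n \<le> j'"
    and k: "T \<le> k" "j - T < k" "j' - T < k" "k < j" "k < j'" "k \<le> s" "s \<le> real k + 1"
  shows "pair_weight T D A j j' k s \<le> ennreal (1800 * exp (1 + sqrt 2) * (A + 1) * exp (- sqrt 2 * A) / (n * sqrt n))"
proof -
  note ad' = admissibleD[OF ad]
  have k0: "0 < k" "3 \<le> k" "real n \<le> 2 * real k" "0 < n" using ad'(3,4) k j by auto
  have b: "gf T D A j k y * gf T D A j' k y \<le> indicator {..1 - A} y" for y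
  proof -
    have "gf T D A j k y * gf T D A j' k y \<le> 1 * gf T D A j' k y" by (intro mult_right_mono gf_le_1) simp
    also have "\<dots> \<le> indicator {..1 - A} y" using k by (simp add: gf_def G_def)
    finally show ?thesis .
  qed
  have "pexp (real 0) 0 (steps (\<lambda>i y. gf T D A j i y * gf T D A j' i y) 0 k
     @ [(s, \<lambda>x. ennreal (exp (sqrt 2 * x)) * (psi T D A j k s x * psi T D A j' k s x))])
     \<le> (kill 1 ^^ (k - 0)) (\<lambda>y. indicator {..1 - A} y * ennreal (exp (1 + sqrt 2 * y))) 0"
  proof (rule pexp_steps_le_kill)
    show "gf T D A j i y * gf T D A j' i y \<le> indicator {..1} y" for i y
      using mult_mono[OF gf_le_1[of T D A j i y] gf_le_barrier[OF ad, of j' i y]] by simp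
    show "gf T D A j k y * gf T D A j' k y * pexp k y [(s, \<lambda>x. ennreal (exp (sqrt 2 * x)) * (psi T D A j k s x * psi T D A j' k s x))]
      \<le> indicator {..1} y * (indicator {..1 - A} y * ennreal (exp (1 + sqrt 2 * y)))" for y
      by (rule order_trans[OF pair_weight_last[OF k0(1) k(6,7) b]]) (use ad'(7) in \<open>auto simp: indicator_def\<close>)
  qed (use k0 in auto)
  also have "\<dots> \<le> ennreal (100 * (1 - 0 + 1) / (k * sqrt k)) * (\<integral>\<^sup>+y\<in>{..1}. (indicator {..1 - A} y * ennreal (exp (1 + sqrt 2 * y))) * ennreal (1 - y + 1) \<partial>lborel)"
    unfolding diff_zero by (rule order_trans[OF kill_pow_le]) (use k0 in auto)
  also have "\<dots> \<le> ennreal (100 * (1 - 0 + 1) / (k * sqrt k)) * ennreal (3 * exp (1 + sqrt 2) * (A + 1) * exp (- sqrt 2 * A))"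
    by (intro mult_left_mono integral_exp_barrier ad') simp
  also have "\<dots> = ennreal (600 * exp (1 + sqrt 2) * (A + 1) * exp (- sqrt 2 * A) * (1 / (k * sqrt k)))"
    using ad'(7) by (subst ennreal_mult[symmetric]) (auto simp: mult_ac)
  also have "\<dots> \<le> ennreal (600 * exp (1 + sqrt 2) * (A + 1) * exp (- sqrt 2 * A) * (3 / (n * sqrt n)))"
    using ad'(7) half_power[of n k] k0 by (intro ennreal_leI mult_left_mono) auto
  also have "600 * exp (1 + sqrt 2) * (A + 1) * exp (- sqrt 2 * A) * (3 / (n * sqrt n)) = 1800 * exp (1 + sqrt 2) * (A + 1) * exp (- sqrt 2 * A) / (n * sqrt n)"
    by simp
  finally show ?thesis by (simp add: pair_weight_def)
qed

section \<open>Decomposition of pairs by their last common ancestor\<close>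

lemma nn_integral_count_space_subset_le:
  fixes h :: "'p \<Rightarrow> ennreal"
  shows "(\<integral>\<^sup>+p. h p \<partial>count_space X) \<le> (\<integral>\<^sup>+p. h p \<partial>count_space UNIV)"
proof -
  have "(\<integral>\<^sup>+p. h p \<partial>count_space X) = (\<integral>\<^sup>+p. h p * indicator X p \<partial>count_space UNIV)"
    by (simp add: nn_integral_restrict_space[symmetric] restrict_count_space)
  also have "\<dots> \<le> (\<integral>\<^sup>+p. h p \<partial>count_space UNIV)"
    by (intro nn_integral_mono) (simp split: split_indicator)
  finally show ?thesis .
qed

text \<open>Choosing one preimage per point bounds a sum over pairs by a sum over fork data without
  an injectivity argument.\<close>

lemma nn_integral_count_space_le_image:
  fixes H :: "'q \<Rightarrow> ennreal" and h :: "'p \<Rightarrow> ennreal"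
  assumes "\<And>q. H q \<noteq> 0 \<Longrightarrow> \<exists>p. \<phi> p = q \<and> H q \<le> h p"
  shows "(\<integral>\<^sup>+q. H q \<partial>count_space UNIV) \<le> (\<integral>\<^sup>+p. h p \<partial>count_space UNIV)"
proof -
  define S where "S = {q. H q \<noteq> 0}"
  define \<psi> where "\<psi> q = (SOME p. \<phi> p = q \<and> H q \<le> h p)" for q
  have \<psi>: "\<phi> (\<psi> q) = q" "H q \<le> h (\<psi> q)" if "q \<in> S" for q
    using someI_ex[OF assms[of q]] that unfolding S_def \<psi>_def by blast+
  have b: "bij_betw \<psi> S (\<psi> ` S)" using \<psi>(1) by (intro bij_betw_imageI inj_on_inverseI[of _ \<phi>]) auto
  have "(\<integral>\<^sup>+q. H q \<partial>count_space UNIV) = (\<integral>\<^sup>+q. H q \<partial>count_space S)"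
    by (rule nn_integral_count_space_eq) (auto simp: S_def)
  also have "\<dots> \<le> (\<integral>\<^sup>+q. h (\<psi> q) \<partial>count_space S)" using \<psi>(2) by (intro nn_integral_mono) auto
  also have "\<dots> = (\<integral>\<^sup>+p. h p \<partial>count_space (\<psi> ` S))" by (rule nn_integral_bij_count_space[OF b])
  also have "\<dots> \<le> (\<integral>\<^sup>+p. h p \<partial>count_space UNIV)"
    by (rule nn_integral_count_space_subset_le)
  finally show ?thesis .
qed

text \<open>\<open>w\<close> is the last common ancestor. Ancestors are suffixes because the most
  recent branching comes first, so the decomposition of incomparable prefixes is applied to reversed
  labels.\<close>

lemma incomparable_decomp:
  assumes "\<not> suffix u v" "\<not> suffix v u"
  shows "\<exists>w b u' v'. u = u' @ b # w \<and> v = v' @ (\<not> b) # w"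
proof -
  have "rev u \<parallel> rev v" using assms unfolding suffix_to_prefix by (rule parallelI)
  from parallel_decomp[OF this] obtain as b bs c cs where bc: "b \<noteq> c" "rev u = as @ b # bs" "rev v = as @ c # cs"
    by blast
  have "c = (\<not> b)" using bc(1) by auto
  moreover have "u = rev (as @ b # bs)" "v = rev (as @ c # cs)" unfolding bc(2,3)[symmetric] by (rule rev_rev_ident[symmetric])+
  ultimately have "u = rev bs @ b # rev as \<and> v = rev cs @ (\<not> b) # rev as"
    by (simp only: rev.simps rev_append append_assoc append_Cons append_Nil)
  then show ?thesis by (intro exI)
qed

lemma obs_tilt_steps_mult:
  "obs p (tilt (steps f k n)) * obs p (tilt (steps g k n)) = obs p (tilt (steps (\<lambda>i y. f i y * g i y) k n))"
proof -
  have "obs p (tilt (map (\<lambda>i. (real i, f i)) I)) * obs p (tilt (map (\<lambda>i. (real i, g i)) I))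
      = obs p (tilt (map (\<lambda>i. (real i, \<lambda>y. f i y * g i y)) I))" for I
  proof (induction I)
    case (Cons i I)
    have "f i z * a * (g i z * b) = f i z * g i z * (a * b)" for z a b by (simp only: mult_ac)
    then show ?case using Cons by simp
  qed simp
  then show ?thesis by (simp only: steps_def)
qed

lemma obs_le_1: "(\<And>s f x. (s, f) \<in> set r \<Longrightarrow> f x \<le> 1) \<Longrightarrow> obs p r \<le> 1"
proof (induction r)
  case (Cons sf r)
  obtain s f where sf: "sf = (s, f)" by force
  have "obs p r \<le> 1" by (rule Cons.IH) (use Cons.prems in auto)
  then have "f (p s) * obs p r \<le> 1 * 1" using Cons.prems[of s f] by (intro mult_mono) (auto simp: sf)
  then show ?case by (simp add: sf)
qed simp

lemma obs_tilt_steps_nonzero: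
  assumes "obs p (tilt (steps f k n)) \<noteq> 0" "k < i" "i \<le> n"
  shows "f i (p i - sqrt 2 * i) \<noteq> 0"
proof -
  have "(real i, f i) \<in> set (steps f k n)" using assms(2,3) by (auto simp: steps_def simp del: upt_Suc)
  moreover have nz: "obs q r \<noteq> 0 \<Longrightarrow> (s, g) \<in> set r \<Longrightarrow> g (q s) \<noteq> 0" for q r s g
    by (induction r) auto
  ultimately show ?thesis using nz[of "\<lambda>t. p t - sqrt 2 * t"] assms(1) unfolding obs_tilt by blast
qed

lemma borel_list_tilt_steps: "(\<And>i. f i \<in> borel_measurable borel) \<Longrightarrow> borel_list (tilt (steps f k n))"
  by (intro tilt_simps borel_list_steps)

context branching_data
begin

definition good :: "nat \<Rightarrow> real \<Rightarrow> real \<Rightarrow> nat \<Rightarrow> particle \<Rightarrow> 'a \<Rightarrow> ennreal" where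
  "good T D A j u \<omega> = indicator (N \<omega> j) u * obs (U \<omega> u) (tilt (steps (gf T D A j) 0 j))"

definition good_count :: "nat \<Rightarrow> real \<Rightarrow> real \<Rightarrow> nat \<Rightarrow> 'a \<Rightarrow> ennreal" where
  "good_count T D A j \<omega> = (\<integral>\<^sup>+u. good T D A j u \<omega> \<partial>count_space UNIV)"

lemma good_measurable [measurable]: "good T D A j u \<in> borel_measurable M"
proof -
  have [measurable]: "(\<lambda>\<omega>. obs (U \<omega> u) (tilt (steps (gf T D A j) 0 j))) \<in> borel_measurable M"
    by (rule obs_measurable) (auto intro: borel_list_tilt_steps)
  show ?thesis unfolding good_def by measurable
qed

lemma good_count_measurable [measurable]: "good_count T D A j \<in> borel_measurable M"
  unfolding good_count_def by (intro count_space_measurable) measurable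

lemma good_le_1: "good T D A j u \<omega> \<le> 1"
proof -
  have "good T D A j u \<omega> \<le> 1 * 1" unfolding good_def
    by (intro mult_mono obs_le_1) (auto simp: indicator_def tilt_def steps_def gf_le_1 simp del: upt_Suc)
  then show ?thesis by simp
qed

lemma good_count_mean:
  assumes "0 < j"
  shows "(\<integral>\<^sup>+\<omega>. good_count T D A j \<omega> \<partial>M) = pexp 0 0 (steps (gf T D A j) 0 j @ [(real j, \<lambda>y. ennreal (exp (- sqrt 2 * y)))])"
proof -
  have "(\<integral>\<^sup>+\<omega>. good_count T D A j \<omega> \<partial>M) = (\<integral>\<^sup>+u. (\<integral>\<^sup>+\<omega>. good T D A j u \<omega> \<partial>M) \<partial>count_space UNIV)"
    unfolding good_count_def by (rule nn_integral_count_space_nn_integral) auto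
  also have "\<dots> = ennreal (exp (real j)) * pexp 0 0 (fold_list (\<lambda>x. x) (tilt (steps (gf T D A j) 0 j)))"
    unfolding good_def by (rule many_to_one) (auto simp: folding_def fst_set_steps sorted_steps intro: borel_list_tilt_steps)
  also have "\<dots> = ennreal (exp (real j - 0)) * pexp 0 (0 + sqrt 2 * 0) (tilt (steps (gf T D A j) 0 j))" by simp
  also have "\<dots> = ennreal (exp (sqrt 2 * 0)) * pexp 0 0 (steps (gf T D A j) 0 j @ [(real j, \<lambda>y. ennreal (exp (- sqrt 2 * y)))])"
    by (rule pexp_tilt_steps) (use assms in auto)
  finally show ?thesis by simp
qed

lemma good_witness:
  assumes "good T D A j u \<omega> \<noteq> 0" "0 < T" "T \<le> j"
  shows "u \<in> N \<omega> j \<and> sqrt 2 * j - A - 1 \<le> U \<omega> u j"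
proof -
  have "u \<in> N \<omega> j" "obs (U \<omega> u) (tilt (steps (gf T D A j) 0 j)) \<noteq> 0"
    using assms(1) by (auto simp: good_def indicator_def split: if_splits)
  moreover from obs_tilt_steps_nonzero[OF this(2), of j] have "gf T D A j j (U \<omega> u j - sqrt 2 * j) \<noteq> 0"
    using assms by simp
  ultimately show ?thesis using gf_last[of T j D A] assms by (auto simp: indicator_def split: if_splits)
qed

text \<open>If \<open>j' < j + T\<close>, each \<open>v\<close> has at most one ancestor alive at
  \<open>j\<close>, so the sum is at most the count at \<open>j'\<close>. Otherwise \<open>j\<close>
  lies in the bulk for \<open>v\<close>, whose path is then at most \<open>- D\<close> relative to
  the line, whereas a good particle at its own time \<open>j\<close> is at least at
  \<open>- A - 1 > - D\<close>.\<close>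

lemma comparable_pairs:
  assumes reg: "regular \<omega>" and ad: "admissible n r T D A" and j: "n \<le> j" "j \<le> j'"
  shows "(\<integral>\<^sup>+u. (\<integral>\<^sup>+v. good T D A j u \<omega> * good T D A j' v \<omega> * indicator {(u, v). suffix u v} (u, v) \<partial>count_space UNIV) \<partial>count_space UNIV)
    \<le> (if j' < j + T then good_count T D A j' \<omega> else 0)"
proof -
  note ad' = admissibleD[OF ad]
  have T: "0 < T" "T \<le> j" using ad'(3,4) j by auto
  let ?f = "\<lambda>u v. good T D A j u \<omega> * good T D A j' v \<omega> * indicator {(u, v). suffix u v} (u, v)"
  have alive_u: "u \<in> N \<omega> j" if "good T D A j u \<omega> \<noteq> 0" for u
    using good_witness[OF that] T by simp
  show ?thesis
  proof (cases "j' < j + T")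
    case True
    have one: "(\<integral>\<^sup>+u. ?f u v \<partial>count_space UNIV) \<le> good T D A j' v \<omega>" for v
    proof (cases "\<exists>u0. ?f u0 v \<noteq> 0")
      case True
      then obtain u0 where u0: "?f u0 v \<noteq> 0" by blast
      have "(\<integral>\<^sup>+u. ?f u v \<partial>count_space UNIV) = (\<Sum>u\<in>{u0}. ?f u v)"
      proof (rule nn_integral_count_space')
        show "?f u v = 0" if "u \<notin> {u0}" for u
        proof (rule ccontr)
          assume "?f u v \<noteq> 0"
          then have s: "suffix u v" "suffix u0 v" "u \<in> N \<omega> j" "u0 \<in> N \<omega> j" "u \<noteq> u0"
            using u0 that alive_u by (auto simp: indicator_def split: if_splits)
          then consider "suffix u u0" | "suffix u0 u" using suffix_same_cases by blast
          then show False
            using birth_time_suffix[of "\<lambda>v. L v \<omega>" u u0] birth_time_suffix[of "\<lambda>v. L v \<omega>" u0 u] s regularD(1)[OF reg]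
            by cases (auto simp: alive_def)
        qed
      qed auto
      also have "\<dots> \<le> 1 * good T D A j' v \<omega> * 1" by (simp only: sum.insert_if sum.empty finite.intros empty_iff if_False add_0_right, intro mult_mono good_le_1) (auto simp: indicator_def)
      finally show ?thesis by simp
    next
      case False
      then have "(\<integral>\<^sup>+u. ?f u v \<partial>count_space UNIV) = (\<integral>\<^sup>+u. 0 \<partial>count_space (UNIV :: particle set))"
        by (intro nn_integral_cong) blast
      then show ?thesis by simp
    qed
    have "(\<integral>\<^sup>+u. (\<integral>\<^sup>+v. ?f u v \<partial>count_space UNIV) \<partial>count_space UNIV) = (\<integral>\<^sup>+v. (\<integral>\<^sup>+u. ?f u v \<partial>count_space UNIV) \<partial>count_space UNIV)"
      by (rule nn_integral_count_space_nn_integral) auto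
    also have "\<dots> \<le> good_count T D A j' \<omega>" unfolding good_count_def by (intro nn_integral_mono one)
    finally show ?thesis using True by simp
  next
    case False
    have "?f u v = 0" for u v
    proof (rule ccontr)
      assume nz: "?f u v \<noteq> 0"
      then have s: "suffix u v" "good T D A j u \<omega> \<noteq> 0" "good T D A j' v \<omega> \<noteq> 0" by (auto simp: indicator_def)
      have "obs (U \<omega> v) (tilt (steps (gf T D A j') 0 j')) \<noteq> 0" using s(3) by (auto simp: good_def)
      from obs_tilt_steps_nonzero[OF this, of j] have "gf T D A j' j (U \<omega> v j - sqrt 2 * j) \<noteq> 0" using T j by simp
      then have "U \<omega> v j - sqrt 2 * j \<le> - D" using T False j by (auto simp: gf_def G_def indicator_def split: if_splits)
      moreover have "U \<omega> v j = U \<omega> u j"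
        using alive_u[OF s(2)] s(1) regularD(1)[OF reg] by (intro path_ancestor) (auto simp: alive_def)
      ultimately show False using good_witness[OF s(2)] T ad'(8) by simp
    qed
    then show ?thesis using False by (simp only: if_False) simp
  qed
qed

text \<open>A pair of good particles written in the shape of the many-to-two formula: the
  constraints of both up to time \<open>k\<close> are put on the common ancestor \<open>w\<close>,
  the later ones on the two descendants.\<close>

definition fork :: "nat \<Rightarrow> real \<Rightarrow> real \<Rightarrow> nat \<Rightarrow> nat \<Rightarrow> nat \<Rightarrow> bool \<Rightarrow> particle \<Rightarrow> particle \<Rightarrow> particle \<Rightarrow> 'a \<Rightarrow> ennreal" where
  "fork T D A j j' k b w u v \<omega> = indicator {real k<..real k+1} (death w \<omega>) * obs (U \<omega> w) (tilt (steps (\<lambda>i y. gf T D A j i y * gf T D A j' i y) 0 k))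
        * (indicator (N \<omega> j) (u @ b # w) * obs (U \<omega> (u @ b # w)) (tilt (steps (gf T D A j) k j)))
        * (indicator (N \<omega> j') (v @ (\<not> b) # w) * obs (U \<omega> (v @ (\<not> b) # w)) (tilt (steps (gf T D A j') k j')))"

lemma fork_measurable [measurable]: "fork T D A j j' k b w u v \<in> borel_measurable M"
proof -
  have [measurable]: "(\<lambda>\<omega>. obs (U \<omega> u) (tilt (steps f k n))) \<in> borel_measurable M"
    if "\<And>i. f i \<in> borel_measurable borel" for u f k n
    by (rule obs_measurable) (auto intro: borel_list_tilt_steps that)
  show ?thesis unfolding fork_def by measurable
qed

lemma fork_eq:
  assumes reg: "regular \<omega>" and k: "k < j" "k < j'" and d: "real k < death w \<omega>" "death w \<omega> \<le> real k + 1"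
  shows "fork T D A j j' k b w u v \<omega> = good T D A j (u @ b # w) \<omega> * good T D A j' (v @ (\<not> b) # w) \<omega>"
proof -
  have anc: "U \<omega> (z @ c # w) i = U \<omega> w i" if "i \<le> real k" for z c i
    using regularD(1)[OF reg] that d(1) by (intro path_ancestor) (auto simp: suffix_def death_def)
  have split: "obs (U \<omega> (z @ c # w)) (tilt (steps f 0 i)) = obs (U \<omega> w) (tilt (steps f 0 k)) * obs (U \<omega> (z @ c # w)) (tilt (steps f k i))"
    if "k < i" for z c i f
  proof -
    have "obs (U \<omega> (z @ c # w)) (tilt (steps f 0 k)) = obs (U \<omega> w) (tilt (steps f 0 k))"
      by (rule obs_cong, rule anc) (auto simp: fst_set_steps)
    then show ?thesis using that steps_append[of 0 k i f] by simp
  qed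
  show ?thesis
  proof -
    have "1 * (a * b) * (i * p) * (i' * p') = i * (a * p) * (i' * (b * p'))" for a b i i' p p' :: ennreal
      by (simp add: mult_ac)
    moreover have "indicator {real k<..real k+1} (death w \<omega>) = (1 :: ennreal)" using d by simp
    ultimately show ?thesis
      unfolding fork_def good_def split[OF k(1)] split[OF k(2)] obs_tilt_steps_mult[symmetric] by simp
  qed
qed

lemma incomparable_pairs:
  assumes reg: "regular \<omega>" and death: "\<And>w. 0 < death w \<omega>" and T: "0 < T" "T \<le> j" and j: "j \<le> j'"
  shows "(\<integral>\<^sup>+u. (\<integral>\<^sup>+v. good T D A j u \<omega> * good T D A j' v \<omega> * indicator {(u, v). \<not> suffix u v} (u, v) \<partial>count_space UNIV) \<partial>count_space UNIV)
    \<le> (\<Sum>k<j. \<Sum>b\<in>UNIV. \<integral>\<^sup>+w. (\<integral>\<^sup>+u. (\<integral>\<^sup>+v. fork T D A j j' k b w u v \<omega> \<partial>count_space UNIV) \<partial>count_space UNIV) \<partial>count_space UNIV)"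
proof -
  define H where "H = (\<lambda>(u, v). good T D A j u \<omega> * good T D A j' v \<omega> * indicator {(u, v). \<not> suffix u v} (u, v))"
  define h where "h = (\<lambda>(k, b, w, u, v). indicator {..<j} k * fork T D A j j' k b w u v \<omega>)"
  define \<phi> where "\<phi> = (\<lambda>(k :: nat, b, w :: particle, u, v). (u @ b # w, v @ (\<not> b) # w))"
  have fin: "(\<integral>\<^sup>+k. indicator {..<j} k * g k \<partial>count_space UNIV) = (\<Sum>k<j. g k)" for g :: "nat \<Rightarrow> ennreal"
  proof -
    have "(\<integral>\<^sup>+k. indicator {..<j} k * g k \<partial>count_space UNIV) = (\<Sum>k<j. indicator {..<j} k * g k)"
      by (rule nn_integral_count_space') auto
    also have "\<dots> = (\<Sum>k<j. g k)" by (rule sum.cong) simp_all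
    finally show ?thesis .
  qed
  have "(\<integral>\<^sup>+u. (\<integral>\<^sup>+v. H (u, v) \<partial>count_space UNIV) \<partial>count_space UNIV) = (\<integral>\<^sup>+q. H q \<partial>count_space UNIV)"
    by (rule nn_integral_fst_count_space)
  also have "\<dots> \<le> (\<integral>\<^sup>+p. h p \<partial>count_space UNIV)"
  proof (rule nn_integral_count_space_le_image[of _ \<phi>])
    fix q assume nz: "H q \<noteq> 0"
    obtain u v where q: "q = (u, v)" by force
    have g: "good T D A j u \<omega> \<noteq> 0" "good T D A j' v \<omega> \<noteq> 0" "\<not> suffix u v" using nz by (auto simp: H_def q)
    have al: "u \<in> N \<omega> j" "v \<in> N \<omega> j'" using good_witness[OF g(1)] good_witness[OF g(2)] T j by auto
    have "\<not> suffix v u"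
    proof
      assume "suffix v u"
      moreover have "v \<noteq> u" using g(3) by auto
      ultimately show False using birth_time_suffix[of "\<lambda>v. L v \<omega>" v u] regularD(1)[OF reg] al j by (auto simp: alive_def)
    qed
    from incomparable_decomp[OF g(3) this] obtain w b u' v' where uv: "u = u' @ b # w" "v = v' @ (\<not> b) # w" by blast
    have dj: "death w \<omega> \<le> j"
    proof (cases "u = b # w")
      case True
      then show ?thesis using al(1) birth_eq_death[of \<omega> b w] by (simp add: alive_def del: birth_time.simps)
    next
      case False
      then have "birth_time (\<lambda>v. L v \<omega>) (b # w) + L (b # w) \<omega> \<le> birth_time (\<lambda>v. L v \<omega>) u"
        using regularD(1)[OF reg] uv by (intro birth_time_suffix) (auto simp: suffix_def)
      then show ?thesis using al(1) birth_eq_death[of \<omega> b w] regularD(1)[OF reg, of "b # w"] by (simp add: alive_def del: birth_time.simps)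
    qed
    \<comment> \<open>The unit interval that contains the fork. Positivity of
      \<open>death w \<omega>\<close> makes \<open>k\<close> a natural number, and openness on the
      left gives \<open>k < death w \<omega> \<le> j\<close>.\<close>
    define k where "k = nat (\<lceil>death w \<omega>\<rceil> - 1)"
    have k: "real k < death w \<omega>" "death w \<omega> \<le> real k + 1" using death[of w] by (auto simp: k_def) linarith+
    then have kj: "k < j" using dj by linarith
    have "H q = h (k, b, w, u', v')"
      using fork_eq[OF reg kj _ k, of j' T D A b u' v'] kj j g(3) by (simp add: h_def H_def q uv)
    then show "\<exists>p. \<phi> p = q \<and> H q \<le> h p" by (intro exI[of _ "(k, b, w, u', v')"]) (auto simp: \<phi>_def q uv)
  qed
  also have "\<dots> = (\<integral>\<^sup>+k. \<integral>\<^sup>+b. \<integral>\<^sup>+w. \<integral>\<^sup>+u. \<integral>\<^sup>+v. h (k, b, w, u, v) \<partial>count_space UNIV \<partial>count_space UNIV \<partial>count_space UNIV \<partial>count_space UNIV \<partial>count_space UNIV)"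
    by (rule trans[OF nn_integral_fst_count_space[symmetric] nn_integral_cong])+ (rule refl)
  also have "\<dots> = (\<integral>\<^sup>+k. indicator {..<j} k * (\<integral>\<^sup>+b. \<integral>\<^sup>+w. \<integral>\<^sup>+u. \<integral>\<^sup>+v. fork T D A j j' k b w u v \<omega> \<partial>count_space UNIV \<partial>count_space UNIV \<partial>count_space UNIV \<partial>count_space UNIV) \<partial>count_space UNIV)"
    by (simp add: h_def nn_integral_cmult)
  also have "\<dots> = (\<Sum>k<j. \<Sum>b\<in>UNIV. \<integral>\<^sup>+w. (\<integral>\<^sup>+u. (\<integral>\<^sup>+v. fork T D A j j' k b w u v \<omega> \<partial>count_space UNIV) \<partial>count_space UNIV) \<partial>count_space UNIV)"
    unfolding fin by (simp add: nn_integral_count_space_finite)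
  finally show ?thesis by (simp add: H_def)
qed

end

lemma pexp_append_mono:
  assumes "\<And>s y. pexp s y r \<le> pexp s y r'"
  shows "pexp t x (a @ r) \<le> pexp t x (a @ r')"
proof (induction a arbitrary: t x)
  case (Cons sf a)
  obtain s f where sf: "sf = (s, f)" by force
  show ?case by (auto simp: sf intro!: heat_mono mult_left_mono Cons.IH)
qed (use assms in simp)

lemma tilt_weight_le:
  assumes T: "0 < T" "T \<le> j" and k: "k < j"
  shows "pexp s x (steps (gf T D A j) k j @ [(real j, \<lambda>y. ennreal (exp (- sqrt 2 * y)))])
    \<le> ennreal (exp (sqrt 2 * (A + 1))) * psi T D A j k s x"
proof -
  let ?a = "steps (gf T D A j) k (j - 1)"
  have st: "steps (gf T D A j) k j = ?a @ [(real j, gf T D A j j)]"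
    using steps_append[of k "j - 1" j "gf T D A j"] k by (simp add: steps_Cons)
  have "pexp s x (?a @ [(real j, gf T D A j j), (real j, \<lambda>y. ennreal (exp (- sqrt 2 * y)))])
    \<le> pexp s x (?a @ [(real j, \<lambda>y. ennreal (exp (sqrt 2 * (A + 1))) * gf T D A j j y)])"
  proof (rule pexp_append_mono)
    fix s y
    have "gf T D A j j z * ennreal (exp (- sqrt 2 * z)) \<le> ennreal (exp (sqrt 2 * (A + 1))) * gf T D A j j z" for z
      using gf_last[OF T] mult_left_mono[of "- A - 1" z "sqrt 2"]
      by (auto simp: indicator_def algebra_simps intro!: ennreal_leI)
    then show "pexp s y [(real j, gf T D A j j), (real j, \<lambda>y. ennreal (exp (- sqrt 2 * y)))] \<le> pexp s y [(real j, \<lambda>y. ennreal (exp (sqrt 2 * (A + 1))) * gf T D A j j y)]"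
      by (auto intro!: heat_mono)
  qed
  also have "\<dots> = ennreal (exp (sqrt 2 * (A + 1))) * pexp s x (?a @ [(real j, gf T D A j j)])"
    by (rule pexp_snoc_cmult) (auto intro: borel_list_steps)
  finally show ?thesis by (simp add: st psi_def)
qed

text \<open>The change of slope yields \<open>exp (- sqrt 2 * x)\<close> at the end of the stem and
  \<open>exp (sqrt 2 * x)\<close> at the start of each branch, besides
  \<open>exp (sqrt 2 * (A + 1))\<close> from each window. The product leaves one factor
  \<open>exp (sqrt 2 * x)\<close>, that of \<open>pair_weight\<close>.\<close>

lemma fork_weight_le:
  assumes T: "0 < T" "T \<le> j" "T \<le> j'" and k: "k < j" "k < j'" and s: "real k < s" "s \<le> real k + 1"
  shows "ennreal (exp s) * pexp 0 0 (tilt (steps (\<lambda>i y. gf T D A j i y * gf T D A j' i y) 0 k)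
      @ [(s, \<lambda>y. (ennreal (exp (real j - s)) * pexp s y (tilt (steps (gf T D A j) k j)))
        * (ennreal (exp (real j' - s)) * pexp s y (tilt (steps (gf T D A j') k j'))))])
    \<le> ennreal (exp (2 * sqrt 2 * (A + 1))) * pair_weight T D A j j' k s"
proof -
  let ?F = "steps (\<lambda>i y. gf T D A j i y * gf T D A j' i y) 0 k"
  let ?\<Xi> = "\<lambda>y. (ennreal (exp (real j - s)) * pexp s y (tilt (steps (gf T D A j) k j)))
        * (ennreal (exp (real j' - s)) * pexp s y (tilt (steps (gf T D A j') k j')))"
  let ?\<xi> = "\<lambda>x. ?\<Xi> (x + sqrt 2 * s)" and ?b = "ennreal (exp (2 * sqrt 2 * (A + 1)))"
  let ?h = "\<lambda>x. ennreal (exp (sqrt 2 * x)) * (psi T D A j k s x * psi T D A j' k s x)"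
  have F: "borel_list ?F" by (intro borel_list_steps) auto
  have \<Xi>[measurable]: "?\<Xi> \<in> borel_measurable borel"
    by (intro borel_measurable_times_ennreal borel_measurable_const pexp_measurable_snd borel_list_tilt_steps) auto
  have h: "?h \<in> borel_measurable borel" unfolding psi_def
    by (intro borel_measurable_times_ennreal pexp_measurable_snd borel_list_steps) auto
  have "ennreal (exp (s - 0)) * pexp 0 (0 + sqrt 2 * 0) (tilt (?F @ [(s, ?\<xi>)]))
      = ennreal (exp (sqrt 2 * 0)) * pexp 0 0 (?F @ [(s, \<lambda>y. ennreal (exp (- sqrt 2 * y)) * ?\<xi> y)])"
  proof (rule pexp_tilt)
    show "sorted (0 # map fst ?F @ [s])"
      using strict_sorted_imp_sorted[OF sorted_steps, of _ 0 k] s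
      by (auto simp: sorted_append map_fst_steps simp del: upt_Suc)
  qed (use F in auto)
  moreover have "tilt [(s, ?\<xi>)] = [(s, ?\<Xi>)]" by simp
  ultimately have "ennreal (exp s) * pexp 0 0 (tilt ?F @ [(s, ?\<Xi>)]) = pexp 0 0 (?F @ [(s, \<lambda>y. ennreal (exp (- sqrt 2 * y)) * ?\<xi> y)])"
    by (simp only: tilt_simps(3)) simp
  also have "\<dots> \<le> pexp 0 0 (?F @ [(s, \<lambda>y. ?b * ?h y)])"
  proof (rule pexp_append_mono)
    have 1: "ennreal (exp (real i - s)) * pexp s (x + sqrt 2 * s) (tilt (steps (gf T D A i) k i))
        \<le> ennreal (exp (sqrt 2 * x)) * (ennreal (exp (sqrt 2 * (A + 1))) * psi T D A i k s x)" if "k < i" "T \<le> i" for i x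
    proof -
      have "ennreal (exp (real i - s)) * pexp s (x + sqrt 2 * s) (tilt (steps (gf T D A i) k i))
        = ennreal (exp (sqrt 2 * x)) * pexp s x (steps (gf T D A i) k i @ [(real i, \<lambda>y. ennreal (exp (- sqrt 2 * y)))])"
        using s that by (intro pexp_tilt_steps) auto
      then show ?thesis using tilt_weight_le[OF T(1) that(2,1), of s x D A] by (simp only: mult_left_mono zero_le)
    qed
    have "ennreal (exp (- sqrt 2 * x)) * ?\<xi> x \<le> ?b * ?h x" for x
    proof -
      have "ennreal (exp (- sqrt 2 * x)) * ?\<xi> x \<le> ennreal (exp (- sqrt 2 * x)) * ((ennreal (exp (sqrt 2 * x)) * (ennreal (exp (sqrt 2 * (A + 1))) * psi T D A j k s x))
          * (ennreal (exp (sqrt 2 * x)) * (ennreal (exp (sqrt 2 * (A + 1))) * psi T D A j' k s x)))"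
        using k T by (intro mult_left_mono mult_mono 1) auto
      also have "\<dots> = (ennreal (exp (- sqrt 2 * x)) * ennreal (exp (sqrt 2 * x))) * (ennreal (exp (sqrt 2 * (A + 1))) * ennreal (exp (sqrt 2 * (A + 1)))) * ?h x"
      proof -
        have "a * ((e * (b * p)) * (e * (b * q))) = (a * e) * (b * b) * (e * (p * q))" for a b e p q :: ennreal
          by (simp only: mult_ac)
        then show ?thesis .
      qed
      also have "ennreal (exp (- sqrt 2 * x)) * ennreal (exp (sqrt 2 * x)) = 1"
        by (simp add: ennreal_mult[symmetric] exp_minus)
      also have "ennreal (exp (sqrt 2 * (A + 1))) * ennreal (exp (sqrt 2 * (A + 1))) = ?b"
        by (subst ennreal_mult[symmetric]) (auto simp: exp_add[symmetric])
      finally show ?thesis by simp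
    qed
    then show "pexp u y [(s, \<lambda>y. ennreal (exp (- sqrt 2 * y)) * ?\<xi> y)] \<le> pexp u y [(s, \<lambda>y. ?b * ?h y)]" for u y
      by (auto intro!: heat_mono)
  qed
  also have "\<dots> = ?b * pexp 0 0 (?F @ [(s, ?h)])" by (rule pexp_snoc_cmult) (use F h in auto)
  finally show ?thesis by (simp add: pair_weight_def)
qed

context branching_data
begin

lemma fork_mean:
  assumes T: "0 < T" "T \<le> j" "T \<le> j'" and k: "k < j" "k < j'"
    and B: "\<And>s. real k < s \<Longrightarrow> s \<le> real k + 1 \<Longrightarrow> pair_weight T D A j j' k s \<le> ennreal B" "0 \<le> B"
  shows "(\<integral>\<^sup>+\<omega>. (\<integral>\<^sup>+w. (\<integral>\<^sup>+u. (\<integral>\<^sup>+v. fork T D A j j' k b w u v \<omega> \<partial>count_space UNIV) \<partial>count_space UNIV) \<partial>count_space UNIV) \<partial>M)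
    \<le> ennreal (exp (2 * sqrt 2 * (A + 1)) * B)"
proof -
  let ?F = "tilt (steps (\<lambda>i y. gf T D A j i y * gf T D A j' i y) 0 k)"
  let ?R = "\<lambda>j. tilt (steps (gf T D A j) k j)"
  have b: "borel_list ?F" "borel_list (?R j)" "borel_list (?R j')" by (intro borel_list_tilt_steps; auto)+
  have [measurable]: "(\<lambda>\<omega>. \<integral>\<^sup>+v. fork T D A j j' k b w u v \<omega> \<partial>count_space UNIV) \<in> borel_measurable M" for w u
    by (intro count_space_measurable) measurable
  have [measurable]: "(\<lambda>\<omega>. \<integral>\<^sup>+u. \<integral>\<^sup>+v. fork T D A j j' k b w u v \<omega> \<partial>count_space UNIV \<partial>count_space UNIV) \<in> borel_measurable M" for w
    by (intro count_space_measurable) measurable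
  have "(\<integral>\<^sup>+\<omega>. (\<integral>\<^sup>+w. (\<integral>\<^sup>+u. (\<integral>\<^sup>+v. fork T D A j j' k b w u v \<omega> \<partial>count_space UNIV) \<partial>count_space UNIV) \<partial>count_space UNIV) \<partial>M)
    = (\<integral>\<^sup>+w. (\<integral>\<^sup>+\<omega>. (\<integral>\<^sup>+u. (\<integral>\<^sup>+v. fork T D A j j' k b w u v \<omega> \<partial>count_space UNIV) \<partial>count_space UNIV) \<partial>M) \<partial>count_space UNIV)"
    by (rule nn_integral_count_space_nn_integral) auto
  also have "\<dots> = (\<integral>\<^sup>+w. (\<integral>\<^sup>+u. (\<integral>\<^sup>+\<omega>. (\<integral>\<^sup>+v. fork T D A j j' k b w u v \<omega> \<partial>count_space UNIV) \<partial>M) \<partial>count_space UNIV) \<partial>count_space UNIV)"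
    by (rule nn_integral_cong, rule nn_integral_count_space_nn_integral) auto
  also have "\<dots> = (\<integral>\<^sup>+w. (\<integral>\<^sup>+u. (\<integral>\<^sup>+v. (\<integral>\<^sup>+\<omega>. fork T D A j j' k b w u v \<omega> \<partial>M) \<partial>count_space UNIV) \<partial>count_space UNIV) \<partial>count_space UNIV)"
    by (rule nn_integral_cong, rule nn_integral_cong, rule nn_integral_count_space_nn_integral) auto
  also have "\<dots> = (\<integral>\<^sup>+s\<in>{real k<..real k+1}. ennreal (exp s) * pexp 0 0 (?F @ [(s, \<lambda>y. (ennreal (exp (real j - s)) * pexp s y (?R j)) * (ennreal (exp (real j' - s)) * pexp s y (?R j')))]) \<partial>lborel)"
    unfolding fork_def by (rule many_to_two) (use k b in \<open>auto simp: fst_set_steps sorted_steps\<close>)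
  also have "\<dots> \<le> (\<integral>\<^sup>+s. ennreal (exp (2 * sqrt 2 * (A + 1)) * B) * indicator {real k<..real k+1} s \<partial>lborel)"
  proof (rule nn_integral_mono)
    fix s
    show "ennreal (exp s) * pexp 0 0 (?F @ [(s, \<lambda>y. (ennreal (exp (real j - s)) * pexp s y (?R j)) * (ennreal (exp (real j' - s)) * pexp s y (?R j')))]) * indicator {real k<..real k+1} s
      \<le> ennreal (exp (2 * sqrt 2 * (A + 1)) * B) * indicator {real k<..real k+1} s"
    proof (cases "s \<in> {real k<..real k+1}")
      case True
      then have s: "real k < s" "s \<le> real k + 1" by auto
      have "ennreal (exp s) * pexp 0 0 (?F @ [(s, \<lambda>y. (ennreal (exp (real j - s)) * pexp s y (?R j)) * (ennreal (exp (real j' - s)) * pexp s y (?R j')))])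
          \<le> ennreal (exp (2 * sqrt 2 * (A + 1))) * ennreal B"
        by (rule order_trans[OF fork_weight_le[OF T k s]]) (intro mult_left_mono B s; simp)
      then show ?thesis using True B(2) by (simp add: ennreal_mult)
    qed simp
  qed
  also have "\<dots> = ennreal (exp (2 * sqrt 2 * (A + 1)) * B)"
    by (simp add: nn_integral_cmult del: ennreal_plus)
  finally show ?thesis .
qed

text \<open>The factor 2 counts which child of the common ancestor leads to the first particle; the
  last summand bounds the pairs in which one particle descends from the other.\<close>

lemma pair_mean_le:
  assumes ad: "admissible n r T D A" and j: "n \<le> j" "j \<le> j'" "j' < 2 * n"
    and B: "\<And>k s. k < j \<Longrightarrow> real k < s \<Longrightarrow> s \<le> real k + 1 \<Longrightarrow> pair_weight T D A j j' k s \<le> ennreal (B k)" "\<And>k. 0 \<le> B k"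
  shows "(\<integral>\<^sup>+\<omega>. good_count T D A j \<omega> * good_count T D A j' \<omega> \<partial>M)
    \<le> ennreal (2 * exp (2 * sqrt 2 * (A + 1)) * (\<Sum>k<j. B k)) + (if j' < j + T then ennreal (600 * exp (sqrt 2) * (A + 3) / r) else 0)"
proof -
  note ad' = admissibleD[OF ad]
  have T: "0 < T" "T \<le> j" "T \<le> j'" "0 < j'" using ad'(3,4) j by auto
  let ?c = "\<lambda>\<omega>. if j' < j + T then good_count T D A j' \<omega> else 0"
  let ?s = "\<lambda>k b \<omega>. \<integral>\<^sup>+w. (\<integral>\<^sup>+u. (\<integral>\<^sup>+v. fork T D A j j' k b w u v \<omega> \<partial>count_space UNIV) \<partial>count_space UNIV) \<partial>count_space UNIV"
  have [measurable]: "?s k b \<in> borel_measurable M" for k b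
    by (intro count_space_measurable) measurable
  have "AE \<omega> in M. \<forall>w. 0 < death w \<omega>" using AE_death_pos by (simp add: AE_all_countable)
  then have "AE \<omega> in M. good_count T D A j \<omega> * good_count T D A j' \<omega> \<le> ?c \<omega> + (\<Sum>k<j. \<Sum>b\<in>UNIV. ?s k b \<omega>)"
    using AE_regular'
  proof eventually_elim
    case (elim \<omega>)
    let ?g = "\<lambda>u v. good T D A j u \<omega> * good T D A j' v \<omega>"
    have "good_count T D A j \<omega> * good_count T D A j' \<omega> = (\<integral>\<^sup>+u. (\<integral>\<^sup>+v. ?g u v \<partial>count_space UNIV) \<partial>count_space UNIV)"
    proof -
      have "(\<integral>\<^sup>+v. ?g u v \<partial>count_space UNIV) = good T D A j u \<omega> * good_count T D A j' \<omega>" for u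
        unfolding good_count_def by (rule nn_integral_cmult) simp
      moreover have "good_count T D A j \<omega> * c = (\<integral>\<^sup>+u. good T D A j u \<omega> * c \<partial>count_space UNIV)" for c
        unfolding good_count_def by (rule nn_integral_multc[symmetric]) simp
      ultimately show ?thesis by simp
    qed
    also have "\<dots> = (\<integral>\<^sup>+u. (\<integral>\<^sup>+v. ?g u v * indicator {(u, v). suffix u v} (u, v) + ?g u v * indicator {(u, v). \<not> suffix u v} (u, v) \<partial>count_space UNIV) \<partial>count_space UNIV)"
      by (rule nn_integral_cong, rule nn_integral_cong) (simp add: indicator_def)
    also have "\<dots> = (\<integral>\<^sup>+u. (\<integral>\<^sup>+v. ?g u v * indicator {(u, v). suffix u v} (u, v) \<partial>count_space UNIV) \<partial>count_space UNIV)
        + (\<integral>\<^sup>+u. (\<integral>\<^sup>+v. ?g u v * indicator {(u, v). \<not> suffix u v} (u, v) \<partial>count_space UNIV) \<partial>count_space UNIV)"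
      by (subst nn_integral_add[symmetric]) (simp_all add: nn_integral_add)
    also have "\<dots> \<le> ?c \<omega> + (\<Sum>k<j. \<Sum>b\<in>UNIV. ?s k b \<omega>)"
      by (rule add_mono[OF comparable_pairs[OF elim(2) ad j(1,2)] incomparable_pairs[OF elim(2) elim(1)[rule_format] T(1,2) j(2)]])
    finally show ?case .
  qed
  then have "(\<integral>\<^sup>+\<omega>. good_count T D A j \<omega> * good_count T D A j' \<omega> \<partial>M) \<le> (\<integral>\<^sup>+\<omega>. ?c \<omega> + (\<Sum>k<j. \<Sum>b\<in>UNIV. ?s k b \<omega>) \<partial>M)"
    by (rule nn_integral_mono_AE)
  also have "\<dots> = (\<integral>\<^sup>+\<omega>. ?c \<omega> \<partial>M) + (\<Sum>k<j. \<Sum>b\<in>UNIV. \<integral>\<^sup>+\<omega>. ?s k b \<omega> \<partial>M)"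
    by (simp add: nn_integral_add nn_integral_sum)
  also have "\<dots> \<le> (if j' < j + T then ennreal (600 * exp (sqrt 2) * (A + 3) / r) else 0) + (\<Sum>k<j. \<Sum>b\<in>(UNIV :: bool set). ennreal (exp (2 * sqrt 2 * (A + 1)) * B k))"
  proof (intro add_mono sum_mono)
    show "(\<integral>\<^sup>+\<omega>. ?c \<omega> \<partial>M) \<le> (if j' < j + T then ennreal (600 * exp (sqrt 2) * (A + 3) / r) else 0)"
      using good_weight_le[OF ad, of j'] good_count_mean[OF T(4), of T D A] j by simp
    show "(\<integral>\<^sup>+\<omega>. ?s k b \<omega> \<partial>M) \<le> ennreal (exp (2 * sqrt 2 * (A + 1)) * B k)" if "k \<in> {..<j}" for k b
    proof (rule fork_mean)
      show k: "k < j" "k < j'" using that j by auto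
      show "pair_weight T D A j j' k s \<le> ennreal (B k)" if "real k < s" "s \<le> real k + 1" for s
        using k(1) that by (rule B(1))
    qed (rule T B(2))+
  qed
  also have "(\<Sum>k<j. \<Sum>b\<in>(UNIV :: bool set). ennreal (exp (2 * sqrt 2 * (A + 1)) * B k)) = ennreal (2 * exp (2 * sqrt 2 * (A + 1)) * (\<Sum>k<j. B k))"
  proof -
    have "(\<Sum>b\<in>(UNIV :: bool set). ennreal (exp (2 * sqrt 2 * (A + 1)) * B k)) = ennreal (2 * exp (2 * sqrt 2 * (A + 1)) * B k)" for k
    proof -
      have "(\<Sum>b\<in>(UNIV :: bool set). ennreal c) = ennreal (2 * c)" if "0 \<le> c" for c
        using that by (simp add: ennreal_mult)
      from this[of "exp (2 * sqrt 2 * (A + 1)) * B k"] show ?thesis using B(2)[of k] by (simp only: mult.assoc) simp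
    qed
    then show ?thesis using B(2) by (simp add: sum_ennreal sum_distrib_left del: ennreal_plus)
  qed
  finally show ?thesis by (simp only: add.commute)
qed

end

section \<open>Summation of the pair bounds\<close>

text \<open>80000000 exceeds \<open>2 * (405 * 300\<^sup>2 + 6)\<close>, the constant of early and
  bulk forks, and 3600 is twice the 1800 of late forks.\<close>

definition pair_const :: real where
  "pair_const = exp (2 * sqrt 2) * (80000000 + 3600 * exp (1 + sqrt 2))"

lemma pair_const_pos: "0 < pair_const"
  unfolding pair_const_def by (intro mult_pos_pos add_pos_pos) auto

text \<open>Early, bulk and late forks. A late fork satisfies \<open>j' - T < k < j\<close>, so it
  can occur only for \<open>j' < j + T\<close>.\<close>

lemma pair_sum_le:
  fixes a b c :: real and j j' n T :: nat
  assumes "0 \<le> a" "0 \<le> b" "0 \<le> c" "j \<le> j'" "j < 2 * n"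
  shows "(\<Sum>k<j. if k < T then a else if k \<le> j' - T then b else c) \<le> T * a + 2 * n * b + (if j' < j + T then T * c else 0)"
proof -
  have "(\<Sum>k<j. if k < T then a else if k \<le> j' - T then b else c)
      \<le> (\<Sum>k<j. (if k \<in> {..<T} then a else 0) + b + (if k \<in> {j' - T<..<j} then c else 0))"
    by (rule sum_mono) (use assms in auto)
  also have "\<dots> = card ({..<j} \<inter> {..<T}) * a + j * b + card ({..<j} \<inter> {j' - T<..<j}) * c"
  proof -
    have "(\<Sum>k<j. if k \<in> B then x else 0) = card ({..<j} \<inter> B) * x" for B and x :: real
      by (subst sum.inter_restrict[symmetric]) auto
    from this[of "{..<T}" a] this[of "{j' - T<..<j}" c] show ?thesis by (simp only: sum.distrib) simp
  qed
  also have "\<dots> \<le> T * a + 2 * n * b + (if j' < j + T then T * c else 0)"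
  proof (intro add_mono mult_right_mono)
    have "card ({..<j} \<inter> {..<T}) \<le> card {..<T}" by (intro card_mono) auto
    then show "real (card ({..<j} \<inter> {..<T})) \<le> real T" by simp
    show "real (card ({..<j} \<inter> {j' - T<..<j})) * c \<le> (if j' < j + T then T * c else 0)"
    proof (cases "j' < j + T")
      case True
      have "card ({..<j} \<inter> {j' - T<..<j}) \<le> card {j' - T<..<j}" by (intro card_mono) auto
      also have "\<dots> \<le> T" using assms(4) by auto
      finally show ?thesis using True assms(3) by (auto intro!: mult_right_mono)
    next
      case False
      then have "{..<j} \<inter> {j' - T<..<j} = {}" using assms(4) by auto
      then show ?thesis using False by simp
    qed
  qed (use assms in auto)
  finally show ?thesis .
qed

context branching_data
begin

text \<open>The prefactor contains \<open>exp (2 * sqrt 2 * A) = (m / r)\<^sup>2\<close> with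
  \<open>m = n * sqrt n\<close>. Against it, early forks are of order \<open>1 / r\<^sup>2\<close>,
  as two branches pay the ballot price, and late forks of order \<open>1 / r\<close>, as only the
  stem pays it.\<close>

lemma pair_mean_bound:
  assumes ad: "admissible n r T D A" and j: "n \<le> j" "j \<le> j'" "j' < 2 * n"
  shows "(\<integral>\<^sup>+\<omega>. good_count T D A j \<omega> * good_count T D A j' \<omega> \<partial>M)
    \<le> ennreal (pair_const * T * (A + 3)\<^sup>2 / r\<^sup>2 + (if j' < j + T then 2 * pair_const * T * (A + 3) / r else 0))"
proof -
  note ad' = admissibleD[OF ad]
  define m where "m = real n * sqrt n"
  define a b c where "a = 405 * (300 * (A + 3) / m)\<^sup>2" and "b = exp (1 - sqrt 2 * D)"
    and "c = 1800 * exp (1 + sqrt 2) * (A + 1) * exp (- sqrt 2 * A) / m"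
  have n: "0 < n" "0 < r" "0 < m" "1 \<le> real T" "1 \<le> real n" using ad' by (auto simp: m_def)
  have abc: "0 \<le> a" "0 \<le> b" "0 \<le> c" using ad'(7) n by (auto simp: a_def b_def c_def)
  let ?B = "\<lambda>k. if k < T then a else if k \<le> j' - T then b else c"
  let ?E = "exp (2 * sqrt 2)" and ?q = "m / r"
  have m2: "m\<^sup>2 = real n ^ 3" by (simp add: m_def power_mult_distrib power2_eq_square power3_eq_cube)
  have E: "exp (2 * sqrt 2 * (A + 1)) = ?E * ?q\<^sup>2"
  proof -
    have "exp (2 * sqrt 2 * (A + 1)) = ?E * (exp (sqrt 2 * A) * exp (sqrt 2 * A))"
      unfolding exp_add[symmetric] by (simp add: algebra_simps)
    then show ?thesis unfolding ad'(6) m_def by (simp add: power2_eq_square)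
  qed
  have inv: "exp (- sqrt 2 * A) = r / m"
  proof -
    have "exp (- sqrt 2 * A) = inverse (exp (sqrt 2 * A))" by (simp add: exp_minus)
    then show ?thesis unfolding ad'(6) m_def by simp
  qed
  have qa: "?q\<^sup>2 * a = 36450000 * (A + 3)\<^sup>2 / r\<^sup>2"
    unfolding a_def power_divide power_mult_distrib using n by simp
  have qc: "?q\<^sup>2 * c = 1800 * exp (1 + sqrt 2) * (A + 1) / r"
    unfolding c_def inv using n by (simp add: power2_eq_square)
  \<comment> \<open>With \<open>D = 3 * ln n\<close> and \<open>3 * sqrt 2 \<ge> 4\<close>, a bulk
    fork weighs at most \<open>3 / n ^ 4\<close>; this compensates \<open>m\<^sup>2 = n ^ 3\<close>
    and the \<open>2 * n\<close> possible fork times.\<close>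
  have qb: "?q\<^sup>2 * (2 * n * b) \<le> 6 / r\<^sup>2"
  proof -
    have "b \<le> exp (1 - 4 * ln n)"
    proof -
      have "4 * ln n \<le> (sqrt 2 * 3) * ln n" using sqrt2_bounds n by (intro mult_right_mono) auto
      then show ?thesis by (simp add: b_def ad'(5))
    qed
    also have "\<dots> = exp 1 * exp (ln n * (- 4))" by (simp add: exp_add[symmetric])
    also have "exp (ln n * (- 4)) = 1 / real n ^ 4"
      using n by (simp add: exp_minus exp_of_nat_mult[of 4, simplified] divide_simps mult.commute[of _ 4])
    also have "exp 1 * (1 / real n ^ 4) \<le> 3 * (1 / real n ^ 4)" by (intro mult_right_mono exp_le) simp
    finally have "b \<le> 3 * (1 / real n ^ 4)" .
    then have "?q\<^sup>2 * (2 * n * b) \<le> ?q\<^sup>2 * (2 * n * (3 * (1 / real n ^ 4)))" by (intro mult_left_mono) auto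
    also have "\<dots> = 6 / r\<^sup>2" using n by (simp add: power_divide m2 power3_eq_cube power4_eq_xxxx)
    finally show ?thesis .
  qed
  have "(\<integral>\<^sup>+\<omega>. good_count T D A j \<omega> * good_count T D A j' \<omega> \<partial>M)
    \<le> ennreal (2 * exp (2 * sqrt 2 * (A + 1)) * (\<Sum>k<j. ?B k)) + (if j' < j + T then ennreal (600 * exp (sqrt 2) * (A + 3) / r) else 0)"
  proof (rule pair_mean_le[OF ad j])
    fix k s assume k: "k < j" "real k < s" "s \<le> real k + 1"
    consider "k < T" | "T \<le> k" "k \<le> j' - T" | "T \<le> k" "j' - T < k" by linarith
    then show "pair_weight T D A j j' k s \<le> ennreal (?B k)"
    proof cases
      case 1
      then show ?thesis using pair_weight_early[OF ad j(1) _ 1, of j' s] k j by (simp add: a_def m_def)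
    next
      case 2
      then show ?thesis using pair_weight_middle[OF ad 2, of s j] k by (simp add: b_def)
    next
      case 3
      then show ?thesis using pair_weight_late[OF ad j(1) _ 3(1) _ 3(2) k(1), of s] k j by (simp add: c_def m_def)
    qed
  qed (use abc in auto)
  also have "\<dots> = ennreal (2 * exp (2 * sqrt 2 * (A + 1)) * (\<Sum>k<j. ?B k) + (if j' < j + T then 600 * exp (sqrt 2) * (A + 3) / r else 0))"
    using abc ad'(7) by (subst ennreal_plus) (auto intro!: sum_nonneg mult_nonneg_nonneg)
  also have "\<dots> \<le> ennreal (pair_const * T * (A + 3)\<^sup>2 / r\<^sup>2 + (if j' < j + T then 2 * pair_const * T * (A + 3) / r else 0))"
  proof (rule ennreal_leI)
    let ?i = "if j' < j + T then 1 else 0 :: real"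
    have "2 * exp (2 * sqrt 2 * (A + 1)) * (\<Sum>k<j. ?B k) \<le> 2 * exp (2 * sqrt 2 * (A + 1)) * (T * a + 2 * n * b + ?i * (T * c))"
      using pair_sum_le[OF abc j(2), of n T] j by (intro mult_left_mono) auto
    also have "\<dots> = 2 * ?E * (T * (?q\<^sup>2 * a) + ?q\<^sup>2 * (2 * n * b) + ?i * (T * (?q\<^sup>2 * c)))"
    proof -
      have "2 * (e * q) * (t * x + y + i * (t * z)) = 2 * e * (t * (q * x) + q * y + i * (t * (q * z)))" for e q t x y i z :: real
        by (simp add: algebra_simps)
      then show ?thesis unfolding E .
    qed
    also have "\<dots> \<le> 2 * ?E * (T * (36450000 * (A + 3)\<^sup>2 / r\<^sup>2) + 6 / r\<^sup>2 * (T * (A + 3)\<^sup>2) + ?i * (T * (1800 * exp (1 + sqrt 2) * (A + 3) / r)))"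
    proof (intro mult_left_mono add_mono)
      have "1 * 1 \<le> T * (A + 3)\<^sup>2" using n ad'(7) by (intro mult_mono) (auto intro!: one_le_power)
      then have "6 / r\<^sup>2 * 1 \<le> 6 / r\<^sup>2 * (T * (A + 3)\<^sup>2)" by (intro mult_left_mono) auto
      then show "?q\<^sup>2 * (2 * n * b) \<le> 6 / r\<^sup>2 * (T * (A + 3)\<^sup>2)" using qb by linarith
      show "?q\<^sup>2 * c \<le> 1800 * exp (1 + sqrt 2) * (A + 3) / r"
        unfolding qc by (intro divide_right_mono mult_left_mono) auto
    qed (use qa in auto)
    also have "\<dots> = ?E * 72900012 * (T * (A + 3)\<^sup>2 / r\<^sup>2) + ?i * (?E * (3600 * exp (1 + sqrt 2)) * (T * (A + 3) / r))"
    proof -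
      have "2 * e * (t * (36450000 * x / rr) + 6 / rr * (t * x) + i * (t * (1800 * q * y / s)))
          = e * 72900012 * (t * x / rr) + i * (e * (3600 * q) * (t * y / s))" for e t x rr i q y s :: real
        by (simp add: divide_inverse algebra_simps)
      then show ?thesis .
    qed
    also have "\<dots> \<le> pair_const * (T * (A + 3)\<^sup>2 / r\<^sup>2) + ?i * (pair_const * (T * (A + 3) / r))"
      unfolding pair_const_def by (intro add_mono mult_right_mono mult_left_mono) (use ad'(7) in auto)
    finally have 1: "2 * exp (2 * sqrt 2 * (A + 1)) * (\<Sum>k<j. ?B k) \<le> pair_const * (T * (A + 3)\<^sup>2 / r\<^sup>2) + ?i * (pair_const * (T * (A + 3) / r))" .
    have 2: "600 * exp (sqrt 2) * ((A + 3) / r) \<le> pair_const * T * ((A + 3) / r)"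
    proof (rule mult_right_mono)
      have "600 * exp (sqrt 2) \<le> 1 * (80000000 + 3600 * exp (1 + sqrt 2))" 
      proof -
        have "exp (sqrt 2) \<le> exp (1 + sqrt 2)" "0 < exp (sqrt 2)" by simp_all
        then have "600 * exp (sqrt 2) \<le> 80000000 + 3600 * exp (1 + sqrt 2)" by linarith
        then show ?thesis by simp
      qed
      also have "\<dots> \<le> pair_const" unfolding pair_const_def by (intro mult_right_mono) auto
      also have "\<dots> \<le> pair_const * T" using n pair_const_pos by simp
      finally show "600 * exp (sqrt 2) \<le> pair_const * T" .
    qed (use ad'(7) in simp)
    have e: "600 * exp (sqrt 2) * (A + 3) / r = 600 * exp (sqrt 2) * ((A + 3) / r)"
      "2 * pair_const * T * (A + 3) / r = 2 * (pair_const * (T * (A + 3) / r))"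
      "pair_const * T * (A + 3)\<^sup>2 / r\<^sup>2 = pair_const * (T * (A + 3)\<^sup>2 / r\<^sup>2)"
      "pair_const * T * ((A + 3) / r) = pair_const * (T * (A + 3) / r)" by simp_all
    show "2 * exp (2 * sqrt 2 * (A + 1)) * (\<Sum>k<j. ?B k) + (if j' < j + T then 600 * exp (sqrt 2) * (A + 3) / r else 0)
      \<le> pair_const * T * (A + 3)\<^sup>2 / r\<^sup>2 + (if j' < j + T then 2 * pair_const * T * (A + 3) / r else 0)"
    proof (cases "j' < j + T")
      case True
      have "s + x \<le> p + 2 * q" if "s \<le> p + q" "x \<le> q" for s p q x :: real using that by linarith
      from this[OF 1[unfolded if_P[OF True] mult_1] 2[unfolded e]] show ?thesis unfolding e if_P[OF True] .
    next
      case False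
      show ?thesis using 1 unfolding e if_not_P[OF False] mult_zero_left add_0_right .
    qed
  qed
  finally show ?thesis .
qed

text \<open>All \<open>r\<^sup>2\<close> pairs of times contribute order
  \<open>1 / r\<^sup>2\<close>, while order \<open>1 / r\<close> occurs only for the at most
  \<open>r * T\<close> pairs at distance below \<open>T\<close>. The bound is therefore uniform in
  \<open>r\<close>.\<close>

lemma second_moment:
  assumes ad: "admissible n r T D A"
  shows "(\<integral>\<^sup>+\<omega>. (\<Sum>j\<in>{n..<n+r}. good_count T D A j \<omega>)\<^sup>2 \<partial>M) \<le> ennreal (6 * pair_const * T\<^sup>2 * (A + 3)\<^sup>2)"
proof -
  note ad' = admissibleD[OF ad]
  let ?J = "{n..<n+r}" and ?s = "\<lambda>j \<omega>. good_count T D A j \<omega>"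
  define c1 c2 where "c1 = pair_const * T * (A + 3)\<^sup>2 / r\<^sup>2" and "c2 = 2 * pair_const * T * (A + 3) / r"
  have c: "0 \<le> c1" "0 \<le> c2" using ad'(7) pair_const_pos by (auto simp: c1_def c2_def)
  define p where "p j j' \<omega> = (if j \<le> j' then ?s j \<omega> * ?s j' \<omega> else 0)" for j j' \<omega>
  have [measurable]: "p j j' \<in> borel_measurable M" for j j' unfolding p_def by measurable
  have "(\<Sum>j\<in>?J. ?s j \<omega>)\<^sup>2 \<le> 2 * (\<Sum>j\<in>?J. \<Sum>j'\<in>?J. p j j' \<omega>)" for \<omega>
  proof -
    have "(\<Sum>j\<in>?J. ?s j \<omega>)\<^sup>2 = (\<Sum>j\<in>?J. \<Sum>j'\<in>?J. ?s j \<omega> * ?s j' \<omega>)"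
      by (simp add: power2_eq_square sum_product)
    also have "\<dots> \<le> (\<Sum>j\<in>?J. \<Sum>j'\<in>?J. p j j' \<omega> + p j' j \<omega>)"
      by (intro sum_mono) (auto simp: p_def mult.commute)
    also have "\<dots> = (\<Sum>j\<in>?J. \<Sum>j'\<in>?J. p j j' \<omega>) + (\<Sum>j\<in>?J. \<Sum>j'\<in>?J. p j' j \<omega>)"
      by (simp add: sum.distrib)
    also have "(\<Sum>j\<in>?J. \<Sum>j'\<in>?J. p j' j \<omega>) = (\<Sum>j\<in>?J. \<Sum>j'\<in>?J. p j j' \<omega>)" by (rule sum.swap)
    finally show ?thesis by (simp add: mult_2)
  qed
  then have "(\<integral>\<^sup>+\<omega>. (\<Sum>j\<in>?J. ?s j \<omega>)\<^sup>2 \<partial>M) \<le> (\<integral>\<^sup>+\<omega>. 2 * (\<Sum>j\<in>?J. \<Sum>j'\<in>?J. p j j' \<omega>) \<partial>M)"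
    by (rule nn_integral_mono)
  also have "\<dots> = 2 * (\<Sum>j\<in>?J. \<Sum>j'\<in>?J. \<integral>\<^sup>+\<omega>. p j j' \<omega> \<partial>M)"
    by (simp add: nn_integral_cmult nn_integral_sum)
  also have "\<dots> \<le> 2 * (\<Sum>j\<in>?J. \<Sum>j'\<in>?J. ennreal (c1 + (if j' \<in> {j..<j+T} then c2 else 0)))"
  proof (intro mult_left_mono sum_mono)
    fix j j' assume j: "j \<in> ?J" "j' \<in> ?J"
    show "(\<integral>\<^sup>+\<omega>. p j j' \<omega> \<partial>M) \<le> ennreal (c1 + (if j' \<in> {j..<j+T} then c2 else 0))"
      using pair_mean_bound[OF ad, of j j'] j ad'(2) by (auto simp: p_def c1_def c2_def)
  qed simp
  also have "\<dots> = ennreal (2 * (\<Sum>j\<in>?J. \<Sum>j'\<in>?J. c1 + (if j' \<in> {j..<j+T} then c2 else 0)))"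
  proof -
    have 0: "0 \<le> c1 + (if j' \<in> {j..<j+T} then c2 else 0)" for j j' using c by simp
    then have "(\<Sum>j\<in>?J. \<Sum>j'\<in>?J. ennreal (c1 + (if j' \<in> {j..<j+T} then c2 else 0))) = ennreal (\<Sum>j\<in>?J. \<Sum>j'\<in>?J. c1 + (if j' \<in> {j..<j+T} then c2 else 0))"
      by (simp only: sum_ennreal sum_nonneg)
    then show ?thesis by (simp only: ennreal_mult'[of 2, simplified])
  qed
  also have "\<dots> \<le> ennreal (6 * pair_const * T\<^sup>2 * (A + 3)\<^sup>2)"
  proof (rule ennreal_leI)
    have "(\<Sum>j'\<in>?J. c1 + (if j' \<in> {j..<j+T} then c2 else 0)) \<le> r * c1 + T * c2" for j
    proof -
      have "(\<Sum>j'\<in>?J. c1 + (if j' \<in> {j..<j+T} then c2 else 0)) = r * c1 + card (?J \<inter> {j..<j+T}) * c2"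
        by (simp only: sum.distrib sum.inter_restrict[symmetric] finite_atLeastLessThan) simp
      also have "card (?J \<inter> {j..<j+T}) \<le> card {j..<j+T}" by (intro card_mono) auto
      then have "r * c1 + card (?J \<inter> {j..<j+T}) * c2 \<le> r * c1 + T * c2" using c by (intro add_left_mono mult_right_mono) auto
      finally show ?thesis .
    qed
    then have "2 * (\<Sum>j\<in>?J. \<Sum>j'\<in>?J. c1 + (if j' \<in> {j..<j+T} then c2 else 0)) \<le> 2 * (\<Sum>j\<in>?J. r * c1 + T * c2)"
      by (intro mult_left_mono sum_mono) auto
    also have "\<dots> = 2 * (r * (r * c1 + T * c2))" by simp
    also have "\<dots> = 2 * (pair_const * (T * (A + 3)\<^sup>2)) + 2 * (2 * pair_const * (T\<^sup>2 * (A + 3)))"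
      using ad'(1) by (simp add: c1_def c2_def field_simps power2_eq_square)
    also have "\<dots> \<le> 2 * (pair_const * (T\<^sup>2 * (A + 3)\<^sup>2)) + 2 * (2 * pair_const * (T\<^sup>2 * (A + 3)\<^sup>2))"
      using ad'(3,7) pair_const_pos by (intro add_mono mult_left_mono mult_right_mono) (auto simp: power2_eq_square)
    finally show "2 * (\<Sum>j\<in>?J. \<Sum>j'\<in>?J. c1 + (if j' \<in> {j..<j+T} then c2 else 0)) \<le> 6 * pair_const * T\<^sup>2 * (A + 3)\<^sup>2"
      by (simp add: mult_ac)
  qed
  finally show ?thesis .
qed

end

section \<open>From moments to a lower bound on probabilities\<close>

text \<open>Integrates the pointwise inequality
  \<open>2 * Z \<le> l * Z\<^sup>2 + (1 / l) * indicator ?E\<close> with the optimal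
  \<open>l = c / K\<close>; it plays the role of Cauchy-Schwarz and holds for infinite values as
  well.\<close>

lemma (in prob_space) paley_zygmund:
  fixes Z :: "'a \<Rightarrow> ennreal"
  assumes [measurable]: "Z \<in> borel_measurable M"
    and c: "ennreal c \<le> (\<integral>\<^sup>+\<omega>. Z \<omega> \<partial>M)" "0 < c" and K: "(\<integral>\<^sup>+\<omega>. (Z \<omega>)\<^sup>2 \<partial>M) \<le> ennreal K" "0 < K"
  shows "c\<^sup>2 / K \<le> prob {\<omega>\<in>space M. Z \<omega> \<noteq> 0}"
proof -
  let ?E = "{\<omega>\<in>space M. Z \<omega> \<noteq> 0}" and ?l = "c / K"
  have l: "0 < ?l" using c K by simp
  have "2 * Z \<omega> \<le> ennreal ?l * (Z \<omega>)\<^sup>2 + ennreal (1 / ?l) * indicator ?E \<omega>" if "\<omega> \<in> space M" for \<omega>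
  proof (cases "Z \<omega>")
    case (real z)
    have "0 \<le> (?l * z - 1)\<^sup>2 * (1 / ?l)" using c K by (intro mult_nonneg_nonneg) auto
    also have "\<dots> = ?l * z\<^sup>2 + 1 / ?l - 2 * z" using c K by (simp add: power2_eq_square field_simps)
    finally have "ennreal (2 * z) \<le> ennreal (?l * z\<^sup>2 + 1 / ?l)" by (intro ennreal_leI) simp
    also have "\<dots> = ennreal ?l * (ennreal z)\<^sup>2 + ennreal (1 / ?l)"
    proof -
      have "ennreal ?l * (ennreal z)\<^sup>2 = ennreal (?l * z\<^sup>2)"
        using c K real by (simp only: ennreal_power) (subst ennreal_mult[symmetric], auto)
      then show ?thesis using c K by (subst ennreal_plus) auto
    qed
    finally show ?thesis using real that by (cases "z = 0") (auto simp: ennreal_mult' indicator_def)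
  next
    case top
    then show ?thesis using c K by (simp add: ennreal_mult_top power2_eq_square)
  qed
  then have "(\<integral>\<^sup>+\<omega>. 2 * Z \<omega> \<partial>M) \<le> (\<integral>\<^sup>+\<omega>. ennreal ?l * (Z \<omega>)\<^sup>2 + ennreal (1 / ?l) * indicator ?E \<omega> \<partial>M)"
    by (intro nn_integral_mono) auto
  also have "\<dots> = ennreal ?l * (\<integral>\<^sup>+\<omega>. (Z \<omega>)\<^sup>2 \<partial>M) + ennreal (1 / ?l) * emeasure M ?E"
    by (simp add: nn_integral_add nn_integral_cmult)
  also have "\<dots> \<le> ennreal ?l * ennreal K + ennreal (1 / ?l) * ennreal (prob ?E)"
    using K by (intro add_mono mult_left_mono) (auto simp: emeasure_eq_measure)
  also have "\<dots> = ennreal (c + 1 / ?l * prob ?E)"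
    using l c K by (subst (1 2) ennreal_mult[symmetric]) (auto simp: ennreal_plus[symmetric] simp del: ennreal_plus)
  finally have "2 * ennreal c \<le> ennreal (c + 1 / ?l * prob ?E)"
    using mult_left_mono[OF c(1), of 2] by (simp add: nn_integral_cmult del: ennreal_plus)
  then have "ennreal (2 * c) \<le> ennreal (c + 1 / ?l * prob ?E)" using c(2) by (simp add: ennreal_mult' del: ennreal_plus)
  then have "2 * c \<le> c + 1 / ?l * prob ?E" using c K by (subst (asm) ennreal_le_iff) auto
  then show ?thesis using c(2) K(2) by (simp add: field_simps power2_eq_square)
qed

context branching_data
begin

text \<open>Time runs from the birth of \<open>x\<close> and height is measured from its birth
  place, so the event involves only labels of the subtree at \<open>x\<close>.\<close>

definition reaches :: "particle \<Rightarrow> nat \<Rightarrow> real \<Rightarrow> 'a \<Rightarrow> bool" where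
  "reaches x j c \<omega> \<longleftrightarrow> (\<exists>u. u \<in> alive (\<lambda>v. L (v @ x) \<omega>) (real j)
    \<and> c \<le> path (\<lambda>y. y) (\<lambda>v. L (v @ x) \<omega>) (\<lambda>v t. Wr (v @ x) t \<omega>) u (real j))"

lemma reaches_sets:
  assumes "\<And>v. Inl (v @ x) \<in> K" "\<And>v. Inr (v @ x) \<in> K"
  shows "{\<omega>\<in>space M. reaches x j c \<omega>} \<in> sets (GA K)"
proof -
  have id: "(\<lambda>\<omega>. \<omega>) \<in> GA K \<rightarrow>\<^sub>M GA K" by simp
  have 1: "(\<lambda>\<omega>. indicator (alive (\<lambda>v. L (v @ x) \<omega>) (real j)) u :: ennreal) \<in> borel_measurable (GA K)" for u
    by (rule alive_copy_measurable[OF assms(1) id]) simp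
  have 2: "(\<lambda>\<omega>. path (\<lambda>y. y) (\<lambda>v. L (v @ x) \<omega>) (\<lambda>v t. Wr (v @ x) t \<omega>) u (real j)) \<in> borel_measurable (GA K)" for u
    by (rule path_copy_measurable[OF assms id]) simp
  have "{\<omega>\<in>space M. reaches x j c \<omega>} = (\<Union>u. {\<omega>\<in>space (GA K). (indicator (alive (\<lambda>v. L (v @ x) \<omega>) (real j)) u :: ennreal) = 1}
      \<inter> {\<omega>\<in>space (GA K). c \<le> path (\<lambda>y. y) (\<lambda>v. L (v @ x) \<omega>) (\<lambda>v t. Wr (v @ x) t \<omega>) u (real j)})"
    by (auto simp: reaches_def indicator_def)
  also have "\<dots> \<in> sets (GA K)"
    by (intro sets.countable_UN' image_subsetI sets.Int borel_measurable_eq borel_measurable_le borel_measurable_const 1 2 countableI_type)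
  finally show ?thesis .
qed

lemma reaches_prob:
  assumes ad: "admissible n r T D A"
  shows "c_low\<^sup>2 / (6 * pair_const * T\<^sup>2 * (A + 3)\<^sup>2) \<le> prob {\<omega>\<in>space M. \<exists>j\<in>{n..<n+r}. reaches [] j (sqrt 2 * j - A - 1) \<omega>}"
proof -
  note ad' = admissibleD[OF ad]
  let ?Z = "\<lambda>\<omega>. \<Sum>j\<in>{n..<n+r}. good_count T D A j \<omega>"
  let ?E = "{\<omega>\<in>space M. \<exists>j\<in>{n..<n+r}. reaches [] j (sqrt 2 * j - A - 1) \<omega>}"
  have "{\<omega>\<in>space M. reaches [] j (sqrt 2 * j - A - 1) \<omega>} \<in> events" for j
    using reaches_sets[of "[]" UNIV j] sets_GA_sub[of UNIV] by auto
  then have E: "?E \<in> events" by (intro sets.sets_Collect_finite_Ex) auto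
  have "c_low\<^sup>2 / (6 * pair_const * T\<^sup>2 * (A + 3)\<^sup>2) \<le> prob {\<omega>\<in>space M. ?Z \<omega> \<noteq> 0}"
  proof (rule paley_zygmund)
    have "ennreal c_low = (\<Sum>j\<in>{n..<n+r}. ennreal (c_low / r))"
      using c_low_pos ad'(1) by (subst sum_ennreal) auto
    also have "\<dots> \<le> (\<Sum>j\<in>{n..<n+r}. \<integral>\<^sup>+\<omega>. good_count T D A j \<omega> \<partial>M)"
    proof (rule sum_mono)
      fix j assume "j \<in> {n..<n+r}"
      then show "ennreal (c_low / r) \<le> (\<integral>\<^sup>+\<omega>. good_count T D A j \<omega> \<partial>M)"
        using good_weight_ge[OF ad, of j] good_count_mean[of j T D A] ad' by simp
    qed
    finally show "ennreal c_low \<le> (\<integral>\<^sup>+\<omega>. ?Z \<omega> \<partial>M)" by (simp add: nn_integral_sum)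
    show "0 < 6 * pair_const * T\<^sup>2 * (A + 3)\<^sup>2" using pair_const_pos ad'(3,7) by simp
  qed (use second_moment[OF ad] c_low_pos in auto)
  also have "\<dots> \<le> prob ?E"
  proof (rule finite_measure_mono[OF _ E])
    show "{\<omega>\<in>space M. ?Z \<omega> \<noteq> 0} \<subseteq> ?E"
    proof safe
      fix \<omega> assume "?Z \<omega> \<noteq> 0" and [simp]: "\<omega> \<in> space M"
      then obtain j where j: "j \<in> {n..<n+r}" "good_count T D A j \<omega> \<noteq> 0" by (meson sum.neutral)
      have "\<exists>u. good T D A j u \<omega> \<noteq> 0"
      proof (rule ccontr)
        assume "\<nexists>u. good T D A j u \<omega> \<noteq> 0"
        then show False using j(2) by (simp add: good_count_def)
      qed
      then obtain u where "good T D A j u \<omega> \<noteq> 0" by blast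
      then have "u \<in> N \<omega> j \<and> sqrt 2 * j - A - 1 \<le> U \<omega> u j" using ad' j by (intro good_witness) auto
      then show "\<exists>j\<in>{n..<n+r}. reaches [] j (sqrt 2 * j - A - 1) \<omega>" using j(1) by (auto simp: reaches_def)
    qed
  qed
  finally show ?thesis .
qed

end

section \<open>Independent copies of the process\<close>

text \<open>The fourth power makes \<open>sqrt (window n)\<close> at least \<open>ln n ^ 2\<close>,
  which for large \<open>n\<close> exceeds \<open>2 * D = 6 * ln n\<close>.\<close>

definition window :: "nat \<Rightarrow> nat" where
  "window n = nat \<lceil>ln (real n) ^ 4\<rceil>"

text \<open>Solves \<open>exp (sqrt 2 * offset a n) = n powr a\<close>; the value
  \<open>a = 3 / 2\<close> belongs to \<open>r = 1\<close> and \<open>a = 1 / 2\<close> to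
  \<open>r = n\<close>.\<close>

definition offset :: "real \<Rightarrow> nat \<Rightarrow> real" where
  "offset a n = a * ln n / sqrt 2"

lemma admissible_window:
  assumes a: "0 \<le> a" "a \<le> 3 / 2" and r: "1 \<le> r" "r \<le> n" and n: "exp 10 \<le> real n" "16 * ln (real n) ^ 4 + 16 \<le> real n"
    and eq: "exp (a * ln n) = n * sqrt n / r"
  shows "admissible n r (window n) (3 * ln n) (offset a n)"
proof -
  have n0: "0 < real n" by (rule less_le_trans[OF exp_gt_zero n(1)])
  have ln: "10 \<le> ln (real n)" using n(1) n0 by (simp add: ln_ge_iff)
  have ln4: "10 ^ 4 \<le> ln (real n) ^ 4" using ln by (intro power_mono) auto
  have w: "ln (real n) ^ 4 \<le> real (window n)" "real (window n) \<le> ln (real n) ^ 4 + 1"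
    using ln4 unfolding window_def by (auto simp: of_nat_nat)
  have "real (16 * window n) \<le> real n" using w n(2) by simp
  then have 16: "16 * window n \<le> n" by (simp only: of_nat_le_iff)
  have "real 100 \<le> real (window n)" using w ln4 by simp
  then have 100: "100 \<le> window n" by (simp only: of_nat_le_iff)
  have "6 * ln (real n) \<le> ln (real n) * ln (real n)" using ln by (intro mult_right_mono) auto
  also have "\<dots> = sqrt (ln (real n) ^ 4)" using ln by (simp add: power4_eq_xxxx real_sqrt_mult)
  also have "\<dots> \<le> sqrt (window n)" using w by simp
  finally have sq: "2 * (3 * ln (real n)) \<le> sqrt (window n)" by simp
  have "offset a n \<le> 3 / 2 * ln n / 1"
    unfolding offset_def using a ln sqrt2_bounds by (intro frac_le mult_right_mono) auto
  then have "offset a n + 1 < 3 * ln n" using ln by simp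
  moreover have "0 \<le> offset a n" using a ln by (simp add: offset_def)
  moreover have "exp (sqrt 2 * offset a n) = n * sqrt n / r" using eq by (simp add: offset_def)
  ultimately show ?thesis using r 16 100 sq unfolding admissible_def by blast
qed

text \<open>The denominator grows like \<open>ln n ^ 10\<close>: eight powers from the square of
  \<open>window n\<close> and two from that of \<open>offset\<close>. One further power beats the
  constants.\<close>

lemma window_prob_bound:
  "\<forall>\<^sub>F n in sequentially. 1 / ln (real n) ^ 11 \<le> c_low\<^sup>2 / (6 * pair_const * (window n)\<^sup>2 * (offset (3 / 2) n + 3)\<^sup>2)"
proof -
  have c: "0 < c_low\<^sup>2 / (6 * pair_const)" using c_low_pos pair_const_pos by simp
  have "\<forall>\<^sub>F x in at_top. exp 1 \<le> x \<and> (ln x ^ 4 + 1)\<^sup>2 * (3 / 2 * ln x / sqrt 2 + 3)\<^sup>2 \<le> C * ln x ^ 11" if "0 < C" for C :: real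
    using that by (intro eventually_conj eventually_ge_at_top) real_asymp
  from filterlim_real_sequentially[unfolded filterlim_iff, rule_format, OF this[OF c]]
  show ?thesis
  proof eventually_elim
    case (elim n)
    have n0: "0 < real n" by (rule less_le_trans[OF exp_gt_zero, of 1]) (use elim in simp)
    have ln: "1 \<le> ln (real n)" using elim n0 by (simp add: ln_ge_iff)
    have w: "0 < real (window n)" "real (window n) \<le> ln (real n) ^ 4 + 1"
    proof -
      have "1 \<le> ln (real n) ^ 4" using ln by (rule one_le_power)
      then show "0 < real (window n)" "real (window n) \<le> ln (real n) ^ 4 + 1" unfolding window_def by (auto simp: of_nat_nat)
    qed
    have o: "0 < offset (3 / 2) n + 3" using ln by (simp add: offset_def add_nonneg_pos)
    have "(window n)\<^sup>2 * (offset (3 / 2) n + 3)\<^sup>2 \<le> (ln (real n) ^ 4 + 1)\<^sup>2 * (3 / 2 * ln n / sqrt 2 + 3)\<^sup>2"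
      using w o unfolding offset_def by (simp only: of_nat_power) (intro mult_right_mono power_mono; simp)
    also have "\<dots> \<le> c_low\<^sup>2 / (6 * pair_const) * ln (real n) ^ 11" using elim by simp
    finally have "6 * pair_const * ((window n)\<^sup>2 * (offset (3 / 2) n + 3)\<^sup>2) \<le> c_low\<^sup>2 * ln (real n) ^ 11"
      using pair_const_pos by (simp add: field_simps)
    then show ?case using pair_const_pos w o ln by (simp add: field_simps)
  qed
qed

definition large :: "nat \<Rightarrow> bool" where
  "large n \<longleftrightarrow> exp 10 \<le> real n \<and> 16 * ln (real n) ^ 4 + 16 \<le> real n
    \<and> 1 / ln (real n) ^ 11 \<le> c_low\<^sup>2 / (6 * pair_const * (window n)\<^sup>2 * (offset (3 / 2) n + 3)\<^sup>2)"

lemma large_n: "\<forall>\<^sub>F n in sequentially. large n"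
proof -
  have "\<forall>\<^sub>F x in at_top. exp 10 \<le> x \<and> 16 * ln x ^ 4 + 16 \<le> (x :: real)"
    by (intro eventually_conj eventually_ge_at_top) real_asymp
  from filterlim_real_sequentially[unfolded filterlim_iff, rule_format, OF this] window_prob_bound
  show ?thesis by eventually_elim (simp add: large_def)
qed

context branching_data
begin

lemma reaches_prob_large:
  assumes "large n"
  shows "1 / ln (real n) ^ 11 \<le> prob {\<omega>\<in>space M. \<exists>j\<in>{n..<n+1}. reaches [] j (sqrt 2 * j - offset (3 / 2) n - 1) \<omega>}
    \<and> 1 / ln (real n) ^ 11 \<le> prob {\<omega>\<in>space M. \<exists>j\<in>{n..<n+n}. reaches [] j (sqrt 2 * j - offset (1 / 2) n - 1) \<omega>}"
proof -
  have elim: "exp 10 \<le> real n \<and> 16 * ln (real n) ^ 4 + 16 \<le> real n"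
    "1 / ln (real n) ^ 11 \<le> c_low\<^sup>2 / (6 * pair_const * (window n)\<^sup>2 * (offset (3 / 2) n + 3)\<^sup>2)"
    using assms by (auto simp: large_def)
  have n0: "0 < real n" by (rule less_le_trans[OF exp_gt_zero, of 10]) (use elim in simp)
  have ln0: "0 \<le> ln (real n)" using elim(1) n0 by (auto simp: ln_ge_zero_iff intro: order_trans[of 1 "exp 10"])
  have e: "exp (1 / 2 * ln (real n)) = sqrt n" using n0 by (simp add: powr_half_sqrt[symmetric] powr_def)
  have e3: "exp (3 / 2 * ln (real n)) = n * sqrt n"
  proof -
    have "exp (3 / 2 * ln (real n)) = exp (ln (real n)) * exp (1 / 2 * ln (real n))" by (simp add: exp_add[symmetric])
    then show ?thesis using e n0 by simp
  qed
  have 1: "admissible n 1 (window n) (3 * ln n) (offset (3 / 2) n)"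
    by (rule admissible_window) (use elim n0 e3 in auto)
  have 2: "admissible n n (window n) (3 * ln n) (offset (1 / 2) n)"
    by (rule admissible_window) (use elim n0 e in auto)
  have "c_low\<^sup>2 / (6 * pair_const * (window n)\<^sup>2 * (offset (3 / 2) n + 3)\<^sup>2) \<le> c_low\<^sup>2 / (6 * pair_const * (window n)\<^sup>2 * (offset (1 / 2) n + 3)\<^sup>2)"
  proof (intro divide_left_mono mult_left_mono power_mono)
    show "offset (1 / 2) n + 3 \<le> offset (3 / 2) n + 3" using ln0 by (simp add: offset_def divide_right_mono)
    show "0 < 6 * pair_const * (window n)\<^sup>2 * (offset (3 / 2) n + 3)\<^sup>2 * (6 * pair_const * (window n)\<^sup>2 * (offset (1 / 2) n + 3)\<^sup>2)"
      using admissibleD(3,7)[OF 1] admissibleD(7)[OF 2] pair_const_pos by (intro mult_pos_pos) auto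
    show "0 \<le> offset (1 / 2) n + 3" using admissibleD(7)[OF 2] by simp
  qed (use pair_const_pos in auto)
  then show ?thesis using reaches_prob[OF 1] reaches_prob[OF 2] elim(2) by linarith
qed

definition copy_labels :: "particle \<Rightarrow> (particle + particle) set" where
  "copy_labels x = {Inl (v @ x) | v. True} \<union> {Inr (v @ x) | v. True}"

lemma reaches_copy_sets:
  "finite J \<Longrightarrow> {\<omega>\<in>space M. \<exists>j\<in>J. reaches x j (c j) \<omega>} \<in> sets (GA (copy_labels x))"
  using reaches_sets[of x "copy_labels x"]
    sets.sets_Collect_finite_Ex[of J "GA (copy_labels x)" "\<lambda>j \<omega>. reaches x j (c j) \<omega>"]
  by (auto simp: copy_labels_def)

lemma reaches_copy: 
  "branching_data.reaches (\<lambda>v. L (v @ x)) (\<lambda>v. W (v @ x)) [] j c \<omega> = reaches x j c \<omega>"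
proof -
  interpret C: branching_data M "\<lambda>v. L (v @ x)" "\<lambda>v. W (v @ x)" by (rule branching_data_copy)
  show ?thesis by (simp add: C.reaches_def reaches_def Wr_copy)
qed

lemma reaches_copy_prob:
  "\<forall>\<^sub>F n in sequentially. \<forall>x. 1 / ln (real n) ^ 11 \<le> prob {\<omega>\<in>space M. \<exists>j\<in>{n..<n+1}. reaches x j (sqrt 2 * j - offset (3 / 2) n - 1) \<omega>}
    \<and> 1 / ln (real n) ^ 11 \<le> prob {\<omega>\<in>space M. \<exists>j\<in>{n..<n+n}. reaches x j (sqrt 2 * j - offset (1 / 2) n - 1) \<omega>}"
  using large_n
proof eventually_elim
  case (elim n)
  show ?case
  proof
    fix x
    interpret C: branching_data M "\<lambda>v. L (v @ x)" "\<lambda>v. W (v @ x)" by (rule branching_data_copy)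
    show "1 / ln (real n) ^ 11 \<le> prob {\<omega>\<in>space M. \<exists>j\<in>{n..<n+1}. reaches x j (sqrt 2 * j - offset (3 / 2) n - 1) \<omega>}
      \<and> 1 / ln (real n) ^ 11 \<le> prob {\<omega>\<in>space M. \<exists>j\<in>{n..<n+n}. reaches x j (sqrt 2 * j - offset (1 / 2) n - 1) \<omega>}"
      using C.reaches_prob_large[OF elim] unfolding reaches_copy .
  qed
qed

text \<open>Distinct words of equal length root disjoint subtrees, so all copies fail with
  probability at most \<open>(1 - p) ^ (2 ^ g) \<le> exp (- p * 2 ^ g)\<close>.\<close>

lemma independent_copies:
  fixes E :: "particle \<Rightarrow> 'a set"
  assumes E: "\<And>x. length x = g \<Longrightarrow> E x \<in> sets (GA (copy_labels x))" "\<And>x. length x = g \<Longrightarrow> p \<le> prob (E x)"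
  shows "prob {\<omega>\<in>space M. \<forall>x :: particle. length x = g \<longrightarrow> \<omega> \<notin> E x} \<le> exp (- p * 2 ^ g)"
proof -
  let ?X = "{x :: particle. length x = g}"
  have fin: "finite ?X" "card ?X = 2 ^ g"
    using finite_lists_length_eq[of "UNIV :: bool set" g] card_lists_length_eq[of "UNIV :: bool set" g] by auto
  have ne: "?X \<noteq> {}" using Ex_list_of_length[of g] by auto
  have "disjoint_family_on copy_labels ?X"
    by (auto simp: disjoint_family_on_def copy_labels_def)
  from indep_GA[OF this] have ind: "indep_sets (\<lambda>x. sets (GA (copy_labels x))) ?X" .
  have c: "space M - E x \<in> sets (GA (copy_labels x))" if "x \<in> ?X" for x
    using E(1)[of x] that sets.compl_sets[of "E x" "GA (copy_labels x)"] by simp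
  have ev: "E x \<in> events" if "x \<in> ?X" for x using E(1)[of x] that sets_GA_sub by blast
  have "{\<omega>\<in>space M. \<forall>x. length x = g \<longrightarrow> \<omega> \<notin> E x} = (\<Inter>x\<in>?X. space M - E x)" using ne by auto
  also have "prob \<dots> = (\<Prod>x\<in>?X. prob (space M - E x))"
    by (rule indep_setsD[OF ind]) (use fin ne c in auto)
  also have "\<dots> \<le> (\<Prod>x\<in>?X. exp (- p))"
  proof (rule prod_mono, safe)
    fix x :: particle assume x: "g = length x"
    have "prob (space M - E x) = 1 - prob (E x)" using ev[of x] x by (intro prob_compl) auto
    also have "\<dots> \<le> 1 + (- p)" using E(2)[of x] x by simp
    also have "\<dots> \<le> exp (- p)" by (rule exp_ge_add_one_self)
    finally show "prob (space M - E x) \<le> exp (- p)" .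
  qed simp
  also have "\<dots> = exp (- p * 2 ^ g)" using fin(2) by (simp add: exp_of_nat_mult[symmetric] mult.commute)
  finally show ?thesis .
qed

text \<open>The event asked of a copy may depend on its random birth time through
  \<open>\<kappa>\<close>. Birth times in generation \<open>g\<close> involve only lifetimes of
  labels shorter than \<open>g\<close>, which are independent of all copies rooted there, so they
  can be frozen.\<close>

lemma shifted_copies:
  fixes \<kappa> :: "real \<Rightarrow> nat"
  assumes E: "\<And>x k. length x = g \<Longrightarrow> E x k \<in> sets (GA (copy_labels x))"
    and p: "\<And>x k. length x = g \<Longrightarrow> k \<in> S \<Longrightarrow> p \<le> prob (E x k)"
    and \<kappa>[measurable]: "\<kappa> \<in> borel \<rightarrow>\<^sub>M count_space UNIV"
  defines "B \<equiv> {\<omega>\<in>space M. \<forall>x. length x = g \<longrightarrow> \<kappa> (birth_time (\<lambda>v. L v \<omega>) x) \<in> S \<and> \<omega> \<notin> E x (\<kappa> (birth_time (\<lambda>v. L v \<omega>) x))}"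
  shows "B \<in> events" and "prob B \<le> exp (- p * 2 ^ g)"
proof -
  let ?X = "{x :: particle. length x = g}"
  define I :: "(particle + particle) set" where "I = {Inl v | v. length v < g}"
  define J :: "(particle + particle) set" where "J = {Inl v | v. g \<le> length v} \<union> {Inr v | v. True}"
  have IJ: "I \<inter> J = {}" by (auto simp: I_def J_def)
  have fin: "finite ?X" using finite_lists_length_eq[of "UNIV :: bool set" g] by auto
  define b where "b x \<omega> = \<kappa> (birth_time (\<lambda>v. L v \<omega>) x)" for x \<omega>
  have b: "b x \<in> GA I \<rightarrow>\<^sub>M count_space UNIV" if "length x = g" for x
  proof -
    have [measurable]: "(\<lambda>\<omega>. birth_time (\<lambda>v. L v \<omega>) x) \<in> borel_measurable (GA I)"
    proof (rule birth_time_measurable)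
      fix v assume "suffix v x" "v \<noteq> x"
      then have "length v < g" using that by (auto simp: suffix_def)
      then show "(\<lambda>\<omega>. L v \<omega>) \<in> borel_measurable (GA I)" using L_measurable[of v I] by (auto simp: I_def)
    qed
    show ?thesis unfolding b_def by measurable
  qed
  have EJ: "E x k \<in> sets (GA J)" if "length x = g" for x k
  proof -
    have "copy_labels x \<subseteq> J" using that by (auto simp: copy_labels_def J_def)
    from GA_mono[OF this] show ?thesis using E[OF that, of k] by (auto simp: subalgebra_def)
  qed
  \<comment> \<open>Naming the value \<open>k\<close> of \<open>b x\<close> writes \<open>Q\<close>
    as a countable combination of events that each involve one coordinate.\<close>
  define Q where "Q = {z\<in>space (GA I \<Otimes>\<^sub>M GA J). \<forall>x\<in>?X. \<exists>k. b x (fst z) = k \<and> k \<in> S \<and> snd z \<notin> E x k}"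
  have Q: "Q \<in> sets (GA I \<Otimes>\<^sub>M GA J)" unfolding Q_def
  proof (intro sets.sets_Collect_finite_All' sets.sets_Collect_countable_Ex sets.sets_Collect_conj fin)
    fix x k assume "x \<in> ?X"
    then have x: "length x = g" by simp
    note [measurable] = b[OF x] EJ[OF x]
    show "{z \<in> space (GA I \<Otimes>\<^sub>M GA J). b x (fst z) = k} \<in> sets (GA I \<Otimes>\<^sub>M GA J)" by measurable
    show "{z \<in> space (GA I \<Otimes>\<^sub>M GA J). snd z \<notin> E x k} \<in> sets (GA I \<Otimes>\<^sub>M GA J)" by measurable
  qed (auto simp: Ex_list_of_length)
  have BQ: "\<omega> \<in> B \<longleftrightarrow> (\<omega>, \<omega>) \<in> Q" if "\<omega> \<in> space M" for \<omega>
    using that unfolding B_def Q_def b_def by (simp add: space_pair_measure)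
  have diag: "(\<lambda>\<omega>. (\<omega>, \<omega>)) \<in> M \<rightarrow>\<^sub>M GA I \<Otimes>\<^sub>M GA J"
    by (intro measurable_Pair measurable_from_subalg[OF subalgebra_GA measurable_ident_sets]) (rule refl)+
  have "B \<subseteq> space M" unfolding B_def by blast
  then have "B = (\<lambda>\<omega>. (\<omega>, \<omega>)) -` Q \<inter> space M" using BQ by blast
  then show Bev: "B \<in> events" using measurable_sets[OF diag Q] by simp
  have "emeasure M B = (\<integral>\<^sup>+\<omega>. indicator B \<omega> \<partial>M)" using nn_integral_indicator[OF Bev] by simp
  also have "\<dots> = (\<integral>\<^sup>+\<omega>. indicator Q (\<omega>, \<omega>) \<partial>M)"
    by (rule nn_integral_cong) (simp add: BQ indicator_def)
  also have "\<dots> = (\<integral>\<^sup>+\<omega>1. (\<integral>\<^sup>+\<omega>2. indicator Q (\<omega>1, \<omega>2) \<partial>M) \<partial>M)"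
    by (rule decouple[OF IJ, of "indicator Q"]) (rule borel_measurable_indicator[OF Q])
  also have "\<dots> \<le> (\<integral>\<^sup>+\<omega>1. ennreal (exp (- p * 2 ^ g)) \<partial>M)"
  proof (rule nn_integral_mono)
    fix \<omega>1 assume \<omega>1: "\<omega>1 \<in> space M"
    show "(\<integral>\<^sup>+\<omega>2. indicator Q (\<omega>1, \<omega>2) \<partial>M) \<le> ennreal (exp (- p * 2 ^ g))"
    proof (cases "\<forall>x\<in>?X. b x \<omega>1 \<in> S")
      case True
      let ?B = "{\<omega>\<in>space M. \<forall>x. length x = g \<longrightarrow> \<omega> \<notin> E x (b x \<omega>1)}"
      have "(\<integral>\<^sup>+\<omega>2. indicator Q (\<omega>1, \<omega>2) \<partial>M) \<le> (\<integral>\<^sup>+\<omega>2. indicator ?B \<omega>2 \<partial>M)"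
      proof (rule nn_integral_mono)
        fix \<omega>2
        have "(\<omega>1, \<omega>2) \<in> Q \<Longrightarrow> \<omega>2 \<in> ?B" by (simp add: Q_def space_pair_measure)
        then show "indicator Q (\<omega>1, \<omega>2) \<le> (indicator ?B \<omega>2 :: ennreal)" by (simp add: indicator_def)
      qed
      also have "\<dots> = emeasure M ?B"
      proof (rule nn_integral_indicator)
        have "{\<omega>\<in>space M. \<forall>x\<in>?X. \<omega> \<notin> E x (b x \<omega>1)} \<in> events"
        proof (rule sets.sets_Collect_finite_All'[OF _ fin])
          fix x assume "x \<in> ?X"
          then have "E x (b x \<omega>1) \<in> events" using EJ[of x "b x \<omega>1"] sets_GA_sub by blast
          then show "{\<omega>\<in>space M. \<omega> \<notin> E x (b x \<omega>1)} \<in> events" by measurable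
        qed (use Ex_list_of_length in blast)
        then show "?B \<in> events" by (simp only: Ball_def mem_Collect_eq)
      qed
      also have "\<dots> \<le> ennreal (exp (- p * 2 ^ g))"
        unfolding emeasure_eq_measure
      proof (intro ennreal_leI, rule independent_copies)
        show "E x (b x \<omega>1) \<in> sets (GA (copy_labels x))" if "length x = g" for x using that by (rule E)
        show "p \<le> prob (E x (b x \<omega>1))" if "length x = g" for x using that True by (intro p) auto
      qed
      finally show ?thesis .
    next
      case False
      then obtain x where "x \<in> ?X" "b x \<omega>1 \<notin> S" by blast
      then have "(\<omega>1, \<omega>2) \<notin> Q" for \<omega>2 unfolding Q_def by fastforce
      then show ?thesis by simp
    qed
  qed
  also have "\<dots> = ennreal (exp (- p * 2 ^ g))" by (simp add: emeasure_space_1)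
  finally show "prob B \<le> exp (- p * 2 ^ g)" by (simp add: emeasure_eq_measure)
qed

section \<open>Delay of a whole generation and comparison with the reflected system\<close>

text \<open>A Chernoff bound in density form: half of \<open>exp (- s)\<close> is bounded by its
  value at \<open>4 * Suc (length w)\<close>, and the other half gives an Erlang density of rate 1/2
  at the price of \<open>2 ^ Suc (length w)\<close>.\<close>

lemma death_tail:
  "(\<integral>\<^sup>+\<omega>. indicator {4 * real (Suc (length w))<..} (death w \<omega>) \<partial>M) \<le> ennreal ((2 * exp (- 2)) ^ Suc (length w))"
proof -
  let ?k = "length w"
  have "(\<integral>\<^sup>+\<omega>. indicator {4 * real (Suc ?k)<..} (death w \<omega>) \<partial>M)
      = (\<integral>\<^sup>+s. ennreal (erlang_density ?k 1 s) * indicator {4 * real (Suc ?k)<..} s \<partial>lborel)"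
    by (rule distributed_nn_integral[OF death_distributed, symmetric]) simp
  also have "\<dots> \<le> (\<integral>\<^sup>+s. ennreal ((2 * exp (- 2)) ^ Suc ?k) * ennreal (erlang_density ?k (1 / 2) s) \<partial>lborel)"
  proof (rule nn_integral_mono)
    fix s :: real
    show "ennreal (erlang_density ?k 1 s) * indicator {4 * real (Suc ?k)<..} s \<le> ennreal ((2 * exp (- 2)) ^ Suc ?k) * ennreal (erlang_density ?k (1 / 2) s)"
    proof (cases "4 * real (Suc ?k) < s")
      case True
      then have s: "0 \<le> s" by (rule order_trans[rotated, OF less_imp_le]) simp
      have "exp (- s) = exp (- s / 2) * exp (- s / 2)" by (simp add: exp_add[symmetric])
      also have "\<dots> \<le> exp (- 2 * real (Suc ?k)) * exp (- s / 2)" using True by (intro mult_right_mono) auto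
      also have "exp (- 2 * real (Suc ?k)) = exp (- 2) ^ Suc ?k" by (simp only: exp_of_nat2_mult[symmetric])
      finally have "s ^ ?k / fact ?k * exp (- s) \<le> s ^ ?k / fact ?k * (exp (- 2) ^ Suc ?k * exp (- s / 2))"
        using s by (intro mult_left_mono) auto
      also have "\<dots> = (2 * exp (- 2)) ^ Suc ?k * ((1 / 2) ^ Suc ?k * s ^ ?k * exp (- (1 / 2) * s) / fact ?k)"
        unfolding power_mult_distrib by (simp add: power_divide)
      finally have "erlang_density ?k 1 s \<le> (2 * exp (- 2)) ^ Suc ?k * erlang_density ?k (1 / 2) s"
        using s unfolding erlang_density_def by (simp add: mult_ac)
      then show ?thesis using True by (subst ennreal_mult'[symmetric]) (auto intro: ennreal_leI)
    qed simp
  qed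
  also have "\<dots> = ennreal ((2 * exp (- 2)) ^ Suc ?k) * emeasure (density lborel (\<lambda>s. ennreal (erlang_density ?k (1 / 2) s))) UNIV"
    by (simp add: nn_integral_cmult emeasure_density)
  also have "\<dots> = ennreal ((2 * exp (- 2)) ^ Suc ?k)"
    using prob_space.emeasure_space_1[OF prob_space_erlang_density[of "1 / 2" ?k]] by simp
  finally show ?thesis .
qed

text \<open>Speed 4 suffices because the \<open>2 ^ g\<close> labels times the tail
  \<open>(2 * exp (- 2)) ^ g\<close> form a geometric series of ratio
  \<open>4 * exp (- 2) < 1\<close>.\<close>

lemma AE_generation_births:
  "AE \<omega> in M. \<forall>\<^sub>F g in sequentially. \<forall>x. length x = g \<longrightarrow> birth_time (\<lambda>v. L v \<omega>) x \<le> 4 * real g"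
proof -
  define Y :: "nat \<Rightarrow> particle \<Rightarrow> 'a \<Rightarrow> ennreal" where
    "Y g x \<omega> = indicator {x. length x = g} x * indicator {4 * real g<..} (birth_time (\<lambda>v. L v \<omega>) x)" for g x \<omega>
  have [measurable]: "(\<lambda>\<omega>. birth_time (\<lambda>v. L v \<omega>) x) \<in> borel_measurable M" for x
    by (rule birth_time_measurable) simp
  let ?q = "4 * exp (- 2) :: real"
  have q: "?q < 1"
  proof -
    have "1 + 1 + 1\<^sup>2 / 2 \<le> exp (1 :: real)" by (rule exp_lower_Taylor_quadratic) simp
    then have "(5 / 2) * (5 / 2) \<le> exp 1 * exp (1 :: real)" by (intro mult_mono) auto
    then have "4 < exp (2 :: real)" by (simp add: exp_add[symmetric])
    then show ?thesis by (simp add: exp_minus field_simps)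
  qed
  have "AE \<omega> in M. \<forall>\<^sub>F g in sequentially. \<forall>x. Y g x \<omega> < 1"
  proof (rule AE_eventually_none)
    show "Y g x \<in> borel_measurable M" for g x unfolding Y_def by measurable
    show "summable (\<lambda>g. ?q ^ g)" using q by (intro summable_geometric) simp
    show "\<forall>\<^sub>F g in sequentially. (\<integral>\<^sup>+x. (\<integral>\<^sup>+\<omega>. Y g x \<omega> \<partial>M) \<partial>count_space UNIV) \<le> ennreal (?q ^ g)"
      using eventually_gt_at_top[of 0]
    proof eventually_elim
      case (elim g)
      have "(\<integral>\<^sup>+x. (\<integral>\<^sup>+\<omega>. Y g x \<omega> \<partial>M) \<partial>count_space UNIV) \<le> (\<integral>\<^sup>+x. ennreal ((2 * exp (- 2)) ^ g) * indicator {x :: particle. length x = g} x \<partial>count_space UNIV)"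
      proof (rule nn_integral_mono)
        fix x :: particle
        show "(\<integral>\<^sup>+\<omega>. Y g x \<omega> \<partial>M) \<le> ennreal ((2 * exp (- 2)) ^ g) * indicator {x. length x = g} x"
        proof (cases "length x = g")
          case True
          then obtain b w where x: "x = b # w" "Suc (length w) = g" using elim by (cases x) auto
          have "(\<integral>\<^sup>+\<omega>. Y g x \<omega> \<partial>M) = (\<integral>\<^sup>+\<omega>. indicator {4 * real (Suc (length w))<..} (death w \<omega>) \<partial>M)"
            using True x by (auto simp: Y_def birth_eq_death simp del: birth_time.simps)
          then show ?thesis using death_tail[of w] True x by simp
        qed (simp add: Y_def)
      qed
      also have "\<dots> = ennreal ((2 * exp (- 2)) ^ g) * ennreal (2 ^ g)"
      proof -
        have "emeasure (count_space UNIV) {x :: particle. length x = g} = 2 ^ g"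
          using finite_lists_length_eq[of "UNIV :: bool set" g] card_lists_length_eq[of "UNIV :: bool set" g]
          by (simp add: emeasure_count_space)
        then show ?thesis by (subst nn_integral_cmult_indicator) (auto simp: ennreal_power[symmetric])
      qed
      also have "\<dots> = ennreal (?q ^ g)"
      proof -
        have "(2 * exp (- 2)) ^ g * 2 ^ g = ?q ^ g" unfolding power_mult_distrib[symmetric] by simp
        then show ?thesis by (subst ennreal_mult[symmetric]) simp_all
      qed
      finally show ?case .
    qed
  qed simp
  then show ?thesis
  proof (eventually_elim)
    case (elim \<omega>)
    then show ?case
    proof eventually_elim
      case (elim g)
      show ?case
      proof (intro allI impI)
        fix x :: particle assume "length x = g"
        then show "birth_time (\<lambda>v. L v \<omega>) x \<le> 4 * real g" using elim[rule_format, of x] by (intro leI) (auto simp: Y_def)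
      qed
    qed
  qed
qed

text \<open>The reflected lineage enters the subtree at a nonnegative height while the copy starts
  at 0, and every later \<open>abs\<close> only raises the former.\<close>

lemma path_copy_le:
  assumes l: "\<And>v. 0 < l v" and w: "\<And>v. w v 0 = 0" and t: "birth_time l x \<le> t"
  shows "path (\<lambda>y. y) (\<lambda>v. l (v @ x)) (\<lambda>v. w (v @ x)) u (t - birth_time l x) \<le> path abs l w (u @ x) t"
  using t
proof (induction u arbitrary: t)
  case Nil
  show ?case
  proof (cases x)
    case (Cons b y)
    have "0 \<le> path abs l w y (birth_time l (b # y))" by (rule path_abs_nonneg)
    then show ?thesis using Nil by (auto simp: Cons simp del: birth_time.simps)
  qed simp
next
  case (Cons b u)
  let ?l = "\<lambda>v. l (v @ x)" and ?w = "\<lambda>v. w (v @ x)"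
  have b: "birth_time l (b # u @ x) = birth_time l x + birth_time ?l (b # u)"
    using birth_time_append[of l "b # u" x] by simp
  have nn: "0 \<le> birth_time ?l (b # u)" using l by (intro birth_time_nonneg)
  have "path (\<lambda>y. y) ?l ?w u (birth_time l (b # u @ x) - birth_time l x) \<le> path abs l w (u @ x) (birth_time l (b # u @ x))"
    by (rule Cons.IH) (use b nn in simp)
  then have 1: "path (\<lambda>y. y) ?l ?w u (birth_time ?l (b # u)) \<le> path abs l w (u @ x) (birth_time l (b # u @ x))"
    by (simp add: b del: birth_time.simps)
  have 2: "t - birth_time l x - birth_time ?l (b # u) = t - birth_time l (b # u @ x)" using b by simp
  show ?case
  proof (cases "t < birth_time l (b # u @ x)")
    case True
    then have "t - birth_time l x < birth_time ?l (b # u)" using b by simp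
    then show ?thesis using True Cons by (simp del: birth_time.simps)
  next
    case False
    then have "\<not> t - birth_time l x < birth_time ?l (b # u)" using b by simp
    then show ?thesis using False 1 by (simp add: 2 del: birth_time.simps)
  qed
qed

lemma reaches_position:
  assumes reg: "regular \<omega>" and r: "reaches x j c \<omega>"
  shows "\<exists>u\<in>N \<omega> (birth_time (\<lambda>v. L v \<omega>) x + j). c \<le> X \<omega> u (birth_time (\<lambda>v. L v \<omega>) x + j)"
proof -
  let ?b = "birth_time (\<lambda>v. L v \<omega>) x"
  obtain u where u: "u \<in> alive (\<lambda>v. L (v @ x) \<omega>) (real j)" "c \<le> path (\<lambda>y. y) (\<lambda>v. L (v @ x) \<omega>) (\<lambda>v t. Wr (v @ x) t \<omega>) u (real j)"
    using r by (auto simp: reaches_def)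
  have "u @ x \<in> N \<omega> (?b + j)" using u(1) by (simp add: alive_append)
  moreover have "path (\<lambda>y. y) (\<lambda>v. L (v @ x) \<omega>) (\<lambda>v t. Wr (v @ x) t \<omega>) u (?b + j - ?b) \<le> X \<omega> (u @ x) (?b + j)"
    using regularD(1,2)[OF reg] by (intro path_copy_le) auto
  ultimately show ?thesis using u(2) by (intro bexI[of _ "u @ x"]) auto
qed

end

section \<open>Almost sure limits\<close>

text \<open>Tolerances run through a sequence, so that the almost sure statements for single
  tolerances can be intersected.\<close>

lemma Limsup_ereal_eqI:
  fixes f :: "'b \<Rightarrow> real"
  assumes e: "e \<longlonglongrightarrow> 0" and up: "\<And>k :: nat. \<forall>\<^sub>F t in F. f t \<le> c + e k"
    and low: "\<And>k. \<exists>\<^sub>F t in F. c - e k \<le> f t"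
  shows "Limsup F (\<lambda>t. ereal (f t)) = ereal c"
proof (rule antisym)
  have up_lim: "(\<lambda>k. ereal (c + e k)) \<longlonglongrightarrow> ereal c" and low_lim: "(\<lambda>k. ereal (c - e k)) \<longlonglongrightarrow> ereal c"
    using tendsto_add[OF tendsto_const e, of c] tendsto_diff[OF tendsto_const e, of c] by auto
  have "Limsup F (\<lambda>t. ereal (f t)) \<le> ereal (c + e k)" for k
    using up[of k] by (intro Limsup_bounded) simp
  then show "Limsup F (\<lambda>t. ereal (f t)) \<le> ereal c" by (intro LIMSEQ_le_const[OF up_lim]) auto
  have "ereal (c - e k) \<le> Limsup F (\<lambda>t. ereal (f t))" for k
  proof (rule ccontr)
    assume "\<not> ereal (c - e k) \<le> Limsup F (\<lambda>t. ereal (f t))"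
    then have "\<forall>\<^sub>F t in F. ereal (f t) < ereal (c - e k)" by (intro Limsup_lessD) simp
    then have "\<forall>\<^sub>F t in F. \<not> c - e k \<le> f t" by eventually_elim simp
    then show False using low[of k] by (simp add: frequently_def)
  qed
  then show "ereal c \<le> Limsup F (\<lambda>t. ereal (f t))" by (intro LIMSEQ_le_const2[OF low_lim]) auto
qed

lemma Liminf_ereal_eqI:
  fixes f :: "'b \<Rightarrow> real"
  assumes e: "e \<longlonglongrightarrow> 0" and low: "\<And>k :: nat. \<forall>\<^sub>F t in F. c - e k \<le> f t"
    and up: "\<And>k. \<exists>\<^sub>F t in F. f t \<le> c + e k"
  shows "Liminf F (\<lambda>t. ereal (f t)) = ereal c"
proof -
  have "Limsup F (\<lambda>t. ereal (- f t)) = ereal (- c)"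
  proof (rule Limsup_ereal_eqI[OF e])
    show "\<forall>\<^sub>F t in F. - f t \<le> - c + e k" for k using low[of k] by eventually_elim simp
    show "\<exists>\<^sub>F t in F. - c - e k \<le> - f t" for k using up[of k] by (rule frequently_elim1) simp
  qed
  then have "- Liminf F (\<lambda>t. ereal (f t)) = - ereal c" using ereal_Limsup_uminus[of F "\<lambda>t. ereal (f t)"] by simp
  then show ?thesis by (simp only: ereal_uminus_eq_iff)
qed

text \<open>This generation offers at least \<open>m powr (\<delta> * ln 2)\<close> copies, while
  its depth, which governs the delay, is only about \<open>\<delta> * ln m\<close>.\<close>

definition gen :: "real \<Rightarrow> nat \<Rightarrow> nat" where
  "gen \<delta> m = nat \<lceil>\<delta> * ln m\<rceil>"

lemma gen_bounds:
  assumes "0 < \<delta>" "1 \<le> m"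
  shows "\<delta> * ln m \<le> gen \<delta> m" "gen \<delta> m \<le> \<delta> * ln m + 1"
proof -
  have "0 \<le> \<delta> * ln m" using assms by simp
  then show "\<delta> * ln m \<le> gen \<delta> m" "gen \<delta> m \<le> \<delta> * ln m + 1" unfolding gen_def by (auto simp: of_nat_nat)
qed

lemma filterlim_gen: "0 < \<delta> \<Longrightarrow> filterlim (gen \<delta>) sequentially sequentially"
  unfolding gen_def by real_asymp

text \<open>A positive power of \<open>m\<close> divided by \<open>ln m ^ 11\<close> eventually
  exceeds \<open>2 * ln m\<close>, so the terms are at most \<open>inverse (m ^ 2)\<close>.\<close>

lemma summable_no_good_copy:
  assumes \<delta>: "0 < \<delta>"
  shows "summable (\<lambda>m. exp (- (1 / ln (real m) ^ 11) * 2 ^ gen \<delta> m))"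
proof (rule summable_comparison_test_ev)
  show "summable (\<lambda>m. inverse (real m ^ 2))" by (rule inverse_power_summable) simp
  have "\<forall>\<^sub>F x in at_top. 3 \<le> x \<and> 2 * ln x \<le> 1 / ln x ^ 11 * x powr d" if "0 < d" for d :: real
    using that by (intro eventually_conj eventually_ge_at_top) real_asymp
  from this[of "\<delta> * ln 2"] have "\<forall>\<^sub>F x in at_top. 3 \<le> x \<and> 2 * ln x \<le> 1 / ln x ^ 11 * x powr (\<delta> * ln 2)" using \<delta> by simp
  from filterlim_real_sequentially[unfolded filterlim_iff, rule_format, OF this]
  show "\<forall>\<^sub>F m in sequentially. norm (exp (- (1 / ln (real m) ^ 11) * 2 ^ gen \<delta> m)) \<le> inverse (real m ^ 2)"
  proof eventually_elim
    case (elim m)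
    have m: "1 \<le> m" "0 < real m" "0 \<le> ln (real m)" using elim by auto
    have "real m powr (\<delta> * ln 2) = 2 powr (\<delta> * ln m)" using m by (simp add: powr_def)
    also have "\<dots> \<le> 2 powr real (gen \<delta> m)" using gen_bounds[OF \<delta> m(1)] by (intro powr_mono) auto
    also have "\<dots> = 2 ^ gen \<delta> m" by (simp add: powr_realpow)
    finally have "1 / ln (real m) ^ 11 * real m powr (\<delta> * ln 2) \<le> 1 / ln (real m) ^ 11 * 2 ^ gen \<delta> m"
      using m by (intro mult_left_mono) auto
    then have "2 * ln (real m) \<le> 1 / ln (real m) ^ 11 * 2 ^ gen \<delta> m" using elim by linarith
    then have "exp (- (1 / ln (real m) ^ 11) * 2 ^ gen \<delta> m) \<le> exp (- (2 * ln (real m)))" by simp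
    also have "\<dots> = inverse (real m ^ 2)" using m by (simp only: exp_minus exp_double exp_ln)
    finally show ?case by simp
  qed
qed

context branching_data
begin

abbreviation birth :: "'a \<Rightarrow> particle \<Rightarrow> real" where
  "birth \<omega> x \<equiv> birth_time (\<lambda>v. L v \<omega>) x"

text \<open>\<open>S m\<close> holds the parameters for which the probability bound is available.
  That all shifted parameters lie in \<open>S m\<close> remains a pathwise premise, to be met by the
  bound on birth times.\<close>

lemma AE_good_copy:
  fixes \<kappa> :: "nat \<Rightarrow> real \<Rightarrow> nat"
  assumes \<delta>: "0 < \<delta>" and E: "\<And>m x k. E m x k \<in> sets (GA (copy_labels x))"
    and p: "\<forall>\<^sub>F m in sequentially. \<forall>x. \<forall>k\<in>S m. 1 / ln (real m) ^ 11 \<le> prob (E m x k)"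
    and \<kappa>: "\<And>m. \<kappa> m \<in> borel \<rightarrow>\<^sub>M count_space UNIV"
  shows "AE \<omega> in M. \<forall>\<^sub>F m in sequentially. (\<forall>x. length x = gen \<delta> m \<longrightarrow> \<kappa> m (birth \<omega> x) \<in> S m)
    \<longrightarrow> (\<exists>x. length x = gen \<delta> m \<and> \<omega> \<in> E m x (\<kappa> m (birth \<omega> x)))"
proof -
  define B where "B m = {\<omega>\<in>space M. \<forall>x. length x = gen \<delta> m \<longrightarrow> \<kappa> m (birth \<omega> x) \<in> S m \<and> \<omega> \<notin> E m x (\<kappa> m (birth \<omega> x))}" for m
  have B: "B m \<in> events" for m
    unfolding B_def by (rule shifted_copies(1)[of "gen \<delta> m" "E m" "S m" 0]) (use E \<kappa> in auto)
  have "summable (\<lambda>m. prob (B m))"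
  proof (rule summable_comparison_test_ev[OF _ summable_no_good_copy[OF \<delta>]])
    show "\<forall>\<^sub>F m in sequentially. norm (prob (B m)) \<le> exp (- (1 / ln (real m) ^ 11) * 2 ^ gen \<delta> m)"
      using p
    proof eventually_elim
      case (elim m)
      have "prob (B m) \<le> exp (- (1 / ln (real m) ^ 11) * 2 ^ gen \<delta> m)"
        unfolding B_def by (rule shifted_copies(2)[of "gen \<delta> m" "E m" "S m"]) (use E \<kappa> elim in auto)
      then show ?case by simp
    qed
  qed
  then have "AE \<omega> in M. \<forall>\<^sub>F m in sequentially. \<omega> \<in> space M - B m"
    using B by (intro borel_cantelli_AE1) (auto simp: emeasure_eq_measure)
  then show ?thesis
  proof eventually_elim
    case (elim \<omega>)
    then show ?case by eventually_elim (auto simp: B_def)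
  qed
qed

text \<open>During the delay of at most \<open>4 * g\<close> the line rises by at most
  \<open>sqrt 2 * 4 * g \<le> 6 * g\<close>, while the reflected particle starts its subtree at
  height at least 0.\<close>

lemma copy_position:
  assumes reg: "regular \<omega>" and x: "birth \<omega> x \<le> 4 * real g" and r: "reaches x j (sqrt 2 * j - q - 1) \<omega>"
  shows "\<exists>t u. t = birth \<omega> x + j \<and> 0 \<le> birth \<omega> x \<and> u \<in> N \<omega> t \<and> sqrt 2 * t - q - 6 * g - 1 \<le> X \<omega> u t"
proof -
  obtain u where u: "u \<in> N \<omega> (birth \<omega> x + j)" "sqrt 2 * j - q - 1 \<le> X \<omega> u (birth \<omega> x + j)"
    using reaches_position[OF reg r] by blast
  have b: "0 \<le> birth \<omega> x" using regularD(1)[OF reg] by (intro birth_time_nonneg)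
  have "sqrt 2 * birth \<omega> x \<le> 3 / 2 * (4 * real g)" using sqrt2_bounds b x by (intro mult_mono) auto
  then have "sqrt 2 * (birth \<omega> x + j) - q - 6 * g - 1 \<le> X \<omega> u (birth \<omega> x + j)"
    using u(2) by (simp add: distrib_left)
  then show ?thesis using u(1) b by blast
qed

section \<open>Lower bounds for the maximum at real times\<close>

text \<open>Any time beyond \<open>n\<close> will do, so every copy receives the same parameter and
  no alignment with its birth time is made.\<close>

lemma AE_limsup_ge:
  assumes \<epsilon>: "0 < \<epsilon>"
  shows "AE \<omega> in M. \<exists>\<^sub>F t in at_top. \<exists>u\<in>N \<omega> t. sqrt 2 * t - (1 / (2 * sqrt 2) + \<epsilon>) * ln t \<le> X \<omega> u t"
proof -
  \<comment> \<open>Keeps the loss \<open>6 * gen \<delta> n\<close> caused by the delay at most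
    \<open>\<epsilon> / 2 * ln n + 6\<close>.\<close>
  define \<delta> where "\<delta> = \<epsilon> / 12"
  have \<delta>: "0 < \<delta>" using \<epsilon> by (simp add: \<delta>_def)
  define E where "E m x k = {\<omega>\<in>space M. \<exists>j\<in>{k..<k+k}. reaches x j (sqrt 2 * j - offset (1 / 2) k - 1) \<omega>}" for m :: nat and x k
  have "AE \<omega> in M. \<forall>\<^sub>F m in sequentially. (\<forall>x :: particle. length x = gen \<delta> m \<longrightarrow> m \<in> {m})
    \<longrightarrow> (\<exists>x. length x = gen \<delta> m \<and> \<omega> \<in> E m x m)"
  proof (rule AE_good_copy[OF \<delta>, of E "\<lambda>m. {m}" "\<lambda>m _. m"])
    show "E m x k \<in> sets (GA (copy_labels x))" for m x k unfolding E_def by (rule reaches_copy_sets) simp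
    show "\<forall>\<^sub>F m in sequentially. \<forall>x. \<forall>k\<in>{m}. 1 / ln (real m) ^ 11 \<le> prob (E m x k)"
      using reaches_copy_prob by eventually_elim (simp add: E_def)
  qed simp
  then show ?thesis using AE_generation_births AE_regular'
  proof eventually_elim
    case (elim \<omega>)
    have "\<forall>\<^sub>F x in at_top. 3 \<le> x \<and> 7 \<le> \<epsilon> / 2 * ln x" using \<epsilon> by (intro eventually_conj eventually_ge_at_top) real_asymp
    from filterlim_real_sequentially[unfolded filterlim_iff, rule_format, OF this]
      elim(1) filterlim_gen[OF \<delta>, unfolded filterlim_iff, rule_format, OF elim(2)]
    have "\<forall>\<^sub>F n in sequentially. \<exists>t\<ge>real n. \<exists>u\<in>N \<omega> t. sqrt 2 * t - (1 / (2 * sqrt 2) + \<epsilon>) * ln t \<le> X \<omega> u t"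
    proof eventually_elim
      case (elim n)
      obtain x where x: "length x = gen \<delta> n" "\<omega> \<in> E n x n" using elim(2) by blast
      then obtain j where j: "n \<le> j" "reaches x j (sqrt 2 * j - offset (1 / 2) n - 1) \<omega>" by (auto simp: E_def)
      obtain t u where tu: "t = birth \<omega> x + j" "0 \<le> birth \<omega> x" "u \<in> N \<omega> t" "sqrt 2 * t - offset (1 / 2) n - 6 * gen \<delta> n - 1 \<le> X \<omega> u t"
        using copy_position[OF \<open>regular \<omega>\<close> _ j(2), of "gen \<delta> n"] elim(3) x(1) by blast
      have n: "1 \<le> n" "0 < real n" using elim(1) by auto
      have t: "real n \<le> t" using tu j by simp
      have "6 * real (gen \<delta> n) \<le> \<epsilon> / 2 * ln n + 6" using gen_bounds(2)[OF \<delta> n(1)] by (simp add: \<delta>_def)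
      moreover have "(1 / (2 * sqrt 2) + \<epsilon>) * ln n \<le> (1 / (2 * sqrt 2) + \<epsilon>) * ln t"
        using t n \<epsilon> by (intro mult_left_mono) auto
      moreover have "offset (1 / 2) n = 1 / (2 * sqrt 2) * ln n" by (simp add: offset_def)
      moreover have "(1 / (2 * sqrt 2) + \<epsilon>) * ln n = 1 / (2 * sqrt 2) * ln n + \<epsilon> / 2 * ln n + \<epsilon> / 2 * ln n"
        by (simp add: distrib_right)
      ultimately have "sqrt 2 * t - (1 / (2 * sqrt 2) + \<epsilon>) * ln t \<le> X \<omega> u t" using tu(4) elim(1) by linarith
      then show ?case using t tu(3) by blast
    qed
    then obtain n0 where n0: "\<And>n. n0 \<le> n \<Longrightarrow> \<exists>t\<ge>real n. \<exists>u\<in>N \<omega> t. sqrt 2 * t - (1 / (2 * sqrt 2) + \<epsilon>) * ln t \<le> X \<omega> u t"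
      unfolding eventually_sequentially by blast
    show ?case unfolding frequently_def eventually_at_top_linorder
    proof
      assume "\<exists>T. \<forall>t\<ge>T. \<not> (\<exists>u\<in>N \<omega> t. sqrt 2 * t - (1 / (2 * sqrt 2) + \<epsilon>) * ln t \<le> X \<omega> u t)"
      then obtain T where T: "\<And>t. T \<le> t \<Longrightarrow> \<not> (\<exists>u\<in>N \<omega> t. sqrt 2 * t - (1 / (2 * sqrt 2) + \<epsilon>) * ln t \<le> X \<omega> u t)" by blast
      obtain n where n: "n0 \<le> n" "T \<le> real n" using real_arch_simple[of "max T (real n0)"] by auto
      then show False using n0[OF n(1)] T by fastforce
    qed
  qed
qed

text \<open>The time is now prescribed up to 1: a copy born at time \<open>b\<close> is asked at the
  age \<open>\<lfloor>m - b\<rfloor>\<close>, which leads into \<open>{m - 1<..m}\<close>. Ages lie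
  between \<open>m / 2\<close> and \<open>m\<close>, where the probability bound
  \<open>1 / ln k ^ 11\<close> is at least \<open>1 / ln m ^ 11\<close>.\<close>

lemma AE_liminf_ge_point:
  assumes \<epsilon>: "0 < \<epsilon>"
  shows "AE \<omega> in M. \<forall>\<^sub>F m in sequentially. \<exists>t. real m - 1 < t \<and> t \<le> real m \<and> (\<exists>u\<in>N \<omega> t. sqrt 2 * m - (3 / (2 * sqrt 2) + \<epsilon>) * ln m \<le> X \<omega> u t)"
proof -
  define \<delta> where "\<delta> = \<epsilon> / 12"
  have \<delta>: "0 < \<delta>" using \<epsilon> by (simp add: \<delta>_def)
  define E where "E m x k = {\<omega>\<in>space M. \<exists>j\<in>{k..<k+1}. reaches x j (sqrt 2 * j - offset (3 / 2) k - 1) \<omega>}" for m :: nat and x k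
  define \<kappa> where "\<kappa> m b = nat \<lfloor>real m - b\<rfloor>" for m :: nat and b
  define S where "S m = {k. m \<le> 2 * k \<and> 2 \<le> k \<and> k \<le> m}" for m :: nat
  have "AE \<omega> in M. \<forall>\<^sub>F m in sequentially. (\<forall>x. length x = gen \<delta> m \<longrightarrow> \<kappa> m (birth \<omega> x) \<in> S m)
    \<longrightarrow> (\<exists>x. length x = gen \<delta> m \<and> \<omega> \<in> E m x (\<kappa> m (birth \<omega> x)))"
  proof (rule AE_good_copy[OF \<delta>])
    show "E m x k \<in> sets (GA (copy_labels x))" for m x k unfolding E_def by (rule reaches_copy_sets) simp
    show "\<kappa> m \<in> borel \<rightarrow>\<^sub>M count_space UNIV" for m unfolding \<kappa>_def by measurable
    obtain n0 where n0: "\<And>n x. n0 \<le> n \<Longrightarrow> 1 / ln (real n) ^ 11 \<le> prob (E m x n)" for m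
      using reaches_copy_prob unfolding eventually_sequentially E_def by blast
    show "\<forall>\<^sub>F m in sequentially. \<forall>x. \<forall>k\<in>S m. 1 / ln (real m) ^ 11 \<le> prob (E m x k)"
      using eventually_ge_at_top[of "2 * n0"]
    proof eventually_elim
      case (elim m)
      show ?case
      proof (intro allI ballI)
        fix x k assume k: "k \<in> S m"
        then have ln: "0 < ln (real k)" "ln (real k) \<le> ln (real m)" by (auto simp: S_def)
        have "1 / ln (real m) ^ 11 \<le> 1 / ln (real k) ^ 11" using ln by (intro divide_left_mono power_mono mult_pos_pos) auto
        also have "\<dots> \<le> prob (E m x k)" using k elim by (intro n0) (auto simp: S_def)
        finally show "1 / ln (real m) ^ 11 \<le> prob (E m x k)" .
      qed
    qed
  qed
  then show ?thesis using AE_generation_births AE_regular'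
  proof eventually_elim
    case (elim \<omega>)
    note reg = \<open>regular \<omega>\<close>
    have "\<forall>\<^sub>F x in at_top. 8 \<le> x \<and> 10 \<le> \<epsilon> / 2 * ln x \<and> 4 * (\<delta> * ln x + 1) + 1 \<le> x / 2" using \<epsilon>
      by (intro eventually_conj eventually_ge_at_top) real_asymp+
    from filterlim_real_sequentially[unfolded filterlim_iff, rule_format, OF this]
      elim(1) filterlim_gen[OF \<delta>, unfolded filterlim_iff, rule_format, OF elim(2)]
    show ?case
    proof eventually_elim
      case (elim m)
      have m: "1 \<le> m" "8 \<le> real m" using elim(1) by auto
      have b: "0 \<le> birth \<omega> x" for x using regularD(1)[OF reg] by (intro birth_time_nonneg)
      have g: "4 * real (gen \<delta> m) + 1 \<le> real m / 2" using gen_bounds(2)[OF \<delta> m(1)] elim(1) by simp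
      have \<kappa>: "real m - 1 < birth \<omega> x + \<kappa> m (birth \<omega> x)" "birth \<omega> x + \<kappa> m (birth \<omega> x) \<le> real m" if "length x = gen \<delta> m" for x
      proof -
        have "birth \<omega> x \<le> 4 * real (gen \<delta> m)" using elim(3) that by blast
        then have "0 \<le> real m - birth \<omega> x" using g m by linarith
        then have "real (\<kappa> m (birth \<omega> x)) = of_int \<lfloor>real m - birth \<omega> x\<rfloor>" by (simp add: \<kappa>_def)
        then show "real m - 1 < birth \<omega> x + \<kappa> m (birth \<omega> x)" "birth \<omega> x + \<kappa> m (birth \<omega> x) \<le> real m"
          using floor_correct[of "real m - birth \<omega> x"] by linarith+
      qed
      have "\<kappa> m (birth \<omega> x) \<in> S m" if "length x = gen \<delta> m" for x
      proof -
        have 1: "birth \<omega> x \<le> 4 * real (gen \<delta> m)" using elim(3) that by blast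
        have "real m / 2 \<le> real (\<kappa> m (birth \<omega> x))" "real (\<kappa> m (birth \<omega> x)) \<le> real m" using \<kappa>[OF that] 1 g b[of x] by linarith+
        then have "real m \<le> real (2 * \<kappa> m (birth \<omega> x))" "real 2 \<le> real (\<kappa> m (birth \<omega> x))" "real (\<kappa> m (birth \<omega> x)) \<le> real m"
          using m by auto
        then show ?thesis unfolding S_def of_nat_le_iff by blast
      qed
      then obtain x where x: "length x = gen \<delta> m" "\<omega> \<in> E m x (\<kappa> m (birth \<omega> x))" using elim(2) by blast
      let ?k = "\<kappa> m (birth \<omega> x)"
      have "reaches x ?k (sqrt 2 * ?k - offset (3 / 2) ?k - 1) \<omega>" using x(2) by (auto simp: E_def)
      then obtain t u where tu: "t = birth \<omega> x + ?k" "u \<in> N \<omega> t" "sqrt 2 * t - offset (3 / 2) ?k - 6 * gen \<delta> m - 1 \<le> X \<omega> u t"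
        using copy_position[OF reg, of x "gen \<delta> m"] elim(3) x(1) by blast
      have t: "real m - 1 < t" "t \<le> real m" using \<kappa>[OF x(1)] tu(1) by auto
      have "6 * real (gen \<delta> m) \<le> \<epsilon> / 2 * ln m + 6" using gen_bounds(2)[OF \<delta> m(1)] by (simp add: \<delta>_def)
      moreover have "offset (3 / 2) ?k \<le> 3 / (2 * sqrt 2) * ln m"
      proof -
        have "0 < ?k" using \<kappa>[OF x(1)] elim(3) x(1) g m by (intro gr0I) fastforce
        then have "ln (real ?k) \<le> ln m" using \<kappa>(2)[OF x(1)] b[of x] by (subst ln_le_cancel_iff) auto
        then have "3 / (2 * sqrt 2) * ln (real ?k) \<le> 3 / (2 * sqrt 2) * ln m" by (intro mult_left_mono) auto
        then show ?thesis by (simp add: offset_def)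
      qed
      moreover have "sqrt 2 * m - 3 / 2 \<le> sqrt 2 * t"
      proof -
        have "sqrt 2 * (real m - 1) \<le> sqrt 2 * t" using t by (intro mult_left_mono) auto
        then show ?thesis using sqrt2_bounds by (simp add: right_diff_distrib)
      qed
      moreover have "(3 / (2 * sqrt 2) + \<epsilon>) * ln m = 3 / (2 * sqrt 2) * ln m + \<epsilon> / 2 * ln m + \<epsilon> / 2 * ln m"
        by (simp add: distrib_right)
      ultimately have "sqrt 2 * m - (3 / (2 * sqrt 2) + \<epsilon>) * ln m \<le> X \<omega> u t" using tu(3) elim(1) by linarith
      then show ?case using t tu(2) by blast
    qed
  qed
qed

lemma filterlim_nat_floor: "filterlim (\<lambda>t :: real. nat \<lfloor>t\<rfloor>) sequentially at_top"
  by (rule filterlim_compose[OF filterlim_nat_sequentially filterlim_floor_sequentially])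

text \<open>A lineage that is high at some time in \<open>{n<..n + 1}\<close> was not low at time
  \<open>n\<close>, as fast rises are excluded; hence it is low nowhere in the interval, as fast
  drops are excluded. The tolerance is spent in portions, from \<open>\<epsilon> / 8\<close> at the
  high point up to \<open>\<epsilon>\<close>.\<close>

lemma AE_liminf_ge:
  assumes \<epsilon>: "0 < \<epsilon>"
  shows "AE \<omega> in M. \<forall>\<^sub>F t in at_top. \<exists>v\<in>N \<omega> t. sqrt 2 * t - (3 / (2 * sqrt 2) + \<epsilon>) * ln t \<le> X \<omega> v t"
proof -
  define c :: real where "c = 3 / (2 * sqrt 2)"
  have c: "0 < c" by (simp add: c_def)
  have e: "0 < \<epsilon> / 8" "0 < \<epsilon> / 4" using \<epsilon> by auto
  have "AE \<omega> in M. \<forall>\<^sub>F n in sequentially. \<forall>u\<in>N \<omega> (real n + 3). X \<omega> u n \<le> sqrt 2 * n - (c + \<epsilon> / 4 + \<epsilon> / 4) * ln n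
    \<longrightarrow> (\<forall>t\<in>{real n..real n + 3}. X \<omega> u t \<le> sqrt 2 * n - (c + \<epsilon> / 4) * ln n)"
    using c e by (intro AE_no_rise) auto
  moreover have "AE \<omega> in M. \<forall>\<^sub>F n in sequentially. \<forall>u\<in>N \<omega> (real n + 3). sqrt 2 * n - (c + \<epsilon> / 4 + \<epsilon> / 4) * ln n \<le> X \<omega> u n
    \<longrightarrow> (\<forall>t\<in>{real n..real n + 3}. sqrt 2 * n - (c + \<epsilon> / 4 + \<epsilon> / 4 + \<epsilon> / 4) * ln n \<le> X \<omega> u t)"
    using c e by (intro AE_no_drop) auto
  ultimately show ?thesis using AE_liminf_ge_point[OF e(1)] AE_regular'
  proof eventually_elim
    case (elim \<omega>)
    note reg = \<open>regular \<omega>\<close>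
    have "\<forall>\<^sub>F x in at_top. 3 \<le> x \<and> sqrt 2 \<le> \<epsilon> / 4 * ln x \<and> sqrt 2 * x - (c + \<epsilon> / 4) * ln x < sqrt 2 * (x + 1) - (c + \<epsilon> / 8) * ln (x + 1)"
      using \<epsilon> c by (intro eventually_conj eventually_ge_at_top) real_asymp+
    from filterlim_real_sequentially[unfolded filterlim_iff, rule_format, OF this] elim(1,2)
      sequentially_offset[OF elim(3), of 1]
    have "\<forall>\<^sub>F n in sequentially. \<forall>t\<in>{real n..real n + 1}. \<exists>v\<in>N \<omega> t. sqrt 2 * t - (c + \<epsilon>) * ln t \<le> X \<omega> v t"
    proof eventually_elim
      case (elim n)
      obtain s u where s: "real n < s" "s \<le> real n + 1" "u \<in> N \<omega> s"
        "sqrt 2 * (real n + 1) - (c + \<epsilon> / 8) * ln (real n + 1) \<le> X \<omega> u s"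
        using elim(4) by (auto simp: c_def add.commute)
      \<comment> \<open>A descendant alive at \<open>n + 3\<close> carries the whole lineage, so
        both exclusions apply to one and the same path.\<close>
      have "birth \<omega> u \<le> real n + 3" using s by (simp add: alive_def)
      from alive_ex[OF _ regularD(4)[OF reg] this] obtain u' where u': "u' \<in> N \<omega> (real n + 3)" "suffix u u'"
        using regularD(1)[OF reg] by blast
      have "X \<omega> u' s = X \<omega> u s" using regularD(1)[OF reg] u'(2) s(3) by (intro path_ancestor) (auto simp: alive_def)
      then have "\<not> X \<omega> u' s \<le> sqrt 2 * n - (c + \<epsilon> / 4) * ln n" using s(4) elim(1) by linarith
      then have "\<not> X \<omega> u' n \<le> sqrt 2 * n - (c + \<epsilon> / 4 + \<epsilon> / 4) * ln n" using elim(2) u'(1) s by fastforce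
      then have low: "sqrt 2 * n - (c + \<epsilon> / 4 + \<epsilon> / 4 + \<epsilon> / 4) * ln n \<le> X \<omega> u' t" if "t \<in> {real n..real n + 3}" for t
        using elim(3) u'(1) that by fastforce
      show ?case
      proof
        fix t assume t: "t \<in> {real n..real n + 1}"
        then obtain v where v: "v \<in> N \<omega> t" "suffix v u'"
          using alive_ancestor_ex[OF regularD(1)[OF reg] u'(1), of t] by auto
        have "X \<omega> u' t = X \<omega> v t" using regularD(1)[OF reg] v by (intro path_ancestor) (auto simp: alive_def)
        then have 1: "sqrt 2 * n - (c + \<epsilon> / 4 + \<epsilon> / 4 + \<epsilon> / 4) * ln n \<le> X \<omega> v t" using low[of t] t by simp
        have "ln (real n) \<le> ln t" using t elim(1) by (subst ln_le_cancel_iff) auto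
        then have 2: "(c + \<epsilon>) * ln n \<le> (c + \<epsilon>) * ln t" using c \<epsilon> by (intro mult_left_mono) auto
        have "sqrt 2 * t \<le> sqrt 2 * (real n + 1)" using t by (intro mult_left_mono) auto
        then have 3: "sqrt 2 * t \<le> sqrt 2 * n + sqrt 2" by (simp add: distrib_left)
        have "(c + \<epsilon>) * ln n = (c + \<epsilon> / 4 + \<epsilon> / 4 + \<epsilon> / 4) * ln n + \<epsilon> / 4 * ln n" by (simp add: algebra_simps)
        then have "sqrt 2 * t - (c + \<epsilon>) * ln t \<le> X \<omega> v t" using 1 2 3 elim(1) by linarith
        then show "\<exists>v\<in>N \<omega> t. sqrt 2 * t - (c + \<epsilon>) * ln t \<le> X \<omega> v t" using v(1) by blast
      qed
    qed
    from filterlim_nat_floor[unfolded filterlim_iff, rule_format, OF this] eventually_ge_at_top[of 1]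
    have "\<forall>\<^sub>F t in at_top. \<exists>v\<in>N \<omega> t. sqrt 2 * t - (c + \<epsilon>) * ln t \<le> X \<omega> v t"
    proof eventually_elim
      case (elim t)
      have "t \<in> {real (nat \<lfloor>t\<rfloor>)..real (nat \<lfloor>t\<rfloor>) + 1}" using elim(2) by (auto simp: of_nat_nat)
      then show ?case using elim(1) by blast
    qed
    then show ?case by (simp only: c_def)
  qed
qed

section \<open>Upper bounds for the maximum at real times\<close>

text \<open>The estimate at the integer \<open>n\<close> with a slightly larger coefficient leaves
  room for the excluded rises; \<open>ln t \<le> 1 + ln n\<close> then exchanges the
  logarithms.\<close>

lemma AE_limsup_le:
  assumes \<epsilon>: "0 < \<epsilon>" "\<epsilon> < 1 / (2 * sqrt 2)"
  shows "AE \<omega> in M. \<forall>\<^sub>F t in at_top. \<forall>v\<in>N \<omega> t. X \<omega> v t < sqrt 2 * t - (1 / (2 * sqrt 2) - \<epsilon>) * ln t"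
proof -
  define c :: real where "c = 1 / (2 * sqrt 2)"
  have c: "\<epsilon> < c" "c \<le> 1" using \<epsilon> sqrt2_bounds by (auto simp: c_def field_simps)
  define a where "a = c - 3 * \<epsilon> / 4"
  have a: "0 \<le> a" "0 < a + \<epsilon> / 4" "a + \<epsilon> / 4 < c" "0 < \<epsilon> / 4" using c \<epsilon> by (auto simp: a_def)
  have "AE \<omega> in M. \<forall>\<^sub>F n in sequentially. \<forall>u\<in>N \<omega> (real n). X \<omega> u n < sqrt 2 * n - (a + \<epsilon> / 4) * ln n"
    using a unfolding c_def by (intro AE_upper_integer) auto
  then show ?thesis using AE_no_rise[OF a(4,1)] AE_regular'
  proof eventually_elim
    case (elim \<omega>)
    note reg = \<open>regular \<omega>\<close>
    have "\<forall>\<^sub>F x in at_top. 3 \<le> x \<and> 1 < \<epsilon> / 4 * ln x" using \<epsilon> by (intro eventually_conj eventually_ge_at_top) real_asymp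
    from filterlim_real_sequentially[unfolded filterlim_iff, rule_format, OF this] elim(1,2)
    have "\<forall>\<^sub>F n in sequentially. \<forall>t\<in>{real n..real n + 1}. \<forall>v\<in>N \<omega> t. X \<omega> v t < sqrt 2 * t - (c - \<epsilon>) * ln t"
    proof eventually_elim
      case (elim n)
      show ?case
      proof (intro ballI)
        fix t v assume t: "t \<in> {real n..real n + 1}" and v: "v \<in> N \<omega> t"
        have "birth \<omega> v \<le> real n + 3" using t v by (simp add: alive_def)
        from alive_ex[OF _ regularD(4)[OF reg] this] obtain u where u: "u \<in> N \<omega> (real n + 3)" "suffix v u"
          using regularD(1)[OF reg] by blast
        obtain w where w: "w \<in> N \<omega> (real n)" "suffix w u"
          using alive_ancestor_ex[OF regularD(1)[OF reg] u(1), of "real n"] by auto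
        have "X \<omega> u t = X \<omega> v t" using regularD(1)[OF reg] v u(2) by (intro path_ancestor) (auto simp: alive_def)
        have "X \<omega> u n = X \<omega> w n" using regularD(1)[OF reg] w by (intro path_ancestor) (auto simp: alive_def)
        moreover have "X \<omega> w n < sqrt 2 * n - (a + \<epsilon> / 4) * ln n" using elim(2) w(1) by blast
        ultimately have "X \<omega> u n \<le> sqrt 2 * n - (a + \<epsilon> / 4) * ln n" by simp
        from elim(3)[rule_format, OF u(1) this, of t] have 1: "X \<omega> v t \<le> sqrt 2 * n - a * ln n"
          using \<open>X \<omega> u t = X \<omega> v t\<close> t by simp
        have n: "3 \<le> real n" "3 \<le> t" using elim(1) t by auto
        have "t \<le> exp 1 * real n"
        proof -
          have "2 * real n \<le> exp 1 * real n" using exp_ge_add_one_self[of 1] by (intro mult_right_mono) auto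
          moreover have "t \<le> real n + 1" using t by simp
          ultimately show ?thesis using n by linarith
        qed
        then have "ln t \<le> ln (exp 1 * real n)" using n by (subst ln_le_cancel_iff) auto
        also have "\<dots> = 1 + ln n" using n by (simp add: ln_mult)
        finally have "(c - \<epsilon>) * ln t \<le> (c - \<epsilon>) * (1 + ln n)" using c by (intro mult_left_mono) auto
        also have "\<dots> \<le> 1 + (c - \<epsilon>) * ln n" using c \<epsilon> by (simp add: distrib_left)
        also have "(c - \<epsilon>) * ln n = a * ln n - \<epsilon> / 4 * ln n" by (simp add: a_def algebra_simps)
        finally have 2: "(c - \<epsilon>) * ln t < a * ln n" using elim(1) by linarith
        have "sqrt 2 * n \<le> sqrt 2 * t" using t by (intro mult_left_mono) auto
        then show "X \<omega> v t < sqrt 2 * t - (c - \<epsilon>) * ln t" using 1 2 by linarith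
      qed
    qed
    from filterlim_nat_floor[unfolded filterlim_iff, rule_format, OF this] eventually_ge_at_top[of 1]
    have "\<forall>\<^sub>F t in at_top. \<forall>v\<in>N \<omega> t. X \<omega> v t < sqrt 2 * t - (c - \<epsilon>) * ln t"
    proof eventually_elim
      case (elim t)
      have "t \<in> {real (nat \<lfloor>t\<rfloor>)..real (nat \<lfloor>t\<rfloor>) + 1}" using elim(2) by (auto simp: of_nat_nat)
      then show ?case using elim(1) by blast
    qed
    then show ?case by (simp only: c_def)
  qed
qed

text \<open>For a property that has to hold only at arbitrarily large times, integer times
  suffice.\<close>

lemma AE_liminf_le:
  assumes \<epsilon>: "0 < \<epsilon>" "\<epsilon> < 3 / (2 * sqrt 2)"
  shows "AE \<omega> in M. \<exists>\<^sub>F t in at_top. \<forall>v\<in>N \<omega> t. X \<omega> v t < sqrt 2 * t - (3 / (2 * sqrt 2) - \<epsilon>) * ln t"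
proof -
  have "AE \<omega> in M. \<exists>\<^sub>F n in sequentially. \<forall>u\<in>N \<omega> (real n). X \<omega> u n < sqrt 2 * n - (3 / (2 * sqrt 2) - \<epsilon>) * ln n"
    using \<epsilon> by (intro AE_lower_liminf) auto
  then show ?thesis
  proof eventually_elim
    case (elim \<omega>)
    then show ?case unfolding frequently_def
      using filterlim_real_sequentially[unfolded filterlim_iff, rule_format, of "\<lambda>t. \<not> (\<forall>v\<in>N \<omega> t. X \<omega> v t < sqrt 2 * t - (3 / (2 * sqrt 2) - \<epsilon>) * ln t)"]
      by blast
  qed
qed

lemma AE_max_limits:
  defines "f \<equiv> \<lambda>\<omega> t. (branching_RBM_max L W t \<omega> - sqrt 2 * t) / ln t"
  shows "AE \<omega> in M. Liminf at_top (\<lambda>t. ereal (f \<omega> t)) = ereal (- (3 / (2 * sqrt 2)))"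
    and "AE \<omega> in M. Limsup at_top (\<lambda>t. ereal (f \<omega> t)) = ereal (- (1 / (2 * sqrt 2)))"
proof -
  \<comment> \<open>The shift by 4 keeps \<open>e k\<close> below \<open>1 / (2 * sqrt 2)\<close>,
    as the upper estimates require.\<close>
  define e where "e k = 1 / (real k + 4)" for k :: nat
  have e: "e \<longlonglongrightarrow> 0" unfolding e_def by real_asymp
  have ek: "0 < e k" "e k < 1 / (2 * sqrt 2)" "e k < 3 / (2 * sqrt 2)" for k
  proof -
    show 0: "0 < e k" by (simp add: e_def)
    have "e k \<le> 1 / 4" unfolding e_def by (intro divide_left_mono) auto
    also have "1 / 4 < 1 / (2 * sqrt 2)" using sqrt2_bounds by (intro divide_strict_left_mono) auto
    finally show 1: "e k < 1 / (2 * sqrt 2)" .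
    also have "1 / (2 * sqrt 2) \<le> 3 / (2 * sqrt 2)" by (intro divide_right_mono) auto
    finally show "e k < 3 / (2 * sqrt 2)" .
  qed
  have ge: "- d \<le> f \<omega> t" if "regular \<omega>" "1 < t" "\<exists>v\<in>N \<omega> t. sqrt 2 * t - d * ln t \<le> X \<omega> v t" for \<omega> t d
  proof -
    have "sqrt 2 * t - d * ln t \<le> branching_RBM_max L W t \<omega>" using RBM_max_ge[OF that(1), of t] that by fastforce
    then show ?thesis using that(2) by (simp add: f_def field_simps)
  qed
  have le: "f \<omega> t \<le> - d" if "regular \<omega>" "1 < t" "\<forall>v\<in>N \<omega> t. X \<omega> v t < sqrt 2 * t - d * ln t" for \<omega> t d
  proof -
    have "branching_RBM_max L W t \<omega> < sqrt 2 * t - d * ln t" using that by (intro RBM_max_less) auto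
    then show ?thesis using that(2) by (simp add: f_def field_simps)
  qed
  have "AE \<omega> in M. \<forall>k. \<forall>\<^sub>F t in at_top. \<exists>v\<in>N \<omega> t. sqrt 2 * t - (3 / (2 * sqrt 2) + e k) * ln t \<le> X \<omega> v t"
    using AE_liminf_ge ek by (simp add: AE_all_countable)
  moreover have "AE \<omega> in M. \<forall>k. \<exists>\<^sub>F t in at_top. \<forall>v\<in>N \<omega> t. X \<omega> v t < sqrt 2 * t - (3 / (2 * sqrt 2) - e k) * ln t"
    using AE_liminf_le ek by (simp add: AE_all_countable)
  ultimately show "AE \<omega> in M. Liminf at_top (\<lambda>t. ereal (f \<omega> t)) = ereal (- (3 / (2 * sqrt 2)))"
    using AE_regular'
  proof eventually_elim
    case (elim \<omega>)
    show ?case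
    proof (rule Liminf_ereal_eqI[OF e])
      fix k
      show "\<forall>\<^sub>F t in at_top. - (3 / (2 * sqrt 2)) - e k \<le> f \<omega> t"
        using elim(1)[rule_format, of k] eventually_gt_at_top[of 1]
        by eventually_elim (use ge[OF elim(3)] in fastforce)
      show "\<exists>\<^sub>F t in at_top. f \<omega> t \<le> - (3 / (2 * sqrt 2)) + e k"
        using frequently_eventually_frequently[OF elim(2)[rule_format, of k] eventually_gt_at_top[of 1]]
        by (rule frequently_elim1) (use le[OF elim(3)] in fastforce)
    qed
  qed
  have "AE \<omega> in M. \<forall>k. \<exists>\<^sub>F t in at_top. \<exists>u\<in>N \<omega> t. sqrt 2 * t - (1 / (2 * sqrt 2) + e k) * ln t \<le> X \<omega> u t"
    using AE_limsup_ge ek by (simp add: AE_all_countable)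
  moreover have "AE \<omega> in M. \<forall>k. \<forall>\<^sub>F t in at_top. \<forall>v\<in>N \<omega> t. X \<omega> v t < sqrt 2 * t - (1 / (2 * sqrt 2) - e k) * ln t"
    using AE_limsup_le ek by (simp add: AE_all_countable)
  ultimately show "AE \<omega> in M. Limsup at_top (\<lambda>t. ereal (f \<omega> t)) = ereal (- (1 / (2 * sqrt 2)))"
    using AE_regular'
  proof eventually_elim
    case (elim \<omega>)
    show ?case
    proof (rule Limsup_ereal_eqI[OF e])
      fix k
      show "\<forall>\<^sub>F t in at_top. f \<omega> t \<le> - (1 / (2 * sqrt 2)) + e k"
        using elim(2)[rule_format, of k] eventually_gt_at_top[of 1]
        by eventually_elim (use le[OF elim(3)] in fastforce)
      show "\<exists>\<^sub>F t in at_top. - (1 / (2 * sqrt 2)) - e k \<le> f \<omega> t"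
        using frequently_eventually_frequently[OF elim(1)[rule_format, of k] eventually_gt_at_top[of 1]]
        by (rule frequently_elim1) (use ge[OF elim(3)] in fastforce)
    qed
  qed
qed

end

theorem corollary1p3:
  fixes M :: "'a measure"
    and L :: "particle \<Rightarrow> 'a \<Rightarrow> real"
    and W :: "particle \<Rightarrow> real \<Rightarrow> 'a \<Rightarrow> real"
  assumes "branching_data M L W"
  shows "(AE \<omega> in M. Liminf at_top
            (\<lambda>t::real. ereal ((branching_RBM_max L W t \<omega> - sqrt 2 * t) / ln t))
            = ereal (- (3 / (2 * sqrt 2)))) \<and>
         (AE \<omega> in M. Limsup at_top
            (\<lambda>t::real. ereal ((branching_RBM_max L W t \<omega> - sqrt 2 * t) / ln t))
            = ereal (- (1 / (2 * sqrt 2))))"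
proof -
  interpret branching_data M L W by fact
  show ?thesis by (intro conjI AE_max_limits)
qed

end
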